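(* Let $X=G/P_{\mathtt i}$ be one of the classical compact Hermitian symmetric spaces listed in (1)–(5) below. Suppose $X_w\subset X$ is a proper Schubert variety. Then the integer $\mathsf a=\mathsf a(w)\ge0$ and the nonempty set $\mathtt J=\mathtt J(w)=\{\mathtt j_1<\dots<\mathtt j_{\mathsf p}\}\subset I_{\mathfrak p}$ satisfy the following criteria. Conversely, any pair $(\mathsf a,\mathtt J)$, with $\mathsf a\in\mathbb Z_{\ge0}$ and $\emptyset\ne\mathtt J\subset I_{\mathfrak p}$, meeting the criteria is realized by a unique Schubert variety: there exists a unique $w\in W^{\mathfrak p}$ such that $\mathsf a=\mathsf a(w)$ and $\mathtt J=\mathtt J(w)$. (1) $A_n/P_{\mathtt i}$: $\mathsf a\le\min(\mathtt i-1,n-\mathtt i)$ and, with $\mathsf q=\#\{\mathtt j\in\mathtt J:\mathtt j<\mathtt i\}$, $(\mathsf p,\mathsf q)\in\{(2\mathsf a,\mathsf a),(2\mathsf a+1,\mathsf a),(2\mathsf a+1,\mathsf a+1),(2\mathsf a+2,\mathsf a+1)\}$. (2) $B_n/P_1$: $\mathsf a\le1$ and $\mathtt J=\{\mathtt j\}$ is a singleton. (3) $D_n/P_1$: $\mathsf a\le1$; if $\mathsf a=0$, then $\mathtt J=\{\mathtt j\}$ is a singleton or $\mathtt J=\{n-1,n\}$; if $\mathsf a=1$, then $\mathtt J=\{\mathtt j\}$ with $\mathtt j\le n-2$, or $\mathtt J=\{n-1,n\}$. (4) $C_n/P_n$: $\mathsf a\le n-1$ and $\mathsf p=\mathsf a$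 or $\mathsf p=\mathsf a+1$. (5) $D_n/P_n$: either (i) $\mathsf a\le n-3$; [$\mathsf p=\mathsf a$ and $n-1\notin\mathtt J$] or [$\mathsf p=\mathsf a+1$ and $n-1\in\mathtt J$]; and $\mathtt j_{\mathsf s}-\mathtt j_{\mathsf s-1}\ge2$ for $\mathsf s=\lceil\frac{\mathsf p+1}2\rceil$; or (ii) $\mathsf a\le n-4$; [$\mathsf p=\mathsf a+1$ and $n-1\notin\mathtt J$] or [$\mathsf p=\mathsf a+2$ and $n-1\in\mathtt J$]; and $\mathtt j_{\mathsf s+1}-\mathtt j_{\mathsf s}\ge2$ for $\mathsf s=\lceil\frac{\mathsf p}2\rceil$.
   Context: Setting. $\mathfrak g$ is a complex simple Lie algebra with Cartan subalgebra $\mathfrak h$, roots $\Delta$, positive/negative roots $\Delta^\pm$, simple roots $\alpha_1,\dots,\alpha_n$ (Bourbaki numbering), root spaces $\mathfrak g_\beta$, Weyl group $W$; $Z_1,\dots,Z_n$ is the basis of $\mathfrak h$ dual to the simple roots. The index $\mathtt i$ is such that every root takes values in $\{-1,0,1\}$ on $Z_{\mathtt i}$, so $\mathfrak g=\mathfrak g_{-1}\oplus\mathfrak g_0\oplus\mathfrak g_1$ with $\mathfrak g_j$ the $j$-eigenspace of $\mathrm{ad}(Z_{\mathtt i})$; $\mathfrak p=\mathfrak g_0\oplus\mathfrak g_1$; $G/P_{\mathtt i}$ is the corresponding irreducible compact Hermitian symmetric space. The classical ones are $A_n/P_{\mathtt i}$ ($1\le\mathtt i\le n$), $B_n/P_1$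 ($n\ge2$), $D_n/P_1$ ($n\ge4$), $C_n/P_n$ ($n\ge3$), $D_n/P_n\simeq D_n/P_{n-1}$ ($n\ge4$). For $w\in W$ put $\Delta(w)=w\Delta^-\cap\Delta^+$ and $W^{\mathfrak p}=\{w\in W: \mathfrak g_\alpha\subset\mathfrak g_1\ \forall\alpha\in\Delta(w)\}$. For $w\in W^{\mathfrak p}$ put $\mathfrak n_w=\bigoplus_{\alpha\in\Delta(w)}\mathfrak g_{-\alpha}\subset\mathfrak g_{-1}$. The Schubert variety $X_w$ is the closure of $Bw^{-1}\cdot o$ ($B$ the Borel subgroup of the positive roots, $o=P_{\mathtt i}$); it is proper if it is neither a point nor $X$ (equivalently $0\neq\mathfrak n_w\neq\mathfrak g_{-1}$). Put $I_{\mathfrak p}=\{1,\dots,n\}\setminus\{\mathtt i\}$, $\mathtt J(w)=\{\mathtt j\in I_{\mathfrak p}:[\mathfrak g_{-\alpha_{\mathtt j}},\mathfrak n_w]\not\subset\mathfrak n_w\}$, $Z_w=\sum_{\mathtt j\in\mathtt J(w)}Z_{\mathtt j}$, $\mathsf a(w)=\max\{\alpha(Z_w):\alpha\in\Delta(w)\}$. Conventions: $\mathtt j_0:=0$ and $\mathtt j_{\mathsf p+1}:=1+\max I_{\mathfrak p}$. *)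

theory Defs
  imports Complex_Main
begin

section \<open>Complex simple Lie algebras\<close>

class complex_lie_algebra = ab_group_add +
  fixes scaleC :: "complex \<Rightarrow> 'a \<Rightarrow> 'a"  (infixr \<open>*\<^sub>C\<close> 75)
    and lie :: "'a \<Rightarrow> 'a \<Rightarrow> 'a"
  assumes scaleC_add_right: "c *\<^sub>C (x + y) = c *\<^sub>C x + c *\<^sub>C y"
    and scaleC_add_left: "(c + d) *\<^sub>C x = c *\<^sub>C x + d *\<^sub>C x"
    and scaleC_scaleC: "c *\<^sub>C d *\<^sub>C x = (c * d) *\<^sub>C x"
    and scaleC_one: "1 *\<^sub>C x = x"
    and lie_add_left: "lie (x + y) z = lie x z + lie y z"
    and lie_add_right: "lie x (y + z) = lie x y + lie x z"
    and lie_scaleC_left: "lie (c *\<^sub>C x) y = c *\<^sub>C lie x y"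
    and lie_scaleC_right: "lie x (c *\<^sub>C y) = c *\<^sub>C lie x y"
    and lie_self: "lie x x = 0"
    and jacobi: "lie x (lie y z) + lie y (lie z x) + lie z (lie x y) = 0"

global_interpretation lie_vs:
  vector_space "scaleC :: complex \<Rightarrow> 'a \<Rightarrow> 'a :: complex_lie_algebra"
  by unfold_locales
    (simp_all add: scaleC_add_right scaleC_add_left scaleC_scaleC scaleC_one)

definition lie_span :: "'a::complex_lie_algebra set \<Rightarrow> 'a set \<Rightarrow> 'a set" where
  "lie_span A B = lie_vs.span {lie x y | x y. x \<in> A \<and> y \<in> B}"

definition lie_ideal :: "'a::complex_lie_algebra set \<Rightarrow> bool" where
  "lie_ideal I \<longleftrightarrow> lie_vs.subspace I \<and> (\<forall>x. \<forall>y\<in>I. lie x y \<in> I)"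

definition simple_lie_algebra :: "'a::complex_lie_algebra itself \<Rightarrow> bool" where
  "simple_lie_algebra _ \<longleftrightarrow>
     (\<exists>S :: 'a set. finite S \<and> lie_vs.span S = UNIV) \<and>
     (\<exists>x y :: 'a. lie x y \<noteq> 0) \<and>
     (\<forall>I :: 'a set. lie_ideal I \<longrightarrow> I = {0} \<or> I = UNIV)"


section \<open>Cartan subalgebras, roots and the Weyl group\<close>

text \<open>Cartan subalgebra of a complex semisimple Lie algebra: a subspace that is abelian,
  equal to its own centralizer, and acts by diagonalizable endomorphisms.\<close>

definition cartan_subalgebra :: "'a::complex_lie_algebra set \<Rightarrow> bool" where
  "cartan_subalgebra \<hh> \<longleftrightarrow>
     lie_vs.subspace \<hh> \<and>
     (\<forall>H\<in>\<hh>. \<forall>H'\<in>\<hh>. lie H H' = 0) \<and>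
     (\<forall>X. (\<forall>H\<in>\<hh>. lie H X = 0) \<longrightarrow> X \<in> \<hh>) \<and>
     (\<forall>H\<in>\<hh>. lie_vs.span {X. \<exists>c. lie H X = c *\<^sub>C X} = UNIV)"

text \<open>A linear form on \<open>\<hh>\<close> is represented by the function that extends it by \<open>0\<close> outside \<open>\<hh>\<close>,
  so that linear forms are equal iff they are equal as functions.\<close>

definition dual_space :: "'a::complex_lie_algebra set \<Rightarrow> ('a \<Rightarrow> complex) set" where
  "dual_space \<hh> = {\<mu>.
     (\<forall>x\<in>\<hh>. \<forall>y\<in>\<hh>. \<mu> (x + y) = \<mu> x + \<mu> y) \<and>
     (\<forall>c. \<forall>x\<in>\<hh>. \<mu> (c *\<^sub>C x) = c * \<mu> x) \<and>
     (\<forall>x. x \<notin> \<hh> \<longrightarrow> \<mu> x = 0)}"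

definition root_space :: "'a::complex_lie_algebra set \<Rightarrow> ('a \<Rightarrow> complex) \<Rightarrow> 'a set" where
  "root_space \<hh> \<beta> = {X. \<forall>H\<in>\<hh>. lie H X = \<beta> H *\<^sub>C X}"

definition roots :: "'a::complex_lie_algebra set \<Rightarrow> ('a \<Rightarrow> complex) set" where
  "roots \<hh> = {\<beta> \<in> dual_space \<hh>. \<beta> \<noteq> (\<lambda>H. 0) \<and> root_space \<hh> \<beta> \<noteq> {0}}"

definition coroot :: "'a::complex_lie_algebra set \<Rightarrow> ('a \<Rightarrow> complex) \<Rightarrow> 'a" where
  "coroot \<hh> \<beta> =
     (THE H. H \<in> lie_span (root_space \<hh> \<beta>) (root_space \<hh> (\<lambda>H. - \<beta> H)) \<and> \<beta> H = 2)"

text \<open>The Weyl group acts on \<open>\<hh>\<^sup>*\<close>; its elements are taken to be the identity on functions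
  that do not represent linear forms, so that they are determined by their action on \<open>\<hh>\<^sup>*\<close>.\<close>

definition reflection ::
    "'a::complex_lie_algebra set \<Rightarrow> ('a \<Rightarrow> complex) \<Rightarrow> ('a \<Rightarrow> complex) \<Rightarrow> ('a \<Rightarrow> complex)" where
  "reflection \<hh> \<beta> \<mu> =
     (if \<mu> \<in> dual_space \<hh> then (\<lambda>H. \<mu> H - \<mu> (coroot \<hh> \<beta>) * \<beta> H) else \<mu>)"

inductive_set weyl_group ::
    "'a::complex_lie_algebra set \<Rightarrow> (('a \<Rightarrow> complex) \<Rightarrow> ('a \<Rightarrow> complex)) set"
  for \<hh> where
  weyl_id: "id \<in> weyl_group \<hh>"
| weyl_reflection: "w \<in> weyl_group \<hh> \<Longrightarrow> \<beta> \<in> roots \<hh> \<Longrightarrow> reflection \<hh> \<beta> \<circ> w \<in> weyl_group \<hh>"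


section \<open>Simple roots and Dynkin types\<close>

text \<open>Throughout, \<open>\<alpha> 1, \<dots>, \<alpha> n\<close> are the simple roots; other values of \<open>\<alpha>\<close> are irrelevant.\<close>

definition pos_roots ::
    "'a::complex_lie_algebra set \<Rightarrow> nat \<Rightarrow> (nat \<Rightarrow> 'a \<Rightarrow> complex) \<Rightarrow> ('a \<Rightarrow> complex) set" where
  "pos_roots \<hh> n \<alpha> =
     {\<beta> \<in> roots \<hh>. \<exists>c :: nat \<Rightarrow> nat. \<beta> = (\<lambda>H. \<Sum>k = 1..n. of_nat (c k) * \<alpha> k H)}"

definition neg_roots ::
    "'a::complex_lie_algebra set \<Rightarrow> nat \<Rightarrow> (nat \<Rightarrow> 'a \<Rightarrow> complex) \<Rightarrow> ('a \<Rightarrow> complex) set" where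
  "neg_roots \<hh> n \<alpha> =
     {\<beta> \<in> roots \<hh>. \<exists>c :: nat \<Rightarrow> nat. \<beta> = (\<lambda>H. - (\<Sum>k = 1..n. of_nat (c k) * \<alpha> k H))}"

definition simple_roots ::
    "'a::complex_lie_algebra set \<Rightarrow> nat \<Rightarrow> (nat \<Rightarrow> 'a \<Rightarrow> complex) \<Rightarrow> bool" where
  "simple_roots \<hh> n \<alpha> \<longleftrightarrow>
     (\<forall>k\<in>{1..n}. \<alpha> k \<in> roots \<hh>) \<and>
     (\<forall>\<mu>\<in>dual_space \<hh>. \<exists>!c :: nat \<Rightarrow> complex.
        (\<forall>k. k \<notin> {1..n} \<longrightarrow> c k = 0) \<and> \<mu> = (\<lambda>H. \<Sum>k = 1..n. c k * \<alpha> k H)) \<and>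
     roots \<hh> = pos_roots \<hh> n \<alpha> \<union> neg_roots \<hh> n \<alpha>"

datatype dynkin = TypeA | TypeB | TypeC | TypeD

text \<open>The entry \<open>\<langle>\<alpha>\<^sub>k, \<alpha>\<^sub>l\<^sup>\<or>\<rangle>\<close> of the Cartan matrix of rank \<open>n\<close>, for \<open>1 \<le> k, l \<le> n\<close> in Bourbaki's
  numbering (\<open>\<alpha>\<^sub>n\<close> is the short simple root in type B and the long one in type C).\<close>

fun cartan_entry :: "dynkin \<Rightarrow> nat \<Rightarrow> nat \<Rightarrow> nat \<Rightarrow> int" where
  "cartan_entry TypeA n k l =
     (if k = l then 2 else if k = l + 1 \<or> l = k + 1 then -1 else 0)"
| "cartan_entry TypeB n k l =
     (if k = l then 2 else if k = n - 1 \<and> l = n then -2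
      else if k = l + 1 \<or> l = k + 1 then -1 else 0)"
| "cartan_entry TypeC n k l =
     (if k = l then 2 else if k = n \<and> l = n - 1 then -2
      else if k = l + 1 \<or> l = k + 1 then -1 else 0)"
| "cartan_entry TypeD n k l =
     (if k = l then 2 else if {k, l} = {n - 1, n} then 0 else if {k, l} = {n - 2, n} then -1
      else if k = l + 1 \<or> l = k + 1 then -1 else 0)"

definition has_dynkin_type ::
    "dynkin \<Rightarrow> 'a::complex_lie_algebra set \<Rightarrow> nat \<Rightarrow> (nat \<Rightarrow> 'a \<Rightarrow> complex) \<Rightarrow> bool" where
  "has_dynkin_type T \<hh> n \<alpha> \<longleftrightarrow>
     (\<forall>k\<in>{1..n}. \<forall>l\<in>{1..n}. \<alpha> k (coroot \<hh> (\<alpha> l)) = of_int (cartan_entry T n k l))"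

text \<open>The basis \<open>Z\<^sub>1, \<dots>, Z\<^sub>n\<close> of \<open>\<hh>\<close> dual to the simple roots.\<close>

definition Zdual ::
    "'a::complex_lie_algebra set \<Rightarrow> nat \<Rightarrow> (nat \<Rightarrow> 'a \<Rightarrow> complex) \<Rightarrow> nat \<Rightarrow> 'a" where
  "Zdual \<hh> n \<alpha> k = (THE H. H \<in> \<hh> \<and> (\<forall>l\<in>{1..n}. \<alpha> l H = (if l = k then 1 else 0)))"


section \<open>Schubert varieties in \<open>G/P\<^sub>i\<close>\<close>

definition graded_piece ::
    "'a::complex_lie_algebra set \<Rightarrow> nat \<Rightarrow> (nat \<Rightarrow> 'a \<Rightarrow> complex) \<Rightarrow> nat \<Rightarrow> int \<Rightarrow> 'a set" where
  "graded_piece \<hh> n \<alpha> i j = {X. lie (Zdual \<hh> n \<alpha> i) X = of_int j *\<^sub>C X}"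

definition inv_roots ::
    "'a::complex_lie_algebra set \<Rightarrow> nat \<Rightarrow> (nat \<Rightarrow> 'a \<Rightarrow> complex) \<Rightarrow>
     (('a \<Rightarrow> complex) \<Rightarrow> ('a \<Rightarrow> complex)) \<Rightarrow> ('a \<Rightarrow> complex) set" where
  "inv_roots \<hh> n \<alpha> w = w ` neg_roots \<hh> n \<alpha> \<inter> pos_roots \<hh> n \<alpha>"

text \<open>\<open>hasse\<close> is the set \<open>W\<^sup>\<pp>\<close> of minimal coset representatives (the Hasse diagram of \<open>\<pp>\<close>), and
  \<open>inv_roots\<close> is \<open>\<Delta>(w) = w \<Delta>\<^sup>- \<inter> \<Delta>\<^sup>+\<close>.\<close>

definition hasse ::
    "'a::complex_lie_algebra set \<Rightarrow> nat \<Rightarrow> (nat \<Rightarrow> 'a \<Rightarrow> complex) \<Rightarrow> nat \<Rightarrow>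
     (('a \<Rightarrow> complex) \<Rightarrow> ('a \<Rightarrow> complex)) set" where
  "hasse \<hh> n \<alpha> i =
     {w \<in> weyl_group \<hh>. \<forall>\<beta>\<in>inv_roots \<hh> n \<alpha> w. root_space \<hh> \<beta> \<subseteq> graded_piece \<hh> n \<alpha> i 1}"

definition schubert_n ::
    "'a::complex_lie_algebra set \<Rightarrow> nat \<Rightarrow> (nat \<Rightarrow> 'a \<Rightarrow> complex) \<Rightarrow>
     (('a \<Rightarrow> complex) \<Rightarrow> ('a \<Rightarrow> complex)) \<Rightarrow> 'a set" where
  "schubert_n \<hh> n \<alpha> w =
     lie_vs.span (\<Union>\<beta>\<in>inv_roots \<hh> n \<alpha> w. root_space \<hh> (\<lambda>H. - \<beta> H))"

text \<open>Schubert varieties of \<open>G/P\<^sub>i\<close> are indexed by \<open>w \<in> hasse \<hh> n \<alpha> i\<close>. The variety \<open>X\<^sub>w\<close>, the closure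
  of \<open>B w\<^sup>-\<^sup>1 o\<close>, is proper (neither a point nor \<open>G/P\<^sub>i\<close>) iff \<open>0 \<noteq> \<nn>\<^sub>w \<noteq> \<gg>\<^sub>-\<^sub>1\<close>, where \<open>\<nn>\<^sub>w\<close> is the
  tangent space at \<open>o\<close> of \<open>w X\<^sub>w\<close>; this is taken as the definition.\<close>

definition proper_schubert ::
    "'a::complex_lie_algebra set \<Rightarrow> nat \<Rightarrow> (nat \<Rightarrow> 'a \<Rightarrow> complex) \<Rightarrow> nat \<Rightarrow>
     (('a \<Rightarrow> complex) \<Rightarrow> ('a \<Rightarrow> complex)) \<Rightarrow> bool" where
  "proper_schubert \<hh> n \<alpha> i w \<longleftrightarrow>
     schubert_n \<hh> n \<alpha> w \<noteq> {0} \<and> schubert_n \<hh> n \<alpha> w \<noteq> graded_piece \<hh> n \<alpha> i (-1)"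

definition I_par :: "nat \<Rightarrow> nat \<Rightarrow> nat set" where
  "I_par n i = {1..n} - {i}"

definition schubert_J ::
    "'a::complex_lie_algebra set \<Rightarrow> nat \<Rightarrow> (nat \<Rightarrow> 'a \<Rightarrow> complex) \<Rightarrow> nat \<Rightarrow>
     (('a \<Rightarrow> complex) \<Rightarrow> ('a \<Rightarrow> complex)) \<Rightarrow> nat set" where
  "schubert_J \<hh> n \<alpha> i w =
     {j \<in> I_par n i. \<not> lie_span (root_space \<hh> (\<lambda>H. - \<alpha> j H)) (schubert_n \<hh> n \<alpha> w)
                          \<subseteq> schubert_n \<hh> n \<alpha> w}"

definition schubert_Z ::
    "'a::complex_lie_algebra set \<Rightarrow> nat \<Rightarrow> (nat \<Rightarrow> 'a \<Rightarrow> complex) \<Rightarrow> nat \<Rightarrow>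
     (('a \<Rightarrow> complex) \<Rightarrow> ('a \<Rightarrow> complex)) \<Rightarrow> 'a" where
  "schubert_Z \<hh> n \<alpha> i w = (\<Sum>j\<in>schubert_J \<hh> n \<alpha> i w. Zdual \<hh> n \<alpha> j)"

text \<open>Roots take integer values on \<open>Z\<^sub>w\<close>, but these values are typed as complex numbers; the maximum
  is therefore taken over the corresponding integers. It is only meaningful if \<open>\<Delta>(w) \<noteq> \<emptyset>\<close>.\<close>

definition schubert_a ::
    "'a::complex_lie_algebra set \<Rightarrow> nat \<Rightarrow> (nat \<Rightarrow> 'a \<Rightarrow> complex) \<Rightarrow> nat \<Rightarrow>
     (('a \<Rightarrow> complex) \<Rightarrow> ('a \<Rightarrow> complex)) \<Rightarrow> int" where
  "schubert_a \<hh> n \<alpha> i w =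
     Max {m :: int. \<exists>\<beta>\<in>inv_roots \<hh> n \<alpha> w. \<beta> (schubert_Z \<hh> n \<alpha> i w) = of_int m}"


section \<open>The classical cases and their criteria\<close>

inductive classical_chss :: "dynkin \<Rightarrow> nat \<Rightarrow> nat \<Rightarrow> bool" where
  "1 \<le> i \<Longrightarrow> i \<le> n \<Longrightarrow> classical_chss TypeA n i"
| "2 \<le> n \<Longrightarrow> classical_chss TypeB n 1"
| "4 \<le> n \<Longrightarrow> classical_chss TypeD n 1"
| "3 \<le> n \<Longrightarrow> classical_chss TypeC n n"
| "4 \<le> n \<Longrightarrow> classical_chss TypeD n n"

text \<open>The \<open>s\<close>-th element \<open>j\<^sub>s\<close> of \<open>J = {j\<^sub>1 < \<dots> < j\<^sub>p}\<close>, with \<open>j\<^sub>0 = 0\<close> and \<open>j\<^sub>p\<^sub>+\<^sub>1 = 1 + max I\<close>.\<close>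

definition jnth :: "nat set \<Rightarrow> nat set \<Rightarrow> nat \<Rightarrow> nat" where
  "jnth I J s =
     (if s = 0 then 0 else if s \<le> card J then sorted_list_of_set J ! (s - 1) else 1 + Max I)"

definition criteria_A :: "nat \<Rightarrow> nat \<Rightarrow> int \<Rightarrow> nat set \<Rightarrow> bool" where
  "criteria_A n i a J \<longleftrightarrow>
     a \<le> min (int i - 1) (int n - int i) \<and>
     (let p = int (card J); q = int (card {j \<in> J. j < i})
      in (p, q) \<in> {(2*a, a), (2*a + 1, a), (2*a + 1, a + 1), (2*a + 2, a + 1)})"

definition criteria_B1 :: "int \<Rightarrow> nat set \<Rightarrow> bool" where
  "criteria_B1 a J \<longleftrightarrow> a \<le> 1 \<and> (\<exists>j. J = {j})"

definition criteria_D1 :: "nat \<Rightarrow> int \<Rightarrow> nat set \<Rightarrow> bool" where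
  "criteria_D1 n a J \<longleftrightarrow>
     a \<le> 1 \<and>
     (a = 0 \<longrightarrow> (\<exists>j. J = {j}) \<or> J = {n - 1, n}) \<and>
     (a = 1 \<longrightarrow> (\<exists>j. J = {j} \<and> j \<le> n - 2) \<or> J = {n - 1, n})"

definition criteria_Cn :: "nat \<Rightarrow> int \<Rightarrow> nat set \<Rightarrow> bool" where
  "criteria_Cn n a J \<longleftrightarrow> a \<le> int n - 1 \<and> (int (card J) = a \<or> int (card J) = a + 1)"

definition criteria_Dn :: "nat \<Rightarrow> int \<Rightarrow> nat set \<Rightarrow> bool" where
  "criteria_Dn n a J \<longleftrightarrow>
     (let p = int (card J); js = (\<lambda>s. int (jnth (I_par n n) J (nat s))) in
       (a \<le> int n - 3 \<and>
        (p = a \<and> n - 1 \<notin> J \<or> p = a + 1 \<and> n - 1 \<in> J) \<and>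
        (let s = \<lceil>(real_of_int p + 1) / 2\<rceil> in js s - js (s - 1) \<ge> 2))
       \<or>
       (a \<le> int n - 4 \<and>
        (p = a + 1 \<and> n - 1 \<notin> J \<or> p = a + 2 \<and> n - 1 \<in> J) \<and>
        (let s = \<lceil>real_of_int p / 2\<rceil> in js (s + 1) - js s \<ge> 2)))"

definition criteria :: "dynkin \<Rightarrow> nat \<Rightarrow> nat \<Rightarrow> int \<Rightarrow> nat set \<Rightarrow> bool" where
  "criteria T n i a J \<longleftrightarrow>
     (case T of
        TypeA \<Rightarrow> criteria_A n i a J
      | TypeB \<Rightarrow> criteria_B1 a J
      | TypeC \<Rightarrow> criteria_Cn n a J
      | TypeD \<Rightarrow> (if i = 1 then criteria_D1 n a J else criteria_Dn n a J))"

end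

theory Submission
  imports Defs "HOL-Library.Function_Algebras"
begin

text \<open>The sets \<open>\<Delta>(w)\<close>, for \<open>w\<close> in the Hasse diagram of \<open>\<pp>\<close>, are exactly the order ideals of the poset of roots
  with coefficient \<open>1\<close> at \<open>\<alpha>\<^sub>i\<close>: an ideal is realized by induction, removing a root of maximal height, which the
  inverse of the Weyl group element of the smaller ideal sends to a simple root. Under this bijection \<open>J(w)\<close>
  consists of the simple roots whose addition leads out of the ideal, and \<open>a(w)\<close> is the maximum over the ideal of
  the level, the sum of the coefficients at the elements of \<open>J(w)\<close>.

  In types A and C the poset is a rectangle, or the quotient of a square by transposition, and its ideals are
  staircases. The numbers \<open>\<rho> x\<close> and \<open>\<sigma> y\<close> of corners of the staircase before row \<open>x\<close> and column \<open>y\<close> add up to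
  the level of the cell \<open>(x, y)\<close>, and a cell of the staircase has strictly smaller level than a cell outside of it. Hence the staircase is the
  set of cells of level at most \<open>a\<close>, so that \<open>(a, J)\<close> determines it, and the criteria say which pairs occur.
  For \<open>D\<^sub>n / P\<^sub>n\<close> the diagonal of the square is missing; it is filled in so as to reduce to the staircase
  argument. For quadrics the poset is nearly a chain.

  The degree-one roots are found from the Cartan matrix alone. Every root is a Weyl conjugate of a simple root, so
  in the coordinates \<open>\<epsilon>\<^sub>k\<close> of Bourbaki it has the norm of a simple root, which leaves few possibilities;
  root strings show that all of them occur. The
  Killing form is nondegenerate on a simple Lie algebra because \<open>\<kappa>(H, H) > 0\<close> for an \<open>H\<close> on which all simple
  roots take the value \<open>1\<close>, so Cartan's criterion is not needed.\<close>

section \<open>Weights and roots\<close>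

text \<open>The criteria have a common source: for a proper nonempty staircase, the number of row
  corners and the number of column corners each equal \<open>a\<close> or \<open>a + 1\<close>. In
  type A these numbers count the elements of \<open>J\<close> on the two sides of \<open>i\<close>,
  whence the four pairs (p, q); in type C both equal p. The bounds on \<open>a\<close> then come
  from counting the available labels. In type D the last simple root is \<epsilon>_(n-1) +
  \<epsilon>_n instead of 2 \<epsilon>_n, so the vectors of the half square are those of type C
  minus \<alpha>_(n-1). This lowers the level by one exactly if \<open>n - 1 \<in> J\<close>, which
  explains the brackets in the criteria. The gap condition expresses that a corner next to the
  diagonal must be visible in a cell off the diagonal. Two notions of ideal are in play. Sets coming
  from the Weyl group are used through closure under subtracting one simple root, while realizing a
  set requires closure in the coefficientwise order. Each ideal turns out to be a level set, and
  level sets have the stronger property. On the Lie algebra side, root spaces are handled through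
  nonzero vectors and the Killing form, whatever their dimension.\<close>

lemma eigenvectors_independent:
  fixes f :: "'g::complex_lie_algebra \<Rightarrow> 'g"
  assumes add: "\<And>x y. f (x + y) = f x + f y" and scale: "\<And>c x. f (c *\<^sub>C x) = c *\<^sub>C f x"
    and "finite C" and "\<forall>c\<in>C. f (v c) = c *\<^sub>C v c" and "(\<Sum>c\<in>C. v c) = 0"
  shows "\<forall>c\<in>C. v c = 0"
  using assms(3-)
proof (induction C arbitrary: v rule: finite_induct)
  case empty
  then show ?case by simp
next
  case (insert d C)
  have f0: "f 0 = 0" using scale[of 0 0] by simp
  have f_sum: "f (\<Sum>c\<in>S. v c) = (\<Sum>c\<in>S. f (v c))" if "finite S" for S
    using that by (induction S rule: finite_induct) (simp_all add: f0 add)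
  \<comment> \<open>Applying \<open>f - d\<close> to the relation removes the summand of
    \<open>d\<close> and multiplies the summand of \<open>c\<close> by \<open>c - d\<close>, which
    is nonzero on \<open>C\<close>.\<close>
  have "(\<Sum>c\<in>C. (c - d) *\<^sub>C v c) = (\<Sum>c\<in>C. f (v c)) - (\<Sum>c\<in>C. d *\<^sub>C v c)"
    using insert.prems(1) by (simp add: sum_subtractf[symmetric] lie_vs.scale_left_diff_distrib)
  also have "\<dots> = f (\<Sum>c\<in>C. v c) - d *\<^sub>C (\<Sum>c\<in>C. v c)"
    using insert.hyps by (simp add: f_sum lie_vs.scale_sum_right)
  also have "(\<Sum>c\<in>C. v c) = (-1) *\<^sub>C v d"
    using insert.prems(2) insert.hyps by (simp add: add_eq_0_iff)
  also have "f \<dots> - d *\<^sub>C \<dots> = 0"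
    using insert.prems(1) by (simp only: scale) (simp add: lie_vs.scale_left_commute)
  finally have "(\<Sum>c\<in>C. (c - d) *\<^sub>C v c) = 0" .
  moreover have "\<forall>c\<in>C. f ((c - d) *\<^sub>C v c) = c *\<^sub>C ((c - d) *\<^sub>C v c)"
    using insert.prems(1) by (simp add: scale lie_vs.scale_left_commute mult.commute)
  ultimately have "\<forall>c\<in>C. (c - d) *\<^sub>C v c = 0"
    using insert.IH[of "\<lambda>c. (c - d) *\<^sub>C v c"] by blast
  then have "\<forall>c\<in>C. v c = 0" using insert.hyps(2) by auto
  then show ?case using insert.prems(2) insert.hyps by simp
qed

text \<open>Indexing the components by their eigenvalue, with value 0 outside \<open>C\<close>,
  makes adding one more eigenvector an update of \<open>v\<close> at a single point.\<close>

lemma span_eigenvectors_sum: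
  fixes f :: "'g::complex_lie_algebra \<Rightarrow> 'g"
  assumes add: "\<And>x y. f (x + y) = f x + f y" and scale: "\<And>c x. f (c *\<^sub>C x) = c *\<^sub>C f x"
    and "X \<in> lie_vs.span {X. \<exists>c. f X = c *\<^sub>C X}"
  shows "\<exists>C v. finite C \<and> (\<forall>c. f (v c) = c *\<^sub>C v c) \<and> X = (\<Sum>c\<in>C. v c) \<and> (\<forall>c. c \<notin> C \<longrightarrow> v c = 0)"
  using assms(3)
proof (induction rule: lie_vs.span_induct_alt)
  case base
  have "f 0 = 0" using scale[of 0 0] by simp
  then show ?case by (intro exI[of _ "{}"] exI[of _ "\<lambda>_. 0"]) simp
next
  case (step a x y)
  then obtain C v d where Cv: "finite C" "\<forall>c. f (v c) = c *\<^sub>C v c" "y = (\<Sum>c\<in>C. v c)"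
      "\<forall>c. c \<notin> C \<longrightarrow> v c = 0" and d: "f x = d *\<^sub>C x" by blast
  define v' where "v' = v(d := v d + a *\<^sub>C x)"
  have "(\<Sum>c\<in>insert d C. v' c) = v' d + (\<Sum>c\<in>C - {d}. v' c)"
    using Cv(1) by (simp add: sum.insert_remove)
  also have "(\<Sum>c\<in>C - {d}. v' c) = (\<Sum>c\<in>C - {d}. v c)"
    by (rule sum.cong) (auto simp: v'_def)
  also have "v' d + \<dots> = a *\<^sub>C x + (v d + (\<Sum>c\<in>C - {d}. v c))" by (simp add: v'_def)
  also have "v d + (\<Sum>c\<in>C - {d}. v c) = (\<Sum>c\<in>insert d C. v c)"
    using Cv(1) by (simp add: sum.insert_remove)
  also have "\<dots> = y" using Cv by (cases "d \<in> C") (simp_all add: insert_absorb)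
  finally have "a *\<^sub>C x + y = (\<Sum>c\<in>insert d C. v' c)" ..
  moreover have "\<forall>c. f (v' c) = c *\<^sub>C v' c"
    using Cv(2) d by (auto simp: v'_def add scale scaleC_add_right lie_vs.scale_left_commute mult.commute)
  moreover have "\<forall>c. c \<notin> insert d C \<longrightarrow> v' c = 0" using Cv(4) by (simp add: v'_def)
  ultimately show ?case using Cv(1) by blast
qed

lemma lie_zero_left [simp]: "lie 0 (x :: 'g::complex_lie_algebra) = 0"
  using lie_scaleC_left[of 0 0 x] by simp

lemma lie_zero_right [simp]: "lie (x :: 'g::complex_lie_algebra) 0 = 0"
  using lie_scaleC_right[of x 0 0] by simp

lemma lie_minus_right: "lie x (- y :: 'g::complex_lie_algebra) = - lie x y"
  using lie_scaleC_right[of x "-1" y] by simp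

lemma lie_diff_right: "lie x (y - z :: 'g::complex_lie_algebra) = lie x y - lie x z"
  using lie_add_right[of x y "-z"] by (simp add: lie_minus_right)

lemma lie_sum_right: "lie y (\<Sum>k\<in>K. f k :: 'g::complex_lie_algebra) = (\<Sum>k\<in>K. lie y (f k))"
  by (induction K rule: infinite_finite_induct) (simp_all add: lie_add_right)

lemma lie_antisym: "lie y (x :: 'g::complex_lie_algebra) = - lie x y"
proof -
  have "lie (x + y) (x + y) = 0" by (rule lie_self)
  then have "lie y x + lie x y = 0"
    by (simp add: lie_add_left lie_add_right lie_self[of x] lie_self[of y] add.commute)
  then show ?thesis by (rule eq_neg_iff_add_eq_0[THEN iffD2])
qed

lemma lie_lie_left: "lie (lie x y) (z :: 'g::complex_lie_algebra) = lie x (lie y z) - lie y (lie x z)"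
proof -
  have "lie x (lie y z) + lie y (lie z x) + lie z (lie x y) = 0" by (rule jacobi)
  moreover have "lie y (lie z x) = - lie y (lie x z)" by (simp add: lie_antisym[of z x] lie_minus_right)
  moreover have "lie z (lie x y) = - lie (lie x y) z" by (rule lie_antisym)
  ultimately show ?thesis by (simp add: algebra_simps add_eq_0_iff)
qed

lemma lie_lie_right: "lie x (lie y (z :: 'g::complex_lie_algebra)) = lie (lie x y) z + lie y (lie x z)"
  by (simp add: lie_lie_left)

lemma subspace_lie_in:
  fixes U V :: "'g::complex_lie_algebra set"
  assumes "lie_vs.subspace V" "\<And>x y. x \<in> A \<Longrightarrow> y \<in> U \<Longrightarrow> lie x y \<in> V"
    "x \<in> A" "y \<in> lie_vs.span U"
  shows "lie x y \<in> V"
  using assms(4)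
proof (induction rule: lie_vs.span_induct_alt)
  case base
  then show ?case using assms(1) by (simp add: lie_vs.subspace_0)
next
  case (step c u y)
  then show ?case
    using assms by (simp add: lie_add_right lie_scaleC_right lie_vs.subspace_add lie_vs.subspace_scale)
qed

locale cartan_setting =
  fixes \<hh> :: "'g::complex_lie_algebra set" and n :: nat and \<alpha> :: "nat \<Rightarrow> 'g \<Rightarrow> complex"
  assumes simple: "simple_lie_algebra TYPE('g)"
    and cartan: "cartan_subalgebra \<hh>"
    and simple_roots: "simple_roots \<hh> n \<alpha>"
begin

lemma subspace_h: "lie_vs.subspace \<hh>" using cartan by (simp add: cartan_subalgebra_def)
lemma lie_h_h: "H \<in> \<hh> \<Longrightarrow> H' \<in> \<hh> \<Longrightarrow> lie H H' = 0" using cartan by (simp add: cartan_subalgebra_def)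
lemma centralizer_h: "(\<And>H. H \<in> \<hh> \<Longrightarrow> lie H X = 0) \<Longrightarrow> X \<in> \<hh>" using cartan unfolding cartan_subalgebra_def by blast

lemma independent_finite: "lie_vs.independent (S :: 'g set) \<Longrightarrow> finite S"
proof -
  obtain T :: "'g set" where "finite T" "lie_vs.span T = UNIV"
    using simple unfolding simple_lie_algebra_def by blast
  then show "finite S" if "lie_vs.independent S"
    using lie_vs.independent_span_bound[OF _ that, of T] by simp
qed

text \<open>The Cartan condition diagonalizes each ad H separately. Commuting diagonalizable
  operators are diagonalized together: the components of a joint eigenvector under a further
  operator remain joint eigenvectors.\<close>

lemma joint_eigenvectors_span:
  assumes "finite S" "S \<subseteq> \<hh>"
  shows "lie_vs.span {X. \<forall>H\<in>S. \<exists>c. lie H X = c *\<^sub>C X} = UNIV"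
  using assms
proof (induction S rule: finite_induct)
  case empty
  then show ?case by simp
next
  case (insert H S)
  let ?E = "{X. \<forall>H\<in>S. \<exists>c. lie H X = c *\<^sub>C X}"
  let ?E' = "{X. \<forall>H\<in>insert H S. \<exists>c. lie H X = c *\<^sub>C X}"
  have "X \<in> lie_vs.span ?E'" if X: "X \<in> ?E" for X
  proof -
    have "X \<in> lie_vs.span {X. \<exists>c. lie H X = c *\<^sub>C X}"
      using cartan insert.prems by (simp add: cartan_subalgebra_def)
    from span_eigenvectors_sum[of "lie H", OF lie_add_right lie_scaleC_right this]
    obtain C v where Cv: "finite C" "\<forall>c. lie H (v c) = c *\<^sub>C v c" "X = (\<Sum>c\<in>C. v c)" by blast
    have "v c \<in> ?E'" if "c \<in> C" for c
    proof -
      have "\<exists>c'. lie H' (v c) = c' *\<^sub>C v c" if H': "H' \<in> S" for H'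
      proof -
        obtain c' where c': "lie H' X = c' *\<^sub>C X" using X H' by blast
        have comm: "lie H (lie H' Y) = lie H' (lie H Y)" for Y
          using H' insert.prems lie_h_h[of H H'] by (subst lie_lie_right) auto
        \<comment> \<open>The defect of \<open>v c\<close> from being an eigenvector of ad H'. It
          lies in the same eigenspace of ad H, and the defects sum to 0 because \<open>X\<close>
          itself is an eigenvector of ad H'.\<close>
        define w where "w c = lie H' (v c) - c' *\<^sub>C v c" for c
        have "\<forall>c\<in>C. lie H (w c) = c *\<^sub>C w c"
          using Cv(2) by (simp add: w_def lie_diff_right comm lie_scaleC_right
              lie_vs.scale_right_diff_distrib lie_vs.scale_left_commute mult.commute)
        moreover have "(\<Sum>c\<in>C. w c) = 0"
          using c' by (simp add: w_def sum_subtractf Cv(3) lie_sum_right lie_vs.scale_sum_right)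
        ultimately have "w c = 0"
          using eigenvectors_independent[of "lie H" C w, OF lie_add_right lie_scaleC_right Cv(1)] \<open>c \<in> C\<close>
          by blast
        then show ?thesis unfolding w_def by auto
      qed
      then show ?thesis using Cv(2) by auto
    qed
    then show ?thesis unfolding Cv(3) by (intro lie_vs.span_sum) (simp add: lie_vs.span_base)
  qed
  then have "lie_vs.span ?E \<subseteq> lie_vs.span ?E'"
    by (intro lie_vs.span_minimal subsetI lie_vs.subspace_span)
  then show ?case using insert by auto
qed

abbreviation "D \<equiv> dual_space \<hh>"
abbreviation "R \<equiv> roots \<hh>"
abbreviation "g \<equiv> root_space \<hh>"

lemma D_add: "\<mu> \<in> D \<Longrightarrow> x \<in> \<hh> \<Longrightarrow> y \<in> \<hh> \<Longrightarrow> \<mu> (x + y) = \<mu> x + \<mu> y"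
  and D_scale: "\<mu> \<in> D \<Longrightarrow> x \<in> \<hh> \<Longrightarrow> \<mu> (c *\<^sub>C x) = c * \<mu> x"
  and D_out: "\<mu> \<in> D \<Longrightarrow> x \<notin> \<hh> \<Longrightarrow> \<mu> x = 0"
  by (auto simp: dual_space_def)

lemma h_0: "0 \<in> \<hh>" and h_add: "x \<in> \<hh> \<Longrightarrow> y \<in> \<hh> \<Longrightarrow> x + y \<in> \<hh>" and h_scale: "x \<in> \<hh> \<Longrightarrow> c *\<^sub>C x \<in> \<hh>"
  and h_diff: "x \<in> \<hh> \<Longrightarrow> y \<in> \<hh> \<Longrightarrow> x - y \<in> \<hh>" and h_neg: "x \<in> \<hh> \<Longrightarrow> - x \<in> \<hh>"
  and h_sum: "(\<And>k. k \<in> K \<Longrightarrow> f k \<in> \<hh>) \<Longrightarrow> sum f K \<in> \<hh>"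
  using subspace_h by (simp_all add: lie_vs.subspace_0 lie_vs.subspace_add lie_vs.subspace_scale
      lie_vs.subspace_diff lie_vs.subspace_neg lie_vs.subspace_sum)

lemma D_0: "\<mu> \<in> D \<Longrightarrow> \<mu> 0 = 0" using D_scale[of \<mu> 0 0] h_0 by simp

lemma D_neg: "\<mu> \<in> D \<Longrightarrow> x \<in> \<hh> \<Longrightarrow> \<mu> (- x) = - \<mu> x" using D_scale[of \<mu> x "-1"] by simp

lemma D_diff: "\<mu> \<in> D \<Longrightarrow> x \<in> \<hh> \<Longrightarrow> y \<in> \<hh> \<Longrightarrow> \<mu> (x - y) = \<mu> x - \<mu> y"
  using D_add[of \<mu> x "-y"] D_neg[of \<mu> y] h_neg[of y] by simp

lemma D_sum: "\<mu> \<in> D \<Longrightarrow> (\<And>k. k \<in> K \<Longrightarrow> f k \<in> \<hh>) \<Longrightarrow> \<mu> (sum f K) = (\<Sum>k\<in>K. \<mu> (f k))"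
  by (induction K rule: infinite_finite_induct) (simp_all add: D_0 D_add h_sum)

lemma D_plus: "\<mu> \<in> D \<Longrightarrow> \<nu> \<in> D \<Longrightarrow> \<mu> + \<nu> \<in> D"
  and D_minus: "\<mu> \<in> D \<Longrightarrow> \<nu> \<in> D \<Longrightarrow> \<mu> - \<nu> \<in> D"
  and D_uminus: "\<mu> \<in> D \<Longrightarrow> - \<mu> \<in> D"
  and D_zero: "0 \<in> D"
  and D_smult: "\<mu> \<in> D \<Longrightarrow> (\<lambda>H. c * \<mu> H) \<in> D"
  by (simp_all add: dual_space_def algebra_simps)

lemma D_eqI: "\<mu> \<in> D \<Longrightarrow> \<nu> \<in> D \<Longrightarrow> (\<And>H. H \<in> \<hh> \<Longrightarrow> \<mu> H = \<nu> H) \<Longrightarrow> \<mu> = \<nu>"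
  by (metis D_out ext)

lemma root_spaceD: "X \<in> g \<mu> \<Longrightarrow> H \<in> \<hh> \<Longrightarrow> lie H X = \<mu> H *\<^sub>C X" by (simp add: root_space_def)

text \<open>An eigenvector for a basis of \<open>\<hh>\<close> is one for all of
  \<open>\<hh>\<close>, and its eigenvalue depends linearly on \<open>H\<close>. The eigenvalue
  function is set to 0 outside \<open>\<hh>\<close>, as the encoding of linear forms
  demands.\<close>

lemma weight_basis_exists:
  "\<exists>B \<mu>. finite B \<and> lie_vs.independent B \<and> lie_vs.span B = UNIV \<and> (\<forall>b\<in>B. \<mu> b \<in> D \<and> b \<in> g (\<mu> b))"
proof -
  obtain S where S: "S \<subseteq> \<hh>" "lie_vs.independent S" "\<hh> \<subseteq> lie_vs.span S"
    by (rule lie_vs.maximal_independent_subset[of \<hh>])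
  let ?E = "{X. \<forall>H\<in>S. \<exists>c. lie H X = c *\<^sub>C X}"
  obtain B where B: "B \<subseteq> ?E" "lie_vs.independent B" "?E \<subseteq> lie_vs.span B"
    by (rule lie_vs.maximal_independent_subset[of ?E])
  have "lie_vs.span ?E \<subseteq> lie_vs.span B"
    by (rule lie_vs.span_minimal[OF B(3) lie_vs.subspace_span])
  then have span: "lie_vs.span B = UNIV"
    using joint_eigenvectors_span[OF independent_finite[OF S(2)] S(1)] by auto
  have "\<exists>\<mu>. \<mu> \<in> D \<and> b \<in> g \<mu>" if b: "b \<in> B" for b
  proof -
    have b0: "b \<noteq> 0" using b B(2) lie_vs.dependent_zero by blast
    have ev: "\<exists>c. lie H b = c *\<^sub>C b" if "H \<in> lie_vs.span S" for H
      using that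
    proof (induction rule: lie_vs.span_induct_alt)
      case base
      then show ?case by (intro exI[of _ 0]) simp
    next
      case (step c x y)
      then obtain d e where "lie x b = d *\<^sub>C b" "lie y b = e *\<^sub>C b" using B(1) b by blast
      then have "lie (c *\<^sub>C x + y) b = (c * d + e) *\<^sub>C b"
        by (simp add: lie_add_left lie_scaleC_left scaleC_add_left)
      then show ?case by blast
    qed
    define \<mu> where "\<mu> H = (if H \<in> \<hh> then SOME c. lie H b = c *\<^sub>C b else 0)" for H
    have \<mu>: "lie H b = \<mu> H *\<^sub>C b" if "H \<in> \<hh>" for H
      using someI_ex[OF ev[of H]] that S(3) by (auto simp: \<mu>_def)
    have uniq: "\<mu> H = c" if "H \<in> \<hh>" "lie H b = c *\<^sub>C b" for H c
      using \<mu>[OF that(1)] that(2) b0 by simp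
    have "\<mu> \<in> D"
    proof -
      have "\<mu> (x + y) = \<mu> x + \<mu> y" if "x \<in> \<hh>" "y \<in> \<hh>" for x y
        by (intro uniq) (simp_all add: h_add that lie_add_left \<mu> scaleC_add_left)
      moreover have "\<mu> (c *\<^sub>C x) = c * \<mu> x" if "x \<in> \<hh>" for x c
        by (intro uniq) (simp_all add: h_scale that lie_scaleC_left \<mu>)
      ultimately show ?thesis by (simp add: dual_space_def) (simp add: \<mu>_def)
    qed
    moreover have "b \<in> g \<mu>" using \<mu> by (simp add: root_space_def)
    ultimately show ?thesis by blast
  qed
  then have "\<exists>\<mu>. \<forall>b\<in>B. \<mu> b \<in> D \<and> b \<in> g (\<mu> b)" by metis
  then show ?thesis using B(2) span independent_finite by blast
qed

text \<open>One basis of weight vectors is fixed by choice. In it every ad H is diagonal, so that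
  traces become sums over weights.\<close>

definition basis :: "'g set" where
  "basis = (SOME B. \<exists>\<mu>. finite B \<and> lie_vs.independent B \<and> lie_vs.span B = UNIV \<and>
     (\<forall>b\<in>B. \<mu> b \<in> D \<and> b \<in> g (\<mu> b)))"

definition wt :: "'g \<Rightarrow> 'g \<Rightarrow> complex" where
  "wt = (SOME \<mu>. \<forall>b\<in>basis. \<mu> b \<in> D \<and> b \<in> g (\<mu> b))"

lemma basis: "finite basis" "lie_vs.independent basis" "lie_vs.span basis = UNIV"
  and wt: "b \<in> basis \<Longrightarrow> wt b \<in> D" "b \<in> basis \<Longrightarrow> b \<in> g (wt b)"
proof -
  have *: "\<exists>\<mu>. finite basis \<and> lie_vs.independent basis \<and> lie_vs.span basis = UNIV \<and>
     (\<forall>b\<in>basis. \<mu> b \<in> D \<and> b \<in> g (\<mu> b))"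
    unfolding basis_def by (rule someI_ex) (rule weight_basis_exists)
  then show "finite basis" "lie_vs.independent basis" "lie_vs.span basis = UNIV" by auto
  from * have "\<exists>\<mu>. \<forall>b\<in>basis. \<mu> b \<in> D \<and> b \<in> g (\<mu> b)" by blast
  from someI_ex[OF this] show "b \<in> basis \<Longrightarrow> wt b \<in> D" "b \<in> basis \<Longrightarrow> b \<in> g (wt b)"
    unfolding wt_def by auto
qed

lemma basis_nonzero: "b \<in> basis \<Longrightarrow> b \<noteq> 0" using basis(2) lie_vs.dependent_zero by blast

definition rep :: "'g \<Rightarrow> 'g \<Rightarrow> complex" where "rep = lie_vs.representation basis"

lemma rep_add: "rep (x + y) b = rep x b + rep y b"
  and rep_scale: "rep (c *\<^sub>C x) b = c * rep x b"
  and rep_diff: "rep (x - y) b = rep x b - rep y b"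
  and rep_sum: "rep (sum f K) b = (\<Sum>k\<in>K. rep (f k) b)"
  and rep_basis: "b \<in> basis \<Longrightarrow> rep b b' = (if b' = b then 1 else 0)"
  and sum_rep: "(\<Sum>b\<in>basis. rep x b *\<^sub>C b) = x"
  and rep_zero: "rep 0 b = 0"
  using basis unfolding rep_def
  by (simp_all add: lie_vs.representation_add lie_vs.representation_scale lie_vs.representation_diff
      lie_vs.representation_sum lie_vs.representation_basis lie_vs.sum_representation_eq lie_vs.representation_zero)

lemma rep_eqI: "(\<And>b. b \<in> basis \<Longrightarrow> rep x b = rep y b) \<Longrightarrow> x = y"
  by (subst sum_rep[symmetric], subst (2) sum_rep[symmetric]) simp

lemma rep_lie_h: assumes "H \<in> \<hh>" "b \<in> basis" shows "rep (lie H x) b = wt b H * rep x b"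
proof -
  have "lie H x = lie H (\<Sum>c\<in>basis. rep x c *\<^sub>C c)" by (simp add: sum_rep)
  also have "\<dots> = (\<Sum>c\<in>basis. (rep x c * wt c H) *\<^sub>C c)"
    unfolding lie_sum_right lie_scaleC_right
    using assms by (intro sum.cong) (simp_all add: root_spaceD[OF wt(2)])
  finally have "rep (lie H x) b = (\<Sum>c\<in>basis. rep x c * wt c H * (if b = c then 1 else 0))"
    using assms by (simp add: rep_sum rep_scale rep_basis)
  also have "\<dots> = wt b H * rep x b" using assms basis(1) by (simp add: if_distrib sum.delta' cong: if_cong)
  finally show ?thesis .
qed

lemma root_space_rep:
  assumes "X \<in> g \<mu>" "b \<in> basis" "rep X b \<noteq> 0" "H \<in> \<hh>"
  shows "wt b H = \<mu> H"
proof -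
  have "wt b H * rep X b = rep (\<mu> H *\<^sub>C X) b"
    using rep_lie_h[OF assms(4,2), of X] root_spaceD[OF assms(1,4)] by simp
  then show ?thesis using assms(3) by (simp add: rep_scale)
qed

text \<open>Bounds the set of all weights by a finite set. This yields finiteness of the roots and
  terminates every chain of raising operators.\<close>

lemma weight_in_basis:
  assumes "X \<in> g \<mu>" "X \<noteq> 0" "\<mu> \<in> D"
  shows "\<mu> \<in> wt ` basis"
proof -
  obtain b where "b \<in> basis" "rep X b \<noteq> 0"
    using assms(2) rep_eqI[of X 0] by (auto simp: rep_zero)
  then have "wt b = \<mu>" using root_space_rep[OF assms(1)] assms(3) wt(1) by (intro D_eqI) auto
  then show ?thesis using \<open>b \<in> basis\<close> by blast
qed

lemma root_D: "\<beta> \<in> R \<Longrightarrow> \<beta> \<in> D" by (simp add: roots_def)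
lemma root_nonzero: "\<beta> \<in> R \<Longrightarrow> \<beta> \<noteq> 0" by (simp add: roots_def zero_fun_def)

lemma subspace_root_space: "lie_vs.subspace (g \<mu>)"
  by (simp add: lie_vs.subspace_def root_space_def lie_add_right scaleC_add_right lie_scaleC_right
      mult.commute)

lemma root_vector: assumes "\<beta> \<in> R" obtains X where "X \<in> g \<beta>" "X \<noteq> 0"
  using assms lie_vs.subspace_0[OF subspace_root_space[of \<beta>]] by (auto simp: roots_def)

lemma rootI: "\<mu> \<in> D \<Longrightarrow> \<mu> \<noteq> 0 \<Longrightarrow> X \<in> g \<mu> \<Longrightarrow> X \<noteq> 0 \<Longrightarrow> \<mu> \<in> R"
  by (auto simp: roots_def zero_fun_def)

lemma finite_roots: "finite R"
proof (rule finite_subset)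
  show "R \<subseteq> wt ` basis"
  proof
    fix \<beta> assume "\<beta> \<in> R"
    then show "\<beta> \<in> wt ` basis" by (metis root_vector weight_in_basis root_D)
  qed
qed (simp add: basis(1))

lemma root_space_lie: "X \<in> g \<mu> \<Longrightarrow> Y \<in> g \<nu> \<Longrightarrow> lie X Y \<in> g (\<mu> + \<nu>)"
  unfolding root_space_def
proof (clarify)
  fix H assume "\<forall>H\<in>\<hh>. lie H X = \<mu> H *\<^sub>C X" "\<forall>H\<in>\<hh>. lie H Y = \<nu> H *\<^sub>C Y" "H \<in> \<hh>"
  then show "lie H (lie X Y) = (\<mu> + \<nu>) H *\<^sub>C lie X Y"
    by (subst lie_lie_right) (simp add: lie_scaleC_left lie_scaleC_right scaleC_add_left)
qed

lemma root_space_zero: "g 0 = \<hh>"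
  using centralizer_h lie_h_h by (auto simp: root_space_def)

section \<open>Coordinates of roots and the Killing form\<close>

lemma simple_root: "k \<in> {1..n} \<Longrightarrow> \<alpha> k \<in> R"
  using simple_roots unfolding simple_roots_def by blast

lemma dual_coords: "\<mu> \<in> D \<Longrightarrow> \<exists>!c :: nat \<Rightarrow> complex.
        (\<forall>k. k \<notin> {1..n} \<longrightarrow> c k = 0) \<and> \<mu> = (\<lambda>H. \<Sum>k = 1..n. c k * \<alpha> k H)"
  using simple_roots by (simp add: simple_roots_def)

lemma pos_or_neg: "R = pos_roots \<hh> n \<alpha> \<union> neg_roots \<hh> n \<alpha>"
  using simple_roots by (simp add: simple_roots_def)

text \<open>The simple roots are a basis of the dual space by hypothesis. Expanding the coordinate
  functionals of a basis of \<open>\<hh>\<close> in them and transposing the coefficients gives the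
  dual basis.\<close>

lemma coweights_exist:
  "\<exists>Z. (\<forall>k\<in>{1..n}. Z k \<in> \<hh> \<and> (\<forall>l\<in>{1..n}. \<alpha> l (Z k) = (if l = k then 1 else 0))) \<and>
    (\<forall>H\<in>\<hh>. H = (\<Sum>k = 1..n. \<alpha> k H *\<^sub>C Z k))"
proof -
  obtain S where S: "S \<subseteq> \<hh>" "lie_vs.independent S" "\<hh> \<subseteq> lie_vs.span S"
    by (rule lie_vs.maximal_independent_subset[of \<hh>])
  have fin: "finite S" using S(2) by (rule independent_finite)
  define d where "d s H = (if H \<in> \<hh> then lie_vs.representation S H s else 0)" for s H
  have dD: "d s \<in> D" for s
    using S by (simp add: dual_space_def d_def h_add h_scale subset_iff
        lie_vs.representation_add lie_vs.representation_scale)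
  obtain c where c: "\<And>s. d s = (\<lambda>H. \<Sum>k = 1..n. c s k * \<alpha> k H)"
    using dual_coords[OF dD] by metis
  define Z where "Z k = (\<Sum>s\<in>S. c s k *\<^sub>C s)" for k
  have Zh: "Z k \<in> \<hh>" for k
    using S(1) by (auto simp: Z_def intro!: h_sum h_scale)
  have exp: "H = (\<Sum>k = 1..n. \<alpha> k H *\<^sub>C Z k)" if H: "H \<in> \<hh>" for H
  proof -
    have "H = (\<Sum>s\<in>S. lie_vs.representation S H s *\<^sub>C s)"
      using S H fin by (subst lie_vs.sum_representation_eq) auto
    also have "\<dots> = (\<Sum>s\<in>S. \<Sum>k = 1..n. (c s k * \<alpha> k H) *\<^sub>C s)"
    proof (rule sum.cong)
      fix s
      have "lie_vs.representation S H s = (\<Sum>k = 1..n. c s k * \<alpha> k H)"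
        using fun_cong[OF c, of s H] H by (simp add: d_def)
      then show "lie_vs.representation S H s *\<^sub>C s = (\<Sum>k = 1..n. (c s k * \<alpha> k H) *\<^sub>C s)"
        by (simp add: lie_vs.scale_sum_left)
    qed simp
    also have "\<dots> = (\<Sum>k = 1..n. \<Sum>s\<in>S. (c s k * \<alpha> k H) *\<^sub>C s)" by (rule sum.swap)
    also have "\<dots> = (\<Sum>k = 1..n. \<alpha> k H *\<^sub>C Z k)"
      by (simp add: Z_def lie_vs.scale_sum_right mult.commute)
    finally show ?thesis .
  qed
  have "\<alpha> l (Z k) = (if l = k then 1 else 0)" if l: "l \<in> {1..n}" and k: "k \<in> {1..n}" for l k
  proof -
    have aD: "\<alpha> l \<in> D" using l simple_root root_D by blast
    \<comment> \<open>Two expansions of \<open>\<alpha> l\<close> in the simple roots, this one and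
      the trivial \<open>e2\<close>; uniqueness of coefficients compares them and gives
      duality.\<close>
    have e1: "\<alpha> l = (\<lambda>H. \<Sum>k = 1..n. (if k \<in> {1..n} then \<alpha> l (Z k) else 0) * \<alpha> k H)" (is "_ = ?r")
    proof (rule D_eqI[OF aD])
      have a: "\<alpha> k \<in> D" if "k \<in> {1..n}" for k using that simple_root root_D by blast
      show "?r \<in> D"
        using a by (simp add: dual_space_def sum.distrib distrib_left sum_distrib_left mult.left_commute)
      fix H assume "H \<in> \<hh>"
      then have "\<alpha> l H = \<alpha> l (\<Sum>k = 1..n. \<alpha> k H *\<^sub>C Z k)" using exp by simp
      also have "\<dots> = (\<Sum>k = 1..n. \<alpha> k H * \<alpha> l (Z k))"
        by (simp add: D_sum[OF aD] h_scale Zh D_scale[OF aD])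
      finally show "\<alpha> l H = ?r H" by (simp add: mult.commute)
    qed
    have e2: "\<alpha> l = (\<lambda>H. \<Sum>k = 1..n. (if k = l then 1 else 0) * \<alpha> k H)"
      using l by (simp add: if_distrib[of "\<lambda>x. x * _"] sum.delta cong: if_cong)
    define P where "P c \<longleftrightarrow> (\<forall>k. k \<notin> {1..n} \<longrightarrow> c k = 0) \<and> \<alpha> l = (\<lambda>H. \<Sum>k = 1..n. c k * \<alpha> k H)" for c
    have "\<exists>!c. P c" unfolding P_def by (rule dual_coords[OF aD])
    moreover have "P (\<lambda>k. if k \<in> {1..n} then \<alpha> l (Z k) else 0)" unfolding P_def using e1 by auto
    moreover have "P (\<lambda>k. if k = l then 1 else 0)" unfolding P_def using e2 l by auto
    ultimately have "(\<lambda>k. if k \<in> {1..n} then \<alpha> l (Z k) else 0) = (\<lambda>k. if k = l then 1 else 0)"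
      by blast
    from fun_cong[OF this, of k] show ?thesis using k by auto
  qed
  then show ?thesis using Zh exp by blast
qed

abbreviation "Z \<equiv> Zdual \<hh> n \<alpha>"

lemma Zdual: "k \<in> {1..n} \<Longrightarrow> Z k \<in> \<hh>"
    "k \<in> {1..n} \<Longrightarrow> l \<in> {1..n} \<Longrightarrow> \<alpha> l (Z k) = (if l = k then 1 else 0)"
  and h_expand: "H \<in> \<hh> \<Longrightarrow> H = (\<Sum>k = 1..n. \<alpha> k H *\<^sub>C Z k)"
proof -
  obtain Y where Y: "\<And>k. k \<in> {1..n} \<Longrightarrow> Y k \<in> \<hh>"
    "\<And>k l. k \<in> {1..n} \<Longrightarrow> l \<in> {1..n} \<Longrightarrow> \<alpha> l (Y k) = (if l = k then 1 else 0)"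
    "\<And>H. H \<in> \<hh> \<Longrightarrow> H = (\<Sum>k = 1..n. \<alpha> k H *\<^sub>C Y k)"
    using coweights_exist by metis
  have eq: "Z k = Y k" if k: "k \<in> {1..n}" for k
    unfolding Zdual_def
  proof (rule the_equality)
    show "Y k \<in> \<hh> \<and> (\<forall>l\<in>{1..n}. \<alpha> l (Y k) = (if l = k then 1 else 0))" using Y k by blast
    fix H assume H: "H \<in> \<hh> \<and> (\<forall>l\<in>{1..n}. \<alpha> l H = (if l = k then 1 else 0))"
    then have "H = (\<Sum>l = 1..n. \<alpha> l H *\<^sub>C Y l)" using Y(3) by blast
    also have "\<dots> = (\<Sum>l = 1..n. \<alpha> l (Y k) *\<^sub>C Y l)" using H Y(2)[OF k] by (intro sum.cong) auto
    also have "\<dots> = Y k" using Y(3)[OF Y(1)[OF k]] by simp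
    finally show "H = Y k" .
  qed
  show "k \<in> {1..n} \<Longrightarrow> Z k \<in> \<hh>" "k \<in> {1..n} \<Longrightarrow> l \<in> {1..n} \<Longrightarrow> \<alpha> l (Z k) = (if l = k then 1 else 0)"
    using Y eq by simp_all
  show "H \<in> \<hh> \<Longrightarrow> H = (\<Sum>k = 1..n. \<alpha> k H *\<^sub>C Z k)"
    using Y(3)[of H] eq by simp
qed

lemma D_expand: "\<mu> \<in> D \<Longrightarrow> H \<in> \<hh> \<Longrightarrow> \<mu> H = (\<Sum>k = 1..n. \<mu> (Z k) * \<alpha> k H)"
proof -
  assume \<mu>: "\<mu> \<in> D" and H: "H \<in> \<hh>"
  have "\<mu> H = \<mu> (\<Sum>k = 1..n. \<alpha> k H *\<^sub>C Z k)" using h_expand[OF H] by simp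
  also have "\<dots> = (\<Sum>k = 1..n. \<mu> (\<alpha> k H *\<^sub>C Z k))"
    by (rule D_sum[OF \<mu>]) (rule h_scale[OF Zdual(1)])
  also have "\<dots> = (\<Sum>k = 1..n. \<mu> (Z k) * \<alpha> k H)"
    by (rule sum.cong) (simp_all add: D_scale[OF \<mu> Zdual(1)])
  finally show ?thesis .
qed

lemma D_eqI_Z: "\<mu> \<in> D \<Longrightarrow> \<nu> \<in> D \<Longrightarrow> (\<And>k. k \<in> {1..n} \<Longrightarrow> \<mu> (Z k) = \<nu> (Z k)) \<Longrightarrow> \<mu> = \<nu>"
  by (rule D_eqI) (simp_all add: D_expand)

lemma pos_roots_iff: "\<beta> \<in> pos_roots \<hh> n \<alpha> \<longleftrightarrow> \<beta> \<in> R \<and> (\<forall>k\<in>{1..n}. \<exists>m::nat. \<beta> (Z k) = of_nat m)"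
  and neg_roots_iff: "\<beta> \<in> neg_roots \<hh> n \<alpha> \<longleftrightarrow> \<beta> \<in> R \<and> (\<forall>k\<in>{1..n}. \<exists>m::nat. \<beta> (Z k) = - of_nat m)"
proof -
  have aD: "\<And>k. k \<in> {1..n} \<Longrightarrow> \<alpha> k \<in> D" using simple_root root_D by blast
  have *: "(\<lambda>H. \<Sum>k = 1..n. of_nat (c k) * \<alpha> k H) (Z l) = of_nat (c l)" if "l \<in> {1..n}" for c :: "nat \<Rightarrow> nat" and l
    using that by (simp add: Zdual if_distrib sum.delta cong: if_cong sum.cong_simp)
  have sD: "(\<lambda>H. \<Sum>k = 1..n. of_nat (c k) * \<alpha> k H) \<in> D" for c :: "nat \<Rightarrow> nat"
    using aD by (simp add: dual_space_def sum.distrib distrib_left sum_distrib_left mult.left_commute)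
  have nD: "(\<lambda>H. - (\<Sum>k = 1..n. of_nat (c k) * \<alpha> k H)) \<in> D" for c :: "nat \<Rightarrow> nat"
    using D_uminus[OF sD[of c]] by (simp add: fun_Compl_def)
  show "\<beta> \<in> pos_roots \<hh> n \<alpha> \<longleftrightarrow> \<beta> \<in> R \<and> (\<forall>k\<in>{1..n}. \<exists>m::nat. \<beta> (Z k) = of_nat m)"
  proof
    assume a: "\<beta> \<in> pos_roots \<hh> n \<alpha>"
    then obtain c :: "nat \<Rightarrow> nat" where c: "\<beta> = (\<lambda>H. \<Sum>k = 1..n. of_nat (c k) * \<alpha> k H)"
      unfolding pos_roots_def by blast
    have "\<forall>k\<in>{1..n}. \<exists>m::nat. \<beta> (Z k) = of_nat m" using * unfolding c by blast
    then show "\<beta> \<in> R \<and> (\<forall>k\<in>{1..n}. \<exists>m::nat. \<beta> (Z k) = of_nat m)"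
      using a unfolding pos_roots_def by blast
  next
    assume a: "\<beta> \<in> R \<and> (\<forall>k\<in>{1..n}. \<exists>m::nat. \<beta> (Z k) = of_nat m)"
    then obtain c :: "nat \<Rightarrow> nat" where c: "\<And>k. k \<in> {1..n} \<Longrightarrow> \<beta> (Z k) = of_nat (c k)" by metis
    have "\<beta> = (\<lambda>H. \<Sum>k = 1..n. of_nat (c k) * \<alpha> k H)"
      by (rule D_eqI_Z[OF _ sD]) (use a root_D c * in auto)
    then show "\<beta> \<in> pos_roots \<hh> n \<alpha>" unfolding pos_roots_def using a by blast
  qed
  show "\<beta> \<in> neg_roots \<hh> n \<alpha> \<longleftrightarrow> \<beta> \<in> R \<and> (\<forall>k\<in>{1..n}. \<exists>m::nat. \<beta> (Z k) = - of_nat m)"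
  proof
    assume a: "\<beta> \<in> neg_roots \<hh> n \<alpha>"
    then obtain c :: "nat \<Rightarrow> nat" where c: "\<beta> = (\<lambda>H. - (\<Sum>k = 1..n. of_nat (c k) * \<alpha> k H))"
      unfolding neg_roots_def by blast
    have "\<forall>k\<in>{1..n}. \<exists>m::nat. \<beta> (Z k) = - of_nat m" using * unfolding c by (metis (no_types, lifting))
    then show "\<beta> \<in> R \<and> (\<forall>k\<in>{1..n}. \<exists>m::nat. \<beta> (Z k) = - of_nat m)"
      using a unfolding neg_roots_def by blast
  next
    assume a: "\<beta> \<in> R \<and> (\<forall>k\<in>{1..n}. \<exists>m::nat. \<beta> (Z k) = - of_nat m)"
    then obtain c :: "nat \<Rightarrow> nat" where c: "\<And>k. k \<in> {1..n} \<Longrightarrow> \<beta> (Z k) = - of_nat (c k)" by metis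
    have "\<beta> = (\<lambda>H. - (\<Sum>k = 1..n. of_nat (c k) * \<alpha> k H))"
      by (rule D_eqI_Z[OF _ nD]) (use a root_D c * in auto)
    then show "\<beta> \<in> neg_roots \<hh> n \<alpha>" unfolding neg_roots_def using a by blast
  qed
qed

text \<open>Turns the complex value on \<open>Z k\<close> into the integer coefficient of a root.
  The value 0 outside the index range allows coefficient vectors to be compared as functions on all
  naturals.\<close>

definition cf :: "('g \<Rightarrow> complex) \<Rightarrow> nat \<Rightarrow> int" where
  "cf \<beta> k = (if k \<in> {1..n} then \<lfloor>Re (\<beta> (Z k))\<rfloor> else 0)"

lemma cf: assumes "\<beta> \<in> R" "k \<in> {1..n}" shows "\<beta> (Z k) = of_int (cf \<beta> k)"
proof -
  have "\<exists>m::int. \<beta> (Z k) = of_int m"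
    using assms pos_or_neg unfolding set_eq_iff Un_iff pos_roots_iff neg_roots_iff
    by (metis of_int_of_nat_eq of_int_minus)
  then show ?thesis using assms(2) by (auto simp: cf_def)
qed

lemma cf_outside: "k \<notin> {1..n} \<Longrightarrow> cf \<beta> k = 0" unfolding cf_def by (rule if_not_P)

lemma root_expand: "\<beta> \<in> R \<Longrightarrow> H \<in> \<hh> \<Longrightarrow> \<beta> H = (\<Sum>k = 1..n. of_int (cf \<beta> k) * \<alpha> k H)"
  using D_expand[of \<beta> H] by (simp add: root_D cf)

lemma cf_inj: "\<beta> \<in> R \<Longrightarrow> \<gamma> \<in> R \<Longrightarrow> cf \<beta> = cf \<gamma> \<Longrightarrow> \<beta> = \<gamma>"
  by (rule D_eqI_Z) (simp_all add: root_D cf)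

lemma pos_iff_cf: "\<beta> \<in> pos_roots \<hh> n \<alpha> \<longleftrightarrow> \<beta> \<in> R \<and> (\<forall>k. cf \<beta> k \<ge> 0)"
  and neg_iff_cf: "\<beta> \<in> neg_roots \<hh> n \<alpha> \<longleftrightarrow> \<beta> \<in> R \<and> (\<forall>k. cf \<beta> k \<le> 0)"
proof -
  have *: "(\<exists>m::nat. (of_int z :: complex) = of_nat m) \<longleftrightarrow> z \<ge> 0" for z
    by (metis of_int_eq_iff of_int_of_nat_eq of_nat_0_le_iff zero_le_imp_eq_int)
  have **: "(\<exists>m::nat. (of_int z :: complex) = - of_nat m) \<longleftrightarrow> z \<le> 0" for z
    using *[of "-z"] by (metis neg_0_le_iff_le of_int_minus minus_minus)
  show "\<beta> \<in> pos_roots \<hh> n \<alpha> \<longleftrightarrow> \<beta> \<in> R \<and> (\<forall>k. cf \<beta> k \<ge> 0)"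
    proof -
    have "(\<forall>k\<in>{1..n}. cf \<beta> k \<ge> 0) \<longleftrightarrow> (\<forall>k. cf \<beta> k \<ge> 0)" using cf_outside[of _ \<beta>] by (metis order_refl)
    then show ?thesis unfolding pos_roots_iff by (simp add: cf * cong: conj_cong)
  qed
  show "\<beta> \<in> neg_roots \<hh> n \<alpha> \<longleftrightarrow> \<beta> \<in> R \<and> (\<forall>k. cf \<beta> k \<le> 0)"
    proof -
    have "(\<forall>k\<in>{1..n}. cf \<beta> k \<le> 0) \<longleftrightarrow> (\<forall>k. cf \<beta> k \<le> 0)" using cf_outside[of _ \<beta>] by (metis order_refl)
    then show ?thesis unfolding neg_roots_iff by (simp add: cf ** cong: conj_cong)
  qed
qed

section \<open>Traces and nondegeneracy of the Killing form\<close>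

lemma sum_linear_trace:
  assumes f: "\<And>x y. f (x + y) = f x + f y" "\<And>c x. f (c *\<^sub>C x) = c *\<^sub>C f x" and "finite K"
  shows "f (\<Sum>k\<in>K. v k :: 'g) = (\<Sum>k\<in>K. f (v k) :: 'g)"
proof -
  have "f 0 = 0" using f(2)[of 0 0] by simp
  with \<open>finite K\<close> show ?thesis by (induction K rule: finite_induct) (simp_all add: f(1))
qed

definition trace :: "('g \<Rightarrow> 'g) \<Rightarrow> complex" where
  "trace f = (\<Sum>b\<in>basis. rep (f b) b)"

lemma trace_commute:
  assumes f: "\<And>x y. f (x + y) = f x + f y" "\<And>c x. f (c *\<^sub>C x) = c *\<^sub>C f x"
    and h: "\<And>x y. h (x + y) = h x + h y" "\<And>c x. h (c *\<^sub>C x) = c *\<^sub>C h x"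
  shows "trace (\<lambda>x. f (h x)) = trace (\<lambda>x. h (f x))"
proof -
  have *: "rep (p (q b)) b = (\<Sum>c\<in>basis. rep (q b) c * rep (p c) b)"
    if "\<And>x y. p (x + y) = p x + p y" "\<And>c x. p (c *\<^sub>C x) = c *\<^sub>C p x" for p q b
  proof -
    have "p (q b) = p (\<Sum>c\<in>basis. rep (q b) c *\<^sub>C c)" by (simp add: sum_rep)
    also have "\<dots> = (\<Sum>c\<in>basis. rep (q b) c *\<^sub>C p c)"
      by (simp add: sum_linear_trace[OF that basis(1)] that)
    finally show ?thesis by (simp add: rep_sum rep_scale)
  qed
  have "trace (\<lambda>x. f (h x)) = (\<Sum>b\<in>basis. \<Sum>c\<in>basis. rep (h b) c * rep (f c) b)"
    by (simp add: trace_def *[OF f])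
  also have "\<dots> = (\<Sum>c\<in>basis. \<Sum>b\<in>basis. rep (f c) b * rep (h b) c)"
    by (subst sum.swap) (simp add: mult.commute)
  also have "\<dots> = trace (\<lambda>x. h (f x))"
    by (simp add: trace_def *[OF h])
  finally show ?thesis .
qed

definition killing :: "'g \<Rightarrow> 'g \<Rightarrow> complex" where
  "killing x y = trace (\<lambda>z. lie x (lie y z))"

lemma killing_add_left: "killing (x + y) z = killing x z + killing y z"
  and killing_add_right: "killing z (x + y) = killing z x + killing z y"
  and killing_scale_left: "killing (c *\<^sub>C x) z = c * killing x z"
  and killing_scale_right: "killing z (c *\<^sub>C x) = c * killing z x"
  by (simp_all add: killing_def trace_def lie_add_left lie_add_right lie_scaleC_left lie_scaleC_right
      rep_add rep_scale sum.distrib sum_distrib_left)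

lemma killing_zero: "killing 0 z = 0" "killing z 0 = 0"
  using killing_scale_left[of 0 0 z] killing_scale_right[of z 0 0] by simp_all

lemma killing_minus_left: "killing (- x) z = - killing x z"
  using killing_scale_left[of "-1" x z] by simp

lemma killing_sum_right: "killing z (sum f K) = (\<Sum>k\<in>K. killing z (f k))"
  by (induction K rule: infinite_finite_induct) (simp_all add: killing_zero killing_add_right)

lemma killing_sym: "killing x y = killing y x"
  unfolding killing_def by (rule trace_commute) (simp_all add: lie_add_right lie_scaleC_right)

text \<open>Writing x, y, z for their adjoint maps, the two sides are the traces of xyz - yxz and of
  xyz - xzy; they agree by cyclicity.\<close>

lemma killing_invariant: "killing (lie x y) z = killing x (lie y z)"
proof -
  have "trace (\<lambda>u. lie y (lie x (lie z u))) = trace (\<lambda>u. lie x (lie z (lie y u)))"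
    by (rule trace_commute[of "lie y" "\<lambda>u. lie x (lie z u)"]) (simp_all add: lie_add_right lie_scaleC_right)
  then show ?thesis
    by (simp add: killing_def trace_def lie_lie_left lie_diff_right rep_diff sum_subtractf)
qed

lemma killing_h: "H \<in> \<hh> \<Longrightarrow> H' \<in> \<hh> \<Longrightarrow> killing H H' = (\<Sum>b\<in>basis. wt b H * wt b H')"
  unfolding killing_def trace_def by (intro sum.cong) (simp_all add: rep_lie_h rep_basis)

lemma wt_cases: "b \<in> basis \<Longrightarrow> wt b = 0 \<or> wt b \<in> R"
  using wt basis_nonzero by (auto intro: rootI)

text \<open>The radical is an ideal by invariance, so simplicity leaves only the possibility that
  the form vanishes identically, which the element \<open>\<rho>\<close> refutes.\<close>

lemma killing_nondegenerate: assumes "\<And>y. killing x y = 0" shows "x = 0"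
proof -
  define I where "I = {x. \<forall>y. killing x y = 0}"
  have "lie_ideal I"
    unfolding lie_ideal_def
  proof (intro conjI allI ballI)
    show "lie_vs.subspace I"
      by (simp add: lie_vs.subspace_def I_def killing_zero killing_add_left killing_scale_left)
    fix x y assume "y \<in> I"
    then have "killing (lie y x) z = 0" for z by (simp add: I_def killing_invariant)
    then show "lie x y \<in> I" by (simp add: I_def lie_antisym[of x y] killing_minus_left)
  qed
  moreover have "I \<noteq> UNIV"
  proof
    assume I: "I = UNIV"
    define \<rho> where "\<rho> = (\<Sum>k = 1..n. Z k)"
    have \<rho>: "\<rho> \<in> \<hh>" unfolding \<rho>_def by (intro h_sum Zdual)
    have root_\<rho>: "\<beta> \<rho> = of_int (\<Sum>k = 1..n. cf \<beta> k)" if "\<beta> \<in> R" for \<beta>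
      unfolding \<rho>_def by (subst D_sum[OF root_D[OF that] Zdual(1)]) (simp_all add: cf[OF that])
    \<comment> \<open>The value of a root on \<open>\<rho>\<close> is its height, and the
      coefficients of a root are all of one sign.\<close>
    have nz: "\<beta> \<rho> \<noteq> 0" if \<beta>: "\<beta> \<in> R" for \<beta>
    proof
      assume "\<beta> \<rho> = 0"
      then have s: "(\<Sum>k = 1..n. cf \<beta> k) = 0" using root_\<rho>[OF \<beta>] by (metis of_int_eq_0_iff)
      have "(\<forall>k. cf \<beta> k \<ge> 0) \<or> (\<forall>k. cf \<beta> k \<le> 0)"
        using \<beta> pos_or_neg pos_iff_cf neg_iff_cf by blast
      then have "\<forall>k\<in>{1..n}. cf \<beta> k = 0"
      proof
        assume "\<forall>k. cf \<beta> k \<le> 0"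
        then show ?thesis using s sum_nonneg_eq_0_iff[of "{1..n}" "\<lambda>k. - cf \<beta> k"] by (simp add: sum_negf)
      qed (use s sum_nonneg_eq_0_iff[of "{1..n}" "cf \<beta>"] in simp)
      then have "\<beta> = 0" by (intro D_eqI_Z) (simp_all add: \<beta> root_D D_zero cf)
      then show False using root_nonzero[OF \<beta>] by simp
    qed
    have real: "wt b \<rho> \<in> \<real>" if "b \<in> basis" for b
      using wt_cases[OF that] root_\<rho>[of "wt b"] by (auto simp del: of_int_sum)
    have "(\<Sum>b\<in>basis. (Re (wt b \<rho>))\<^sup>2) = Re (killing \<rho> \<rho>)"
      unfolding killing_h[OF \<rho> \<rho>] Re_sum using real
      by (intro sum.cong) (auto simp: power2_eq_square complex_is_Real_iff)
    also have "\<dots> = 0"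
      using I unfolding I_def by (metis (mono_tags) UNIV_I mem_Collect_eq zero_complex.sel(1))
    finally have "\<forall>b\<in>basis. Re (wt b \<rho>) = 0"
      using basis(1) by (simp add: sum_nonneg_eq_0_iff)
    then have "\<forall>b\<in>basis. wt b \<rho> = 0" using real by (auto simp: complex_is_Real_iff complex_eq_iff)
    then have "\<forall>b\<in>basis. wt b = 0" using wt_cases nz by blast
    \<comment> \<open>If all weights vanish, the algebra coincides with its Cartan subalgebra and is
      abelian, against simplicity.\<close>
    then have "basis \<subseteq> \<hh>" using wt(2) root_space_zero by (metis subsetI)
    then have "\<hh> = UNIV" using lie_vs.span_minimal[OF _ subspace_h, of basis] basis(3) by (simp add: top.extremum_unique)
    then show False using simple lie_h_h by (simp add: simple_lie_algebra_def)
  qed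
  ultimately have "I = {0}" using simple by (auto simp: simple_lie_algebra_def)
  then show ?thesis using assms unfolding I_def by blast
qed

lemma killing_orthogonal:
  assumes "X \<in> g \<mu>" "Y \<in> g \<nu>" "H \<in> \<hh>" "\<mu> H + \<nu> H \<noteq> 0"
  shows "killing X Y = 0"
proof -
  have "killing (lie H X) Y = - killing X (lie H Y)"
    by (simp add: killing_invariant[symmetric] lie_antisym[of X H] killing_minus_left)
  then have "(\<mu> H + \<nu> H) * killing X Y = 0"
    using assms by (simp add: root_spaceD killing_scale_left killing_scale_right distrib_right)
  then show ?thesis using assms(4) by simp
qed

lemma killing_basis_eqI:
  assumes "\<And>b. b \<in> basis \<Longrightarrow> killing X b = 0" shows "X = 0"
proof (rule killing_nondegenerate)
  fix y
  have "killing X y = killing X (\<Sum>b\<in>basis. rep y b *\<^sub>C b)" by (simp add: sum_rep)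
  also have "\<dots> = (\<Sum>b\<in>basis. rep y b * killing X b)"
    by (simp add: killing_sum_right killing_scale_right)
  finally show "killing X y = 0" using assms by simp
qed

text \<open>Nondegeneracy provides a basis vector that pairs nontrivially with \<open>X\<close>;
  orthogonality of weight spaces forces its weight to be the opposite one.\<close>

lemma killing_dual:
  assumes "\<mu> \<in> D" "X \<in> g \<mu>" "X \<noteq> 0"
  obtains Y where "Y \<in> g (- \<mu>)" "killing X Y \<noteq> 0"
proof -
  obtain b where b: "b \<in> basis" "killing X b \<noteq> 0" using killing_basis_eqI assms(3) by blast
  have "wt b = - \<mu>"
  proof (rule D_eqI)
    fix H assume "H \<in> \<hh>"
    then have "\<mu> H + wt b H = 0" using killing_orthogonal[OF assms(2) wt(2)[OF b(1)]] b(2) by blast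
    then show "wt b H = (- \<mu>) H" by (simp add: eq_neg_iff_add_eq_0 add.commute)
  qed (use b wt assms D_uminus in auto)
  then show ?thesis using that[of b] b wt(2)[of b] by simp
qed

lemma killing_h_eqI:
  assumes "x \<in> \<hh>" "\<And>H. H \<in> \<hh> \<Longrightarrow> killing x H = 0" shows "x = 0"
proof (rule ccontr)
  assume "x \<noteq> 0"
  then obtain Y where "Y \<in> g (- 0)" "killing x Y \<noteq> 0"
    using killing_dual[of 0 x] assms(1) root_space_zero D_zero by metis
  then show False using assms(2) root_space_zero by simp
qed

section \<open>Coroots and root strings\<close>

definition str :: "('g \<Rightarrow> complex) \<Rightarrow> ('g \<Rightarrow> complex) \<Rightarrow> int \<Rightarrow> 'g \<Rightarrow> complex" where
  "str \<mu> \<beta> k = (\<lambda>H. \<mu> H + of_int k * \<beta> H)"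

lemma str_apply: "str \<mu> \<beta> k H = \<mu> H + of_int k * \<beta> H" by (simp add: str_def)

lemma str_0: "str \<mu> \<beta> 0 = \<mu>" by (simp add: str_def)

lemma str_neg: "str \<mu> (- \<beta>) k = str \<mu> \<beta> (- k)" by (simp add: str_def)

lemma str_D: "\<mu> \<in> D \<Longrightarrow> \<beta> \<in> D \<Longrightarrow> str \<mu> \<beta> k \<in> D"
  by (simp add: str_def dual_space_def algebra_simps)

lemma iterate_root_space:
  assumes "e \<in> g \<beta>" "X \<in> g \<mu>" shows "(lie e ^^ q) X \<in> g (str \<mu> \<beta> (int q))"
proof (induction q)
  case 0
  then show ?case using assms by (simp add: str_0)
next
  case (Suc q)
  have "\<beta> + str \<mu> \<beta> (int q) = str \<mu> \<beta> (int (Suc q))" by (simp add: str_def fun_eq_iff algebra_simps)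
  with root_space_lie[OF assms(1) Suc] show ?case by simp
qed

lemma root_uminus: assumes "\<beta> \<in> R" shows "- \<beta> \<in> R"
proof -
  obtain X where X: "X \<in> g \<beta>" "X \<noteq> 0" using root_vector[OF assms] .
  obtain Y where "Y \<in> g (- \<beta>)" "killing X Y \<noteq> 0" using killing_dual[OF root_D[OF assms] X] .
  moreover have "- \<beta> \<noteq> 0" using root_nonzero[OF assms] by simp
  ultimately show ?thesis
    using rootI[of "- \<beta>" Y] D_uminus[OF root_D[OF assms]] killing_zero(2)[of X] by auto
qed

text \<open>If \<open>e\<close> never annihilated the iterates, all the forms
  \<open>\<mu> + q \<beta>\<close> would be weights. They are pairwise distinct as \<beta> is
  nonzero, and there are only finitely many weights.\<close>

lemma raise_to_top:
  assumes "\<beta> \<in> R" "e \<in> g \<beta>" "\<mu> \<in> D" "X \<in> g \<mu>" "X \<noteq> 0"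
  obtains q where "(lie e ^^ q) X \<noteq> 0" "lie e ((lie e ^^ q) X) = 0"
proof -
  have "\<exists>q. (lie e ^^ q) X = 0"
  proof (rule ccontr)
    assume "\<nexists>q. (lie e ^^ q) X = 0"
    then have "str \<mu> \<beta> (int q) \<in> wt ` basis" for q
      using weight_in_basis[OF iterate_root_space[OF assms(2,4)]] str_D assms(1,3) root_D by blast
    then have "range (\<lambda>q. str \<mu> \<beta> (int q)) \<subseteq> wt ` basis" by blast
    then have fin: "finite (range (\<lambda>q. str \<mu> \<beta> (int q)))" using basis(1) finite_subset by blast
    obtain H where H: "\<beta> H \<noteq> 0" using root_nonzero[OF assms(1)] by (auto simp: fun_eq_iff)
    have "inj (\<lambda>q. str \<mu> \<beta> (int q))"
    proof (rule injI)
      fix p q assume "str \<mu> \<beta> (int p) = str \<mu> \<beta> (int q)"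
      from fun_cong[OF this, of H] H show "p = q" by (simp add: str_apply)
    qed
    then show False using fin finite_imageD by blast
  qed
  then obtain q where q: "(lie e ^^ q) X = 0" "\<And>p. p < q \<Longrightarrow> (lie e ^^ p) X \<noteq> 0"
    using exists_least_iff[of "\<lambda>q. (lie e ^^ q) X = 0"] by blast
  then have "q \<noteq> 0" using assms(5) by (cases q) auto
  then obtain p where "q = Suc p" using not0_implies_Suc by blast
  then show ?thesis using q that[of p] by auto
qed

text \<open>The bracket of opposite root vectors is a multiple of the element of
  \<open>\<hh>\<close> that represents \<beta> under the Killing form.\<close>

lemma lie_opposite:
  assumes "X \<in> g \<beta>" "Y \<in> g (- \<beta>)"
  shows "lie X Y \<in> \<hh>" "H \<in> \<hh> \<Longrightarrow> killing (lie X Y) H = killing X Y * \<beta> H"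
proof -
  show "lie X Y \<in> \<hh>" using root_space_lie[OF assms] root_space_zero by simp
  assume H: "H \<in> \<hh>"
  have "killing (lie X Y) H = killing X (- lie H Y)"
    by (simp add: killing_invariant lie_antisym[of Y H])
  also have "\<dots> = killing X Y * \<beta> H"
    by (simp add: root_spaceD[OF assms(2) H] killing_scale_right)
  finally show "killing (lie X Y) H = killing X Y * \<beta> H" .
qed

text \<open>The familiar formula of sl2 theory, with the value of \<beta> on [e, f] left open: it is
  used with value 0 for a Heisenberg algebra and with value 2 for an sl2 triple.\<close>

lemma raise_lower:
  assumes e: "e \<in> g \<beta>" and f: "f \<in> g (- \<beta>)" and X: "X \<in> g \<mu>" and top: "lie e X = 0"
  shows "lie e ((lie f ^^ Suc k) X) =
    (of_nat (k + 1) * \<mu> (lie e f) - \<beta> (lie e f) * of_nat (k * (k + 1)) / 2) *\<^sub>C (lie f ^^ k) X"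
proof (induction k)
  case 0
  show ?case using root_spaceD[OF X lie_opposite(1)[OF e f]] top
    by (simp add: lie_lie_right[of e f X])
next
  case (Suc k)
  let ?h = "lie e f"
  let ?Y = "(lie f ^^ Suc k) X"
  have "?Y \<in> g (str \<mu> (- \<beta>) (int (Suc k)))" by (rule iterate_root_space[OF f X])
  from root_spaceD[OF this lie_opposite(1)[OF e f]]
  have "lie ?h ?Y = (\<mu> ?h - of_nat (Suc k) * \<beta> ?h) *\<^sub>C ?Y" by (simp add: str_apply)
  moreover have "lie e ((lie f ^^ Suc (Suc k)) X) = lie ?h ?Y + lie f (lie e ?Y)"
    by (simp add: lie_lie_right[of e f])
  ultimately have "lie e ((lie f ^^ Suc (Suc k)) X) = (\<mu> ?h - of_nat (Suc k) * \<beta> ?h) *\<^sub>C ?Y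
      + (of_nat (k + 1) * \<mu> ?h - \<beta> ?h * of_nat (k * (k + 1)) / 2) *\<^sub>C ?Y"
    unfolding Suc by (simp add: lie_scaleC_right)
  also have "\<dots> = (\<mu> ?h - of_nat (Suc k) * \<beta> ?h
      + (of_nat (k + 1) * \<mu> ?h - \<beta> ?h * of_nat (k * (k + 1)) / 2)) *\<^sub>C ?Y"
    by (simp only: scaleC_add_left)
  also have "\<mu> ?h - of_nat (Suc k) * \<beta> ?h
      + (of_nat (k + 1) * \<mu> ?h - \<beta> ?h * of_nat (k * (k + 1)) / 2)
    = of_nat (Suc k + 1) * \<mu> ?h - \<beta> ?h * of_nat (Suc k * (Suc k + 1)) / 2"
    by (simp add: field_simps)
  finally show ?case .
qed

text \<open>If \<open>\<beta>\<close> vanished on \<open>[X, Y]\<close>, then \<open>X\<close>, \<open>Y\<close> and \<open>[X, Y]\<close> would span a Heisenberg algebra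
  with a finite-dimensional representation in which the center acts by a nonzero scalar.\<close>

lemma root_bracket_nonzero:
  assumes \<beta>: "\<beta> \<in> R" and X: "X \<in> g \<beta>" and Y: "Y \<in> g (- \<beta>)" and nz: "killing X Y \<noteq> 0"
  shows "\<beta> (lie X Y) \<noteq> 0"
proof
  let ?H = "lie X Y"
  assume z: "\<beta> ?H = 0"
  note H = lie_opposite[OF X Y]
  obtain H0 where H0: "\<beta> H0 \<noteq> 0" using root_nonzero[OF \<beta>] by (auto simp: fun_eq_iff)
  then have "H0 \<in> \<hh>" using D_out root_D[OF \<beta>] by blast
  then have "killing ?H H0 \<noteq> 0" using H(2) nz H0 by simp
  then have "(\<Sum>b\<in>basis. wt b ?H * wt b H0) \<noteq> 0" using killing_h[OF H(1) \<open>H0 \<in> \<hh>\<close>] by simp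
  then obtain b where b: "b \<in> basis" "wt b ?H \<noteq> 0"
    by (metis (no_types, lifting) mult_zero_left sum.neutral)
  obtain q where q: "(lie X ^^ q) b \<noteq> 0" "lie X ((lie X ^^ q) b) = 0"
    using raise_to_top[OF \<beta> X wt(1)[OF b(1)] wt(2)[OF b(1)] basis_nonzero[OF b(1)]] .
  define T where "T = (lie X ^^ q) b"
  define \<mu> where "\<mu> = str (wt b) \<beta> (int q)"
  have T: "T \<in> g \<mu>" "T \<noteq> 0" "lie X T = 0"
    using iterate_root_space[OF X wt(2)[OF b(1)]] q by (simp_all add: T_def \<mu>_def)
  have \<mu>: "\<mu> \<in> D" using str_D wt(1) b(1) root_D \<beta> by (simp add: \<mu>_def)
  have \<mu>H: "\<mu> ?H = wt b ?H" using z by (simp add: \<mu>_def str_apply)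
  obtain r where r: "(lie Y ^^ r) T \<noteq> 0" "lie Y ((lie Y ^^ r) T) = 0"
    using raise_to_top[OF root_uminus[OF \<beta>] Y \<mu> T(1,2)] .
  have "(of_nat (r + 1) * \<mu> ?H) *\<^sub>C (lie Y ^^ r) T = 0"
    using raise_lower[OF X Y T(1,3), of r] z r(2) by simp
  then show False using r(1) b(2) \<mu>H by (simp del: of_nat_Suc of_nat_add)
qed

text \<open>Every element of the span is a multiple of the Killing dual of \<beta>, so the
  normalization \<open>\<beta> K = 2\<close> leaves one candidate. This makes the definite
  description in \<open>coroot\<close> meaningful.\<close>

lemma coroot_unique:
  assumes \<beta>: "\<beta> \<in> R"
    and K: "K \<in> lie_span (g \<beta>) (g (- \<beta>))" "\<beta> K = 2"
    and L: "L \<in> lie_span (g \<beta>) (g (- \<beta>))" "\<beta> L = 2"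
  shows "K = L"
proof -
  have *: "K \<in> \<hh> \<and> (\<exists>c. \<forall>H\<in>\<hh>. killing K H = c * \<beta> H)" if "K \<in> lie_span (g \<beta>) (g (- \<beta>))" for K
    using that unfolding lie_span_def
  proof (induction rule: lie_vs.span_induct_alt)
    case base
    then show ?case by (auto simp: h_0 killing_zero intro: exI[of _ 0])
  next
    case (step c x y)
    then obtain X Y d where xy: "x = lie X Y" "X \<in> g \<beta>" "Y \<in> g (- \<beta>)" "\<forall>H\<in>\<hh>. killing y H = d * \<beta> H"
      by blast
    have "\<forall>H\<in>\<hh>. killing (c *\<^sub>C x + y) H = (c * killing X Y + d) * \<beta> H"
      using xy lie_opposite(2)[OF xy(2,3)] by (simp add: killing_add_left killing_scale_left algebra_simps)
    then show ?case using step lie_opposite(1) h_add h_scale by blast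
  qed
  obtain c d where c: "\<forall>H\<in>\<hh>. killing K H = c * \<beta> H" and d: "\<forall>H\<in>\<hh>. killing L H = d * \<beta> H"
    and h: "K \<in> \<hh>" "L \<in> \<hh>" using * K(1) L(1) by blast
  have "d *\<^sub>C K - c *\<^sub>C L = 0"
    using c d by (intro killing_h_eqI h_diff h_scale h)
      (simp add: killing_add_left[of _ "- _", simplified] killing_minus_left killing_scale_left)
  then have eq: "d *\<^sub>C K = c *\<^sub>C L" by simp
  have "d * \<beta> K = c * \<beta> L" using arg_cong[OF eq, of \<beta>] D_scale root_D[OF \<beta>] h by simp
  then have "d = c" using K(2) L(2) by simp
  moreover have "d \<noteq> 0"
  proof
    assume "d = 0"
    then have "L = 0" using d by (intro killing_h_eqI h) simp
    then show False using L(2) D_0[OF root_D[OF \<beta>]] by simp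
  qed
  ultimately show ?thesis using eq by simp
qed

abbreviation "cor \<equiv> coroot \<hh>"

lemma sl2_triple:
  assumes \<beta>: "\<beta> \<in> R" and e: "e \<in> g \<beta>" "e \<noteq> 0"
  obtains f where "f \<in> g (- \<beta>)" "lie e f = cor \<beta>" "\<beta> (lie e f) = 2" "killing e f \<noteq> 0"
proof -
  obtain Y where Y: "Y \<in> g (- \<beta>)" "killing e Y \<noteq> 0" using killing_dual[OF root_D[OF \<beta>] e] .
  define t where "t = \<beta> (lie e Y)"
  have t: "t \<noteq> 0" using root_bracket_nonzero[OF \<beta> e(1) Y] by (simp add: t_def)
  define f where "f = (2 / t) *\<^sub>C Y"
  have f: "f \<in> g (- \<beta>)" using Y(1) lie_vs.subspace_scale[OF subspace_root_space] by (simp add: f_def)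
  have 2: "\<beta> (lie e f) = 2"
    using t D_scale[OF root_D[OF \<beta>] lie_opposite(1)[OF e(1) Y(1)]] by (simp add: f_def lie_scaleC_right t_def)
  have span: "lie e f \<in> lie_span (g \<beta>) (g (- \<beta>))"
    unfolding lie_span_def using e f by (intro lie_vs.span_base) blast
  have neg: "(\<lambda>H. - \<beta> H) = - \<beta>" by (simp add: fun_Compl_def)
  have "cor \<beta> = lie e f"
    unfolding coroot_def neg
  proof (rule the_equality)
    fix H assume "H \<in> lie_span (g \<beta>) (g (- \<beta>)) \<and> \<beta> H = 2"
    then show "H = lie e f" using coroot_unique[OF \<beta> _ _ span 2] by simp
  qed (simp add: span 2)
  then show ?thesis using that[of f] f 2 Y t by (simp add: f_def killing_scale_right)
qed

lemma coroot_h: "\<beta> \<in> R \<Longrightarrow> cor \<beta> \<in> \<hh>" and coroot_2: "\<beta> \<in> R \<Longrightarrow> \<beta> (cor \<beta>) = 2"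
proof -
  assume \<beta>: "\<beta> \<in> R"
  obtain e where e: "e \<in> g \<beta>" "e \<noteq> 0" using root_vector[OF \<beta>] .
  obtain f where f: "f \<in> g (- \<beta>)" "lie e f = cor \<beta>" "\<beta> (lie e f) = 2" using sl2_triple[OF \<beta> e] .
  show "cor \<beta> \<in> \<hh>" "\<beta> (cor \<beta>) = 2" using lie_opposite(1)[OF e(1) f(1)] f by simp_all
qed

lemma killing_coroot:
  assumes \<beta>: "\<beta> \<in> R" and H: "H \<in> \<hh>"
  shows "killing (cor \<beta>) H = killing (cor \<beta>) (cor \<beta>) / 2 * \<beta> H"
proof -
  obtain e where e: "e \<in> g \<beta>" "e \<noteq> 0" using root_vector[OF \<beta>] .
  obtain f where f: "f \<in> g (- \<beta>)" "lie e f = cor \<beta>" using sl2_triple[OF \<beta> e] .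
  show ?thesis
    using lie_opposite(2)[OF e(1) f(1) H] lie_opposite(2)[OF e(1) f(1) coroot_h[OF \<beta>]] coroot_2[OF \<beta>] f(2)
    by simp
qed

text \<open>Let r be the last exponent at which lowering gives a nonzero vector. The formula of
  \<open>raise_lower\<close> at r must vanish, and this solves to the weight on [e, f] being
  r.\<close>

lemma lower_nonzero:
  assumes \<beta>: "\<beta> \<in> R" and e: "e \<in> g \<beta>" and f: "f \<in> g (- \<beta>)" and 2: "\<beta> (lie e f) = 2"
    and \<mu>: "\<mu> \<in> D" and X: "X \<in> g \<mu>" "X \<noteq> 0" "lie e X = 0"
  shows "\<exists>m::nat. \<mu> (lie e f) = of_nat m \<and> (\<forall>k\<le>m. (lie f ^^ k) X \<noteq> 0)"
proof -
  obtain r where r: "(lie f ^^ r) X \<noteq> 0" "lie f ((lie f ^^ r) X) = 0"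
    using raise_to_top[OF root_uminus[OF \<beta>] f \<mu> X(1,2)] .
  have "(of_nat (r + 1) * \<mu> (lie e f) - 2 * of_nat (r * (r + 1)) / 2) *\<^sub>C (lie f ^^ r) X = 0"
    using raise_lower[OF e f X(1,3), of r] r(2) unfolding 2 by simp
  then have "of_nat (r + 1) * \<mu> (lie e f) - 2 * of_nat (r * (r + 1)) / 2 = 0"
    using r(1) unfolding lie_vs.scale_eq_0_iff by blast
  then have "of_nat (r + 1) * (\<mu> (lie e f) - of_nat r) = 0"
    by (simp only: right_diff_distrib of_nat_mult mult.commute nonzero_mult_div_cancel_left) simp
  then have "\<mu> (lie e f) - of_nat r = 0" unfolding mult_eq_0_iff of_nat_eq_0_iff by simp
  then have "\<mu> (lie e f) = of_nat r" by simp
  moreover have "(lie f ^^ k) X \<noteq> 0" if "k \<le> r" for k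
  proof
    assume "(lie f ^^ k) X = 0"
    then have "(lie f ^^ (j + k)) X = 0" for j by (induction j) simp_all
    from this[of "r - k"] show False using r(1) that by simp
  qed
  ultimately show ?thesis by blast
qed

lemma weight_string_down:
  assumes \<beta>: "\<beta> \<in> R" and e: "e \<in> g \<beta>" and f: "f \<in> g (- \<beta>)" and 2: "\<beta> (lie e f) = 2"
    and \<mu>: "\<mu> \<in> D" and X: "X \<in> g \<mu>" "X \<noteq> 0"
  shows "\<exists>m::int. \<mu> (lie e f) = of_int m \<and> (\<forall>j. 0 \<le> j \<and> j \<le> m \<longrightarrow> (\<exists>Y\<in>g (str \<mu> \<beta> (- j)). Y \<noteq> 0))"
proof -
  obtain q where q: "(lie e ^^ q) X \<noteq> 0" "lie e ((lie e ^^ q) X) = 0" using raise_to_top[OF \<beta> e \<mu> X] .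
  define T where "T = (lie e ^^ q) X"
  have T: "T \<in> g (str \<mu> \<beta> (int q))" unfolding T_def by (rule iterate_root_space[OF e X(1)])
  obtain m where m: "str \<mu> \<beta> (int q) (lie e f) = of_nat m" "\<And>k. k \<le> m \<Longrightarrow> (lie f ^^ k) T \<noteq> 0"
    using lower_nonzero[OF \<beta> e f 2 str_D[OF \<mu> root_D[OF \<beta>]] T] q unfolding T_def by blast
  have val: "\<mu> (lie e f) = of_int (int m - 2 * int q)"
    using m(1) 2 by (simp add: str_apply algebra_simps)
  have "\<exists>Y\<in>g (str \<mu> \<beta> (- j)). Y \<noteq> 0" if j: "0 \<le> j" "j \<le> int m - 2 * int q" for j
  proof
    \<comment> \<open>\<open>q\<close> lowering steps return from the top of the string to the
      weight \<mu>, and \<open>j\<close> more lead below it. The total stays within the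
      \<open>m\<close> steps available from the top.\<close>
    let ?k = "nat (int q + j)"
    have "str (str \<mu> \<beta> (int q)) (- \<beta>) (int ?k) = str \<mu> \<beta> (- j)"
      using j by (simp add: str_def algebra_simps)
    then show "(lie f ^^ ?k) T \<in> g (str \<mu> \<beta> (- j))" using iterate_root_space[OF f T, of ?k] by simp
    show "(lie f ^^ ?k) T \<noteq> 0" using m(2)[of ?k] j by simp
  qed
  then show ?thesis using val by blast
qed

text \<open>The Cartan integer. The floor extracts it from a complex value, which is an integer
  whenever \<mu> is a weight.\<close>

definition pair :: "('g \<Rightarrow> complex) \<Rightarrow> ('g \<Rightarrow> complex) \<Rightarrow> int" where
  "pair \<mu> \<beta> = \<lfloor>Re (\<mu> (cor \<beta>))\<rfloor>"

text \<open>The upward half is the downward half for the root -\<beta>, using the same triple with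
  \<open>e\<close> and \<open>f\<close> exchanged.\<close>

lemma weight_string:
  assumes \<beta>: "\<beta> \<in> R" and \<mu>: "\<mu> \<in> D" and X: "X \<in> g \<mu>" "X \<noteq> 0"
  shows "\<mu> (cor \<beta>) = of_int (pair \<mu> \<beta>)"
    and "0 \<le> j \<Longrightarrow> j \<le> pair \<mu> \<beta> \<Longrightarrow> \<exists>Y\<in>g (str \<mu> \<beta> (- j)). Y \<noteq> 0"
    and "0 \<le> j \<Longrightarrow> j \<le> - pair \<mu> \<beta> \<Longrightarrow> \<exists>Y\<in>g (str \<mu> \<beta> j). Y \<noteq> 0"
proof -
  obtain e where e: "e \<in> g \<beta>" "e \<noteq> 0" using root_vector[OF \<beta>] .
  obtain f where f: "f \<in> g (- \<beta>)" "lie e f = cor \<beta>" "\<beta> (lie e f) = 2" using sl2_triple[OF \<beta> e] .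
  obtain m :: int where m: "\<mu> (cor \<beta>) = of_int m"
    "\<And>j. 0 \<le> j \<Longrightarrow> j \<le> m \<Longrightarrow> \<exists>Y\<in>g (str \<mu> \<beta> (- j)). Y \<noteq> 0"
    using weight_string_down[OF \<beta> e(1) f(1,3) \<mu> X] f(2) by auto
  have fe: "lie f e = - cor \<beta>" using lie_antisym[of f e] f(2) by simp
  have neg: "\<nu> (lie f e) = - \<nu> (cor \<beta>)" if "\<nu> \<in> D" for \<nu>
    unfolding fe using D_neg that coroot_h[OF \<beta>] by blast
  have "(- \<beta>) (lie f e) = 2" using neg[OF root_D[OF \<beta>]] coroot_2[OF \<beta>] by simp
  from weight_string_down[OF root_uminus[OF \<beta>] f(1) _ this \<mu> X]
  obtain m' :: int where m': "\<mu> (lie f e) = of_int m'"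
    "\<And>j. 0 \<le> j \<Longrightarrow> j \<le> m' \<Longrightarrow> \<exists>Y\<in>g (str \<mu> (- \<beta>) (- j)). Y \<noteq> 0"
    unfolding minus_minus using e(1) by blast
  have pm: "pair \<mu> \<beta> = m" using m(1) by (simp add: pair_def)
  have "(of_int m' :: complex) = of_int (- m)" using m'(1) m(1) neg[OF \<mu>] by simp
  then have mm: "m' = - m" by (simp only: of_int_eq_iff)
  show "\<mu> (cor \<beta>) = of_int (pair \<mu> \<beta>)" using m pm by simp
  show "0 \<le> j \<Longrightarrow> j \<le> pair \<mu> \<beta> \<Longrightarrow> \<exists>Y\<in>g (str \<mu> \<beta> (- j)). Y \<noteq> 0" using m pm by simp
  show "0 \<le> j \<Longrightarrow> j \<le> - pair \<mu> \<beta> \<Longrightarrow> \<exists>Y\<in>g (str \<mu> \<beta> j). Y \<noteq> 0"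
    using m'(2)[of j] pm mm by (simp add: str_neg)
qed

lemma pair_eqI: "\<mu> (cor \<beta>) = of_int m \<Longrightarrow> pair \<mu> \<beta> = m" by (simp add: pair_def)

lemma pair: "\<gamma> \<in> R \<Longrightarrow> \<beta> \<in> R \<Longrightarrow> \<gamma> (cor \<beta>) = of_int (pair \<gamma> \<beta>)"
  by (metis root_vector weight_string(1) root_D)

lemma root_string_down:
  assumes "\<gamma> \<in> R" "\<beta> \<in> R" "0 \<le> j" "j \<le> pair \<gamma> \<beta>" "str \<gamma> \<beta> (- j) \<noteq> 0"
  shows "str \<gamma> \<beta> (- j) \<in> R"
  by (metis assms root_vector weight_string(2) rootI str_D root_D)

lemma root_string_up:
  assumes "\<gamma> \<in> R" "\<beta> \<in> R" "0 \<le> j" "j \<le> - pair \<gamma> \<beta>" "str \<gamma> \<beta> j \<noteq> 0"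
  shows "str \<gamma> \<beta> j \<in> R"
  by (metis assms root_vector weight_string(3) rootI str_D root_D)

abbreviation "s \<equiv> reflection \<hh>"

lemma reflection_str: assumes "\<gamma> \<in> R" "\<beta> \<in> R" shows "s \<beta> \<gamma> = str \<gamma> \<beta> (- pair \<gamma> \<beta>)"
  using assms root_D[of \<gamma>] by (simp add: reflection_def str_def pair)

text \<open>The reflected form lies on the string through \<gamma>. It is nonzero since its value at
  the coroot is the negative of that of \<gamma>.\<close>

lemma reflection_root: assumes \<gamma>: "\<gamma> \<in> R" and \<beta>: "\<beta> \<in> R" shows "s \<beta> \<gamma> \<in> R"
proof (cases "pair \<gamma> \<beta> = 0")
  case True
  then show ?thesis using \<gamma> reflection_str[OF \<gamma> \<beta>] by (simp add: str_0)
next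
  case False
  have "str \<gamma> \<beta> (- pair \<gamma> \<beta>) (cor \<beta>) = - of_int (pair \<gamma> \<beta>)"
    using pair[OF \<gamma> \<beta>] coroot_2[OF \<beta>] by (simp add: str_apply)
  then have nz: "str \<gamma> \<beta> (- pair \<gamma> \<beta>) \<noteq> 0" using False by auto
  show ?thesis
    unfolding reflection_str[OF \<gamma> \<beta>]
    using root_string_down[OF \<gamma> \<beta>, of "pair \<gamma> \<beta>"] root_string_up[OF \<gamma> \<beta>, of "- pair \<gamma> \<beta>"] nz
    by (cases "pair \<gamma> \<beta> \<ge> 0") auto
qed

text \<open>A vector annihilated by \<open>e\<close> is the top of its string, and a top has a
  nonnegative Cartan integer.\<close>

lemma raise_injective:
  assumes \<beta>: "\<beta> \<in> R" and e: "e \<in> g \<beta>" "e \<noteq> 0" and \<mu>: "\<mu> \<in> D" "X \<in> g \<mu>" "X \<noteq> 0" and neg: "pair \<mu> \<beta> < 0"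
  shows "lie e X \<noteq> 0"
proof
  assume z: "lie e X = 0"
  obtain f where f: "f \<in> g (- \<beta>)" "lie e f = cor \<beta>" "\<beta> (lie e f) = 2" using sl2_triple[OF \<beta> e] .
  obtain m :: nat where "\<mu> (lie e f) = of_nat m" using lower_nonzero[OF \<beta> e(1) f(1,3) \<mu> z] by blast
  then show False using f(2) neg by (simp add: pair_def)
qed

text \<open>For Y of weight -2\<beta>, invariance and [e, e] = 0 make [e, Y] orthogonal to
  \<open>e\<close>, hence [e, [e, Y]] = 0. But raising is injective on the weights -2\<beta> and
  -\<beta>, whose Cartan integers are -4 and -2.\<close>

lemma double_not_root: assumes \<beta>: "\<beta> \<in> R" shows "\<beta> + \<beta> \<notin> R"
proof
  assume "\<beta> + \<beta> \<in> R"
  then have R2: "- (\<beta> + \<beta>) \<in> R" by (rule root_uminus)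
  obtain e where e: "e \<in> g \<beta>" "e \<noteq> 0" using root_vector[OF \<beta>] .
  obtain Y where Y: "Y \<in> g (- (\<beta> + \<beta>))" "Y \<noteq> 0" using root_vector[OF R2] .
  have "pair (- (\<beta> + \<beta>)) \<beta> = - 4" "pair (- \<beta>) \<beta> = - 2" using coroot_2[OF \<beta>] by (simp_all add: pair_def)
  then have inj: "lie e Y \<noteq> 0" "\<And>X. X \<in> g (- \<beta>) \<Longrightarrow> X \<noteq> 0 \<Longrightarrow> lie e X \<noteq> 0"
    using raise_injective[OF \<beta> e root_D[OF R2] Y] raise_injective[OF \<beta> e root_D[OF root_uminus[OF \<beta>]]]
    by simp_all
  have "\<beta> + - (\<beta> + \<beta>) = - \<beta>" by (simp add: fun_eq_iff)
  then have eY: "lie e Y \<in> g (- \<beta>)" using root_space_lie[OF e(1) Y(1)] by simp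
  have "killing e (lie e Y) = 0" by (simp add: killing_invariant[symmetric] lie_self killing_zero)
  then have "lie e (lie e Y) = 0"
    using lie_opposite[OF e(1) eY] by (intro killing_h_eqI) simp_all
  then show False using inj eY by blast
qed

text \<open>A larger multiple would descend along its own \<beta>-string to 2\<beta>.\<close>

lemma root_multiple: assumes "\<beta> \<in> R" "(\<lambda>H. of_int k * \<beta> H) \<in> R" shows "k = 1 \<or> k = - 1"
proof -
  have pos: "k \<le> 1" if kR: "(\<lambda>H. of_int k * \<beta> H) \<in> R" for k
  proof (rule ccontr)
    assume k: "\<not> k \<le> 1"
    have "(\<lambda>H. of_int k * \<beta> H) (cor \<beta>) = of_int (2 * k)" using coroot_2[OF assms(1)] by simp
    then have "pair (\<lambda>H. of_int k * \<beta> H) \<beta> = 2 * k" by (rule pair_eqI)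
    moreover have "str (\<lambda>H. of_int k * \<beta> H) \<beta> (- (k - 2)) = \<beta> + \<beta>" by (auto simp: str_def algebra_simps)
    moreover have "\<beta> + \<beta> \<noteq> 0"
    proof
      assume "\<beta> + \<beta> = 0"
      from fun_cong[OF this, of "cor \<beta>"] show False using coroot_2[OF assms(1)] by simp
    qed
    ultimately have "\<beta> + \<beta> \<in> R" using root_string_down[OF kR assms(1), of "k - 2"] k by simp
    then show False using double_not_root assms(1) by blast
  qed
  have "(\<lambda>H. of_int (- k) * \<beta> H) \<in> R" using root_uminus[OF assms(2)] by (simp add: fun_Compl_def)
  moreover have "k \<noteq> 0"
  proof
    assume "k = 0"
    then show False using root_nonzero[OF assms(2)] by (auto simp: zero_fun_def)
  qed
  ultimately show ?thesis using pos[OF assms(2)] pos[of "- k"] by auto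
qed

text \<open>Either \<open>ad e\<close> is injective on the weight space \<open>\<mu>\<close>, or its transpose with respect to the Killing
  form is injective on the weight space \<open>-\<mu>-\<beta>\<close>; no dimension count is needed.\<close>

lemma root_bracket:
  assumes \<beta>: "\<beta> \<in> R" and \<mu>: "\<mu> \<in> R" and sum: "\<mu> + \<beta> \<in> R" and e: "e \<in> g \<beta>" "e \<noteq> 0"
  obtains X where "X \<in> g \<mu>" "lie e X \<noteq> 0"
proof (rule ccontr)
  assume "\<not> thesis"
  then have z: "\<And>X. X \<in> g \<mu> \<Longrightarrow> lie e X = 0" using that by blast
  obtain X where X: "X \<in> g \<mu>" "X \<noteq> 0" using root_vector[OF \<mu>] .
  have p: "pair \<mu> \<beta> \<ge> 0" using raise_injective[OF \<beta> e root_D[OF \<mu>] X] z[OF X(1)] by linarith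
  have n: "- (\<mu> + \<beta>) \<in> R" by (rule root_uminus[OF sum])
  obtain Y where Y: "Y \<in> g (- (\<mu> + \<beta>))" "Y \<noteq> 0" using root_vector[OF n] .
  have "pair (- (\<mu> + \<beta>)) \<beta> = - (pair \<mu> \<beta> + 2)"
    by (rule pair_eqI) (use coroot_2[OF \<beta>] pair[OF \<mu> \<beta>] in simp)
  then have nz: "lie e Y \<noteq> 0" using raise_injective[OF \<beta> e root_D[OF n] Y] p by simp
  have "\<beta> + - (\<mu> + \<beta>) = - \<mu>" by (simp add: fun_eq_iff)
  then have eY: "lie e Y \<in> g (- \<mu>)" using root_space_lie[OF e(1) Y(1)] by simp
  obtain X' where X': "X' \<in> g (- (- \<mu>))" "killing (lie e Y) X' \<noteq> 0"
    using killing_dual[OF root_D[OF root_uminus[OF \<mu>]] eY nz] .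
  have "killing (lie e Y) X' = - killing Y (lie e X')"
    by (simp add: lie_antisym[of e Y] killing_minus_left killing_invariant)
  then show False using X' z[of X'] by (simp add: killing_zero)
qed

text \<open>All weights are integers on a coroot, so the value is a sum of integer squares. It is
  nonzero because the Killing form is nondegenerate on \<open>\<hh>\<close>.\<close>

lemma killing_coroot_pos: assumes \<beta>: "\<beta> \<in> R"
  obtains c :: real where "c > 0" "killing (cor \<beta>) (cor \<beta>) = of_real c"
proof -
  have w: "\<exists>z::int. wt b (cor \<beta>) = of_int z" if "b \<in> basis" for b
    using wt_cases[OF that] pair \<beta> by (metis of_int_0 zero_fun_apply)
  then obtain z :: "'g \<Rightarrow> int" where z: "\<And>b. b \<in> basis \<Longrightarrow> wt b (cor \<beta>) = of_int (z b)" by metis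
  have k: "killing (cor \<beta>) (cor \<beta>) = of_real (\<Sum>b\<in>basis. (of_int (z b))\<^sup>2)"
    by (simp add: killing_h coroot_h[OF \<beta>] z power2_eq_square)
  have "killing (cor \<beta>) (cor \<beta>) \<noteq> 0"
  proof
    assume "killing (cor \<beta>) (cor \<beta>) = 0"
    then have "cor \<beta> = 0" using killing_coroot[OF \<beta>] by (intro killing_h_eqI coroot_h[OF \<beta>]) simp
    then show False using coroot_2[OF \<beta>] D_0[OF root_D[OF \<beta>]] by simp
  qed
  then have "(\<Sum>b\<in>basis. (of_int (z b))\<^sup>2) \<noteq> (0::real)"
    unfolding k by (metis of_real_0)
  moreover have "(\<Sum>b\<in>basis. (of_int (z b))\<^sup>2) \<ge> (0::real)" by (rule sum_nonneg) simp
  ultimately show ?thesis using that k by (metis order_le_less)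
qed

text \<open>Both Cartan integers are positive multiples of the same number, the Killing product of
  the two coroots.\<close>

lemma pair_sign: assumes \<beta>: "\<beta> \<in> R" and \<gamma>: "\<gamma> \<in> R" and "pair \<beta> \<gamma> > 0" shows "pair \<gamma> \<beta> > 0"
proof -
  obtain c where c: "c > 0" "killing (cor \<beta>) (cor \<beta>) = of_real c" using killing_coroot_pos[OF \<beta>] .
  obtain d where d: "d > 0" "killing (cor \<gamma>) (cor \<gamma>) = of_real d" using killing_coroot_pos[OF \<gamma>] .
  have "of_real c / 2 * of_int (pair \<beta> \<gamma>) = (of_real d / 2 * of_int (pair \<gamma> \<beta>) :: complex)"
    using killing_coroot[OF \<beta> coroot_h[OF \<gamma>]] killing_coroot[OF \<gamma> coroot_h[OF \<beta>]]
      killing_sym[of "cor \<beta>" "cor \<gamma>"] c d pair[OF \<beta> \<gamma>] pair[OF \<gamma> \<beta>] by simp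
  then have "(of_real (c * of_int (pair \<beta> \<gamma>)) :: complex) = of_real (d * of_int (pair \<gamma> \<beta>))" by simp
  then have "c * of_int (pair \<beta> \<gamma>) = d * of_int (pair \<gamma> \<beta>)" by (simp only: of_real_eq_iff)
  moreover have "c * of_int (pair \<beta> \<gamma>) > 0" using c assms(3) by simp
  ultimately show ?thesis using d(1) by (simp add: zero_less_mult_iff)
qed

text \<open>Expanding \<beta> at its own coroot writes 2 as the sum of the products
  \<open>cf \<beta> k * pair (\<alpha> k) \<beta>\<close>, so one of them is positive;
  \<open>pair_sign\<close> exchanges the two roots.\<close>

lemma pos_root_pairing:
  assumes "\<beta> \<in> pos_roots \<hh> n \<alpha>" obtains k where "k \<in> {1..n}" "cf \<beta> k > 0" "pair \<beta> (\<alpha> k) > 0"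
proof (rule ccontr)
  assume no: "\<not> thesis"
  note witness = that
  have \<beta>: "\<beta> \<in> R" "\<And>k. cf \<beta> k \<ge> 0" using assms by (auto simp: pos_iff_cf)
  have "cf \<beta> k * pair (\<alpha> k) \<beta> \<le> 0" if k: "k \<in> {1..n}" for k
    using no witness[of k] \<beta>(2)[of k] pair_sign[OF simple_root[OF k] \<beta>(1)] k
    by (smt (verit) mult_nonneg_nonpos zero_less_mult_iff)
  then have "(\<Sum>k = 1..n. cf \<beta> k * pair (\<alpha> k) \<beta>) \<le> 0" by (rule sum_nonpos)
  moreover have "(of_int (\<Sum>k = 1..n. cf \<beta> k * pair (\<alpha> k) \<beta>) :: complex) = 2"
  proof -
    have "(of_int (\<Sum>k = 1..n. cf \<beta> k * pair (\<alpha> k) \<beta>) :: complex)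
        = (\<Sum>k = 1..n. of_int (cf \<beta> k) * \<alpha> k (cor \<beta>))"
      unfolding of_int_sum by (rule sum.cong) (simp_all add: pair[OF simple_root \<beta>(1)])
    also have "\<dots> = 2" using root_expand[OF \<beta>(1) coroot_h[OF \<beta>(1)]] coroot_2[OF \<beta>(1)] by simp
    finally show ?thesis .
  qed
  then have "(\<Sum>k = 1..n. cf \<beta> k * pair (\<alpha> k) \<beta>) = 2" by (simp only: of_int_eq_numeral_iff)
  ultimately show False by simp
qed

section \<open>The Weyl group\<close>

abbreviation "W \<equiv> weyl_group \<hh>"
abbreviation "Rpos \<equiv> pos_roots \<hh> n \<alpha>"
abbreviation "Rneg \<equiv> neg_roots \<hh> n \<alpha>"

lemma cf_str: "\<gamma> \<in> R \<Longrightarrow> \<beta> \<in> R \<Longrightarrow> str \<gamma> \<beta> k \<in> R \<Longrightarrow> cf (str \<gamma> \<beta> k) j = cf \<gamma> j + k * cf \<beta> j"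
proof (cases "j \<in> {1..n}")
  case True
  assume a: "\<gamma> \<in> R" "\<beta> \<in> R" "str \<gamma> \<beta> k \<in> R"
  have "(of_int (cf (str \<gamma> \<beta> k) j) :: complex) = of_int (cf \<gamma> j + k * cf \<beta> j)"
    using True a by (simp add: cf[symmetric] str_apply)
  then show ?thesis by (simp only: of_int_eq_iff)
qed (simp add: cf_outside)

lemma cf_add: "\<gamma> \<in> R \<Longrightarrow> \<beta> \<in> R \<Longrightarrow> \<gamma> + \<beta> \<in> R \<Longrightarrow> cf (\<gamma> + \<beta>) j = cf \<gamma> j + cf \<beta> j"
  using cf_str[of \<gamma> \<beta> 1 j] by (simp add: str_def plus_fun_def)

lemma cf_diff: "\<gamma> \<in> R \<Longrightarrow> \<beta> \<in> R \<Longrightarrow> \<gamma> - \<beta> \<in> R \<Longrightarrow> cf (\<gamma> - \<beta>) j = cf \<gamma> j - cf \<beta> j"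
  using cf_str[of \<gamma> \<beta> "-1" j] by (simp add: str_def fun_diff_def)

lemma cf_uminus: "\<beta> \<in> R \<Longrightarrow> cf (- \<beta>) j = - cf \<beta> j"
proof (cases "j \<in> {1..n}")
  case True
  assume a: "\<beta> \<in> R"
  have "(of_int (cf (- \<beta>) j) :: complex) = of_int (- cf \<beta> j)"
    using True a by (simp add: cf[symmetric] root_uminus)
  then show ?thesis by (simp only: of_int_eq_iff)
qed (simp add: cf_outside)

lemma cf_simple: "k \<in> {1..n} \<Longrightarrow> cf (\<alpha> k) j = (if j = k then 1 else 0)"
  by (cases "j \<in> {1..n}") (auto simp: cf_def Zdual)

lemma cf_nonzero: assumes "\<beta> \<in> R" obtains k where "k \<in> {1..n}" "cf \<beta> k \<noteq> 0"
proof (rule ccontr)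
  assume "\<not> thesis"
  then have "\<And>k. k \<in> {1..n} \<Longrightarrow> cf \<beta> k = 0" using that by blast
  then have "\<beta> = 0" using assms by (intro D_eqI_Z) (simp_all add: root_D D_zero cf)
  then show False using root_nonzero assms by blast
qed

lemma pos_root: "\<beta> \<in> Rpos \<Longrightarrow> \<beta> \<in> R" and neg_root: "\<beta> \<in> Rneg \<Longrightarrow> \<beta> \<in> R"
  by (simp_all add: pos_iff_cf neg_iff_cf)

lemma pos_not_neg: "\<beta> \<in> Rpos \<Longrightarrow> \<beta> \<notin> Rneg"
  by (metis cf_nonzero order_antisym pos_iff_cf neg_iff_cf)

lemma root_sign: "\<beta> \<in> R \<Longrightarrow> \<beta> \<in> Rpos \<or> \<beta> \<in> Rneg" using pos_or_neg by blast

lemma neg_iff: "\<beta> \<in> Rneg \<longleftrightarrow> - \<beta> \<in> Rpos"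
  using root_uminus[of "- \<beta>"] by (auto simp: pos_iff_cf neg_iff_cf root_uminus cf_uminus)

lemma posI: assumes "\<beta> \<in> R" "cf \<beta> k > 0" shows "\<beta> \<in> Rpos"
  using root_sign[OF assms(1)] assms(2) by (auto simp: neg_iff_cf linorder_not_le[symmetric])

lemma simple_pos: "k \<in> {1..n} \<Longrightarrow> \<alpha> k \<in> Rpos"
  by (rule posI[of _ k]) (simp_all add: simple_root cf_simple)

definition ht :: "('g \<Rightarrow> complex) \<Rightarrow> int" where "ht \<beta> = (\<Sum>k = 1..n. cf \<beta> k)"

lemma ht_pos: assumes "\<beta> \<in> Rpos" shows "ht \<beta> > 0"
proof -
  obtain k where "k \<in> {1..n}" "cf \<beta> k \<noteq> 0" using cf_nonzero[OF pos_root[OF assms]] .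
  moreover have "\<And>k. cf \<beta> k \<ge> 0" using assms by (simp add: pos_iff_cf)
  ultimately show ?thesis unfolding ht_def by (metis (no_types, lifting) finite_atLeastAtMost order_le_less sum_pos2)
qed

lemma reflection_D: "\<beta> \<in> R \<Longrightarrow> \<mu> \<in> D \<Longrightarrow> s \<beta> \<mu> \<in> D"
  using D_minus[OF _ D_smult[OF root_D], of \<mu> \<beta> "\<mu> (cor \<beta>)"] by (simp add: reflection_def fun_diff_def)

lemma reflection_in_W: "\<beta> \<in> R \<Longrightarrow> s \<beta> \<in> W"
  using weyl_group.weyl_reflection[OF weyl_group.weyl_id] by fastforce

lemma W_comp: assumes "u \<in> W" "w \<in> W" shows "u \<circ> w \<in> W"
  using assms(1)
proof induction
  case weyl_id
  then show ?case using assms(2) by simp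
next
  case (weyl_reflection u \<beta>)
  then show ?case unfolding comp_assoc by (intro weyl_group.weyl_reflection)
qed

lemma reflection_involution: "\<beta> \<in> R \<Longrightarrow> s \<beta> \<circ> s \<beta> = id"
proof
  fix \<mu> assume \<beta>: "\<beta> \<in> R"
  show "(s \<beta> \<circ> s \<beta>) \<mu> = id \<mu>"
  proof (cases "\<mu> \<in> D")
    case True
    then show ?thesis using reflection_D[OF \<beta> True] coroot_2[OF \<beta>]
      by (simp add: reflection_def fun_eq_iff algebra_simps)
  qed (simp add: reflection_def)
qed

lemma W_inverse: assumes "w \<in> W" obtains v where "v \<in> W" "v \<circ> w = id" "w \<circ> v = id"
proof -
  have "\<exists>v\<in>W. v \<circ> w = id \<and> w \<circ> v = id"
    using assms
  proof induction
    case weyl_id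
    then show ?case using weyl_group.weyl_id by (intro bexI[of _ id]) auto
  next
    case (weyl_reflection w \<beta>)
    then obtain v where v: "v \<in> W" "v \<circ> w = id" "w \<circ> v = id" by blast
    have "(v \<circ> s \<beta>) \<circ> (s \<beta> \<circ> w) = v \<circ> (s \<beta> \<circ> s \<beta>) \<circ> w"
      "(s \<beta> \<circ> w) \<circ> (v \<circ> s \<beta>) = s \<beta> \<circ> (w \<circ> v) \<circ> s \<beta>" by (simp_all only: comp_assoc)
    then have "(v \<circ> s \<beta>) \<circ> (s \<beta> \<circ> w) = id" "(s \<beta> \<circ> w) \<circ> (v \<circ> s \<beta>) = id"
      unfolding reflection_involution[OF weyl_reflection(2)] v(3) by (simp_all add: v(2) reflection_involution[OF weyl_reflection(2)])
    then show ?case using W_comp[OF v(1) reflection_in_W[OF weyl_reflection(2)]] by blast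
  qed
  then show ?thesis using that by blast
qed

lemma W_D: assumes "w \<in> W" "\<mu> \<in> D" shows "w \<mu> \<in> D"
  using assms(1) by induction (simp_all add: assms(2) reflection_D)

lemma W_outside: assumes "w \<in> W" "\<mu> \<notin> D" shows "w \<mu> = \<mu>"
  using assms(1) by induction (simp_all add: assms(2) reflection_def)

lemma W_root: assumes "w \<in> W" "\<mu> \<in> R" shows "w \<mu> \<in> R"
  using assms(1) by induction (simp_all add: assms(2) reflection_root)

text \<open>Elements of the Weyl group act on linear forms by composition with a map of
  \<open>\<hh>\<close>. Additivity and the expansion in simple roots then reduce to evaluation at
  points.\<close>

lemma W_transpose: assumes "w \<in> W"
  shows "\<exists>t. (\<forall>H\<in>\<hh>. t H \<in> \<hh>) \<and> (\<forall>\<mu>\<in>D. \<forall>H\<in>\<hh>. w \<mu> H = \<mu> (t H))"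
  using assms
proof induction
  case weyl_id
  then show ?case by (intro exI[of _ id]) simp
next
  case (weyl_reflection w \<beta>)
  then obtain t where t: "\<forall>H\<in>\<hh>. t H \<in> \<hh>" "\<forall>\<mu>\<in>D. \<forall>H\<in>\<hh>. w \<mu> H = \<mu> (t H)" by blast
  define t' where "t' H = t (H - \<beta> H *\<^sub>C cor \<beta>)" for H
  have h: "H - \<beta> H *\<^sub>C cor \<beta> \<in> \<hh>" if "H \<in> \<hh>" for H
    using that coroot_h[OF weyl_reflection(2)] by (simp add: h_diff h_scale)
  have "(s \<beta> \<circ> w) \<mu> H = \<mu> (t' H)" if \<mu>: "\<mu> \<in> D" and H: "H \<in> \<hh>" for \<mu> H
  proof -
    have wD: "w \<mu> \<in> D" using W_D weyl_reflection(1) \<mu> by blast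
    have "(s \<beta> \<circ> w) \<mu> H = w \<mu> H - w \<mu> (cor \<beta>) * \<beta> H" using wD by (simp add: reflection_def)
    also have "\<dots> = w \<mu> (H - \<beta> H *\<^sub>C cor \<beta>)"
      using H coroot_h[OF weyl_reflection(2)] by (simp add: D_diff[OF wD] D_scale[OF wD] h_scale)
    finally show ?thesis using t(2) \<mu> h[OF H] by (simp add: t'_def)
  qed
  moreover have "\<forall>H\<in>\<hh>. t' H \<in> \<hh>" using t(1) h by (simp add: t'_def)
  ultimately show ?case by blast
qed

lemma W_str: assumes w: "w \<in> W" and \<mu>: "\<mu> \<in> D" and \<beta>: "\<beta> \<in> D"
  shows "w (str \<mu> \<beta> k) = str (w \<mu>) (w \<beta>) k"
proof -
  obtain t where "\<forall>\<mu>\<in>D. \<forall>H\<in>\<hh>. w \<mu> H = \<mu> (t H)" using W_transpose[OF w] by blast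
  note t = this[rule_format]
  show ?thesis
  proof (rule D_eqI[OF W_D[OF w str_D[OF \<mu> \<beta>]] str_D[OF W_D[OF w \<mu>] W_D[OF w \<beta>]]])
    fix H assume H: "H \<in> \<hh>"
    show "w (str \<mu> \<beta> k) H = str (w \<mu>) (w \<beta>) k H"
      unfolding str_apply t[OF str_D[OF \<mu> \<beta>] H] t[OF \<mu> H] t[OF \<beta> H] ..
  qed
qed

lemma W_add: "w \<in> W \<Longrightarrow> \<mu> \<in> D \<Longrightarrow> \<beta> \<in> D \<Longrightarrow> w (\<mu> + \<beta>) = w \<mu> + w \<beta>"
  using W_str[of w \<mu> \<beta> 1] by (simp add: str_def plus_fun_def)

lemma W_uminus: assumes w: "w \<in> W" and \<beta>: "\<beta> \<in> D" shows "w (- \<beta>) = - w \<beta>"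
proof -
  obtain t where "\<forall>\<mu>\<in>D. \<forall>H\<in>\<hh>. w \<mu> H = \<mu> (t H)" using W_transpose[OF w] by blast
  note t = this[rule_format]
  show ?thesis
  proof (rule D_eqI[OF W_D[OF w D_uminus[OF \<beta>]] D_uminus[OF W_D[OF w \<beta>]]])
    fix H assume H: "H \<in> \<hh>"
    show "w (- \<beta>) H = (- w \<beta>) H" using t[OF D_uminus[OF \<beta>] H] t[OF \<beta> H] by simp
  qed
qed

lemma W_ext: assumes "u \<in> W" "w \<in> W" "\<And>k. k \<in> {1..n} \<Longrightarrow> u (\<alpha> k) = w (\<alpha> k)" shows "u = w"
proof
  fix \<mu>
  show "u \<mu> = w \<mu>"
  proof (cases "\<mu> \<in> D")
    case True
    have *: "v \<mu> H = (\<Sum>k = 1..n. \<mu> (Z k) * v (\<alpha> k) H)" if v: "v \<in> W" and H: "H \<in> \<hh>" for v H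
    proof -
      obtain t where t: "\<forall>H\<in>\<hh>. t H \<in> \<hh>" "\<forall>\<mu>\<in>D. \<forall>H\<in>\<hh>. v \<mu> H = \<mu> (t H)" using W_transpose[OF v] by blast
      have "v \<mu> H = (\<Sum>k = 1..n. \<mu> (Z k) * \<alpha> k (t H))" using t True H D_expand[OF True, of "t H"] by simp
      also have "\<dots> = (\<Sum>k = 1..n. \<mu> (Z k) * v (\<alpha> k) H)"
        using t(2) H root_D[OF simple_root] by (intro sum.cong) simp_all
      finally show ?thesis .
    qed
    show ?thesis
      by (rule D_eqI[OF W_D[OF assms(1) True] W_D[OF assms(2) True]])
        (simp add: *[OF assms(1)] *[OF assms(2)] assms(3))
  qed (simp add: W_outside assms)
qed

text \<open>For \<open>\<gamma> = u \<beta>\<close> the map \<open>s\<^sub>\<gamma> u s\<^sub>\<beta> u\<^sup>-\<^sup>1\<close> fixes \<open>\<gamma>\<close> and is unipotent modulo \<open>\<gamma>\<close>; as it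
  permutes the finite set of roots, it is trivial.\<close>

lemma pair_invariant:
  assumes u: "u \<in> W" and \<beta>: "\<beta> \<in> R" and \<mu>: "\<mu> \<in> R" shows "pair (u \<mu>) (u \<beta>) = pair \<mu> \<beta>"
proof -
  obtain v where v: "v \<in> W" "v \<circ> u = id" "u \<circ> v = id" using W_inverse[OF u] .
  have uv: "u (v x) = x" "v (u x) = x" for x using v(2,3) by (simp_all add: fun_eq_iff)
  define \<gamma> where "\<gamma> = u \<beta>"
  have \<gamma>: "\<gamma> \<in> R" using W_root u \<beta> by (simp add: \<gamma>_def)
  define \<tau> where "\<tau> = s \<gamma> \<circ> (u \<circ> (s \<beta> \<circ> v))"
  have \<tau>: "\<tau> \<in> W" unfolding \<tau>_def by (intro W_comp reflection_in_W \<gamma> \<beta> u v)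
  have \<tau>_str: "\<tau> \<nu> = str \<nu> \<gamma> (pair (v \<nu>) \<beta> - pair \<nu> \<gamma>)" if \<nu>: "\<nu> \<in> R" for \<nu>
  proof -
    have vn: "v \<nu> \<in> R" using W_root v \<nu> by blast
    have "u (s \<beta> (v \<nu>)) = str \<nu> \<gamma> (- pair (v \<nu>) \<beta>)"
      using W_str[OF u] vn \<beta> root_D by (simp add: reflection_str uv \<gamma>_def)
    then have "\<tau> \<nu> = s \<gamma> (str \<nu> \<gamma> (- pair (v \<nu>) \<beta>))" by (simp add: \<tau>_def)
    then show ?thesis
      using \<nu> \<gamma> root_D str_D coroot_2[OF \<gamma>] pair[OF \<nu> \<gamma>]
      by (simp add: reflection_def) (simp add: str_def algebra_simps fun_eq_iff)
  qed
  have "\<tau> \<gamma> = \<gamma>"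
  proof -
    have "pair (v \<gamma>) \<beta> = 2" "pair \<gamma> \<gamma> = 2"
      using coroot_2[OF \<beta>] coroot_2[OF \<gamma>] by (auto simp: \<gamma>_def uv intro!: pair_eqI)
    then show ?thesis using \<tau>_str[OF \<gamma>] by (simp add: str_0)
  qed
  define \<nu> where "\<nu> = u \<mu>"
  have \<nu>: "\<nu> \<in> R" using W_root u \<mu> by (simp add: \<nu>_def)
  define c where "c = pair (v \<nu>) \<beta> - pair \<nu> \<gamma>"
  have iter: "(\<tau> ^^ k) \<nu> = str \<nu> \<gamma> (int k * c)" for k
  proof (induction k)
    case (Suc k)
    have "(\<tau> ^^ Suc k) \<nu> = str (str \<nu> \<gamma> c) \<gamma> (int k * c)"
      using Suc W_str[OF \<tau> root_D[OF \<nu>] root_D[OF \<gamma>]] \<open>\<tau> \<gamma> = \<gamma>\<close> \<tau>_str[OF \<nu>] by (simp add: c_def)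
    then show ?case by (simp add: str_def algebra_simps)
  qed (simp add: str_0)
  have "(\<tau> ^^ k) \<nu> \<in> R" for k by (induction k) (simp_all add: \<nu> W_root \<tau>)
  then have "range (\<lambda>k. str \<nu> \<gamma> (int k * c)) \<subseteq> R" using iter by auto
  then have fin: "finite (range (\<lambda>k. str \<nu> \<gamma> (int k * c)))" using finite_roots finite_subset by blast
  have "c = 0"
  proof (rule ccontr)
    assume c: "c \<noteq> 0"
    have "inj (\<lambda>k. str \<nu> \<gamma> (int k * c))"
    proof (rule injI)
      fix p q assume "str \<nu> \<gamma> (int p * c) = str \<nu> \<gamma> (int q * c)"
      from fun_cong[OF this, of "cor \<gamma>"] c show "p = q" using coroot_2[OF \<gamma>] by (simp add: str_apply)
    qed
    then show False using fin finite_imageD by blast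
  qed
  then show ?thesis by (simp add: c_def \<nu>_def \<gamma>_def uv)
qed

lemma reflection_conj: assumes u: "u \<in> W" and \<beta>: "\<beta> \<in> R" shows "s (u \<beta>) \<circ> u = u \<circ> s \<beta>"
proof (rule W_ext)
  show "s (u \<beta>) \<circ> u \<in> W" by (rule W_comp[OF reflection_in_W[OF W_root[OF u \<beta>]] u])
  show "u \<circ> s \<beta> \<in> W" by (rule W_comp[OF u reflection_in_W[OF \<beta>]])
  fix k assume k: "k \<in> {1..n}"
  show "(s (u \<beta>) \<circ> u) (\<alpha> k) = (u \<circ> s \<beta>) (\<alpha> k)"
    using u \<beta> simple_root[OF k] W_root[OF u] root_D
    by (simp add: reflection_str pair_invariant W_str)
qed

section \<open>Words in the simple reflections\<close>

abbreviation "sk k \<equiv> s (\<alpha> k)"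

definition word :: "nat list \<Rightarrow> ('g \<Rightarrow> complex) \<Rightarrow> ('g \<Rightarrow> complex)" where
  "word ks = foldr (\<lambda>k f. sk k \<circ> f) ks id"

lemma word_simps [simp]: "word [] = id" "word (k # ks) = sk k \<circ> word ks" by (simp_all add: word_def)

lemma word_append: "word (ks @ ls) = word ks \<circ> word ls" by (induction ks) (simp_all add: comp_assoc)

lemma word_W: "set ks \<subseteq> {1..n} \<Longrightarrow> word ks \<in> W"
  by (induction ks) (simp_all add: weyl_group.weyl_id weyl_group.weyl_reflection simple_root)

lemma word_rev: "set ks \<subseteq> {1..n} \<Longrightarrow> word ks \<circ> word (rev ks) = id"
proof (induction ks)
  case (Cons k ks)
  have "word (k # ks) \<circ> word (rev (k # ks)) = sk k \<circ> (word ks \<circ> word (rev ks)) \<circ> sk k"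
    by (simp only: word_append word_simps rev.simps comp_id comp_assoc)
  also have "word ks \<circ> word (rev ks) = id" by (rule Cons.IH) (use Cons.prems in simp)
  also have "sk k \<circ> id \<circ> sk k = id" using reflection_involution[OF simple_root, of k] Cons.prems by simp
  finally show ?case .
qed simp

lemma cf_sk: assumes "\<beta> \<in> R" "k \<in> {1..n}"
  shows "cf (sk k \<beta>) j = cf \<beta> j - (if j = k then pair \<beta> (\<alpha> k) else 0)"
  using cf_str[OF assms(1) simple_root[OF assms(2)], of "- pair \<beta> (\<alpha> k)" j]
    reflection_root[OF assms(1) simple_root[OF assms(2)]] cf_simple[OF assms(2), of j]
  unfolding reflection_str[OF assms(1) simple_root[OF assms(2)]] by simp

text \<open>Otherwise \<beta> would be an integer multiple of \<open>\<alpha> k\<close>, and by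
  \<open>root_multiple\<close> the only positive one is \<open>\<alpha> k\<close> itself.\<close>

lemma pos_other_coeff:
  assumes \<beta>: "\<beta> \<in> Rpos" and k: "k \<in> {1..n}" and ne: "\<beta> \<noteq> \<alpha> k" shows "\<exists>j. j \<noteq> k \<and> cf \<beta> j > 0"
proof (rule ccontr)
  have R: "\<beta> \<in> R" and c: "\<And>j. cf \<beta> j \<ge> 0" using \<beta> by (auto simp: pos_iff_cf)
  assume "\<nexists>j. j \<noteq> k \<and> cf \<beta> j > 0"
  then have z: "cf \<beta> j = 0" if "j \<noteq> k" for j using c[of j] that by force
  have m: "\<beta> = (\<lambda>H. of_int (cf \<beta> k) * \<alpha> k H)"
  proof (rule D_eqI_Z)
    show "\<beta> (Z j) = of_int (cf \<beta> k) * \<alpha> k (Z j)" if "j \<in> {1..n}" for j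
      using cf[OF R that] z[of j] Zdual(2)[OF that k] by auto
  qed (use R root_D D_smult simple_root k in auto)
  have "(\<lambda>H. of_int (cf \<beta> k) * \<alpha> k H) \<in> R" using R m by simp
  then have "cf \<beta> k = 1 \<or> cf \<beta> k = - 1" by (rule root_multiple[OF simple_root[OF k]])
  then have "cf \<beta> k = 1" using c[of k] by simp
  then show False using m ne by simp
qed

text \<open>The reflection alters only the coefficient at \<open>k\<close>. Some other coefficient
  is positive and stays so, and one positive coefficient decides the sign of a root.\<close>

lemma sk_pos: assumes \<beta>: "\<beta> \<in> Rpos" and k: "k \<in> {1..n}" and ne: "\<beta> \<noteq> \<alpha> k" shows "sk k \<beta> \<in> Rpos"
proof -
  have R: "\<beta> \<in> R" using \<beta> by (rule pos_root)
  obtain j where "j \<noteq> k" "cf \<beta> j > 0" using pos_other_coeff[OF assms] by blast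
  then show ?thesis using R k by (intro posI[of _ j]) (simp_all add: reflection_root simple_root cf_sk)
qed

lemma sk_simple: assumes "k \<in> {1..n}" shows "sk k (\<alpha> k) = - \<alpha> k"
proof -
  have "pair (\<alpha> k) (\<alpha> k) = 2" using coroot_2[OF simple_root[OF assms]] by (intro pair_eqI) simp
  then show ?thesis using assms by (simp add: reflection_str simple_root) (simp add: str_def fun_eq_iff)
qed

text \<open>Induction on the height: a simple root with positive Cartan integer exists, and
  reflecting in it lowers the height while keeping the root positive.\<close>

lemma root_word_pos:
  "\<beta> \<in> Rpos \<Longrightarrow> \<exists>ks k. set ks \<subseteq> {1..n} \<and> k \<in> {1..n} \<and> \<beta> = word ks (\<alpha> k)"
proof (induction "nat (ht \<beta>)" arbitrary: \<beta> rule: less_induct)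
  case less
  obtain k where k: "k \<in> {1..n}" "pair \<beta> (\<alpha> k) > 0" using pos_root_pairing[OF less.prems] .
  show ?case
  proof (cases "\<beta> = \<alpha> k")
    case True
    then show ?thesis using k by (intro exI[of _ "[]"] exI[of _ k]) simp
  next
    case False
    note pos = sk_pos[OF less.prems k(1) False]
    have "ht (sk k \<beta>) = ht \<beta> - pair \<beta> (\<alpha> k)"
      using k(1) by (simp add: ht_def cf_sk[OF pos_root[OF less.prems] k(1)] sum_subtractf)
    then have "nat (ht (sk k \<beta>)) < nat (ht \<beta>)" using k(2) ht_pos[OF less.prems] by simp
    then obtain ks j where ks: "set ks \<subseteq> {1..n}" "j \<in> {1..n}" "sk k \<beta> = word ks (\<alpha> j)"
      using less.hyps pos by blast
    have "\<beta> = sk k (sk k \<beta>)" using reflection_involution[OF simple_root[OF k(1)]] by (simp add: fun_eq_iff)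
    then show ?thesis using ks k(1) by (intro exI[of _ "k # ks"] exI[of _ j]) simp
  qed
qed

lemma root_word: assumes "\<beta> \<in> R" obtains ks k where "set ks \<subseteq> {1..n}" "k \<in> {1..n}" "\<beta> = word ks (\<alpha> k)"
proof (cases "\<beta> \<in> Rpos")
  case True
  then show ?thesis using root_word_pos that by blast
next
  case False
  then have "- \<beta> \<in> Rpos" using root_sign[OF assms] neg_iff by blast
  then obtain ks k where ks: "set ks \<subseteq> {1..n}" "k \<in> {1..n}" "- \<beta> = word ks (\<alpha> k)" using root_word_pos by blast
  have "word (ks @ [k]) (\<alpha> k) = word ks (- \<alpha> k)" using ks(2) by (simp add: word_append sk_simple)
  also have "\<dots> = - word ks (\<alpha> k)" by (rule W_uminus[OF word_W[OF ks(1)] root_D[OF simple_root[OF ks(2)]]])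
  also have "\<dots> = \<beta>" using ks(3) by (metis minus_minus)
  finally show ?thesis using that[of "ks @ [k]" k] ks by simp
qed

text \<open>The group is generated by the reflections in all roots; each is a conjugate of a simple
  one, since each root is the image of a simple root under a word.\<close>

lemma W_word: assumes "w \<in> W" shows "\<exists>ks. set ks \<subseteq> {1..n} \<and> w = word ks"
  using assms
proof induction
  case weyl_id
  then show ?case by (intro exI[of _ "[]"]) simp
next
  case (weyl_reflection w \<beta>)
  then obtain ls where ls: "set ls \<subseteq> {1..n}" "w = word ls" by blast
  obtain ks k where ks: "set ks \<subseteq> {1..n}" "k \<in> {1..n}" "\<beta> = word ks (\<alpha> k)" using root_word[OF weyl_reflection(2)] .
  have "s \<beta> \<circ> word ks \<circ> word (rev ks) = word ks \<circ> sk k \<circ> word (rev ks)"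
    using reflection_conj[OF word_W[OF ks(1)] simple_root[OF ks(2)]] ks(3) by simp
  then have "s \<beta> = word (ks @ [k] @ rev ks)"
    using word_rev[OF ks(1)] by (simp add: word_append comp_assoc)
  then show ?case using ls ks by (intro exI[of _ "ks @ [k] @ rev ks @ ls"]) (simp add: word_append comp_assoc)
qed

text \<open>The exchange condition. Reading the word from the right, the image of
  \<open>\<alpha> j\<close> turns negative at some letter \<open>k\<close>; just before, it equals
  \<open>\<alpha> k\<close>, and conjugation cancels this letter against the appended
  reflection.\<close>

lemma word_deletion:
  "set ks \<subseteq> {1..n} \<Longrightarrow> j \<in> {1..n} \<Longrightarrow> word ks (\<alpha> j) \<in> Rneg \<Longrightarrow>
    \<exists>ks'. set ks' \<subseteq> {1..n} \<and> Suc (length ks') = length ks \<and> word ks \<circ> sk j = word ks'"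
proof (induction ks)
  case Nil
  then show ?case using simple_pos pos_not_neg by auto
next
  case (Cons k ks)
  let ?\<beta> = "word ks (\<alpha> j)"
  have k: "k \<in> {1..n}" and ks: "set ks \<subseteq> {1..n}" using Cons.prems by auto
  have R: "?\<beta> \<in> R" using W_root[OF word_W[OF ks] simple_root[OF Cons.prems(2)]] .
  show ?case
  proof (cases "?\<beta> \<in> Rneg")
    case True
    then obtain ks' where "set ks' \<subseteq> {1..n}" "Suc (length ks') = length ks" "word ks \<circ> sk j = word ks'"
      using Cons.IH ks Cons.prems(2) by blast
    then show ?thesis using k by (intro exI[of _ "k # ks'"]) (simp only: word_simps comp_assoc, simp)
  next
    case False
    then have "?\<beta> \<in> Rpos" using root_sign[OF R] by blast
    moreover have "sk k ?\<beta> \<notin> Rpos" using Cons.prems(3) pos_not_neg by auto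
    ultimately have "?\<beta> = \<alpha> k" using sk_pos[OF _ k] by blast
    then have "sk k \<circ> word ks = word ks \<circ> sk j"
      using reflection_conj[OF word_W[OF ks] simple_root[OF Cons.prems(2)]] by simp
    then have "word (k # ks) \<circ> sk j = word ks \<circ> (sk j \<circ> sk j)" by (simp add: comp_assoc)
    then have "word (k # ks) \<circ> sk j = word ks"
      using reflection_involution[OF simple_root[OF Cons.prems(2)]] by simp
    with ks show ?thesis by (intro exI[of _ ks] conjI) (simp, simp, assumption)
  qed
qed

text \<open>Dropping the last letter \<open>j\<close> leaves a word that makes
  \<open>\<alpha> j\<close> negative. Deletion then rewrites the whole word with two letters
  fewer.\<close>

lemma word_pos_id:
  "set ks \<subseteq> {1..n} \<Longrightarrow> (\<And>k. k \<in> {1..n} \<Longrightarrow> word ks (\<alpha> k) \<in> Rpos) \<Longrightarrow> word ks = id"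
proof (induction "length ks" arbitrary: ks rule: less_induct)
  case less
  show ?case
  proof (cases ks rule: rev_cases)
    case (snoc ls j)
    have j: "j \<in> {1..n}" and ls: "set ls \<subseteq> {1..n}" using less.prems(1) snoc by auto
    have "word ks (\<alpha> j) = - word ls (\<alpha> j)"
      using snoc j W_uminus[OF word_W[OF ls] root_D[OF simple_root[OF j]]] by (simp add: word_append sk_simple)
    then have "word ls (\<alpha> j) \<in> Rneg" using less.prems(2)[OF j] by (simp add: neg_iff)
    then obtain ks' where ks': "set ks' \<subseteq> {1..n}" "Suc (length ks') = length ls" "word ls \<circ> sk j = word ks'"
      using word_deletion[OF ls j] by blast
    have "word ks = word ks'" using snoc ks'(3) by (simp add: word_append)
    then show ?thesis using less.hyps[of ks'] less.prems(2) ks' snoc by simp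
  qed simp
qed

lemma W_pos_id: "u \<in> W \<Longrightarrow> (\<And>k. k \<in> {1..n} \<Longrightarrow> u (\<alpha> k) \<in> Rpos) \<Longrightarrow> u = id"
  using W_word word_pos_id by blast

section \<open>Inversion sets\<close>

abbreviation "Inv \<equiv> inv_roots \<hh> n \<alpha>"

lemma inv_iff: assumes "w \<in> W" "v \<circ> w = id" "w \<circ> v = id"
  shows "\<beta> \<in> Inv w \<longleftrightarrow> \<beta> \<in> Rpos \<and> v \<beta> \<in> Rneg"
proof -
  have "w (v x) = x" "v (w x) = x" for x using assms(2,3) by (simp_all add: fun_eq_iff)
  then show ?thesis unfolding inv_roots_def by (metis IntD1 IntD2 IntI imageE imageI)
qed

text \<open>Equal inversion sets make the inverse of \<open>w\<close> composed with
  \<open>w'\<close> keep every simple root positive, so that this composition is the identity. The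
  two cases are the signs of \<open>w' (\<alpha> k)\<close>.\<close>

lemma inv_inj: assumes w: "w \<in> W" and w': "w' \<in> W" and eq: "Inv w = Inv w'" shows "w = w'"
proof -
  obtain v where v: "v \<in> W" "v \<circ> w = id" "w \<circ> v = id" using W_inverse[OF w] .
  obtain v' where v': "v' \<in> W" "v' \<circ> w' = id" "w' \<circ> v' = id" using W_inverse[OF w'] .
  have "v \<circ> w' = id"
  proof (rule W_pos_id[OF W_comp[OF v(1) w']])
    fix k assume k: "k \<in> {1..n}"
    define \<beta> where "\<beta> = w' (\<alpha> k)"
    have \<beta>: "\<beta> \<in> R" using W_root[OF w' simple_root[OF k]] by (simp add: \<beta>_def)
    have v'\<beta>: "v' \<beta> = \<alpha> k" using v'(2) by (simp add: \<beta>_def fun_eq_iff)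
    have "v \<beta> \<in> Rpos"
    proof (cases "\<beta> \<in> Rpos")
      case True
      then have "\<beta> \<notin> Inv w" unfolding eq inv_iff[OF w' v'(2,3)] v'\<beta> using simple_pos[OF k] pos_not_neg by blast
      then show ?thesis
        using True root_sign[OF W_root[OF v(1) \<beta>]] inv_iff[OF w v(2,3)] by blast
    next
      case False
      then have "- \<beta> \<in> Rpos" using root_sign[OF \<beta>] neg_iff by blast
      moreover have "v' (- \<beta>) \<in> Rneg"
        using W_uminus[OF v'(1) root_D[OF \<beta>]] simple_pos[OF k] by (simp add: v'\<beta> neg_iff)
      ultimately have "- \<beta> \<in> Inv w" unfolding eq inv_iff[OF w' v'(2,3)] by blast
      then have "v (- \<beta>) \<in> Rneg" unfolding inv_iff[OF w v(2,3)] by blast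
      then show ?thesis using W_uminus[OF v(1) root_D[OF \<beta>]] by (simp add: neg_iff)
    qed
    then show "(v \<circ> w') (\<alpha> k) \<in> Rpos" by (simp add: \<beta>_def)
  qed
  then have "w \<circ> (v \<circ> w') = w" by simp
  then show ?thesis using v(3) by (simp add: comp_assoc[symmetric])
qed

end

section \<open>Schubert varieties as order ideals of degree-one roots\<close>

definition unit :: "nat \<Rightarrow> nat \<Rightarrow> int" where "unit k = (\<lambda>j. if j = k then 1 else 0)"

text \<open>The weak notion of ideal, tested on single simple roots from \<open>I\<close> only. It
  is what is extracted from a Weyl group element.\<close>

definition lowering_closed :: "(nat \<Rightarrow> int) set \<Rightarrow> nat set \<Rightarrow> (nat \<Rightarrow> int) set \<Rightarrow> bool" where
  "lowering_closed E I \<Phi> \<longleftrightarrow> \<Phi> \<subseteq> E \<and> (\<forall>c\<in>\<Phi>. \<forall>j\<in>I. c - unit j \<in> E \<longrightarrow> c - unit j \<in> \<Phi>)"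

text \<open>The strong notion, for the coefficientwise order. It covers the subtraction of an
  arbitrary positive root, as the construction of a Weyl group element requires.\<close>

definition order_ideal :: "(nat \<Rightarrow> int) set \<Rightarrow> (nat \<Rightarrow> int) set \<Rightarrow> bool" where
  "order_ideal E \<Phi> \<longleftrightarrow> \<Phi> \<subseteq> E \<and> (\<forall>c\<in>\<Phi>. \<forall>d\<in>E. d \<le> c \<longrightarrow> d \<in> \<Phi>)"

definition raising_labels :: "(nat \<Rightarrow> int) set \<Rightarrow> nat set \<Rightarrow> (nat \<Rightarrow> int) set \<Rightarrow> nat set" where
  "raising_labels E I \<Phi> = {j \<in> I. \<exists>c\<in>\<Phi>. c + unit j \<in> E - \<Phi>}"

definition max_level :: "nat set \<Rightarrow> (nat \<Rightarrow> int) set \<Rightarrow> int" where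
  "max_level J \<Phi> = Max ((\<lambda>c. \<Sum>j\<in>J. c j) ` \<Phi>)"

text \<open>The theorem as a statement about a set \<open>E\<close> of integer vectors. Necessity
  and uniqueness are stated for weak ideals and existence for strong ones, so each clause fits what
  the Lie algebra side supplies or consumes.\<close>

definition classified :: "(nat \<Rightarrow> int) set \<Rightarrow> nat set \<Rightarrow> (int \<Rightarrow> nat set \<Rightarrow> bool) \<Rightarrow> bool" where
  "classified E I P \<longleftrightarrow>
    (\<forall>\<Phi> J. lowering_closed E I \<Phi> \<and> \<Phi> \<noteq> {} \<and> \<Phi> \<noteq> E \<and> J = raising_labels E I \<Phi> \<longrightarrow>
       0 \<le> max_level J \<Phi> \<and> J \<noteq> {} \<and> P (max_level J \<Phi>) J) \<and>
    (\<forall>a J. 0 \<le> a \<and> J \<noteq> {} \<and> J \<subseteq> I \<and> P a J \<longrightarrow>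
       (\<exists>\<Phi>. order_ideal E \<Phi> \<and> max_level J \<Phi> = a \<and> raising_labels E I \<Phi> = J)) \<and>
    (\<forall>\<Phi> \<Psi> J. lowering_closed E I \<Phi> \<and> lowering_closed E I \<Psi> \<and> J \<noteq> {} \<and>
       J = raising_labels E I \<Phi> \<and> J = raising_labels E I \<Psi> \<and> max_level J \<Phi> = max_level J \<Psi> \<longrightarrow> \<Phi> = \<Psi>)"

context cartan_setting
begin

lemma pos_decompose:
  assumes \<beta>: "\<beta> \<in> Rpos" and ns: "\<And>k. k \<in> {1..n} \<Longrightarrow> \<beta> \<noteq> \<alpha> k"
  obtains k where "k \<in> {1..n}" "\<beta> - \<alpha> k \<in> Rpos"
proof -
  obtain k where k: "k \<in> {1..n}" "pair \<beta> (\<alpha> k) > 0" using pos_root_pairing[OF \<beta>] .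
  have str: "str \<beta> (\<alpha> k) (- 1) = \<beta> - \<alpha> k" by (simp add: str_def fun_diff_def)
  have R: "\<beta> - \<alpha> k \<in> R"
    using root_string_down[OF pos_root[OF \<beta>] simple_root[OF k(1)], of 1] k(2) ns[OF k(1)] str by simp
  obtain j where j: "j \<noteq> k" "cf \<beta> j > 0" using pos_other_coeff[OF \<beta> k(1) ns[OF k(1)]] by blast
  have "cf (\<beta> - \<alpha> k) j = cf \<beta> j"
    using cf_diff[OF pos_root[OF \<beta>] simple_root[OF k(1)] R] cf_simple[OF k(1)] j by simp
  then show ?thesis using that[OF k(1) posI[OF R, of j]] j by simp
qed

text \<open>Some Y in the root space of \<gamma> pairs nontrivially with \<open>X\<close> but is
  orthogonal to the root spaces of all -\<beta> with \<beta> different from \<gamma>, hence to their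
  span.\<close>

lemma span_root_spaces_separated:
  assumes \<Phi>: "\<Phi> \<subseteq> R" and \<gamma>: "\<gamma> \<in> R" "\<gamma> \<notin> \<Phi>" and X: "X \<in> g (- \<gamma>)" "X \<noteq> 0"
  shows "X \<notin> lie_vs.span (\<Union>\<beta>\<in>\<Phi>. g (- \<beta>))"
proof
  assume sp: "X \<in> lie_vs.span (\<Union>\<beta>\<in>\<Phi>. g (- \<beta>))"
  obtain Y where Y: "Y \<in> g (- (- \<gamma>))" "killing X Y \<noteq> 0"
    using killing_dual[OF root_D[OF root_uminus[OF \<gamma>(1)]] X] .
  have Y': "Y \<in> g \<gamma>" using Y(1) by (metis minus_minus)
  have "killing U Y = 0" if "U \<in> lie_vs.span (\<Union>\<beta>\<in>\<Phi>. g (- \<beta>))" for U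
    using that
  proof (induction rule: lie_vs.span_induct_alt)
    case base
    then show ?case by (simp add: killing_zero)
  next
    case (step c x y)
    then obtain \<beta> where \<beta>: "\<beta> \<in> \<Phi>" "x \<in> g (- \<beta>)" by blast
    have "\<exists>H\<in>\<hh>. \<beta> H \<noteq> \<gamma> H"
      using D_eqI[OF root_D root_D, of \<beta> \<gamma>] \<Phi> \<gamma> \<beta>(1) by blast
    then obtain H where "H \<in> \<hh>" "(- \<beta>) H + \<gamma> H \<noteq> 0" by auto
    then have "killing x Y = 0" using killing_orthogonal[OF \<beta>(2) Y'] by blast
    then show ?case using step by (simp add: killing_add_left killing_scale_left)
  qed
  then show False using sp Y(2) by blast
qed

text \<open>Lowering by \<open>\<alpha> j\<close> sends the root space of -\<beta> to that of
  -(\<beta> + \<alpha>_j), so it acts on \<Phi> by adding \<open>\<alpha> j\<close>. If this leads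
  to a root outside \<Phi>, \<open>root_bracket\<close> gives a nonzero bracket there, and
  separation shows that it has left \<open>N\<close>.\<close>

lemma simple_vector_stable_iff:
  assumes \<Phi>: "\<Phi> \<subseteq> Rpos" and j: "j \<in> {1..n}"
  defines "N \<equiv> lie_vs.span (\<Union>\<beta>\<in>\<Phi>. g (- \<beta>))"
  shows "lie_span (g (- \<alpha> j)) N \<subseteq> N \<longleftrightarrow> (\<forall>\<beta>\<in>\<Phi>. \<beta> + \<alpha> j \<in> R \<longrightarrow> \<beta> + \<alpha> j \<in> \<Phi>)"
proof
  assume sub: "lie_span (g (- \<alpha> j)) N \<subseteq> N"
  show "\<forall>\<beta>\<in>\<Phi>. \<beta> + \<alpha> j \<in> R \<longrightarrow> \<beta> + \<alpha> j \<in> \<Phi>"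
  proof (intro ballI impI, rule ccontr)
    fix \<beta> assume \<beta>: "\<beta> \<in> \<Phi>" "\<beta> + \<alpha> j \<in> R" "\<beta> + \<alpha> j \<notin> \<Phi>"
    have nj: "- \<alpha> j \<in> R" by (rule root_uminus[OF simple_root[OF j]])
    have nb: "- \<beta> \<in> R" using \<beta>(1) \<Phi> pos_root by (intro root_uminus) blast
    have eq: "- \<beta> + - \<alpha> j = - (\<beta> + \<alpha> j)" "- \<alpha> j + - \<beta> = - (\<beta> + \<alpha> j)" by (simp_all add: fun_eq_iff)
    have sm: "- \<beta> + - \<alpha> j \<in> R" unfolding eq by (rule root_uminus[OF \<beta>(2)])
    obtain e where e: "e \<in> g (- \<alpha> j)" "e \<noteq> 0" using root_vector[OF nj] .
    obtain X where X: "X \<in> g (- \<beta>)" "lie e X \<noteq> 0" using root_bracket[OF nj nb sm e] .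
    have "X \<in> N" unfolding N_def using X(1) \<beta>(1) by (intro lie_vs.span_base) blast
    then have "lie e X \<in> lie_span (g (- \<alpha> j)) N"
      unfolding lie_span_def using e(1) by (intro lie_vs.span_base) blast
    then have "lie e X \<in> N" using sub by blast
    moreover have "lie e X \<in> g (- (\<beta> + \<alpha> j))" using root_space_lie[OF e(1) X(1)] unfolding eq .
    ultimately show False
      using span_root_spaces_separated[OF _ \<beta>(2,3)] X(2) \<Phi> pos_root unfolding N_def by blast
  qed
next
  assume st: "\<forall>\<beta>\<in>\<Phi>. \<beta> + \<alpha> j \<in> R \<longrightarrow> \<beta> + \<alpha> j \<in> \<Phi>"
  have sN: "lie_vs.subspace N" unfolding N_def by (rule lie_vs.subspace_span)
  have "lie e y \<in> N" if e: "e \<in> g (- \<alpha> j)" and y: "y \<in> N" for e y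
  proof (rule subspace_lie_in[OF sN _ e y[unfolded N_def]])
    fix x z assume x: "x \<in> g (- \<alpha> j)" and "z \<in> (\<Union>\<beta>\<in>\<Phi>. g (- \<beta>))"
    then obtain \<beta> where \<beta>: "\<beta> \<in> \<Phi>" "z \<in> g (- \<beta>)" by blast
    have pos: "\<beta> \<in> Rpos" using \<beta>(1) \<Phi> by blast
    have eq: "- \<alpha> j + - \<beta> = - (\<beta> + \<alpha> j)" by (simp add: fun_eq_iff)
    have xz: "lie x z \<in> g (- (\<beta> + \<alpha> j))" using root_space_lie[OF x \<beta>(2)] unfolding eq .
    show "lie x z \<in> N"
    proof (cases "lie x z = 0")
      case True
      then show ?thesis using sN lie_vs.subspace_0 by simp
    next
      case False
      have D: "- (\<beta> + \<alpha> j) \<in> D"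
        by (intro D_uminus D_plus root_D simple_root j pos_root pos)
      have "- (\<beta> + \<alpha> j) \<noteq> 0"
      proof
        assume "- (\<beta> + \<alpha> j) = 0"
        then have "\<beta> + \<alpha> j = 0" by (metis neg_equal_0_iff_equal)
        then have "- \<beta> = \<alpha> j" by (metis add_eq_0_iff)
        then show False using simple_pos[OF j] pos pos_not_neg neg_iff by metis
      qed
      then have "- (\<beta> + \<alpha> j) \<in> R" using rootI[OF D _ xz False] by blast
      then have "\<beta> + \<alpha> j \<in> R" using root_uminus minus_minus by metis
      then have "\<beta> + \<alpha> j \<in> \<Phi>" using st \<beta>(1) by blast
      then show ?thesis unfolding N_def using xz by (intro lie_vs.span_base) blast
    qed
  qed
  then show "lie_span (g (- \<alpha> j)) N \<subseteq> N"
    unfolding lie_span_def by (intro lie_vs.span_minimal sN) blast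
qed

lemma Inv_pos: "Inv w \<subseteq> Rpos" by (simp add: inv_roots_def)

lemma schubert_n_eq: "schubert_n \<hh> n \<alpha> w = lie_vs.span (\<Union>\<beta>\<in>Inv w. g (- \<beta>))"
  by (simp add: schubert_n_def fun_Compl_def)

lemma schubert_J_eq:
  "schubert_J \<hh> n \<alpha> i w = {j \<in> I_par n i. \<exists>\<beta>\<in>Inv w. \<beta> + \<alpha> j \<in> R - Inv w}"
proof -
  have neg: "(\<lambda>H. - \<alpha> j H) = - \<alpha> j" for j by (simp add: fun_Compl_def)
  have "j \<in> {1..n}" if "j \<in> I_par n i" for j using that by (simp add: I_par_def)
  then show ?thesis
    unfolding schubert_J_def schubert_n_eq neg using simple_vector_stable_iff[OF Inv_pos] by blast
qed

lemma schubert_a_eq: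
  assumes "Inv w \<noteq> {}"
  shows "schubert_a \<hh> n \<alpha> i w = max_level (schubert_J \<hh> n \<alpha> i w) (cf ` Inv w)"
proof -
  let ?J = "schubert_J \<hh> n \<alpha> i w"
  have J: "?J \<subseteq> {1..n}" by (auto simp: schubert_J_def I_par_def)
  have val: "\<beta> (schubert_Z \<hh> n \<alpha> i w) = of_int (\<Sum>j\<in>?J. cf \<beta> j)" if "\<beta> \<in> Inv w" for \<beta>
  proof -
    have R: "\<beta> \<in> R" using that Inv_pos pos_root by blast
    have "\<beta> (schubert_Z \<hh> n \<alpha> i w) = (\<Sum>j\<in>?J. \<beta> (Z j))"
      unfolding schubert_Z_def using J by (intro D_sum[OF root_D[OF R]] Zdual) blast
    also have "\<dots> = of_int (\<Sum>j\<in>?J. cf \<beta> j)"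
      unfolding of_int_sum using J cf[OF R] by (intro sum.cong) auto
    finally show ?thesis .
  qed
  have level: "\<beta> (schubert_Z \<hh> n \<alpha> i w) = of_int m \<longleftrightarrow> m = (\<Sum>j\<in>?J. cf \<beta> j)" if "\<beta> \<in> Inv w" for \<beta> m
    unfolding val[OF that] by (subst eq_commute) (rule of_int_eq_iff)
  have "{m :: int. \<exists>\<beta>\<in>Inv w. \<beta> (schubert_Z \<hh> n \<alpha> i w) = of_int m} = (\<lambda>\<beta>. \<Sum>j\<in>?J. cf \<beta> j) ` Inv w"
    unfolding image_def by (intro Collect_cong bex_cong refl level)
  then show ?thesis unfolding schubert_a_def max_level_def by (simp add: image_image)
qed

end

section \<open>Inversion sets as ideals of roots with coefficient one\<close>

locale cominuscule = cartan_setting \<hh> n \<alpha>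
  for \<hh> :: "'g::complex_lie_algebra set" and n :: nat and \<alpha> :: "nat \<Rightarrow> 'g \<Rightarrow> complex" +
  fixes i :: nat
  assumes i: "i \<in> {1..n}" and cominuscule: "\<beta> \<in> roots \<hh> \<Longrightarrow> cf \<beta> i \<le> 1"
begin

lemma cominuscule_neg: "\<beta> \<in> R \<Longrightarrow> cf \<beta> i \<ge> - 1"
  using cominuscule[OF root_uminus] cf_uminus[of \<beta> i] by fastforce

definition top_roots :: "('g \<Rightarrow> complex) set" where "top_roots = {\<beta> \<in> R. cf \<beta> i = 1}"

lemma top_pos: "\<beta> \<in> top_roots \<Longrightarrow> \<beta> \<in> Rpos"
  unfolding top_roots_def by (auto intro: posI[of _ i])

lemma graded_iff: assumes "\<beta> \<in> R" shows "g \<beta> \<subseteq> graded_piece \<hh> n \<alpha> i j \<longleftrightarrow> cf \<beta> i = j"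
proof -
  have *: "lie (Z i) X = of_int (cf \<beta> i) *\<^sub>C X" if "X \<in> g \<beta>" for X
    using root_spaceD[OF that Zdual(1)[OF i]] cf[OF assms i] by simp
  obtain X where X: "X \<in> g \<beta>" "X \<noteq> 0" using root_vector[OF assms] .
  show ?thesis unfolding graded_piece_def using * X by (auto simp: subset_iff)
qed

lemma hasse_iff: "w \<in> hasse \<hh> n \<alpha> i \<longleftrightarrow> w \<in> W \<and> Inv w \<subseteq> top_roots"
proof -
  have "\<beta> \<in> R" if "\<beta> \<in> Inv w" for \<beta> using that Inv_pos pos_root by blast
  then show ?thesis unfolding hasse_def top_roots_def using graded_iff by blast
qed

text \<open>The summand \<delta> has coefficient 0 at \<open>i\<close> and is thus no inversion. If
  \<beta> - \<delta> were none either, the inverse of \<open>w\<close> would send \<beta> to a sum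
  of two positive roots.\<close>

lemma Inv_ideal:
  assumes w: "w \<in> hasse \<hh> n \<alpha> i" and \<beta>: "\<beta> \<in> Inv w" and \<delta>: "\<delta> \<in> Rpos" and top: "\<beta> - \<delta> \<in> top_roots"
  shows "\<beta> - \<delta> \<in> Inv w"
proof (rule ccontr)
  assume no: "\<beta> - \<delta> \<notin> Inv w"
  have wW: "w \<in> W" and sub: "Inv w \<subseteq> top_roots" using w hasse_iff by auto
  obtain v where v: "v \<in> W" "v \<circ> w = id" "w \<circ> v = id" using W_inverse[OF wW] .
  note iff = inv_iff[OF wW v(2,3)]
  have R: "\<beta> \<in> R" "\<delta> \<in> R" "\<beta> - \<delta> \<in> R" using \<beta> \<delta> top Inv_pos pos_root by (auto simp: top_roots_def)
  have "cf \<delta> i = 0" using cf_diff[OF R(1,2,3)] top \<beta> sub by (auto simp: top_roots_def)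
  then have "\<delta> \<notin> Inv w" using sub by (auto simp: top_roots_def)
  then have v\<delta>: "v \<delta> \<in> Rpos" using iff \<delta> root_sign[OF W_root[OF v(1) R(2)]] by blast
  have v\<gamma>: "v (\<beta> - \<delta>) \<in> Rpos" using iff no top_pos[OF top] root_sign[OF W_root[OF v(1) R(3)]] by blast
  have eq: "v (\<beta> - \<delta>) + v \<delta> = v \<beta>" using W_add[OF v(1) root_D[OF R(3)] root_D[OF R(2)]] by simp
  have v\<beta>: "v \<beta> \<in> Rneg" using \<beta> iff by blast
  obtain k where k: "k \<in> {1..n}" "cf (v \<beta>) k \<noteq> 0" using cf_nonzero[OF neg_root[OF v\<beta>]] .
  have "cf (v \<beta>) k = cf (v (\<beta> - \<delta>)) k + cf (v \<delta>) k"
    using cf_add[OF pos_root[OF v\<gamma>] pos_root[OF v\<delta>]] neg_root[OF v\<beta>] eq by simp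
  moreover have "cf (v (\<beta> - \<delta>)) k \<ge> 0" "cf (v \<delta>) k \<ge> 0" "cf (v \<beta>) k \<le> 0"
    using v\<gamma> v\<delta> v\<beta> by (simp_all add: pos_iff_cf neg_iff_cf)
  ultimately show False using k(2) by linarith
qed

lemma ideal_realized:
  "\<Phi> \<subseteq> top_roots \<Longrightarrow> (\<And>\<beta> \<delta>. \<beta> \<in> \<Phi> \<Longrightarrow> \<delta> \<in> Rpos \<Longrightarrow> \<beta> - \<delta> \<in> top_roots \<Longrightarrow> \<beta> - \<delta> \<in> \<Phi>) \<Longrightarrow>
    \<exists>w\<in>W. Inv w = \<Phi>"
proof (induction "card \<Phi>" arbitrary: \<Phi> rule: less_induct)
  case less
  have "\<Phi> \<subseteq> R" using less.prems(1) by (auto simp: top_roots_def)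
  then have fin: "finite \<Phi>" by (rule finite_subset[OF _ finite_roots])
  show ?case
  proof (cases "\<Phi> = {}")
    case True
    have "Inv id = {}" unfolding inv_roots_def using pos_not_neg by auto
    then show ?thesis using True weyl_group.weyl_id by blast
  next
    case False
    obtain \<beta> where \<beta>: "\<beta> \<in> \<Phi>" "\<And>\<gamma>. \<gamma> \<in> \<Phi> \<Longrightarrow> ht \<gamma> \<le> ht \<beta>"
      using ex_is_arg_min_if_finite[OF fin False, of "\<lambda>\<gamma>. - ht \<gamma>"] by (auto simp: is_arg_min_linorder)
    define \<Psi> where "\<Psi> = \<Phi> - {\<beta>}"
    have \<beta>top: "\<beta> \<in> top_roots" using \<beta>(1) less.prems(1) by blast
    have \<beta>R: "\<beta> \<in> R" using \<beta>top by (simp add: top_roots_def)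
    have \<Psi>: "\<gamma> - \<delta> \<in> \<Psi>" if "\<gamma> \<in> \<Psi>" "\<delta> \<in> Rpos" "\<gamma> - \<delta> \<in> top_roots" for \<gamma> \<delta>
    proof -
      \<comment> \<open>Equality would make \<gamma> higher than \<beta>, which has maximal height.
        So the smaller set is again closed.\<close>
      have "\<gamma> - \<delta> \<noteq> \<beta>"
      proof
        assume eq: "\<gamma> - \<delta> = \<beta>"
        have R: "\<gamma> \<in> R" "\<gamma> - \<delta> \<in> R" using that less.prems(1) by (auto simp: \<Psi>_def top_roots_def)
        have "ht \<beta> = ht \<gamma> - ht \<delta>"
          unfolding eq[symmetric] ht_def by (simp add: cf_diff[OF R(1) pos_root[OF that(2)] R(2)] sum_subtractf)
        then show False using \<beta>(2)[of \<gamma>] ht_pos[OF that(2)] that(1) by (simp add: \<Psi>_def)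
      qed
      then show ?thesis using less.prems(2)[of \<gamma> \<delta>] that by (simp add: \<Psi>_def)
    qed
    have "card \<Psi> < card \<Phi>" unfolding \<Psi>_def using fin \<beta>(1) by (rule card_Diff1_less)
    moreover have \<Psi>top: "\<Psi> \<subseteq> top_roots" using less.prems(1) by (auto simp: \<Psi>_def)
    ultimately obtain w where w: "w \<in> W" "Inv w = \<Psi>" using less.hyps[of \<Psi>] \<Psi> by blast
    obtain v where v: "v \<in> W" "v \<circ> w = id" "w \<circ> v = id" using W_inverse[OF w(1)] .
    have wv: "w (v x) = x" "v (w x) = x" for x using v(2,3) by (simp_all add: fun_eq_iff)
    note iff = inv_iff[OF w(1) v(2,3), unfolded w(2)]
    have v\<beta>: "v \<beta> \<in> Rpos"
      using iff[of \<beta>] top_pos[OF \<beta>top] root_sign[OF W_root[OF v(1) \<beta>R]] by (auto simp: \<Psi>_def)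
    \<comment> \<open>Otherwise \<open>v \<beta>\<close> is a sum of two positive roots, whose
      images under \<open>w\<close> sum to \<beta>. Their coefficients at \<open>i\<close> lie
      between -1 and 1 and add up to 1, so one of them is 1.\<close>
    have "\<exists>k\<in>{1..n}. v \<beta> = \<alpha> k"
    proof (rule ccontr)
      assume ns: "\<not> (\<exists>k\<in>{1..n}. v \<beta> = \<alpha> k)"
      then obtain k where k: "k \<in> {1..n}" "v \<beta> - \<alpha> k \<in> Rpos" using pos_decompose[OF v\<beta>] by blast
      have sum: "w (v \<beta> - \<alpha> k) + w (\<alpha> k) = \<beta>"
        using W_add[OF w(1) root_D[OF pos_root[OF k(2)]] root_D[OF simple_root[OF k(1)]]] by (simp add: wv)
      \<comment> \<open>The root \<open>w p\<close> has degree one but is no inversion of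
        \<open>w\<close>. If \<open>w q\<close> is positive, closure of \<Phi> puts
        \<open>w p\<close> into \<Psi>; if it is negative, then \<open>- w q\<close> is an inversion
        of degree 0. Both are impossible.\<close>
      have key: "False" if p: "p \<in> Rpos" and q: "q \<in> Rpos" and pq: "w p + w q = \<beta>" and top: "cf (w p) i = 1" for p q
      proof -
        have R: "w p \<in> R" "w q \<in> R" using W_root[OF w(1)] pos_root p q by auto
        have wp: "w p \<in> top_roots" using R top by (simp add: top_roots_def)
        then have wp\<Psi>: "w p \<notin> \<Psi>" using iff[of "w p"] p pos_not_neg by (auto simp: wv)
        have "cf (w q) i = 0" using cf_add[OF R] pq \<beta>R \<beta>top top by (simp add: top_roots_def)
        show False
        proof (cases "w q \<in> Rpos")
          case True
          have "\<beta> - w q = w p" unfolding pq[symmetric] by (rule add_diff_cancel_right')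
          then have "w p \<in> \<Phi>" using less.prems(2)[OF \<beta>(1) True] wp by simp
          moreover have "w p \<noteq> \<beta>"
          proof
            assume "w p = \<beta>"
            then have "w q = 0" using pq by simp
            then show False using root_nonzero[OF R(2)] by simp
          qed
          ultimately show False using wp\<Psi> by (simp add: \<Psi>_def)
        next
          case False
          then have "- w q \<in> Rpos" using root_sign[OF R(2)] neg_iff by blast
          moreover have "v (- w q) \<in> Rneg"
            using W_uminus[OF v(1) root_D[OF R(2)]] q by (simp add: wv neg_iff)
          ultimately have "- w q \<in> \<Psi>" using iff by blast
          then show False using \<Psi>top \<open>cf (w q) i = 0\<close> cf_uminus[OF R(2), of i] by (auto simp: top_roots_def)
        qed
      qed
      have R: "w (v \<beta> - \<alpha> k) \<in> R" "w (\<alpha> k) \<in> R"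
        using W_root[OF w(1)] pos_root k simple_root by auto
      have "cf (w (v \<beta> - \<alpha> k)) i + cf (w (\<alpha> k)) i = 1"
        using cf_add[OF R] sum \<beta>R \<beta>top by (simp add: top_roots_def)
      then have "cf (w (v \<beta> - \<alpha> k)) i = 1 \<or> cf (w (\<alpha> k)) i = 1"
        using cominuscule[OF R(1)] cominuscule[OF R(2)] cominuscule_neg[OF R(1)] by linarith
      then show False
        using key[OF k(2) simple_pos[OF k(1)] sum] key[OF simple_pos[OF k(1)] k(2)] sum
        by (metis add.commute)
    qed
    then obtain k where k: "k \<in> {1..n}" "v \<beta> = \<alpha> k" by blast
    have kR: "\<alpha> k \<in> R" by (rule simple_root[OF k(1)])
    have w': "w \<circ> sk k \<in> W" by (rule W_comp[OF w(1) reflection_in_W[OF kR]])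
    have inv: "(sk k \<circ> v) \<circ> (w \<circ> sk k) = id" "(w \<circ> sk k) \<circ> (sk k \<circ> v) = id"
    proof -
      have "(sk k \<circ> v) \<circ> (w \<circ> sk k) = sk k \<circ> (v \<circ> w) \<circ> sk k"
        "(w \<circ> sk k) \<circ> (sk k \<circ> v) = w \<circ> (sk k \<circ> sk k) \<circ> v" by (simp_all only: comp_assoc)
      then show "(sk k \<circ> v) \<circ> (w \<circ> sk k) = id" "(w \<circ> sk k) \<circ> (sk k \<circ> v) = id"
        unfolding v(2) reflection_involution[OF kR] using reflection_involution[OF kR] v(3) by simp_all
    qed
    \<comment> \<open>The simple reflection permutes the positive roots other than
      \<open>\<alpha> k\<close>, so the only change in the inversion set is that \<beta> is
      added.\<close>
    have "\<gamma> \<in> Inv (w \<circ> sk k) \<longleftrightarrow> \<gamma> \<in> \<Phi>" for \<gamma>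
    proof (cases "\<gamma> \<in> Rpos \<and> \<gamma> \<noteq> \<beta>")
      case True
      have \<gamma>R: "\<gamma> \<in> R" using True pos_root by blast
      have v\<gamma>: "v \<gamma> \<in> R" by (rule W_root[OF v(1) \<gamma>R])
      have ne1: "v \<gamma> \<noteq> \<alpha> k" using k(2) wv True by metis
      have ne2: "v \<gamma> \<noteq> - \<alpha> k"
      proof
        assume "v \<gamma> = - \<alpha> k"
        then have "w (v \<gamma>) = - w (\<alpha> k)" using W_uminus[OF w(1) root_D[OF kR]] by simp
        then have "\<gamma> = - \<beta>" using k(2) wv by metis
        then show False using True top_pos[OF \<beta>top] pos_not_neg neg_iff minus_minus by metis
      qed
      have "sk k (v \<gamma>) \<in> Rneg \<longleftrightarrow> v \<gamma> \<in> Rneg"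
      proof (cases "v \<gamma> \<in> Rpos")
        case True
        then show ?thesis using sk_pos[OF True k(1) ne1] pos_not_neg by blast
      next
        case False
        then have neg: "v \<gamma> \<in> Rneg" using root_sign[OF v\<gamma>] by blast
        then have "- v \<gamma> \<in> Rpos" by (simp add: neg_iff)
        moreover have "- v \<gamma> \<noteq> \<alpha> k" using ne2 minus_minus by metis
        ultimately have "sk k (- v \<gamma>) \<in> Rpos" by (rule sk_pos[OF _ k(1)])
        then have "- sk k (v \<gamma>) \<in> Rpos" using W_uminus[OF reflection_in_W[OF kR] root_D[OF v\<gamma>]] by simp
        then show ?thesis using neg by (simp add: neg_iff)
      qed
      then show ?thesis unfolding inv_iff[OF w' inv] using iff[of \<gamma>] True by (simp add: \<Psi>_def)
    next
      case False
      show ?thesis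
      proof (cases "\<gamma> = \<beta>")
        case True
        have "sk k (v \<beta>) \<in> Rneg" using k simple_pos[OF k(1)] sk_simple[OF k(1)] by (simp add: neg_iff)
        then show ?thesis unfolding inv_iff[OF w' inv] using True top_pos[OF \<beta>top] \<beta>(1) by simp
      next
        case ne: False
        then have "\<gamma> \<notin> Rpos" using False by blast
        then show ?thesis using Inv_pos less.prems(1) top_pos by blast
      qed
    qed
    then show ?thesis using w' by blast
  qed
qed

text \<open>An eigenvector of ad \<open>Z i\<close> for -1 only has components in basis vectors
  whose weight is -1 on \<open>Z i\<close>. Hence if all degree-one roots are inversions, their
  opposite root spaces span all of \<open>g_(-1)\<close>.\<close>

lemma proper_schubertD:
  assumes "proper_schubert \<hh> n \<alpha> i w" shows "Inv w \<noteq> {}" "Inv w \<noteq> top_roots"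
proof -
  show "Inv w \<noteq> {}" using assms by (auto simp: proper_schubert_def schubert_n_eq)
  show "Inv w \<noteq> top_roots"
  proof
    assume eq: "Inv w = top_roots"
    have "schubert_n \<hh> n \<alpha> w = graded_piece \<hh> n \<alpha> i (- 1)"
      unfolding schubert_n_eq eq
    proof
      have "lie_vs.subspace (graded_piece \<hh> n \<alpha> i (- 1))"
        by (simp add: lie_vs.subspace_def graded_piece_def lie_add_right scaleC_add_right lie_scaleC_right)
      moreover have "g (- \<beta>) \<subseteq> graded_piece \<hh> n \<alpha> i (- 1)" if "\<beta> \<in> top_roots" for \<beta>
        using that cf_uminus[of \<beta> i] by (subst graded_iff) (auto simp: top_roots_def root_uminus)
      ultimately show "lie_vs.span (\<Union>\<beta>\<in>top_roots. g (- \<beta>)) \<subseteq> graded_piece \<hh> n \<alpha> i (- 1)"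
        by (intro lie_vs.span_minimal UN_least)
      show "graded_piece \<hh> n \<alpha> i (- 1) \<subseteq> lie_vs.span (\<Union>\<beta>\<in>top_roots. g (- \<beta>))"
      proof
        fix X assume "X \<in> graded_piece \<hh> n \<alpha> i (- 1)"
        then have X: "lie (Z i) X = (- 1) *\<^sub>C X" by (simp add: graded_piece_def)
        have "rep X b *\<^sub>C b \<in> lie_vs.span (\<Union>\<beta>\<in>top_roots. g (- \<beta>))" if b: "b \<in> basis" for b
        proof (cases "rep X b = 0")
          case True
          then show ?thesis by (simp add: lie_vs.span_zero)
        next
          case False
          have "wt b (Z i) * rep X b = - rep X b"
            using rep_lie_h[OF Zdual(1)[OF i] b, of X] unfolding X rep_scale by simp
          then have "(wt b (Z i) + 1) * rep X b = 0" by (simp add: distrib_right)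
          then have wb: "wt b (Z i) = - 1" using False by (simp add: eq_neg_iff_add_eq_0)
          then have R: "wt b \<in> R" using wt_cases[OF b] by auto
          have "(of_int (cf (wt b) i) :: complex) = of_int (- 1)" using wb cf[OF R i] by simp
          then have "cf (wt b) i = - 1" by (simp only: of_int_eq_iff)
          then have "- wt b \<in> top_roots" using R cf_uminus[OF R] by (simp add: top_roots_def root_uminus)
          moreover have "b \<in> g (- (- wt b))" using wt(2)[OF b] minus_minus by metis
          ultimately show ?thesis by (intro lie_vs.span_scale lie_vs.span_base) blast
        qed
        then have "(\<Sum>b\<in>basis. rep X b *\<^sub>C b) \<in> lie_vs.span (\<Union>\<beta>\<in>top_roots. g (- \<beta>))"
          by (rule lie_vs.span_sum)
        then show "X \<in> lie_vs.span (\<Union>\<beta>\<in>top_roots. g (- \<beta>))" by (simp add: sum_rep)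
      qed
    qed
    then show False using assms by (simp add: proper_schubert_def)
  qed
qed

abbreviation "E \<equiv> {c \<in> cf ` R. c i = 1}"

lemma cf_top: "cf ` top_roots = E" by (auto simp: top_roots_def)

lemma cf_plus_unit: assumes "\<beta> \<in> R" "j \<in> {1..n}" shows "cf \<beta> + unit j \<in> cf ` R \<longleftrightarrow> \<beta> + \<alpha> j \<in> R"
  and "\<beta> + \<alpha> j \<in> R \<Longrightarrow> cf (\<beta> + \<alpha> j) = cf \<beta> + unit j"
proof -
  have *: "cf (\<beta> + \<alpha> j) = cf \<beta> + unit j" if "\<beta> + \<alpha> j \<in> R"
    using cf_add[OF assms(1) simple_root[OF assms(2)] that] by (simp add: fun_eq_iff unit_def cf_simple[OF assms(2)])
  then show "\<beta> + \<alpha> j \<in> R \<Longrightarrow> cf (\<beta> + \<alpha> j) = cf \<beta> + unit j" .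
  show "cf \<beta> + unit j \<in> cf ` R \<longleftrightarrow> \<beta> + \<alpha> j \<in> R"
  proof
    assume "cf \<beta> + unit j \<in> cf ` R"
    then obtain \<gamma> where \<gamma>: "\<gamma> \<in> R" "cf \<gamma> = cf \<beta> + unit j" by auto
    have "\<gamma> = \<beta> + \<alpha> j"
    proof (rule D_eqI_Z)
      fix k assume k: "k \<in> {1..n}"
      show "\<gamma> (Z k) = (\<beta> + \<alpha> j) (Z k)"
        using cf[OF \<gamma>(1) k] cf[OF assms(1) k] Zdual(2)[OF k assms(2)] \<gamma>(2) by (simp add: unit_def)
    qed (use \<gamma>(1) assms root_D D_plus simple_root in auto)
    then show "\<beta> + \<alpha> j \<in> R" using \<gamma>(1) by simp
  qed (use * in \<open>metis imageI\<close>)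
qed

lemma I_par_sub: "j \<in> I_par n i \<Longrightarrow> j \<in> {1..n}" "j \<in> I_par n i \<Longrightarrow> j \<noteq> i" by (auto simp: I_par_def)

lemma schubert_J_labels:
  assumes "w \<in> hasse \<hh> n \<alpha> i"
  shows "schubert_J \<hh> n \<alpha> i w = raising_labels E (I_par n i) (cf ` Inv w)"
proof -
  have sub: "Inv w \<subseteq> top_roots" using assms hasse_iff by blast
  have "(\<beta> + \<alpha> j \<in> R - Inv w) \<longleftrightarrow> cf \<beta> + unit j \<in> E - cf ` Inv w"
    if \<beta>: "\<beta> \<in> Inv w" and j: "j \<in> I_par n i" for \<beta> j
  proof -
    have bR: "\<beta> \<in> R" "cf \<beta> i = 1" using \<beta> sub by (auto simp: top_roots_def)
    note c = cf_plus_unit[OF bR(1) I_par_sub(1)[OF j]]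
    have 1: "(cf \<beta> + unit j) i = 1" using bR(2) I_par_sub(2)[OF j] by (simp add: unit_def)
    have "cf \<beta> + unit j \<in> cf ` Inv w \<longleftrightarrow> \<beta> + \<alpha> j \<in> Inv w" if R: "\<beta> + \<alpha> j \<in> R"
    proof
      assume "cf \<beta> + unit j \<in> cf ` Inv w"
      then obtain \<gamma> where "\<gamma> \<in> Inv w" "cf \<gamma> = cf (\<beta> + \<alpha> j)" using c(2)[OF R] by auto
      then show "\<beta> + \<alpha> j \<in> Inv w" using cf_inj[of \<gamma> "\<beta> + \<alpha> j"] R Inv_pos pos_root by blast
    next
      assume "\<beta> + \<alpha> j \<in> Inv w"
      then show "cf \<beta> + unit j \<in> cf ` Inv w" unfolding c(2)[OF R, symmetric] by (rule imageI)
    qed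
    then show ?thesis using c(1) 1 by blast
  qed
  then show ?thesis unfolding schubert_J_eq raising_labels_def by blast
qed

lemma Inv_lowering_closed:
  assumes w: "w \<in> hasse \<hh> n \<alpha> i" shows "lowering_closed E (I_par n i) (cf ` Inv w)"
  unfolding lowering_closed_def
proof (intro conjI ballI impI)
  have sub: "Inv w \<subseteq> top_roots" using w hasse_iff by blast
  then show "cf ` Inv w \<subseteq> E" using cf_top by blast
  fix c j assume "c \<in> cf ` Inv w" and j: "j \<in> I_par n i" and E: "c - unit j \<in> E"
  then obtain \<beta> where \<beta>: "\<beta> \<in> Inv w" "c = cf \<beta>" by blast
  obtain \<gamma> where \<gamma>: "\<gamma> \<in> top_roots" "cf \<gamma> = c - unit j" using E unfolding cf_top[symmetric] by auto
  have R: "\<gamma> \<in> R" "\<beta> \<in> R" using \<gamma> \<beta> sub by (auto simp: top_roots_def)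
  have "cf \<gamma> + unit j = cf \<beta>" using \<gamma>(2) \<beta>(2) by simp
  then have "\<gamma> + \<alpha> j \<in> R" "cf (\<gamma> + \<alpha> j) = cf \<beta>"
    using cf_plus_unit[OF R(1) I_par_sub(1)[OF j]] R(2) by auto
  then have "\<gamma> + \<alpha> j = \<beta>" using cf_inj R(2) by blast
  then have "\<beta> - \<alpha> j = \<gamma>" by auto
  then have "\<gamma> \<in> Inv w" using Inv_ideal[OF w \<beta>(1) simple_pos[OF I_par_sub(1)[OF j]]] \<gamma>(1) by simp
  then show "c - unit j \<in> cf ` Inv w" using \<gamma>(2) by (metis imageI)
qed

lemma order_ideal_realized:
  assumes "order_ideal E \<Phi>" obtains w where "w \<in> hasse \<hh> n \<alpha> i" "cf ` Inv w = \<Phi>"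
proof -
  define \<Psi> where "\<Psi> = {\<beta> \<in> top_roots. cf \<beta> \<in> \<Phi>}"
  have "\<exists>w\<in>W. Inv w = \<Psi>"
  proof (rule ideal_realized)
    show "\<Psi> \<subseteq> top_roots" by (auto simp: \<Psi>_def)
    fix \<beta> \<delta> assume \<beta>: "\<beta> \<in> \<Psi>" and \<delta>: "\<delta> \<in> Rpos" and top: "\<beta> - \<delta> \<in> top_roots"
    have R: "\<beta> \<in> R" "\<beta> - \<delta> \<in> R" using \<beta> top by (auto simp: \<Psi>_def top_roots_def)
    have "cf (\<beta> - \<delta>) \<le> cf \<beta>"
      using cf_diff[OF R(1) pos_root[OF \<delta>] R(2)] \<delta> by (simp add: le_fun_def pos_iff_cf)
    then have "cf (\<beta> - \<delta>) \<in> \<Phi>"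
      using assms \<beta> top unfolding order_ideal_def cf_top[symmetric] \<Psi>_def by blast
    then show "\<beta> - \<delta> \<in> \<Psi>" using top by (simp add: \<Psi>_def)
  qed
  then obtain w where w: "w \<in> W" "Inv w = \<Psi>" by blast
  have "cf ` \<Psi> = \<Phi>"
  proof
    show "\<Phi> \<subseteq> cf ` \<Psi>"
    proof
      fix c assume c: "c \<in> \<Phi>"
      then obtain \<beta> where "\<beta> \<in> top_roots" "c = cf \<beta>"
        using assms unfolding order_ideal_def cf_top[symmetric] by blast
      then show "c \<in> cf ` \<Psi>" using c by (auto simp: \<Psi>_def)
    qed
  qed (auto simp: \<Psi>_def)
  moreover have "w \<in> hasse \<hh> n \<alpha> i" using w by (auto simp: hasse_iff \<Psi>_def)
  ultimately show ?thesis using that w(2) by blast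
qed

lemma cf_Inv_inj:
  assumes "w \<in> hasse \<hh> n \<alpha> i" "w' \<in> hasse \<hh> n \<alpha> i" "cf ` Inv w = cf ` Inv w'" shows "w = w'"
proof -
  have inj: "inj_on cf R" using cf_inj by (auto intro: inj_onI)
  have "Inv w \<subseteq> R" "Inv w' \<subseteq> R" using Inv_pos pos_root by blast+
  then have "Inv w = Inv w'" using assms(3) inj_on_image_eq_iff[OF inj] by blast
  then show ?thesis using inv_inj assms(1,2) hasse_iff by blast
qed

theorem schubert_classification:
  assumes "classified E (I_par n i) P"
  shows "(\<forall>w\<in>hasse \<hh> n \<alpha> i. proper_schubert \<hh> n \<alpha> i w \<longrightarrow>
            schubert_a \<hh> n \<alpha> i w \<ge> 0 \<and>
            schubert_J \<hh> n \<alpha> i w \<noteq> {} \<and>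
            schubert_J \<hh> n \<alpha> i w \<subseteq> I_par n i \<and>
            P (schubert_a \<hh> n \<alpha> i w) (schubert_J \<hh> n \<alpha> i w))
       \<and> (\<forall>(a::int) J. a \<ge> 0 \<and> J \<noteq> {} \<and> J \<subseteq> I_par n i \<and> P a J \<longrightarrow>
            (\<exists>!w. w \<in> hasse \<hh> n \<alpha> i \<and>
                  a = schubert_a \<hh> n \<alpha> i w \<and> J = schubert_J \<hh> n \<alpha> i w))"
proof -
  \<comment> \<open>Ensures that the maximum in \<open>schubert_a\<close> is taken over a nonempty
    set in the converse, where properness is not given but \<open>J\<close> is nonempty.\<close>
  have nonempty: "Inv w \<noteq> {}" if "schubert_J \<hh> n \<alpha> i w \<noteq> {}" for w
    using that unfolding schubert_J_eq by blast
  have T1: "0 \<le> max_level J \<Phi> \<and> J \<noteq> {} \<and> P (max_level J \<Phi>) J"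
    if "lowering_closed E (I_par n i) \<Phi>" "\<Phi> \<noteq> {}" "\<Phi> \<noteq> E" "J = raising_labels E (I_par n i) \<Phi>" for \<Phi> J
    using assms[unfolded classified_def, THEN conjunct1] that by blast
  have T2: "\<exists>\<Phi>. order_ideal E \<Phi> \<and> max_level J \<Phi> = a \<and> raising_labels E (I_par n i) \<Phi> = J"
    if "0 \<le> a" "J \<noteq> {}" "J \<subseteq> I_par n i" "P a J" for a J
    using assms[unfolded classified_def, THEN conjunct2, THEN conjunct1] that by blast
  have T3: "\<Phi> = \<Psi>" if "lowering_closed E (I_par n i) \<Phi>" "lowering_closed E (I_par n i) \<Psi>"
    "J \<noteq> {}" "J = raising_labels E (I_par n i) \<Phi>" "J = raising_labels E (I_par n i) \<Psi>"
    "max_level J \<Phi> = max_level J \<Psi>" for \<Phi> \<Psi> J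
    using assms[unfolded classified_def, THEN conjunct2, THEN conjunct2] that by blast
  show ?thesis
  proof (intro conjI ballI allI impI)
    fix w assume w: "w \<in> hasse \<hh> n \<alpha> i" and ps: "proper_schubert \<hh> n \<alpha> i w"
    note proper = proper_schubertD[OF ps]
    have "cf ` Inv w \<noteq> E"
    proof
      assume "cf ` Inv w = E"
      then have "cf ` Inv w = cf ` top_roots" by (simp only: cf_top)
      moreover have "inj_on cf R" using cf_inj by (auto intro: inj_onI)
      moreover have "Inv w \<subseteq> R" "top_roots \<subseteq> R" using Inv_pos pos_root by (auto simp: top_roots_def)
      ultimately show False using inj_on_image_eq_iff proper(2) by blast
    qed
    then have main: "0 \<le> max_level (schubert_J \<hh> n \<alpha> i w) (cf ` Inv w) \<and> schubert_J \<hh> n \<alpha> i w \<noteq> {} \<and>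
        P (max_level (schubert_J \<hh> n \<alpha> i w) (cf ` Inv w)) (schubert_J \<hh> n \<alpha> i w)"
      using T1[OF Inv_lowering_closed[OF w] _ _ schubert_J_labels[OF w]] proper(1) by blast
    then show "schubert_a \<hh> n \<alpha> i w \<ge> 0" "schubert_J \<hh> n \<alpha> i w \<noteq> {}"
      "P (schubert_a \<hh> n \<alpha> i w) (schubert_J \<hh> n \<alpha> i w)"
      using schubert_a_eq[OF proper(1)] by simp_all
    show "schubert_J \<hh> n \<alpha> i w \<subseteq> I_par n i" by (auto simp: schubert_J_eq)
  next
    fix a :: int and J assume asm: "a \<ge> 0 \<and> J \<noteq> {} \<and> J \<subseteq> I_par n i \<and> P a J"
    then obtain \<Phi> where \<Phi>: "order_ideal E \<Phi>" "max_level J \<Phi> = a" "raising_labels E (I_par n i) \<Phi> = J"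
      using T2 by blast
    obtain w where w: "w \<in> hasse \<hh> n \<alpha> i" "cf ` Inv w = \<Phi>" using order_ideal_realized[OF \<Phi>(1)] .
    have J: "schubert_J \<hh> n \<alpha> i w = J" using schubert_J_labels[OF w(1)] w(2) \<Phi>(3) by simp
    have a: "schubert_a \<hh> n \<alpha> i w = a"
      using schubert_a_eq[OF nonempty, of w i] J asm w(2) \<Phi>(2) by simp
    show "\<exists>!w. w \<in> hasse \<hh> n \<alpha> i \<and> a = schubert_a \<hh> n \<alpha> i w \<and> J = schubert_J \<hh> n \<alpha> i w"
    proof (rule ex1I[of _ w])
      show "w \<in> hasse \<hh> n \<alpha> i \<and> a = schubert_a \<hh> n \<alpha> i w \<and> J = schubert_J \<hh> n \<alpha> i w"
        using w J a by simp
      fix u assume u: "u \<in> hasse \<hh> n \<alpha> i \<and> a = schubert_a \<hh> n \<alpha> i u \<and> J = schubert_J \<hh> n \<alpha> i u"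
      have "max_level J (cf ` Inv u) = a" using schubert_a_eq[OF nonempty, of u i] u asm by simp
      then have "cf ` Inv u = cf ` Inv w"
        using T3[OF Inv_lowering_closed Inv_lowering_closed, of u w J] u w schubert_J_labels[of u]
          schubert_J_labels[of w] J asm \<Phi>(2) by simp
      then show "u = w" using cf_Inv_inj u w(1) by blast
    qed
  qed
qed

end

section \<open>Staircases\<close>

text \<open>Once every proper ideal is the set of vectors of level at most \<open>a\<close> for its
  own \<open>J\<close>, the pair determines it, which is uniqueness. Such sets are strong ideals
  since the level is monotone in the coefficients.\<close>

lemma classifiedI:
  assumes level: "\<And>\<Phi> J. lowering_closed E I \<Phi> \<Longrightarrow> J = raising_labels E I \<Phi> \<Longrightarrow> \<Phi> \<noteq> {} \<Longrightarrow> \<Phi> \<noteq> E \<Longrightarrow>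
      \<Phi> = {c \<in> E. (\<Sum>j\<in>J. c j) \<le> max_level J \<Phi>} \<and> 0 \<le> max_level J \<Phi> \<and> J \<noteq> {} \<and> P (max_level J \<Phi>) J"
    and real: "\<And>a J. 0 \<le> a \<Longrightarrow> J \<noteq> {} \<Longrightarrow> J \<subseteq> I \<Longrightarrow> P a J \<Longrightarrow>
      max_level J {c \<in> E. (\<Sum>j\<in>J. c j) \<le> a} = a \<and> raising_labels E I {c \<in> E. (\<Sum>j\<in>J. c j) \<le> a} = J"
  shows "classified E I P"
proof -
  have ideal: "order_ideal E {c \<in> E. (\<Sum>j\<in>J. c j) \<le> a}" for a J
    unfolding order_ideal_def
  proof (intro conjI ballI impI)
    fix c d assume "c \<in> {c \<in> E. (\<Sum>j\<in>J. c j) \<le> a}" "d \<in> E" "d \<le> c"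
    moreover have "(\<Sum>j\<in>J. d j) \<le> (\<Sum>j\<in>J. c j)" using \<open>d \<le> c\<close> by (intro sum_mono) (simp add: le_fun_def)
    ultimately show "d \<in> {c \<in> E. (\<Sum>j\<in>J. c j) \<le> a}" by simp
  qed blast
  have proper: "\<Phi> \<noteq> {} \<and> \<Phi> \<noteq> E" if "raising_labels E I \<Phi> \<noteq> {}" for \<Phi>
    using that by (auto simp: raising_labels_def)
  show ?thesis
    unfolding classified_def
  proof (intro conjI allI impI)
    fix \<Phi> \<Psi> J
    assume asm: "lowering_closed E I \<Phi> \<and> lowering_closed E I \<Psi> \<and> J \<noteq> {} \<and>
       J = raising_labels E I \<Phi> \<and> J = raising_labels E I \<Psi> \<and> max_level J \<Phi> = max_level J \<Psi>"
    then have "\<Phi> \<noteq> {} \<and> \<Phi> \<noteq> E" "\<Psi> \<noteq> {} \<and> \<Psi> \<noteq> E" using proper by metis+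
    then have 1: "\<Phi> = {c \<in> E. (\<Sum>j\<in>J. c j) \<le> max_level J \<Phi>}"
      and 2: "\<Psi> = {c \<in> E. (\<Sum>j\<in>J. c j) \<le> max_level J \<Psi>}"
      using level[of \<Phi> J] level[of \<Psi> J] asm by blast+
    have eq: "max_level J \<Phi> = max_level J \<Psi>" using asm by blast
    show "\<Phi> = \<Psi>" using 1 unfolding eq by (rule trans[OF _ 2[symmetric]])
  next
    fix a J assume asm: "0 \<le> a \<and> J \<noteq> {} \<and> J \<subseteq> I \<and> P a J"
    show "\<exists>\<Phi>. order_ideal E \<Phi> \<and> max_level J \<Phi> = a \<and> raising_labels E I \<Phi> = J"
      using ideal[of J a] real[of a J] asm by blast
  qed (use level in \<open>blast\<close>)+
qed

text \<open>\<rho> and \<sigma> are specified by their increments: they rise by one exactly where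
  the next row or column is strictly shorter. This allows them to be instantiated by counts of
  labels.\<close>

locale staircase =
  fixes M :: "(nat \<times> nat) set" and A B :: nat and \<rho> \<sigma> :: "nat \<Rightarrow> int"
  assumes box: "(x, y) \<in> M \<Longrightarrow> x < A \<and> y < B"
    and down: "(x, y) \<in> M \<Longrightarrow> x' \<le> x \<Longrightarrow> y' \<le> y \<Longrightarrow> (x', y') \<in> M"
    and rho_0: "\<rho> 0 = 0" and sigma_0: "\<sigma> 0 = 0"
    and rho_Suc: "Suc x < A \<Longrightarrow> \<rho> (Suc x) = \<rho> x + of_bool (\<exists>y. (x, y) \<in> M \<and> (Suc x, y) \<notin> M)"
    and sigma_Suc: "Suc y < B \<Longrightarrow> \<sigma> (Suc y) = \<sigma> y + of_bool (\<exists>x. (x, y) \<in> M \<and> (x, Suc y) \<notin> M)"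
begin

text \<open>Carries every statement about columns over to rows.\<close>

lemma transpose: "staircase {(y, x). (x, y) \<in> M} B A \<sigma> \<rho>"
  by unfold_locales (use box down rho_0 sigma_0 rho_Suc sigma_Suc in auto)

lemma sigma_mono: "y \<le> y' \<Longrightarrow> y' < B \<Longrightarrow> \<sigma> y \<le> \<sigma> y'"
proof (induction y' rule: dec_induct)
  case (step y')
  then show ?case using sigma_Suc[of y'] by simp
qed simp

lemma sigma_nonneg: "y < B \<Longrightarrow> 0 \<le> \<sigma> y" using sigma_mono[of 0 y] sigma_0 by simp

text \<open>Walking along row \<open>x\<close> from inside to outside crosses the end of the row,
  and the column transition there is a corner.\<close>

lemma sigma_drop: "(x, y) \<in> M \<Longrightarrow> (x, y') \<notin> M \<Longrightarrow> y' < B \<Longrightarrow> \<sigma> y < \<sigma> y'"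
proof (induction y')
  case 0
  then show ?case using down[of x y x 0] by simp
next
  case (Suc z)
  show ?case
  proof (cases "(x, z) \<in> M")
    case True
    have "y < Suc z" using down[of x y x "Suc z"] Suc.prems by (meson leI order_refl)
    then have "\<sigma> y \<le> \<sigma> z" using sigma_mono Suc.prems by simp
    moreover have "\<sigma> (Suc z) = \<sigma> z + 1" using sigma_Suc[of z] True Suc.prems by auto
    ultimately show ?thesis by simp
  next
    case False
    then have "\<sigma> y < \<sigma> z" using Suc by simp
    then show ?thesis using sigma_mono[of z "Suc z"] Suc.prems by simp
  qed
qed

text \<open>When \<rho> rises from row \<open>x\<close> to the next, some column z ends there. The
  cell of the lower row is compared with column z inside that row; the strict gain in \<sigma>
  absorbs the rise of \<rho>.\<close>

lemma separation_below:
  "x' \<le> x \<Longrightarrow> (x, y) \<in> M \<Longrightarrow> (x', y') \<notin> M \<Longrightarrow> y' < B \<Longrightarrow> \<rho> x + \<sigma> y < \<rho> x' + \<sigma> y'"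
proof (induction x arbitrary: y rule: dec_induct)
  case base
  then show ?case using sigma_drop by simp
next
  case (step x)
  have xy: "(x, y) \<in> M" using down[OF step.prems(1), of x y] by simp
  have A: "Suc x < A" using box step.prems(1) by blast
  show ?case
  proof (cases "\<exists>z. (x, z) \<in> M \<and> (Suc x, z) \<notin> M")
    case True
    then obtain z where z: "(x, z) \<in> M" "(Suc x, z) \<notin> M" by blast
    have "\<sigma> y < \<sigma> z" using sigma_drop[OF step.prems(1) z(2)] box[OF z(1)] by simp
    moreover have "\<rho> x + \<sigma> z < \<rho> x' + \<sigma> y'" using step.IH[OF z(1) step.prems(2,3)] .
    moreover have "\<rho> (Suc x) = \<rho> x + 1" using rho_Suc[OF A] True by simp
    ultimately show ?thesis by simp
  next
    case False
    then have "\<rho> (Suc x) = \<rho> x" using rho_Suc[OF A] by simp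
    then show ?thesis using step.IH[OF xy step.prems(2,3)] by simp
  qed
qed

lemma rho_mono: "x \<le> x' \<Longrightarrow> x' < A \<Longrightarrow> \<rho> x \<le> \<rho> x'"
  using staircase.sigma_mono[OF transpose] .

lemma rho_nonneg: "x < A \<Longrightarrow> 0 \<le> \<rho> x" using rho_mono[of 0 x] rho_0 by simp

text \<open>\<open>separation_below\<close> and its transpose cover the positions in which one
  coordinate of the outer cell is not larger. In the remaining position both \<rho> and \<sigma> are
  monotone and column \<open>y\<close> provides strictness.\<close>

lemma separation:
  assumes "(x, y) \<in> M" "(x', y') \<notin> M" "x' < A" "y' < B"
  shows "\<rho> x + \<sigma> y < \<rho> x' + \<sigma> y'"
proof (cases "x' \<le> x")
  case True
  then show ?thesis using separation_below assms by blast
next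
  case False
  show ?thesis
  proof (cases "(x', y) \<in> M")
    case True
    have "\<rho> x' + \<sigma> y < \<rho> x' + \<sigma> y'" using separation_below[OF order_refl True assms(2,4)] .
    then show ?thesis using rho_mono[of x x'] False assms(3) by simp
  next
    case F: False
    have drop: "\<rho> x < \<rho> x'" using staircase.sigma_drop[OF transpose, of y x x'] assms F by simp
    show ?thesis
    proof (cases "y \<le> y'")
      case True
      then show ?thesis using drop sigma_mono assms(4) by fastforce
    next
      case False
      then show ?thesis using staircase.separation_below[OF transpose, of y' y x x'] assms by simp
    qed
  qed
qed

definition level :: int where "level = Max ((\<lambda>(x, y). \<rho> x + \<sigma> y) ` M)"

lemma finite_M: "finite M"
  by (rule finite_subset[of _ "{..<A} \<times> {..<B}"]) (use box in auto)

lemma level_ge: "(x, y) \<in> M \<Longrightarrow> \<rho> x + \<sigma> y \<le> level"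
  unfolding level_def using finite_M by (intro Max_ge) force+

lemma level_attained: assumes "M \<noteq> {}" obtains x y where "(x, y) \<in> M" "\<rho> x + \<sigma> y = level"
proof -
  have "level \<in> (\<lambda>(x, y). \<rho> x + \<sigma> y) ` M" unfolding level_def using finite_M assms by (intro Max_in) auto
  then show ?thesis using that by auto
qed

lemma M_eq_level:
  assumes "M \<noteq> {}" shows "(x, y) \<in> M \<longleftrightarrow> x < A \<and> y < B \<and> \<rho> x + \<sigma> y \<le> level"
proof
  assume "(x, y) \<in> M"
  then show "x < A \<and> y < B \<and> \<rho> x + \<sigma> y \<le> level" using box level_ge by blast
next
  assume a: "x < A \<and> y < B \<and> \<rho> x + \<sigma> y \<le> level"
  obtain u v where "(u, v) \<in> M" "\<rho> u + \<sigma> v = level" using level_attained[OF assms] .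
  then show "(x, y) \<in> M" using separation[of u v x y] a by force
qed

lemma level_nonneg: assumes "M \<noteq> {}" shows "0 \<le> level"
proof -
  obtain u v where "(u, v) \<in> M" "\<rho> u + \<sigma> v = level" using level_attained[OF assms] .
  then show ?thesis using rho_nonneg sigma_nonneg box by fastforce
qed

text \<open>Before each rise of \<rho>, row \<open>x\<close> still contains a cell, whose level is
  at least \<open>\<rho> x\<close>.\<close>

lemma rho_le_level: assumes "M \<noteq> {}" shows "x < A \<Longrightarrow> \<rho> x \<le> level + 1"
proof (induction x)
  case 0
  then show ?case using level_nonneg[OF assms] rho_0 by simp
next
  case (Suc x)
  show ?case
  proof (cases "\<exists>y. (x, y) \<in> M \<and> (Suc x, y) \<notin> M")
    case True
    then obtain y where "(x, y) \<in> M" by blast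
    then have "\<rho> x \<le> level" using level_ge sigma_nonneg box by fastforce
    then show ?thesis using rho_Suc[OF Suc.prems] by simp
  next
    case False
    then have "\<rho> (Suc x) = \<rho> x" using rho_Suc[OF Suc.prems] by simp
    then show ?thesis using Suc by simp
  qed
qed

text \<open>Let \<open>y\<close> be the first column missing from the last row. The columns before
  it are full, so no corner lies between them and \<sigma> is at most 1 at \<open>y\<close>;
  separation against this cell bounds the level.\<close>

lemma level_le_rho: assumes "M \<noteq> {}" "(A - 1, B - 1) \<notin> M" shows "level \<le> \<rho> (A - 1)"
proof -
  have pos: "0 < A" "0 < B" using assms(1) box by fastforce+
  obtain y where y: "(A - 1, y) \<notin> M" "\<And>z. z < y \<Longrightarrow> (A - 1, z) \<in> M"
    using assms(2) exists_least_iff[of "\<lambda>y. (A - 1, y) \<notin> M"] by blast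
  have yB: "y < B" using y(2)[of "B - 1"] assms(2) pos by (cases "y \<le> B - 1") auto
  have z0: "z < y \<Longrightarrow> \<sigma> z = 0" for z
  proof (induction z)
    case (Suc z)
    have "(x, Suc z) \<in> M" if "(x, z) \<in> M" for x
    proof -
      have "x \<le> A - 1" using box[OF that] by auto
      then show ?thesis using down[OF y(2)[OF Suc.prems]] by simp
    qed
    then have "\<sigma> (Suc z) = \<sigma> z" using sigma_Suc[of z] Suc.prems yB by auto
    then show ?case using Suc by simp
  qed (rule sigma_0)
  have "\<sigma> y \<le> 1"
  proof (cases y)
    case (Suc z)
    then show ?thesis using z0[of z] sigma_Suc[of z] yB by auto
  qed (simp add: sigma_0)
  moreover obtain u v where "(u, v) \<in> M" "\<rho> u + \<sigma> v = level" using level_attained[OF assms(1)] .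
  ultimately show ?thesis using separation[of u v "A - 1" y] y(1) yB pos by simp
qed

text \<open>This alternative and its counterpart \<open>sigma_last\<close> are the criteria in types
  A and C.\<close>

lemma rho_last:
  assumes "M \<noteq> {}" "(A - 1, B - 1) \<notin> M" shows "\<rho> (A - 1) = level \<or> \<rho> (A - 1) = level + 1"
  using level_le_rho[OF assms] rho_le_level[OF assms(1), of "A - 1"] box assms(1) by fastforce

lemma sigma_last:
  assumes "M \<noteq> {}" "(A - 1, B - 1) \<notin> M" shows "\<sigma> (B - 1) = level \<or> \<sigma> (B - 1) = level + 1"
proof -
  have "staircase.level {(y, x). (x, y) \<in> M} \<sigma> \<rho> = level"
  proof -
    have "(\<lambda>(x, y). \<sigma> x + \<rho> y) ` {(y, x). (x, y) \<in> M} = (\<lambda>(x, y). \<rho> x + \<sigma> y) ` M"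
      by (auto simp: image_iff add.commute)
    then show ?thesis by (simp add: staircase.level_def[OF transpose] level_def)
  qed
  moreover have "{(y, x). (x, y) \<in> M} \<noteq> {}" using assms(1) by auto
  ultimately show ?thesis using staircase.rho_last[OF transpose] assms(2) by simp
qed

end

text \<open>Discrete intermediate values. It supplies all witness cells with a prescribed
  level.\<close>

lemma unit_steps_surjective:
  fixes \<sigma> :: "nat \<Rightarrow> int"
  assumes "\<sigma> 0 = 0" "\<And>y. Suc y < B \<Longrightarrow> \<sigma> (Suc y) = \<sigma> y \<or> \<sigma> (Suc y) = \<sigma> y + 1"
    and "0 < B" "0 \<le> v" "v \<le> \<sigma> (B - 1)"
  obtains y where "y < B" "\<sigma> y = v"
proof -
  have "z < B \<Longrightarrow> v \<le> \<sigma> z \<Longrightarrow> \<exists>y<B. \<sigma> y = v" for z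
  proof (induction z)
    case 0
    then show ?case using assms(1,4) by (intro exI[of _ 0]) simp
  next
    case (Suc z)
    show ?case
    proof (cases "v \<le> \<sigma> z")
      case False
      then have "\<sigma> (Suc z) = v" using assms(2)[OF Suc.prems(1)] Suc.prems(2) by auto
      then show ?thesis using Suc.prems(1) by blast
    qed (use Suc in simp)
  qed
  from this[of "B - 1"] show ?thesis using assms(3,5) that by auto
qed

text \<open>If \<rho> rises at \<open>x\<close>, a column with \<sigma> equal to
  \<open>a - \<rho> x\<close> lies in row \<open>x\<close> of the level set but not in the next
  row.\<close>

lemma level_set_drop:
  fixes \<rho> \<sigma> :: "nat \<Rightarrow> int"
  assumes "\<sigma> 0 = 0" "\<And>y. Suc y < B \<Longrightarrow> \<sigma> (Suc y) = \<sigma> y \<or> \<sigma> (Suc y) = \<sigma> y + 1" "0 < B"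
    and "a \<le> \<sigma> (B - 1)" "0 \<le> \<rho> x" "\<rho> (Suc x) \<le> a + 1" "\<rho> (Suc x) = \<rho> x \<or> \<rho> (Suc x) = \<rho> x + 1"
  shows "(\<exists>y<B. \<rho> x + \<sigma> y \<le> a \<and> \<not> \<rho> (Suc x) + \<sigma> y \<le> a) \<longleftrightarrow> \<rho> (Suc x) = \<rho> x + 1"
proof
  assume s: "\<rho> (Suc x) = \<rho> x + 1"
  obtain y where "y < B" "\<sigma> y = a - \<rho> x"
    using unit_steps_surjective[OF assms(1,2,3), of "a - \<rho> x"] assms(4-6) s by auto
  then show "\<exists>y<B. \<rho> x + \<sigma> y \<le> a \<and> \<not> \<rho> (Suc x) + \<sigma> y \<le> a" using s by (intro exI[of _ y]) simp
qed (use assms(7) in auto)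

section \<open>Grids of degree-one roots: types A and C\<close>

text \<open>The second alternative of \<open>labels\<close> is the folded case, in which a symmetric square array lists each
  vector twice.\<close>

locale labelled_grid =
  fixes r :: "nat \<Rightarrow> nat \<Rightarrow> nat \<Rightarrow> int" and A B :: nat and la lb :: "nat \<Rightarrow> nat" and I :: "nat set"
  assumes pos: "0 < A" "0 < B"
    and step_a: "Suc x < A \<Longrightarrow> y < B \<Longrightarrow> r (Suc x) y = r x y + unit (la x)"
    and step_b: "x < A \<Longrightarrow> Suc y < B \<Longrightarrow> r x (Suc y) = r x y + unit (lb y)"
    and step_cases: "x < A \<Longrightarrow> y < B \<Longrightarrow> x' < A \<Longrightarrow> y' < B \<Longrightarrow> j \<in> I \<Longrightarrow> r x' y' = r x y + unit j \<Longrightarrow>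
      (j = la x \<and> Suc x < A \<and> r x' y' = r (Suc x) y) \<or> (j = lb y \<and> Suc y < B \<and> r x' y' = r x (Suc y))"
    and inj: "inj_on la {..<A - 1}" "inj_on lb {..<B - 1}"
    and I: "I = la ` {..<A - 1} \<union> lb ` {..<B - 1}"
    and labels: "la ` {..<A - 1} \<inter> lb ` {..<B - 1} = {} \<or> (A = B \<and> la = lb \<and> (\<forall>x y. r x y = r y x))"
    and origin: "j \<in> I \<Longrightarrow> r 0 0 j = 0"
begin

definition vectors :: "(nat \<Rightarrow> int) set" where "vectors = (\<lambda>(x, y). r x y) ` ({..<A} \<times> {..<B})"

lemma vectorsI: "x < A \<Longrightarrow> y < B \<Longrightarrow> r x y \<in> vectors" by (auto simp: vectors_def)

definition \<rho> :: "nat set \<Rightarrow> nat \<Rightarrow> int" where "\<rho> J x = int (card {u. u < x \<and> la u \<in> J})"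
definition \<sigma> :: "nat set \<Rightarrow> nat \<Rightarrow> int" where "\<sigma> J y = int (card {u. u < y \<and> lb u \<in> J})"

lemma card_Suc: "int (card {u. u < Suc x \<and> P u}) = int (card {u. u < x \<and> P u}) + of_bool (P x)"
proof -
  have "{u. u < Suc x \<and> P u} = (if P x then insert x {u. u < x \<and> P u} else {u. u < x \<and> P u})"
    by (auto simp: less_Suc_eq)
  then show ?thesis by simp
qed

lemma rho_simps: "\<rho> J 0 = 0" "\<rho> J (Suc x) = \<rho> J x + of_bool (la x \<in> J)"
  and sigma_simps: "\<sigma> J 0 = 0" "\<sigma> J (Suc y) = \<sigma> J y + of_bool (lb y \<in> J)"
  using card_Suc[of _ "\<lambda>u. la u \<in> J"] card_Suc[of _ "\<lambda>u. lb u \<in> J"] by (simp_all add: \<rho>_def \<sigma>_def)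

lemma finite_I: "finite I" using I by simp

lemma sum_unit: "finite J \<Longrightarrow> (\<Sum>j\<in>J. (c + unit k) j) = (\<Sum>j\<in>J. c j) + of_bool (k \<in> J)"
  by (simp add: sum.distrib unit_def)

lemma level_sum: assumes "J \<subseteq> I" shows "x < A \<Longrightarrow> y < B \<Longrightarrow> (\<Sum>j\<in>J. r x y j) = \<rho> J x + \<sigma> J y"
proof (induction x)
  case 0
  have "y < B \<Longrightarrow> (\<Sum>j\<in>J. r 0 y j) = \<sigma> J y" for y
  proof (induction y)
    case 0
    then show ?case using origin assms by (simp add: sigma_simps subset_iff)
  next
    case (Suc y)
    then show ?case
      using sum_unit[OF finite_subset[OF assms finite_I], of "r 0 y" "lb y"] step_b[OF pos(1) Suc.prems]
      by (simp add: sigma_simps)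
  qed
  then show ?case using 0 by (simp add: rho_simps)
next
  case (Suc x)
  then show ?case
    using sum_unit[OF finite_subset[OF assms finite_I], of "r x y" "la x"] step_a[OF Suc.prems]
    by (simp add: rho_simps)
qed

definition cells :: "(nat \<Rightarrow> int) set \<Rightarrow> (nat \<times> nat) set" where
  "cells \<Phi> = {(x, y). x < A \<and> y < B \<and> r x y \<in> \<Phi>}"

lemma cells_iff: "(x, y) \<in> cells \<Phi> \<longleftrightarrow> x < A \<and> y < B \<and> r x y \<in> \<Phi>" by (simp add: cells_def)

text \<open>A label belongs to \<open>J\<close> iff the ideal has a corner at the grid transition
  carrying it; injectivity of the labelling recovers the transition.\<close>

lemma raising_iff:
  assumes \<Phi>: "\<Phi> \<subseteq> vectors"
  shows "Suc x < A \<Longrightarrow> la x \<in> raising_labels vectors I \<Phi> \<longleftrightarrow> (\<exists>y. (x, y) \<in> cells \<Phi> \<and> (Suc x, y) \<notin> cells \<Phi>)"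
    and "Suc y < B \<Longrightarrow> lb y \<in> raising_labels vectors I \<Phi> \<longleftrightarrow> (\<exists>x. (x, y) \<in> cells \<Phi> \<and> (x, Suc y) \<notin> cells \<Phi>)"
proof -
  have raise: "j \<in> raising_labels vectors I \<Phi> \<longleftrightarrow>
      (\<exists>x y. j = la x \<and> Suc x < A \<and> (x, y) \<in> cells \<Phi> \<and> (Suc x, y) \<notin> cells \<Phi>) \<or>
      (\<exists>x y. j = lb y \<and> Suc y < B \<and> (x, y) \<in> cells \<Phi> \<and> (x, Suc y) \<notin> cells \<Phi>)" (is "_ \<longleftrightarrow> ?a \<or> ?b") for j
  proof
    assume "j \<in> raising_labels vectors I \<Phi>"
    then obtain c where c: "j \<in> I" "c \<in> \<Phi>" "c + unit j \<in> vectors" "c + unit j \<notin> \<Phi>"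
      by (auto simp: raising_labels_def)
    then obtain x y x' y' where xy: "x < A" "y < B" "c = r x y" "x' < A" "y' < B" "r x' y' = r x y + unit j"
      using \<Phi> unfolding vectors_def by force
    show "?a \<or> ?b"
      using step_cases[OF xy(1,2,4,5) c(1) xy(6)] c xy by (auto simp: cells_iff)
  next
    assume "?a \<or> ?b"
    then show "j \<in> raising_labels vectors I \<Phi>"
    proof
      assume ?a
      then obtain x y where xy: "j = la x" "Suc x < A" "(x, y) \<in> cells \<Phi>" "(Suc x, y) \<notin> cells \<Phi>" by blast
      then have "r x y + unit j \<in> vectors - \<Phi>" "j \<in> I"
        using step_a[of x y] vectorsI[of "Suc x" y] by (auto simp: cells_iff I)
      then show ?thesis using xy by (auto simp: raising_labels_def cells_iff)
    next
      assume ?b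
      then obtain x y where xy: "j = lb y" "Suc y < B" "(x, y) \<in> cells \<Phi>" "(x, Suc y) \<notin> cells \<Phi>" by blast
      then have "r x y + unit j \<in> vectors - \<Phi>" "j \<in> I"
        using step_b[of x y] vectorsI[of x "Suc y"] by (auto simp: cells_iff I)
      then show ?thesis using xy by (auto simp: raising_labels_def cells_iff)
    qed
  qed
  have la_eq: "x = x'" if "la x = la x'" "Suc x < A" "Suc x' < A" for x x'
    using that inj(1) by (auto simp: inj_on_def)
  have lb_eq: "x = x'" if "lb x = lb x'" "Suc x < B" "Suc x' < B" for x x'
    using that inj(2) by (auto simp: inj_on_def)
  \<comment> \<open>A label shared by a row and a column occurs only in the folded case, where the
    cells are symmetric and a column corner is the mirror image of a row corner.\<close>
  have sym: "(x, y) \<in> cells \<Phi> \<longleftrightarrow> (y, x) \<in> cells \<Phi>" "A = B" "la = lb" if "la u = lb v" "Suc u < A" "Suc v < B" for x y u v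
  proof -
    have "u \<in> {..<A - 1}" "v \<in> {..<B - 1}" using that by auto
    then have "la u \<in> la ` {..<A - 1}" "lb v \<in> lb ` {..<B - 1}" by blast+
    then have "A = B \<and> la = lb \<and> (\<forall>x y. r x y = r y x)" using labels that(1) by auto
    then show "(x, y) \<in> cells \<Phi> \<longleftrightarrow> (y, x) \<in> cells \<Phi>" "A = B" "la = lb"
      unfolding cells_iff by metis+
  qed
  show "la x \<in> raising_labels vectors I \<Phi> \<longleftrightarrow> (\<exists>y. (x, y) \<in> cells \<Phi> \<and> (Suc x, y) \<notin> cells \<Phi>)" if "Suc x < A"
    unfolding raise using that la_eq sym by metis
  show "lb y \<in> raising_labels vectors I \<Phi> \<longleftrightarrow> (\<exists>x. (x, y) \<in> cells \<Phi> \<and> (x, Suc y) \<notin> cells \<Phi>)" if "Suc y < B"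
    unfolding raise using that lb_eq sym by metis
qed

lemma cells_image: "\<Phi> \<subseteq> vectors \<Longrightarrow> (\<lambda>(x, y). r x y) ` cells \<Phi> = \<Phi>"
  unfolding vectors_def cells_def by force

lemma staircase_cells:
  assumes "lowering_closed vectors I \<Phi>"
  shows "staircase (cells \<Phi>) A B (\<rho> (raising_labels vectors I \<Phi>)) (\<sigma> (raising_labels vectors I \<Phi>))"
proof
  have \<Phi>: "\<Phi> \<subseteq> vectors" using assms by (simp add: lowering_closed_def)
  have low: "c - unit j \<in> \<Phi>" if "c \<in> \<Phi>" "j \<in> I" "c - unit j \<in> vectors" for c j
    using assms that by (simp add: lowering_closed_def)
  fix x y x' y'
  show "(x, y) \<in> cells \<Phi> \<Longrightarrow> x < A \<and> y < B" by (simp add: cells_iff)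
  have down_a: "(x, y) \<in> cells \<Phi>" if "(Suc x, y) \<in> cells \<Phi>" for x y
    using low[of "r (Suc x) y" "la x"] step_a[of x y] vectorsI[of x y] that by (auto simp: cells_iff I)
  have down_b: "(x, y) \<in> cells \<Phi>" if "(x, Suc y) \<in> cells \<Phi>" for x y
    using low[of "r x (Suc y)" "lb y"] step_b[of x y] vectorsI[of x y] that by (auto simp: cells_iff I)
  show "(x, y) \<in> cells \<Phi> \<Longrightarrow> x' \<le> x \<Longrightarrow> y' \<le> y \<Longrightarrow> (x', y') \<in> cells \<Phi>"
  proof -
    assume xy: "(x, y) \<in> cells \<Phi>" and "x' \<le> x" and "y' \<le> y"
    have "(x', y) \<in> cells \<Phi>" using \<open>x' \<le> x\<close> xy by (induction rule: inc_induct) (auto intro: down_a)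
    with \<open>y' \<le> y\<close> show ?thesis by (induction rule: inc_induct) (auto intro: down_b)
  qed
qed (use assms raising_iff in \<open>auto simp: rho_simps sigma_simps lowering_closed_def\<close>)

lemma level_of_ideal:
  assumes low: "lowering_closed vectors I \<Phi>" and J: "J = raising_labels vectors I \<Phi>"
    and ne: "\<Phi> \<noteq> {}" "\<Phi> \<noteq> vectors"
  shows "\<Phi> = {c \<in> vectors. (\<Sum>j\<in>J. c j) \<le> max_level J \<Phi>}" "0 \<le> max_level J \<Phi>" "J \<noteq> {}"
    "\<rho> J (A - 1) = max_level J \<Phi> \<or> \<rho> J (A - 1) = max_level J \<Phi> + 1"
    "\<sigma> J (B - 1) = max_level J \<Phi> \<or> \<sigma> J (B - 1) = max_level J \<Phi> + 1"
proof -
  have \<Phi>: "\<Phi> \<subseteq> vectors" using low by (simp add: lowering_closed_def)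
  have JI: "J \<subseteq> I" unfolding J by (auto simp: raising_labels_def)
  interpret staircase "cells \<Phi>" A B "\<rho> J" "\<sigma> J" unfolding J by (rule staircase_cells[OF low])
  have cne: "cells \<Phi> \<noteq> {}" using cells_image[OF \<Phi>] ne(1) by auto
  have lev: "level = max_level J \<Phi>"
  proof -
    have "(\<lambda>(x, y). \<rho> J x + \<sigma> J y) ` cells \<Phi> = (\<lambda>c. \<Sum>j\<in>J. c j) ` (\<lambda>(x, y). r x y) ` cells \<Phi>"
      unfolding image_image by (rule image_cong) (auto simp: cells_iff level_sum[OF JI])
    then show ?thesis unfolding level_def max_level_def cells_image[OF \<Phi>] by simp
  qed
  have top: "(A - 1, B - 1) \<notin> cells \<Phi>"
  proof
    assume "(A - 1, B - 1) \<in> cells \<Phi>"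
    then have "(x, y) \<in> cells \<Phi>" if "x < A" "y < B" for x y using down that by fastforce
    then have "vectors \<subseteq> \<Phi>" by (auto simp: vectors_def cells_iff)
    then show False using \<Phi> ne(2) by blast
  qed
  show "\<Phi> = {c \<in> vectors. (\<Sum>j\<in>J. c j) \<le> max_level J \<Phi>}"
  proof -
    have "r x y \<in> \<Phi> \<longleftrightarrow> (\<Sum>j\<in>J. r x y j) \<le> max_level J \<Phi>" if "x < A" "y < B" for x y
      using M_eq_level[OF cne, of x y] that by (simp add: cells_iff level_sum[OF JI] lev)
    then show ?thesis using \<Phi> unfolding vectors_def by fastforce
  qed
  show "0 \<le> max_level J \<Phi>" using level_nonneg[OF cne] lev by simp
  show "\<rho> J (A - 1) = max_level J \<Phi> \<or> \<rho> J (A - 1) = max_level J \<Phi> + 1" using rho_last[OF cne top] lev by simp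
  show "\<sigma> J (B - 1) = max_level J \<Phi> \<or> \<sigma> J (B - 1) = max_level J \<Phi> + 1" using sigma_last[OF cne top] lev by simp
  show "J \<noteq> {}"
  proof
    assume "J = {}"
    then have "\<rho> J x = 0" "\<sigma> J x = 0" for x by (simp_all add: \<rho>_def \<sigma>_def)
    then have "(A - 1, B - 1) \<in> cells \<Phi>" using M_eq_level[OF cne] level_nonneg[OF cne] pos by simp
    then show False using top by blast
  qed
qed

lemma mono: "x \<le> x' \<Longrightarrow> \<rho> J x \<le> \<rho> J x'" "x \<le> x' \<Longrightarrow> \<sigma> J x \<le> \<sigma> J x'"
  unfolding \<rho>_def \<sigma>_def by (auto intro!: card_mono)

lemma ideal_of_level:
  assumes JI: "J \<subseteq> I" and a: "0 \<le> a"
    and \<rho>: "\<rho> J (A - 1) = a \<or> \<rho> J (A - 1) = a + 1" and \<sigma>: "\<sigma> J (B - 1) = a \<or> \<sigma> J (B - 1) = a + 1"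
  defines "\<Phi> \<equiv> {c \<in> vectors. (\<Sum>j\<in>J. c j) \<le> a}"
  shows "max_level J \<Phi> = a" "raising_labels vectors I \<Phi> = J"
proof -
  have \<rho>\<sigma>: "\<rho> J (Suc x) = \<rho> J x \<or> \<rho> J (Suc x) = \<rho> J x + 1" "\<sigma> J (Suc x) = \<sigma> J x \<or> \<sigma> J (Suc x) = \<sigma> J x + 1"
    "0 \<le> \<rho> J x" "0 \<le> \<sigma> J x" for x
    by (auto simp: rho_simps sigma_simps) (simp_all add: \<rho>_def \<sigma>_def)
  have \<Phi>: "\<Phi> \<subseteq> vectors" by (auto simp: \<Phi>_def)
  have cells: "(x, y) \<in> cells \<Phi> \<longleftrightarrow> x < A \<and> y < B \<and> \<rho> J x + \<sigma> J y \<le> a" for x y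
    using level_sum[OF JI, of x y] by (auto simp: cells_iff \<Phi>_def vectors_def)
  show "max_level J \<Phi> = a"
    unfolding max_level_def
  proof (rule Max_eqI)
    show "finite ((\<lambda>c. \<Sum>j\<in>J. c j) ` \<Phi>)" using \<Phi> by (intro finite_imageI finite_subset[OF \<Phi>]) (simp add: vectors_def)
    show "\<And>m. m \<in> (\<lambda>c. \<Sum>j\<in>J. c j) ` \<Phi> \<Longrightarrow> m \<le> a" by (auto simp: \<Phi>_def)
    \<comment> \<open>Since \<rho> vanishes in row 0, the level \<open>a\<close> is attained in that
      row, at any column where \<sigma> equals \<open>a\<close>.\<close>
    obtain y where y: "y < B" "\<sigma> J y = a"
      by (rule unit_steps_surjective[of "\<sigma> J" B a]) (use \<rho>\<sigma> sigma_simps(1) pos a \<sigma> in auto)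
    have "(0, y) \<in> cells \<Phi>" using y pos by (simp add: cells rho_simps)
    moreover have "(\<Sum>j\<in>J. r 0 y j) = a" using level_sum[OF JI pos(1) y(1)] y(2) by (simp add: rho_simps)
    ultimately show "a \<in> (\<lambda>c. \<Sum>j\<in>J. c j) ` \<Phi>" by (auto simp: cells_iff image_iff)
  qed
  have la: "la x \<in> raising_labels vectors I \<Phi> \<longleftrightarrow> la x \<in> J" if x: "Suc x < A" for x
  proof -
    have "la x \<in> raising_labels vectors I \<Phi> \<longleftrightarrow>
        (\<exists>y<B. \<rho> J x + \<sigma> J y \<le> a \<and> \<not> \<rho> J (Suc x) + \<sigma> J y \<le> a)"
      unfolding raising_iff(1)[OF \<Phi> x] cells using x by auto
    also have "\<dots> \<longleftrightarrow> \<rho> J (Suc x) = \<rho> J x + 1"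
    proof (rule level_set_drop)
      show "\<rho> J (Suc x) \<le> a + 1" using mono(1)[of "Suc x" "A - 1" J] x \<rho> by force
    qed (use \<rho>\<sigma> sigma_simps(1) pos \<sigma> in auto)
    finally show ?thesis by (simp add: rho_simps)
  qed
  have lb: "lb y \<in> raising_labels vectors I \<Phi> \<longleftrightarrow> lb y \<in> J" if y: "Suc y < B" for y
  proof -
    have "lb y \<in> raising_labels vectors I \<Phi> \<longleftrightarrow>
        (\<exists>x<A. \<sigma> J y + \<rho> J x \<le> a \<and> \<not> \<sigma> J (Suc y) + \<rho> J x \<le> a)"
      unfolding raising_iff(2)[OF \<Phi> y] cells using y by (auto simp: add.commute)
    also have "\<dots> \<longleftrightarrow> \<sigma> J (Suc y) = \<sigma> J y + 1"
    proof (rule level_set_drop)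
      show "\<sigma> J (Suc y) \<le> a + 1" using mono(2)[of "Suc y" "B - 1" J] y \<sigma> by force
    qed (use \<rho>\<sigma> rho_simps(1) pos \<rho> in auto)
    finally show ?thesis by (simp add: sigma_simps)
  qed
  have sub: "raising_labels vectors I \<Phi> \<subseteq> I" by (auto simp: raising_labels_def)
  have "j \<in> raising_labels vectors I \<Phi> \<longleftrightarrow> j \<in> J" if "j \<in> I" for j
    using that la lb unfolding I by auto
  then show "raising_labels vectors I \<Phi> = J" using sub JI by blast
qed

theorem grid_classified:
  assumes "\<And>a J. 0 \<le> a \<Longrightarrow> J \<noteq> {} \<Longrightarrow> J \<subseteq> I \<Longrightarrow>
    P a J \<longleftrightarrow> (\<rho> J (A - 1) = a \<or> \<rho> J (A - 1) = a + 1) \<and> (\<sigma> J (B - 1) = a \<or> \<sigma> J (B - 1) = a + 1)"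
  shows "classified vectors I P"
proof (rule classifiedI)
  fix \<Phi> J assume *: "lowering_closed vectors I \<Phi>" "J = raising_labels vectors I \<Phi>" "\<Phi> \<noteq> {}" "\<Phi> \<noteq> vectors"
  have "J \<subseteq> I" using *(2) by (auto simp: raising_labels_def)
  then show "\<Phi> = {c \<in> vectors. (\<Sum>j\<in>J. c j) \<le> max_level J \<Phi>} \<and> 0 \<le> max_level J \<Phi> \<and> J \<noteq> {} \<and> P (max_level J \<Phi>) J"
    using level_of_ideal[OF *] assms by blast
next
  fix a J assume *: "0 \<le> a" "J \<noteq> {}" "J \<subseteq> I" "P a J"
  then show "max_level J {c \<in> vectors. (\<Sum>j\<in>J. c j) \<le> a} = a \<and>
      raising_labels vectors I {c \<in> vectors. (\<Sum>j\<in>J. c j) \<le> a} = J"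
    using ideal_of_level[OF *(3,1)] assms[OF *(1-3)] *(4) by blast
qed

end

text \<open>In Bourbaki's coordinates this is \<epsilon>_(i-x) - \<epsilon>_(i+y+1).\<close>

definition rootA :: "nat \<Rightarrow> nat \<Rightarrow> nat \<Rightarrow> nat \<Rightarrow> int" where
  "rootA i x y = (\<lambda>m. of_bool (i - x \<le> m \<and> m \<le> i + y))"

lemma rootA_step_cases:
  assumes x: "x < i" and x': "x' < i" and j: "j \<noteq> i" and eq: "rootA i x' y' = rootA i x y + unit j"
  shows "(j = i - Suc x \<and> x' = Suc x \<and> y' = y) \<or> (j = i + Suc y \<and> x' = x \<and> y' = Suc y)"
proof -
  have pt: "(i - x' \<le> m \<and> m \<le> i + y') \<longleftrightarrow> (i - x \<le> m \<and> m \<le> i + y) \<or> m = j" for m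
    using fun_cong[OF eq, of m] by (auto simp: rootA_def unit_def of_bool_def split: if_splits)
  have ptj: "\<not> (i - x \<le> j \<and> j \<le> i + y)"
    using fun_cong[OF eq, of j] by (auto simp: rootA_def unit_def of_bool_def split: if_splits)
  show ?thesis
  proof (cases "j < i")
    case True
    have "y' = y" using pt[of "i + y'"] pt[of "i + y"] True by auto
    moreover have "i - x' = j"
      using pt[of j] pt[of "i - x'"] True ptj x x' by linarith
    moreover have "Suc j = i - x" using pt[of "Suc j"] pt[of j] True ptj by linarith
    ultimately show ?thesis using x x' by auto
  next
    case False
    have "x' = x" using pt[of "i - x'"] pt[of "i - x"] False j x x' by linarith
    moreover have "i + y' = j" using pt[of j] pt[of "i + y'"] False j ptj by linarith
    moreover have "j = Suc (i + y)" using pt[of "j - 1"] pt[of j] False j ptj by linarith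
    ultimately show ?thesis by auto
  qed
qed

lemma classified_A:
  assumes i: "1 \<le> i" "i \<le> n"
  shows "classified ((\<lambda>(x, y). rootA i x y) ` ({..<i} \<times> {..<n + 1 - i})) (I_par n i) (criteria_A n i)"
proof -
  interpret labelled_grid "rootA i" i "n + 1 - i" "\<lambda>x. i - Suc x" "\<lambda>y. i + Suc y" "I_par n i"
  proof
    have "(\<lambda>x. i - Suc x) ` {..<i - 1} = {1..<i}"
    proof
      show "{1..<i} \<subseteq> (\<lambda>x. i - Suc x) ` {..<i - 1}"
      proof
        fix j assume "j \<in> {1..<i}"
        then show "j \<in> (\<lambda>x. i - Suc x) ` {..<i - 1}" by (intro image_eqI[of _ _ "i - Suc j"]) auto
      qed
    qed auto
    moreover have "(\<lambda>y. i + Suc y) ` {..<n + 1 - i - 1} = {i<..n}"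
    proof
      show "{i<..n} \<subseteq> (\<lambda>y. i + Suc y) ` {..<n + 1 - i - 1}"
      proof
        fix j assume "j \<in> {i<..n}"
        then show "j \<in> (\<lambda>y. i + Suc y) ` {..<n + 1 - i - 1}" by (intro image_eqI[of _ _ "j - Suc i"]) auto
      qed
    qed auto
    ultimately show "I_par n i = (\<lambda>x. i - Suc x) ` {..<i - 1} \<union> (\<lambda>y. i + Suc y) ` {..<n + 1 - i - 1}"
      using i by (auto simp: I_par_def)
    show "inj_on (\<lambda>x. i - Suc x) {..<i - 1}" "inj_on (\<lambda>y. i + Suc y) {..<n + 1 - i - 1}"
      by (auto simp: inj_on_def)
    show "(\<lambda>x. i - Suc x) ` {..<i - 1} \<inter> (\<lambda>y. i + Suc y) ` {..<n + 1 - i - 1} = {} \<or>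
      (i = n + 1 - i \<and> (\<lambda>x. i - Suc x) = (\<lambda>y. i + Suc y) \<and> (\<forall>x y. rootA i x y = rootA i y x))" by auto
    show "rootA i 0 0 j = 0" if "j \<in> I_par n i" for j using that by (auto simp: rootA_def I_par_def)
    fix x y x' y' j
    show "Suc x < i \<Longrightarrow> rootA i (Suc x) y = rootA i x y + unit (i - Suc x)"
      by (auto simp: rootA_def unit_def fun_eq_iff)
    show "rootA i x (Suc y) = rootA i x y + unit (i + Suc y)"
      by (auto simp: rootA_def unit_def fun_eq_iff)
    show "x < i \<Longrightarrow> y < n + 1 - i \<Longrightarrow> x' < i \<Longrightarrow> y' < n + 1 - i \<Longrightarrow> j \<in> I_par n i \<Longrightarrow>
      rootA i x' y' = rootA i x y + unit j \<Longrightarrow>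
      (j = i - Suc x \<and> Suc x < i \<and> rootA i x' y' = rootA i (Suc x) y) \<or>
      (j = i + Suc y \<and> Suc y < n + 1 - i \<and> rootA i x' y' = rootA i x (Suc y))"
      using rootA_step_cases[of x i x' j y' y] by (auto simp: I_par_def)
  qed (use i in auto)
  have crit: "criteria_A n i a J \<longleftrightarrow> (\<rho> J (i - 1) = a \<or> \<rho> J (i - 1) = a + 1) \<and>
      (\<sigma> J (n + 1 - i - 1) = a \<or> \<sigma> J (n + 1 - i - 1) = a + 1)"
    if a: "0 \<le> a" and J: "J \<subseteq> I_par n i" for a J
  proof -
    have fin: "finite J" using J finite_I finite_subset by blast
    have "bij_betw (\<lambda>x. i - Suc x) {u. u < i - 1 \<and> i - Suc u \<in> J} {j \<in> J. j < i}"
      by (rule bij_betw_byWitness[of _ "\<lambda>j. i - Suc j"]) (use J in \<open>auto simp: I_par_def subset_iff\<close>)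
    then have q: "\<rho> J (i - 1) = int (card {j \<in> J. j < i})" unfolding \<rho>_def by (simp add: bij_betw_same_card)
    have "bij_betw (\<lambda>y. i + Suc y) {u. u < n + 1 - i - 1 \<and> i + Suc u \<in> J} {j \<in> J. i < j}"
      by (rule bij_betw_byWitness[of _ "\<lambda>j. j - Suc i"]) (use J in \<open>auto simp: I_par_def subset_iff\<close>)
    then have s: "\<sigma> J (n + 1 - i - 1) = int (card {j \<in> J. i < j})" unfolding \<sigma>_def by (simp add: bij_betw_same_card)
    have "J = {j \<in> J. j < i} \<union> {j \<in> J. i < j}" using J by (auto simp: I_par_def)
    then have "card J = card ({j \<in> J. j < i} \<union> {j \<in> J. i < j})" by simp
    also have "\<dots> = card {j \<in> J. j < i} + card {j \<in> J. i < j}" using fin by (intro card_Un_disjoint) auto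
    finally have p: "int (card J) = \<rho> J (i - 1) + \<sigma> J (n + 1 - i - 1)" using q s by simp
    have "{j \<in> J. j < i} \<subseteq> {1..<i}" "{j \<in> J. i < j} \<subseteq> {i<..n}" using J by (auto simp: I_par_def)
    then have "card {j \<in> J. j < i} \<le> i - 1" "card {j \<in> J. i < j} \<le> n - i"
      using card_mono[of "{1..<i}" "{j \<in> J. j < i}"] card_mono[of "{i<..n}" "{j \<in> J. i < j}"] by auto
    \<comment> \<open>The bound on \<open>a\<close> in the criteria is implied by the two
      alternatives, because each total is at least \<open>a\<close> and at most the number of nodes
      on its side of \<open>i\<close>.\<close>
    then have bound: "\<rho> J (i - 1) \<le> int i - 1" "\<sigma> J (n + 1 - i - 1) \<le> int n - int i"
      using q s i by linarith+
    show ?thesis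
      unfolding criteria_A_def Let_def q[symmetric] p using bound by auto
  qed
  show ?thesis
    using grid_classified[of "criteria_A n i"] crit unfolding vectors_def by blast
qed

text \<open>In Bourbaki's coordinates this is \<epsilon>_(n-x) + \<epsilon>_(n-y), a long root if x
  = y.\<close>

definition rootC :: "nat \<Rightarrow> nat \<Rightarrow> nat \<Rightarrow> nat \<Rightarrow> int" where
  "rootC n x y = (\<lambda>m. if m < n then of_bool (n - x \<le> m) + of_bool (n - y \<le> m) else of_bool (m = n))"

text \<open>With the thresholds in order, the sum is positive up to the larger one and equals 2 up
  to the smaller one. Adding a single unit therefore moves exactly one threshold by one
  place.\<close>

lemma two_threshold_step:
  assumes xy: "x \<le> y" "y < n" and xy': "x' \<le> y'" "y' < n" and t: "1 \<le> t" "t < n"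
    and eq: "\<And>k. 1 \<le> k \<Longrightarrow> k < n \<Longrightarrow>
      of_bool (k \<le> x') + of_bool (k \<le> y') = of_bool (k \<le> x) + of_bool (k \<le> y) + (of_bool (k = t) :: int)"
  shows "(t = Suc y \<and> y' = Suc y \<and> x' = x) \<or> (t = Suc x \<and> x' = Suc x \<and> y' = y)"
proof -
  have big: "(k \<le> y') \<longleftrightarrow> (k \<le> y) \<or> (k = t \<and> \<not> k \<le> y)" "(k \<le> x') \<longleftrightarrow> (k \<le> x) \<or> (k = t \<and> k \<le> y)"
    if "1 \<le> k" "k < n" for k
    using eq[OF that] xy xy' by (auto simp: of_bool_def split: if_splits)
  show ?thesis
  proof (cases "t \<le> y")
    case True
    have "y' = y" using big(1)[of y'] big(1)[of y] True xy xy' t by fastforce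
    moreover have tx: "\<not> t \<le> x" using eq[OF t] True xy xy' by (auto simp: of_bool_def split: if_splits)
    moreover have x't: "t \<le> x'" using big(2)[OF t] True by blast
    moreover have "x' = t" using big(2)[of x'] x't tx t xy' by linarith
    moreover have "t = Suc x"
    proof -
      have "t - 1 = 0 \<or> t - 1 \<le> x" 
      proof (cases "t - 1 = 0")
        case False
        then have "1 \<le> t - 1" "t - 1 < n" "t - 1 \<le> x'" using x't t by linarith+
        then show ?thesis using big(2)[of "t - 1"] t by auto
      qed simp
      then show ?thesis using tx t by auto
    qed
    ultimately show ?thesis by auto
  next
    case False
    have y't: "t \<le> y'" using big(1)[OF t] False by blast
    have "y' = t" using big(1)[of y'] y't False t xy' by linarith
    moreover have "t = Suc y"
    proof -
      have "t - 1 = 0 \<or> t - 1 \<le> y" 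
      proof (cases "t - 1 = 0")
        case False
        then have "1 \<le> t - 1" "t - 1 < n" "t - 1 \<le> y'" using y't t by linarith+
        then show ?thesis using big(1)[of "t - 1"] t by auto
      qed simp
      then show ?thesis using False t by auto
    qed
    moreover have "x' = x"
    proof -
      have "x' \<le> x" using big(2)[of x'] False xy' xy by (cases "x' = 0") auto
      moreover have "x \<le> x'" using big(2)[of x] xy by (cases "x = 0") auto
      ultimately show ?thesis by simp
    qed
    ultimately show ?thesis by auto
  qed
qed

lemma rootC_sym: "rootC n x y = rootC n y x" by (simp add: rootC_def fun_eq_iff)

lemma rootC_step_cases:
  assumes xy: "x < n" "y < n" and xy': "x' < n" "y' < n" and j: "1 \<le> j" "j < n"
    and eq: "rootC n x' y' = rootC n x y + unit j"
  shows "(j = n - Suc x \<and> Suc x < n \<and> rootC n x' y' = rootC n (Suc x) y) \<or>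
    (j = n - Suc y \<and> Suc y < n \<and> rootC n x' y' = rootC n x (Suc y))"
proof -
  \<comment> \<open>The indices are reflected by k = n - m and the pairs are sorted, which brings
    the vectors into the form of two ordered thresholds.\<close>
  have main: "(n - j = Suc (max x y) \<and> max x' y' = Suc (max x y) \<and> min x' y' = min x y) \<or>
      (n - j = Suc (min x y) \<and> min x' y' = Suc (min x y) \<and> max x' y' = max x y)"
  proof (rule two_threshold_step)
    fix k :: nat assume k: "1 \<le> k" "k < n"
    have th: "n - z \<le> n - k \<longleftrightarrow> k \<le> z" if "z < n" for z using that k by auto
    have "n - k = j \<longleftrightarrow> k = n - j" using k j by auto
    then have "of_bool (k \<le> x') + of_bool (k \<le> y') = of_bool (k \<le> x) + of_bool (k \<le> y) + (of_bool (k = n - j) :: int)"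
      using fun_cong[OF eq, of "n - k"] k xy xy' by (simp add: rootC_def unit_def th)
    then show "of_bool (k \<le> min x' y') + of_bool (k \<le> max x' y') =
        of_bool (k \<le> min x y) + of_bool (k \<le> max x y) + (of_bool (k = n - j) :: int)"
      by (auto simp: min_def max_def split: if_splits)
  qed (use xy xy' j in auto)
  have minmax: "rootC n u v = rootC n (min u v) (max u v)" for u v
    using rootC_sym by (auto simp: min_def max_def)
  from main show ?thesis
  proof (elim disjE conjE)
    assume *: "n - j = Suc (max x y)" "max x' y' = Suc (max x y)" "min x' y' = min x y"
    have "rootC n x' y' = rootC n (min x y) (Suc (max x y))" using minmax[of x' y'] * by simp
    moreover have "Suc (max x y) < n" using * xy' by (simp add: max_def split: if_splits)
    ultimately show ?thesis
      using *(1) j rootC_sym[of n y "Suc x"] by (cases "x \<le> y") (auto simp: min_def max_def)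
  next
    assume *: "n - j = Suc (min x y)" "min x' y' = Suc (min x y)" "max x' y' = max x y"
    have "rootC n x' y' = rootC n (Suc (min x y)) (max x y)" using minmax[of x' y'] * by simp
    moreover have "Suc (min x y) < n" using * xy' by (simp add: min_def split: if_splits)
    ultimately show ?thesis
      using *(1) j rootC_sym[of n "Suc y" x] by (cases "x \<le> y") (auto simp: min_def max_def)
  qed
qed

lemma card_reflect:
  assumes "J \<subseteq> {1..<n}" shows "card {u. u < n - 1 \<and> n - Suc u \<in> J} = card J"
proof -
  have "bij_betw (\<lambda>x. n - Suc x) {u. u < n - 1 \<and> n - Suc u \<in> J} J"
    by (rule bij_betw_byWitness[of _ "\<lambda>j. n - Suc j"]) (use assms in \<open>auto simp: subset_iff\<close>)
  then show ?thesis by (rule bij_betw_same_card)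
qed

lemma reflect_image: "(\<lambda>x. n - Suc x) ` {..<n - 1} = {1..<n}"
proof
  show "{1..<n} \<subseteq> (\<lambda>x. n - Suc x) ` {..<n - 1}"
  proof
    fix j assume "j \<in> {1..<n}"
    then show "j \<in> (\<lambda>x. n - Suc x) ` {..<n - 1}" by (intro image_eqI[of _ _ "n - Suc j"]) auto
  qed
qed auto

lemma I_par_last: "I_par n n = {1..<n}" by (auto simp: I_par_def)

lemma labelled_grid_C:
  assumes n: "1 \<le> n"
  shows "labelled_grid (rootC n) n n (\<lambda>x. n - Suc x) (\<lambda>x. n - Suc x) (I_par n n)"
proof
    show "inj_on (\<lambda>x. n - Suc x) {..<n - 1}" by (auto simp: inj_on_def)
    show "rootC n 0 0 j = 0" if "j \<in> I_par n n" for j using that by (auto simp: rootC_def I_par_def)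
    fix x y x' y' j
    show "Suc x < n \<Longrightarrow> rootC n (Suc x) y = rootC n x y + unit (n - Suc x)"
      by (auto simp: rootC_def unit_def fun_eq_iff)
    show "Suc y < n \<Longrightarrow> rootC n x (Suc y) = rootC n x y + unit (n - Suc y)"
      by (auto simp: rootC_def unit_def fun_eq_iff)
    show "x < n \<Longrightarrow> y < n \<Longrightarrow> x' < n \<Longrightarrow> y' < n \<Longrightarrow> j \<in> I_par n n \<Longrightarrow>
      rootC n x' y' = rootC n x y + unit j \<Longrightarrow>
      (j = n - Suc x \<and> Suc x < n \<and> rootC n x' y' = rootC n (Suc x) y) \<or>
      (j = n - Suc y \<and> Suc y < n \<and> rootC n x' y' = rootC n x (Suc y))"
      using rootC_step_cases[of x n y x' y' j] by (simp add: I_par_last)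
    show "I_par n n = (\<lambda>x. n - Suc x) ` {..<n - 1} \<union> (\<lambda>x. n - Suc x) ` {..<n - 1}"
      by (simp only: reflect_image I_par_last Un_absorb)
qed (use n rootC_sym in auto)

text \<open>In the folded grid rows and columns carry the same labels, so both totals equal
  \<open>card J\<close>.\<close>

lemma classified_C:
  assumes n: "1 \<le> n"
  shows "classified ((\<lambda>(x, y). rootC n x y) ` ({..<n} \<times> {..<n})) (I_par n n) (criteria_Cn n)"
proof -
  interpret labelled_grid "rootC n" n n "\<lambda>x. n - Suc x" "\<lambda>x. n - Suc x" "I_par n n"
    by (rule labelled_grid_C[OF n])
  have crit: "criteria_Cn n a J \<longleftrightarrow> (\<rho> J (n - 1) = a \<or> \<rho> J (n - 1) = a + 1) \<and> (\<sigma> J (n - 1) = a \<or> \<sigma> J (n - 1) = a + 1)"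
    if J: "J \<subseteq> I_par n n" for a J
  proof -
    have p: "\<rho> J (n - 1) = int (card J)" "\<sigma> J (n - 1) = int (card J)"
      using card_reflect[of J n] J by (simp_all add: \<rho>_def \<sigma>_def I_par_last)
    have "card J \<le> n - 1" using card_mono[of "{1..<n}" J] J by (simp add: I_par_last)
    then show ?thesis unfolding criteria_Cn_def p using n by auto
  qed
  show ?thesis
    using grid_classified[of "criteria_Cn n"] crit unfolding vectors_def by blast
qed

section \<open>The half square of type D\<close>

text \<open>Again \<epsilon>_(n-x) + \<epsilon>_(n-y), now for distinct indices. Where type C has
  \<alpha>_n = 2 \<epsilon>_n, type D has 2 \<epsilon>_n = \<alpha>_n - \<alpha>_(n-1); hence the
  correction.\<close>

definition rootD :: "nat \<Rightarrow> nat \<Rightarrow> nat \<Rightarrow> nat \<Rightarrow> int" where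
  "rootD n x y = rootC n x y - unit (n - 1)"

definition vectorsD :: "nat \<Rightarrow> (nat \<Rightarrow> int) set" where
  "vectorsD n = {rootD n x y | x y. x < n \<and> y < n \<and> x \<noteq> y}"

lemma rootC_thresholds:
  assumes "x \<le> y" "y < n" "x' \<le> y'" "y' < n" "rootC n x y = rootC n x' y'"
  shows "x = x' \<and> y = y'"
proof -
  have pt: "(k \<le> y) = (k \<le> y')" "(k \<le> x) = (k \<le> x')" if k: "1 \<le> k" "k < n" for k
  proof -
    have th: "n - z \<le> n - k \<longleftrightarrow> k \<le> z" if "z < n" for z using that k by auto
    show "(k \<le> y) = (k \<le> y')" "(k \<le> x) = (k \<le> x')"
      using fun_cong[OF assms(5), of "n - k"] assms(1-4) k
      by (auto simp: rootC_def th of_bool_def split: if_splits)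
  qed
  have "y \<le> y'" using pt(1)[of y] assms by (cases "y = 0") auto
  moreover have "y' \<le> y" using pt(1)[of y'] assms by (cases "y' = 0") auto
  moreover have "x \<le> x'" using pt(2)[of x] assms by (cases "x = 0") auto
  moreover have "x' \<le> x" using pt(2)[of x'] assms by (cases "x' = 0") auto
  ultimately show ?thesis by simp
qed

lemma rootC_inj:
  assumes "x < n" "y < n" "x' < n" "y' < n" "rootC n x y = rootC n x' y'"
  shows "(x = x' \<and> y = y') \<or> (x = y' \<and> y = x')"
proof -
  have m: "rootC n u v = rootC n (min u v) (max u v)" for u v
    using rootC_sym by (auto simp: min_def max_def)
  have "min x y = min x' y' \<and> max x y = max x' y'"
    using assms m[of x y] m[of x' y'] by (intro rootC_thresholds) auto
  then show ?thesis by (auto simp: min_def max_def split: if_splits)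
qed

lemma rootD_sym: "rootD n x y = rootD n y x" by (simp add: rootD_def rootC_sym)

locale type_D =
  fixes n :: nat
  assumes n: "4 \<le> n"
begin

sublocale C: labelled_grid "rootC n" n n "\<lambda>x. n - Suc x" "\<lambda>x. n - Suc x" "I_par n n"
  using labelled_grid_C n by simp

abbreviation "\<rho> \<equiv> C.\<rho>"

lemma sigma_eq: "C.\<sigma> = \<rho>" by (simp add: fun_eq_iff C.\<rho>_def C.\<sigma>_def)

lemma I_iff: "j \<in> I_par n n \<longleftrightarrow> 1 \<le> j \<and> j < n" by (auto simp: I_par_last)

lemma rho_step: "\<rho> J (Suc x) = \<rho> J x \<or> \<rho> J (Suc x) = \<rho> J x + 1" "0 \<le> \<rho> J x"
  by (simp add: C.rho_simps) (simp add: C.\<rho>_def)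

lemma rho_last_card: "J \<subseteq> I_par n n \<Longrightarrow> \<rho> J (n - 1) = int (card J)"
  using card_reflect[of J n] by (simp add: C.\<rho>_def I_par_last)

lemma rootD_step_a: "Suc x < n \<Longrightarrow> y < n \<Longrightarrow> rootD n (Suc x) y = rootD n x y + unit (n - Suc x)"
  by (simp add: rootD_def C.step_a)

text \<open>The correction term is what distinguishes \<open>n - 1 \<in> J\<close> from
  \<open>n - 1 \<notin> J\<close> in the criteria.\<close>

lemma level_sum:
  assumes J: "J \<subseteq> I_par n n" and xy: "x < n" "y < n"
  shows "(\<Sum>j\<in>J. rootD n x y j) = \<rho> J x + \<rho> J y - of_bool (n - 1 \<in> J)"
proof -
  have fin: "finite J" using finite_subset[OF J C.finite_I] .
  have "rootC n x y = rootD n x y + unit (n - 1)" by (simp add: rootD_def)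
  then have "(\<Sum>j\<in>J. rootC n x y j) = (\<Sum>j\<in>J. rootD n x y j) + of_bool (n - 1 \<in> J)"
    using C.sum_unit[OF fin, of "rootD n x y" "n - 1"] by simp
  then show ?thesis using C.level_sum[OF J xy] by (simp add: sigma_eq)
qed

definition cells :: "(nat \<Rightarrow> int) set \<Rightarrow> (nat \<times> nat) set" where
  "cells \<Phi> = {(x, y). x < n \<and> y < n \<and> x \<noteq> y \<and> rootD n x y \<in> \<Phi>}"

lemma cells_iff: "(x, y) \<in> cells \<Phi> \<longleftrightarrow> x < n \<and> y < n \<and> x \<noteq> y \<and> rootD n x y \<in> \<Phi>" by (simp add: cells_def)

lemma cells_sym: "(x, y) \<in> cells \<Phi> \<Longrightarrow> (y, x) \<in> cells \<Phi>" by (auto simp: cells_iff rootD_sym)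

lemma vectorsD_I: "x < n \<Longrightarrow> y < n \<Longrightarrow> x \<noteq> y \<Longrightarrow> rootD n x y \<in> vectorsD n" by (auto simp: vectorsD_def)

text \<open>As in the full square, except that the step from \<open>(x, Suc x)\<close> onto the
  diagonal does not lead to a root and must be left out.\<close>

lemma raising_iff:
  assumes \<Phi>: "\<Phi> \<subseteq> vectorsD n" and x: "Suc x < n"
  shows "n - Suc x \<in> raising_labels (vectorsD n) (I_par n n) \<Phi> \<longleftrightarrow>
    (\<exists>y. (x, y) \<in> cells \<Phi> \<and> (Suc x, y) \<notin> cells \<Phi> \<and> y \<noteq> Suc x)"
proof
  assume "n - Suc x \<in> raising_labels (vectorsD n) (I_par n n) \<Phi>"
  then obtain c where c: "n - Suc x \<in> I_par n n" "c \<in> \<Phi>" "c + unit (n - Suc x) \<in> vectorsD n" "c + unit (n - Suc x) \<notin> \<Phi>"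
    by (auto simp: raising_labels_def)
  then obtain a b a' b' where ab: "a < n" "b < n" "a \<noteq> b" "c = rootD n a b"
    "a' < n" "b' < n" "a' \<noteq> b'" "rootD n a' b' = rootD n a b + unit (n - Suc x)"
    using \<Phi> unfolding vectorsD_def by force
  have eq: "rootC n a' b' = rootC n a b + unit (n - Suc x)"
    using ab(8) by (simp add: rootD_def fun_eq_iff)
  have *: "(x, v) \<in> cells \<Phi> \<and> (Suc x, v) \<notin> cells \<Phi> \<and> v \<noteq> Suc x"
    if "n - Suc x = n - Suc u" "Suc u < n" "v < n" "u \<noteq> v" "rootC n a' b' = rootC n (Suc u) v"
      "rootD n u v = c" for u v
  proof -
    have u: "u = x" using that x by auto
    have ne: "Suc u \<noteq> v" using rootC_inj[OF ab(5,6) that(2,3,5)] ab(7) by metis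
    have "rootD n (Suc u) v = c + unit (n - Suc x)" using rootD_step_a[OF that(2,3)] that by simp
    then have "rootD n (Suc u) v \<notin> \<Phi>" "rootD n u v \<in> \<Phi>" using c(2,4) that(6) by simp_all
    then show ?thesis using u ne that(2-4) by (simp add: cells_iff)
  qed
  from C.step_cases[OF ab(1,2,5,6) c(1) eq]
  show "\<exists>y. (x, y) \<in> cells \<Phi> \<and> (Suc x, y) \<notin> cells \<Phi> \<and> y \<noteq> Suc x"
  proof (elim disjE conjE)
    assume "n - Suc x = n - Suc a" "Suc a < n" "rootC n a' b' = rootC n (Suc a) b"
    from *[OF this(1,2) ab(2,3) this(3) ab(4)[symmetric]] show ?thesis by blast
  next
    assume b: "n - Suc x = n - Suc b" "Suc b < n" "rootC n a' b' = rootC n a (Suc b)"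
    have "rootC n a' b' = rootC n (Suc b) a" using b(3) rootC_sym by simp
    from *[OF b(1,2) ab(1) ab(3)[symmetric] this] show ?thesis using ab(4) rootD_sym by metis
  qed
next
  assume "\<exists>y. (x, y) \<in> cells \<Phi> \<and> (Suc x, y) \<notin> cells \<Phi> \<and> y \<noteq> Suc x"
  then obtain y where y: "(x, y) \<in> cells \<Phi>" "(Suc x, y) \<notin> cells \<Phi>" "y \<noteq> Suc x" by blast
  have "rootD n x y + unit (n - Suc x) \<in> vectorsD n - \<Phi>"
    using rootD_step_a[OF x, of y] y x vectorsD_I[of "Suc x" y] by (auto simp: cells_iff)
  then show "n - Suc x \<in> raising_labels (vectorsD n) (I_par n n) \<Phi>"
    using y(1) x by (auto simp: raising_labels_def cells_iff I_iff)
qed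

text \<open>The block of equal values of \<open>\<rho>\<close> in which the boundary of \<open>\<rho> x + \<rho> y \<le> a\<close> meets the diagonal has at
  least two elements; this is the gap condition on consecutive \<open>j\<^sub>s\<close>.\<close>

definition wide_middle :: "int \<Rightarrow> nat set \<Rightarrow> bool" where
  "wide_middle a J \<longleftrightarrow> (\<exists>x. Suc x < n \<and> \<rho> J x = (a + 1) div 2 \<and> \<rho> J (Suc x) = (a + 1) div 2)"

text \<open>The diagonal is filled in such a way that the row drops of the resulting symmetric staircase
  are exactly the labels of the ideal.\<close>

definition filled :: "(nat \<Rightarrow> int) set \<Rightarrow> (nat \<times> nat) set" where
  "filled \<Phi> = cells \<Phi> \<union> {(z, z) | z. z < n \<and> (z = 0 \<or> (z, z - 1) \<in> cells \<Phi>) \<and>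
     (z = 0 \<or> (Suc z, z) \<in> cells \<Phi> \<or> (Suc z, z - 1) \<notin> cells \<Phi>)}"

lemma filled_offdiag: "x \<noteq> y \<Longrightarrow> (x, y) \<in> filled \<Phi> \<longleftrightarrow> (x, y) \<in> cells \<Phi>" by (auto simp: filled_def)

lemma filled_diag: "(z, z) \<in> filled \<Phi> \<longleftrightarrow> z < n \<and> (z = 0 \<or> (z, z - 1) \<in> cells \<Phi>) \<and>
     (z = 0 \<or> (Suc z, z) \<in> cells \<Phi> \<or> (Suc z, z - 1) \<notin> cells \<Phi>)"
  by (auto simp: filled_def cells_iff)

lemma filled_sym: "(x, y) \<in> filled \<Phi> \<Longrightarrow> (y, x) \<in> filled \<Phi>"
  by (cases "x = y") (auto simp: filled_offdiag cells_sym)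

text \<open>The path of unit steps has to avoid the diagonal. Lowering the smaller coordinate before
  the larger one keeps it in one triangle; symmetry covers the other.\<close>

lemma cells_down:
  assumes low: "lowering_closed (vectorsD n) (I_par n n) \<Phi>"
    and xy: "(x, y) \<in> cells \<Phi>" "x' \<le> x" "y' \<le> y" "x' \<noteq> y'"
  shows "(x', y') \<in> cells \<Phi>"
proof -
  have down: "(x, y) \<in> cells \<Phi>" if "(Suc x, y) \<in> cells \<Phi>" "x \<noteq> y" for x y
  proof -
    have c: "Suc x < n" "y < n" "rootD n (Suc x) y \<in> \<Phi>" using that(1) by (auto simp: cells_iff)
    have "rootD n (Suc x) y - unit (n - Suc x) = rootD n x y" using rootD_step_a[OF c(1,2)] by simp
    moreover have "rootD n x y \<in> vectorsD n" using c that(2) by (intro vectorsD_I) auto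
    moreover have "n - Suc x \<in> I_par n n" using c by (auto simp: I_iff)
    ultimately have "rootD n x y \<in> \<Phi>"
      using low[unfolded lowering_closed_def, THEN conjunct2, rule_format, OF c(3), of "n - Suc x"] by simp
    then show ?thesis using c that(2) by (simp add: cells_iff)
  qed
  have main: "(x', y') \<in> cells \<Phi>" if "(x, y) \<in> cells \<Phi>" "x' \<le> x" "y' \<le> y" "x < y" "x' < y'" for x y x' y'
  proof -
    have "(x', y) \<in> cells \<Phi>"
      using \<open>x' \<le> x\<close> that(1,4) by (induction rule: inc_induct) (auto intro: down)
    then have "(y, x') \<in> cells \<Phi>" by (rule cells_sym)
    with \<open>y' \<le> y\<close> have "(y', x') \<in> cells \<Phi>" using that(5) by (induction rule: inc_induct) (auto intro: down)
    then show ?thesis by (rule cells_sym)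
  qed
  have xn: "x \<noteq> y" using xy(1) by (simp add: cells_iff)
  show ?thesis
  proof (cases "x < y")
    case True
    then show ?thesis using main[of x y x' y'] main[of x y y' x'] xy cells_sym by (cases "x' < y'") fastforce+
  next
    case False
    then have "y < x" using xn by simp
    then show ?thesis using main[of y x x' y'] main[of y x y' x'] xy cells_sym by (cases "x' < y'") fastforce+
  qed
qed

lemma staircase_filled:
  assumes low: "lowering_closed (vectorsD n) (I_par n n) \<Phi>" and ne: "\<Phi> \<noteq> {}"
  shows "staircase (filled \<Phi>) n n (\<rho> (raising_labels (vectorsD n) (I_par n n) \<Phi>))
    (\<rho> (raising_labels (vectorsD n) (I_par n n) \<Phi>))"
proof -
  have \<Phi>: "\<Phi> \<subseteq> vectorsD n" using low by (simp add: lowering_closed_def)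
  note dn = cells_down[OF low]
  \<comment> \<open>A nonempty ideal contains the lowest root. Hence the filled cell (0, 0) causes
    no corner of its own.\<close>
  have 10: "(1, 0) \<in> cells \<Phi>" "(0, 1) \<in> cells \<Phi>"
  proof -
    obtain x y where xy: "(x, y) \<in> cells \<Phi>" using ne \<Phi> by (force simp: vectorsD_def cells_iff)
    then have "x \<noteq> y" by (simp add: cells_iff)
    then have "1 \<le> x \<or> 1 \<le> y" by auto
    then show "(1, 0) \<in> cells \<Phi>" using dn[OF xy, of 1 0] dn[OF cells_sym[OF xy], of 1 0] by auto
    then show "(0, 1) \<in> cells \<Phi>" by (rule cells_sym)
  qed
  have row: "n - Suc x \<in> raising_labels (vectorsD n) (I_par n n) \<Phi> \<longleftrightarrow> (\<exists>y. (x, y) \<in> filled \<Phi> \<and> (Suc x, y) \<notin> filled \<Phi>)"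
    if x: "Suc x < n" for x
    unfolding raising_iff[OF \<Phi> x]
  proof
    assume "\<exists>y. (x, y) \<in> cells \<Phi> \<and> (Suc x, y) \<notin> cells \<Phi> \<and> y \<noteq> Suc x"
    then show "\<exists>y. (x, y) \<in> filled \<Phi> \<and> (Suc x, y) \<notin> filled \<Phi>" by (auto simp: filled_def)
  next
    assume "\<exists>y. (x, y) \<in> filled \<Phi> \<and> (Suc x, y) \<notin> filled \<Phi>"
    then obtain y where y: "(x, y) \<in> filled \<Phi>" "(Suc x, y) \<notin> filled \<Phi>" by blast
    consider "y \<noteq> x" "y \<noteq> Suc x" | "y = Suc x" | "y = x" by blast
    then show "\<exists>y. (x, y) \<in> cells \<Phi> \<and> (Suc x, y) \<notin> cells \<Phi> \<and> y \<noteq> Suc x"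
    proof cases
      case 1
      then show ?thesis using y by (auto simp: filled_offdiag)
    next
      case 2
      \<comment> \<open>The corner is at the missing diagonal cell of row \<open>Suc x\<close>. The
        filling rule omits it only if row \<open>x\<close> reaches column \<open>Suc (Suc x)\<close>
        and row \<open>Suc x\<close> does not, which is a corner off the diagonal.\<close>
      have c: "(Suc x, x) \<in> cells \<Phi>" using y(1) 2 by (auto simp: filled_offdiag intro: cells_sym)
      then have "(Suc (Suc x), Suc x) \<notin> cells \<Phi>" "(Suc (Suc x), x) \<in> cells \<Phi>"
        using y(2) x unfolding 2 filled_diag by auto
      then have "(x, Suc (Suc x)) \<in> cells \<Phi>" "(Suc x, Suc (Suc x)) \<notin> cells \<Phi>" using cells_sym by blast+
      then show ?thesis by (intro exI[of _ "Suc (Suc x)"]) simp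
    next
      case 3
      \<comment> \<open>The corner is at the filled diagonal cell of row \<open>x\<close>, with the
        cell below it missing. The filling rule then places a corner of the same rows in column
        \<open>x - 1\<close>.\<close>
      have S: "(Suc x, x) \<notin> cells \<Phi>" using y(2) 3 by (simp add: filled_offdiag)
      then have x0: "x \<noteq> 0" using 10(1) by (cases x) auto
      then have "(x, x - 1) \<in> cells \<Phi>" "(Suc x, x - 1) \<notin> cells \<Phi>"
        using y(1) S unfolding 3 filled_diag by auto
      then show ?thesis by (intro exI[of _ "x - 1"]) auto
    qed
  qed
  show ?thesis
  proof
    fix x y x' y'
    show "(x, y) \<in> filled \<Phi> \<Longrightarrow> x < n \<and> y < n" by (auto simp: filled_def cells_iff)
    assume xy: "(x, y) \<in> filled \<Phi>" "x' \<le> x" "y' \<le> y"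
    have diag: "(z, z) \<in> filled \<Phi>" if c: "(u, v) \<in> cells \<Phi>" "z < u" "z \<le> v" for u v z
      using dn[OF c(1), of z "z - 1"] dn[OF c(1), of "Suc z" z] c
      by (cases "z = 0") (auto simp: filled_diag cells_iff)
    have diag': "(z, z) \<in> filled \<Phi>" if "(u, v) \<in> cells \<Phi>" "z \<le> u" "z \<le> v" for u v z
    proof (cases "z < u")
      case True
      then show ?thesis using diag[OF that(1) _ that(3)] by simp
    next
      case False
      then have "z < v" using that by (auto simp: cells_iff)
      then show ?thesis using diag[OF cells_sym[OF that(1)] _ that(2)] by simp
    qed
    show "(x', y') \<in> filled \<Phi>"
    proof (cases "x = y")
      case False
      then have c: "(x, y) \<in> cells \<Phi>" using xy(1) by (simp add: filled_offdiag)
      show ?thesis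
        using dn[OF c xy(2,3)] diag'[OF c] xy by (cases "x' = y'") (auto simp: filled_offdiag)
    next
      case True
      show ?thesis
      proof (cases "x' = x \<and> y' = y")
        case False
        then have x0: "x \<noteq> 0" using xy True by auto
        then have c: "(x, x - 1) \<in> cells \<Phi>" using xy(1) unfolding True filled_diag by auto
        show ?thesis
        proof (cases "x' = y'")
          case eq: True
          then have "x' \<le> x - 1" using False True xy by auto
          then show ?thesis using diag'[OF c, of x'] eq xy by simp
        next
          case ne: False
          show ?thesis
          proof (cases "y' \<le> x - 1")
            case True
            then show ?thesis using dn[OF c xy(2) True ne] ne by (simp add: filled_offdiag)
          next
            case F: False
            then have "x' \<le> x - 1" using ne xy True by auto
            then have "(x', y') \<in> cells \<Phi>" using dn[OF cells_sym[OF c], of x' y'] ne xy True by simp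
            then show ?thesis using ne by (simp add: filled_offdiag)
          qed
        qed
      qed (use xy in simp)
    qed
  next
    fix x assume x: "Suc x < n"
    have "(\<exists>y. (x, y) \<in> filled \<Phi> \<and> (Suc x, y) \<notin> filled \<Phi>) \<longleftrightarrow> (\<exists>y. (y, x) \<in> filled \<Phi> \<and> (y, Suc x) \<notin> filled \<Phi>)"
      using filled_sym by blast
    then show "\<rho> (raising_labels (vectorsD n) (I_par n n) \<Phi>) (Suc x) = \<rho> (raising_labels (vectorsD n) (I_par n n) \<Phi>) x +
       of_bool (\<exists>y. (x, y) \<in> filled \<Phi> \<and> (Suc x, y) \<notin> filled \<Phi>)"
      "\<rho> (raising_labels (vectorsD n) (I_par n n) \<Phi>) (Suc x) = \<rho> (raising_labels (vectorsD n) (I_par n n) \<Phi>) x +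
       of_bool (\<exists>y. (y, x) \<in> filled \<Phi> \<and> (y, Suc x) \<notin> filled \<Phi>)"
      using row[OF x] by (simp_all add: C.rho_simps)
  qed (simp_all add: C.rho_simps)
qed

lemma level_of_ideal:
  assumes low: "lowering_closed (vectorsD n) (I_par n n) \<Phi>" and J: "J = raising_labels (vectorsD n) (I_par n n) \<Phi>"
    and ne: "\<Phi> \<noteq> {}" "\<Phi> \<noteq> vectorsD n"
  defines "a \<equiv> max_level J \<Phi> + of_bool (n - 1 \<in> J)"
  shows "\<Phi> = {c \<in> vectorsD n. (\<Sum>j\<in>J. c j) \<le> max_level J \<Phi>}" "0 \<le> a" "J \<noteq> {}"
    "int (card J) = a \<or> int (card J) = a + 1" "wide_middle a J" "0 \<le> max_level J \<Phi>"
proof -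
  have \<Phi>: "\<Phi> \<subseteq> vectorsD n" using low by (simp add: lowering_closed_def)
  have JI: "J \<subseteq> I_par n n" unfolding J by (auto simp: raising_labels_def)
  interpret staircase "filled \<Phi>" n n "\<rho> J" "\<rho> J" unfolding J by (rule staircase_filled[OF low ne(1)])
  obtain x0 y0 where "(x0, y0) \<in> cells \<Phi>" using ne(1) \<Phi> by (force simp: vectorsD_def cells_iff)
  then have c0: "(x0, y0) \<in> filled \<Phi>" "x0 \<noteq> y0" by (auto simp: filled_def cells_iff)
  then have fne: "filled \<Phi> \<noteq> {}" by auto
  have "(1, 0) \<in> filled \<Phi>"
    using down[OF c0(1), of 1 0] down[OF filled_sym[OF c0(1)], of 1 0] c0(2) by (cases "x0 = 0") auto
  then have c10: "(1, 0) \<in> cells \<Phi>" by (simp add: filled_offdiag)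
  have top: "(n - 1, n - 1) \<notin> filled \<Phi>"
  proof
    assume t: "(n - 1, n - 1) \<in> filled \<Phi>"
    have "rootD n x y \<in> \<Phi>" if "x < n" "y < n" "x \<noteq> y" for x y
    proof -
      have "(x, y) \<in> filled \<Phi>" using down[OF t, of x y] that by simp
      then show ?thesis using that by (simp add: filled_offdiag cells_iff)
    qed
    then show False using \<Phi> ne(2) by (auto simp: vectorsD_def)
  qed
  \<comment> \<open>Each rise of \<rho> is witnessed by an ideal cell off the diagonal; this is the
    information that the filled staircase alone does not carry.\<close>
  have drop: "\<exists>y. (x, y) \<in> cells \<Phi> \<and> y \<noteq> Suc x \<and> level < \<rho> J (Suc x) + \<rho> J y"
    if x: "Suc x < n" and s: "\<rho> J (Suc x) \<noteq> \<rho> J x" for x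
  proof -
    have "n - Suc x \<in> J" using s by (auto simp: C.rho_simps)
    then obtain y where y: "(x, y) \<in> cells \<Phi>" "(Suc x, y) \<notin> cells \<Phi>" "y \<noteq> Suc x"
      using raising_iff[OF \<Phi> x] J by blast
    then have "(Suc x, y) \<notin> filled \<Phi>" by (simp add: filled_offdiag)
    then have "level < \<rho> J (Suc x) + \<rho> J y"
      using M_eq_level[OF fne, of "Suc x" y] x y(1) by (simp add: cells_iff)
    then show ?thesis using y by blast
  qed
  \<comment> \<open>The level of the filled staircase is also attained off the diagonal: a diagonal
    cell of maximal level has a left neighbour of equal level, or else a rise of \<rho> there gives
    another cell of that level.\<close>
  obtain x y where xy: "(x, y) \<in> cells \<Phi>" "\<rho> J x + \<rho> J y = level"
  proof -
    obtain u v where uv: "(u, v) \<in> filled \<Phi>" "\<rho> J u + \<rho> J v = level" using level_attained[OF fne] .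
    have le: "\<rho> J x + \<rho> J y \<le> level" if "(x, y) \<in> cells \<Phi>" for x y
      using level_ge that by (auto simp: filled_def)
    show ?thesis
    proof (cases "u = v")
      case False
      then show ?thesis using uv that by (simp add: filled_offdiag)
    next
      case True
      show ?thesis
      proof (cases u)
        case 0
        have "\<rho> J 1 + \<rho> J 0 = level" using le[OF c10] uv True 0 rho_nonneg[of 1] n by (simp add: C.rho_simps(1))
        then show ?thesis using that[OF c10] by simp
      next
        case (Suc w)
        have c: "(u, w) \<in> cells \<Phi>" using uv(1) True Suc unfolding True filled_diag by auto
        have un: "Suc w < n" using c Suc by (simp add: cells_iff)
        show ?thesis
        proof (cases "\<rho> J (Suc w) = \<rho> J w")
          case True
          then show ?thesis using that[OF c] uv \<open>u = v\<close> Suc by simp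
        next
          case False
          obtain y where y: "(w, y) \<in> cells \<Phi>" "level < \<rho> J (Suc w) + \<rho> J y" using drop[OF un False] by blast
          have "\<rho> J w + \<rho> J y = level" using le[OF y(1)] y(2) rho_step(1)[of J w] by auto
          then show ?thesis using that[OF y(1)] by simp
        qed
      qed
    qed
  qed
  have sums: "(\<Sum>j\<in>J. c j) \<le> level - of_bool (n - 1 \<in> J)" if "c \<in> \<Phi>" for c
  proof -
    have "c \<in> vectorsD n" using that \<Phi> by blast
    then obtain x y where "x < n" "y < n" "x \<noteq> y" "c = rootD n x y" by (auto simp: vectorsD_def)
    moreover then have "(x, y) \<in> filled \<Phi>" using that by (simp add: filled_offdiag cells_iff)
    ultimately show ?thesis using level_sum[OF JI] level_ge by fastforce
  qed
  have ml: "max_level J \<Phi> = level - of_bool (n - 1 \<in> J)"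
    unfolding max_level_def
  proof (rule Max_eqI)
    have "vectorsD n \<subseteq> (\<lambda>(x, y). rootD n x y) ` ({..<n} \<times> {..<n})" by (auto simp: vectorsD_def)
    then have "finite (vectorsD n)" by (rule finite_subset) simp
    then show "finite ((\<lambda>c. \<Sum>j\<in>J. c j) ` \<Phi>)" using finite_subset[OF \<Phi>] by simp
    show "level - of_bool (n - 1 \<in> J) \<in> (\<lambda>c. \<Sum>j\<in>J. c j) ` \<Phi>"
      using xy level_sum[OF JI, of x y] by (intro image_eqI[of _ _ "rootD n x y"]) (auto simp: cells_iff)
  qed (use sums in auto)
  then have a: "a = level" by (simp add: a_def)
  show "0 \<le> a" using level_nonneg[OF fne] a by simp
  have last: "\<rho> J (n - 1) = a \<or> \<rho> J (n - 1) = a + 1" using rho_last[OF fne top] a by simp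
  then show "int (card J) = a \<or> int (card J) = a + 1" using rho_last_card[OF JI] by simp
  show Jne: "J \<noteq> {}"
  proof
    assume "J = {}"
    then have "\<rho> J x = 0" for x by (simp add: C.\<rho>_def)
    then have "(n - 1, n - 1) \<in> filled \<Phi>" using M_eq_level[OF fne] level_nonneg[OF fne] n by simp
    then show False using top by blast
  qed
  have cell: "(x, y) \<in> cells \<Phi> \<longleftrightarrow> x < n \<and> y < n \<and> x \<noteq> y \<and> \<rho> J x + \<rho> J y \<le> a" for x y
  proof (cases "x = y")
    case False
    then show ?thesis using M_eq_level[OF fne, of x y] by (simp add: filled_offdiag a)
  qed (simp add: cells_iff)
  show "\<Phi> = {c \<in> vectorsD n. (\<Sum>j\<in>J. c j) \<le> max_level J \<Phi>}"
  proof -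
    have "rootD n x y \<in> \<Phi> \<longleftrightarrow> (\<Sum>j\<in>J. rootD n x y j) \<le> max_level J \<Phi>" if "x < n" "y < n" "x \<noteq> y" for x y
      using cell[of x y] that level_sum[OF JI that(1,2)] ml a by (simp add: cells_iff)
    then show ?thesis using \<Phi> unfolding vectorsD_def by fastforce
  qed
  \<comment> \<open>If \<open>n - 1 \<in> J\<close> the first step already raises \<rho>, so the
    cell (1, 0) has level at least 1 before the correction, and this pays for it.\<close>
  show "0 \<le> max_level J \<Phi>"
  proof (cases "n - 1 \<in> J")
    case True
    then have "\<rho> J 1 = 1" using C.rho_simps[of J] by (simp add: C.rho_simps(2)[of J 0, simplified])
    then have "1 \<le> level" using level_ge[of 1 0] c10 by (simp add: filled_offdiag C.rho_simps(1))
    then show ?thesis using ml by simp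
  next
    case False
    then show ?thesis using ml level_nonneg[OF fne] by simp
  qed
  define m where "m = (a + 1) div 2"
  have m: "a = 2 * m \<or> a = 2 * m - 1" "0 \<le> m" using \<open>0 \<le> a\<close> unfolding m_def by presburger+
  have p: "1 \<le> \<rho> J (n - 1)" using Jne rho_last_card[OF JI] finite_subset[OF JI C.finite_I] by (simp add: Suc_le_eq card_gt_0_iff)
  \<comment> \<open>Suppose \<rho> takes the middle value \<open>m\<close> only at
    \<open>x0\<close>. For a = 2m the rise after \<open>x0\<close>, for a = 2m - 1 the rise into
    \<open>x0\<close>, needs a witness column with \<rho> equal to \<open>m\<close>. That column is
    \<open>x0\<close>, which is excluded in both cases.\<close>
  have "\<exists>u v. u < n \<and> v < n \<and> u \<noteq> v \<and> \<rho> J u = m \<and> \<rho> J v = m"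
  proof -
    have mp: "m \<le> \<rho> J (n - 1)" using last m p by auto
    obtain x0 where x0: "x0 < n" "\<rho> J x0 = m"
      by (rule unit_steps_surjective[of "\<rho> J" n m]) (use rho_step C.rho_simps(1) n m mp in auto)
    show ?thesis
    proof (rule ccontr)
      assume no: "\<not> ?thesis"
      have uniq: "y = x0" if "y < n" "\<rho> J y = m" for y using no x0 that by blast
      from m(1) show False
      proof
        assume a2: "a = 2 * m"
        have "m \<noteq> \<rho> J (n - 1)" using last a2 p by auto
        then have S: "Suc x0 < n" using x0 n by (cases "Suc x0 = n") auto
        then have "\<rho> J (Suc x0) = m + 1" using uniq[of "Suc x0"] rho_step(1)[of J x0] x0 by auto
        then obtain y where y: "(x0, y) \<in> cells \<Phi>" "level < m + 1 + \<rho> J y" using drop[OF S] x0 by auto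
        then have "\<rho> J y = m" using cell[of x0 y] x0 a a2 by auto
        then show False using uniq[of y] y(1) by (auto simp: cells_iff)
      next
        assume a2: "a = 2 * m - 1"
        have "x0 \<noteq> 0"
        proof
          assume "x0 = 0"
          then show False using x0 a2 \<open>0 \<le> a\<close> C.rho_simps(1)[of J] by simp
        qed
        then obtain w where w: "x0 = Suc w" using not0_implies_Suc by blast
        have s: "\<rho> J w = m - 1" using uniq[of w] rho_step(1)[of J w] x0 w by auto
        obtain y where y: "(w, y) \<in> cells \<Phi>" "y \<noteq> Suc w" "level < m + \<rho> J y"
          using drop[of w] s x0 w by auto
        then have "\<rho> J y = m" using cell[of w y] s a a2 by auto
        then show False using uniq[of y] y(1,2) w by (auto simp: cells_iff)
      qed
    qed
  qed
  then obtain u v where "u < n" "v < n" "u \<noteq> v" "\<rho> J u = m" "\<rho> J v = m" by blast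
  then obtain u v where uv: "u < v" "v < n" "\<rho> J u = m" "\<rho> J v = m" by (metis linorder_neqE_nat)
  have "\<rho> J (Suc u) = m" using C.mono(1)[of "Suc u" v J] C.mono(1)[of u "Suc u" J] uv by auto
  then show "wide_middle a J" unfolding wide_middle_def m_def[symmetric] using uv by (intro exI[of _ u]) auto
qed

lemma ideal_of_level:
  assumes JI: "J \<subseteq> I_par n n" and a: "0 \<le> a"
    and p: "int (card J) = a \<or> int (card J) = a + 1" and wide: "wide_middle a J"
  defines "b \<equiv> a - of_bool (n - 1 \<in> J)"
  defines "\<Phi> \<equiv> {c \<in> vectorsD n. (\<Sum>j\<in>J. c j) \<le> b}"
  shows "max_level J \<Phi> = b" "raising_labels (vectorsD n) (I_par n n) \<Phi> = J"
proof -
  define m where "m = (a + 1) div 2"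
  have m: "a = 2 * m \<or> a = 2 * m - 1" "0 \<le> m" using \<open>0 \<le> a\<close> unfolding m_def by presburger+
  have last: "\<rho> J (n - 1) = a \<or> \<rho> J (n - 1) = a + 1" using p rho_last_card[OF JI] by simp
  obtain w where w: "Suc w < n" "\<rho> J w = m" "\<rho> J (Suc w) = m" using wide by (auto simp: wide_middle_def m_def)
  \<comment> \<open>The wide block provides a second index with the middle value, so a witness that
    would fall on the diagonal can be moved off it.\<close>
  have other: "\<exists>y<n. y \<noteq> x \<and> \<rho> J y = m" for x
    using w by (cases "x = w") (auto intro: exI[of _ w] exI[of _ "Suc w"])
  have surj: "\<exists>x<n. \<rho> J x = v" if v: "0 \<le> v" "v \<le> \<rho> J (n - 1)" for v
  proof -
    obtain x where "x < n" "\<rho> J x = v"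
      by (rule unit_steps_surjective[of "\<rho> J" n v]) (use rho_step C.rho_simps(1) n v in auto)
    then show ?thesis by blast
  qed
  have \<Phi>: "\<Phi> \<subseteq> vectorsD n" by (auto simp: \<Phi>_def)
  have cell: "(x, y) \<in> cells \<Phi> \<longleftrightarrow> x < n \<and> y < n \<and> x \<noteq> y \<and> \<rho> J x + \<rho> J y \<le> a" for x y
    using level_sum[OF JI, of x y] vectorsD_I[of x y] by (auto simp: cells_iff \<Phi>_def b_def)
  show "max_level J \<Phi> = b"
    unfolding max_level_def
  proof (rule Max_eqI)
    have "vectorsD n \<subseteq> (\<lambda>(x, y). rootD n x y) ` ({..<n} \<times> {..<n})" by (auto simp: vectorsD_def)
    then have "finite (vectorsD n)" by (rule finite_subset) simp
    then show "finite ((\<lambda>c. \<Sum>j\<in>J. c j) ` \<Phi>)" using finite_subset[OF \<Phi>] by simp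
    show "\<And>m. m \<in> (\<lambda>c. \<Sum>j\<in>J. c j) ` \<Phi> \<Longrightarrow> m \<le> b" by (auto simp: \<Phi>_def)
    \<comment> \<open>A cell of level \<open>a\<close> off the diagonal: one coordinate has value
      \<open>a - m\<close>, and the other has value \<open>m\<close> and is chosen different from
      it.\<close>
    have "0 \<le> a - m" "a - m \<le> \<rho> J (n - 1)" using m a last by auto
    then obtain x where x: "x < n" "\<rho> J x = a - m" using surj by blast
    obtain y where y: "y < n" "y \<noteq> x" "\<rho> J y = m" using other by blast
    have "(\<Sum>j\<in>J. rootD n x y j) = b" using level_sum[OF JI x(1) y(1)] x y by (simp add: b_def)
    moreover have "rootD n x y \<in> \<Phi>" using cell[of x y] x y by (simp add: cells_iff)
    ultimately show "b \<in> (\<lambda>c. \<Sum>j\<in>J. c j) ` \<Phi>" by (intro image_eqI[of _ _ "rootD n x y"]) auto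
  qed
  have lab: "n - Suc x \<in> raising_labels (vectorsD n) (I_par n n) \<Phi> \<longleftrightarrow> n - Suc x \<in> J" if x: "Suc x < n" for x
  proof -
    have "(\<exists>y. (x, y) \<in> cells \<Phi> \<and> (Suc x, y) \<notin> cells \<Phi> \<and> y \<noteq> Suc x) \<longleftrightarrow> \<rho> J (Suc x) = \<rho> J x + 1"
    proof
      assume "\<exists>y. (x, y) \<in> cells \<Phi> \<and> (Suc x, y) \<notin> cells \<Phi> \<and> y \<noteq> Suc x"
      then show "\<rho> J (Suc x) = \<rho> J x + 1" using rho_step(1)[of J x] x by (auto simp: cell)
    next
      assume s: "\<rho> J (Suc x) = \<rho> J x + 1"
      have "\<rho> J (Suc x) \<le> \<rho> J (n - 1)" using C.mono(1)[of "Suc x" "n - 1" J] x by simp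
      then have "0 \<le> a - \<rho> J x" "a - \<rho> J x \<le> \<rho> J (n - 1)" using s last rho_step(2)[of J x] by auto
      then obtain z where z: "z < n" "\<rho> J z = a - \<rho> J x" using surj by blast
      \<comment> \<open>The column with value \<open>a - \<rho> x\<close> fails only if it is
        \<open>x\<close> or \<open>Suc x\<close>. In that case the value is \<open>m\<close>, and
        the block offers another column.\<close>
      have "\<exists>y<n. y \<noteq> x \<and> y \<noteq> Suc x \<and> \<rho> J y = a - \<rho> J x"
      proof (cases "z = x \<or> z = Suc x")
        case False
        then show ?thesis using z by blast
      next
        case True
        then have mz: "\<rho> J z = m" using z s m by auto
        obtain y where "y < n" "y \<noteq> z" "\<rho> J y = m" using other by blast
        moreover from this have "y \<noteq> x" "y \<noteq> Suc x" using True s mz by auto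
        ultimately show ?thesis using z(2) mz by auto
      qed
      then obtain y where "y < n" "y \<noteq> x" "y \<noteq> Suc x" "\<rho> J y = a - \<rho> J x" by blast
      then show "\<exists>y. (x, y) \<in> cells \<Phi> \<and> (Suc x, y) \<notin> cells \<Phi> \<and> y \<noteq> Suc x"
        using s x by (intro exI[of _ y]) (auto simp: cell)
    qed
    then show ?thesis unfolding raising_iff[OF \<Phi> x] by (simp add: C.rho_simps)
  qed
  have sub: "raising_labels (vectorsD n) (I_par n n) \<Phi> \<subseteq> I_par n n" by (auto simp: raising_labels_def)
  have "j \<in> raising_labels (vectorsD n) (I_par n n) \<Phi> \<longleftrightarrow> j \<in> J" if "j \<in> I_par n n" for j
    using lab[of "n - Suc j"] lab[of "n - j - 1"] that by (auto simp: I_iff Suc_diff_Suc)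
  then show "raising_labels (vectorsD n) (I_par n n) \<Phi> = J" using sub JI by blast
qed

end

section \<open>The gap condition and the criteria for the half square\<close>

context type_D
begin

text \<open>\<rho> reads the labels downwards from \<open>n - 1\<close>, whereas the list of
  \<open>J\<close> is increasing; passing to the complement aligns the two.\<close>

lemma rho_count:
  assumes J: "J \<subseteq> I_par n n" and x: "x < n"
  shows "\<rho> J x = int (card J) - int (card {j \<in> J. j < n - x})"
proof -
  have fin: "finite J" using finite_subset[OF J C.finite_I] .
  have "bij_betw (\<lambda>u. n - Suc u) {u. u < x \<and> n - Suc u \<in> J} {j \<in> J. n - x \<le> j}"
    by (rule bij_betw_byWitness[of _ "\<lambda>j. n - Suc j"]) (use J x in \<open>auto simp: I_iff subset_iff\<close>)
  then have "\<rho> J x = int (card {j \<in> J. n - x \<le> j})" by (simp add: C.\<rho>_def bij_betw_same_card)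
  moreover have "card J = card {j \<in> J. j < n - x} + card {j \<in> J. n - x \<le> j}"
  proof -
    have "J = {j \<in> J. j < n - x} \<union> {j \<in> J. n - x \<le> j}" by auto
    then have "card J = card ({j \<in> J. j < n - x} \<union> {j \<in> J. n - x \<le> j})" by simp
    also have "\<dots> = card {j \<in> J. j < n - x} + card {j \<in> J. n - x \<le> j}"
      using fin by (intro card_Un_disjoint) auto
    finally show ?thesis .
  qed
  ultimately show ?thesis by simp
qed

text \<open>The integers in the half-open interval from \<open>j_t\<close> (excluded) to
  \<open>j_(t+1)\<close> (included) are those with exactly \<open>t\<close> elements of
  \<open>J\<close> below them. The conventions at both ends, 0 and \<open>n\<close>, make this true
  for t = 0 and t = card J.\<close>

lemma jnth_count:
  assumes J: "J \<subseteq> I_par n n" and t: "t \<le> card J" and k: "1 \<le> k" "k \<le> n"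
  shows "jnth (I_par n n) J t < k \<and> k \<le> jnth (I_par n n) J (Suc t) \<longleftrightarrow> card {j \<in> J. j < k} = t"
proof -
  have fin: "finite J" using finite_subset[OF J C.finite_I] .
  let ?q = "jnth (I_par n n) J"
  let ?xs = "sorted_list_of_set J"
  have len: "length ?xs = card J" and set: "set ?xs = J" using fin by simp_all
  have sorted: "u < v \<Longrightarrow> v < card J \<Longrightarrow> ?xs ! u < ?xs ! v" for u v
    using strict_sorted_list_of_set sorted_wrt_nth_less len by metis
  have Max: "1 + Max (I_par n n) = n"
  proof -
    have "Max (I_par n n) = n - 1" using n by (intro Max_eqI) (auto simp: I_par_last)
    then show ?thesis using n by simp
  qed
  have q: "?q 0 = 0" "\<And>s. s < card J \<Longrightarrow> ?q (Suc s) = ?xs ! s" "?q (Suc (card J)) = n"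
    using Max by (simp_all add: jnth_def)
  have inJ: "s < card J \<Longrightarrow> ?q (Suc s) \<in> J" for s using q(2) len set nth_mem by metis
  have qn: "s \<le> card J \<Longrightarrow> ?q (Suc s) \<le> n" for s
    using inJ[of s] q(3) J by (cases "s = card J") (auto simp: I_iff subset_iff)
  have count: "card {j \<in> J. j < k} = t" if t: "t \<le> card J" and a: "?q t < k" "k \<le> ?q (Suc t)" for t k
  proof -
    have lt: "?xs ! u < k \<longleftrightarrow> u < t" if u: "u < card J" for u
    proof
      assume "u < t"
      then obtain s where s: "t = Suc s" "u \<le> s" by (cases t) auto
      have "?xs ! u \<le> ?xs ! s" using sorted[of u s] s t by (cases "u = s") auto
      then show "?xs ! u < k" using a(1) q(2)[of s] s t by simp
    next
      assume uk: "?xs ! u < k"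
      show "u < t"
      proof (rule ccontr)
        assume "\<not> u < t"
        then have "t < card J" "?xs ! t \<le> ?xs ! u" using sorted[of t u] u by (cases "u = t"; simp)+
        then show False using uk a(2) q(2)[of t] by simp
      qed
    qed
    have "{j \<in> J. j < k} = (!) ?xs ` {..<t}"
    proof
      show "{j \<in> J. j < k} \<subseteq> (!) ?xs ` {..<t}"
      proof
        fix j assume "j \<in> {j \<in> J. j < k}"
        then obtain u where "u < card J" "j = ?xs ! u" "j < k" using set len by (metis in_set_conv_nth mem_Collect_eq)
        then show "j \<in> (!) ?xs ` {..<t}" using lt by auto
      qed
      show "(!) ?xs ` {..<t} \<subseteq> {j \<in> J. j < k}" using lt set len t nth_mem by fastforce
    qed
    moreover have "inj_on ((!) ?xs) {..<t}" using t len by (auto simp: inj_on_def nth_eq_iff_index_eq)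
    ultimately show ?thesis by (simp add: card_image)
  qed
  have mono: "card {j \<in> J. j < k} \<le> card {j \<in> J. j < k'}" if "k \<le> k'" for k k'
    using that fin by (intro card_mono) auto
  have step: "?q s < ?q (Suc s)" if "s \<le> card J" for s
  proof (cases s)
    case 0
    then show ?thesis using inJ[of 0] q(3) J n by (cases "card J = 0") (auto simp: q(1) I_iff subset_iff)
  next
    case (Suc r)
    then show ?thesis using sorted[of r s] inJ[of r] q that J by (cases "s = card J") (auto simp: I_iff subset_iff)
  qed
  show ?thesis
  proof
    assume "?q t < k \<and> k \<le> ?q (Suc t)"
    then show "card {j \<in> J. j < k} = t" using count[OF t] by blast
  next
    assume c: "card {j \<in> J. j < k} = t"
    have "?q t < k"
    proof (rule ccontr)
      assume nk: "\<not> ?q t < k"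
      then obtain s where s: "t = Suc s" using q(1) k by (cases t) auto
      have "card {j \<in> J. j < ?q t} = s" using count[of s "?q t"] step[of s] s t by simp
      then show False using mono[of k "?q t"] nk c s by simp
    qed
    moreover have "k \<le> ?q (Suc t)"
    proof (rule ccontr)
      assume nk: "\<not> k \<le> ?q (Suc t)"
      then have tJ: "t < card J" using k q(3) t by (cases "t = card J") auto
      have "?q (Suc t) \<in> J" "?q (Suc t) < k" using inJ[OF tJ] nk by simp_all
      then have "{j \<in> J. j < v} \<subset> {j \<in> J. j < k}" if "v = ?q (Suc t)" for v using that by force
      then have "{j \<in> J. j < ?q (Suc t)} \<subset> {j \<in> J. j < k}" by simp
      then have "card {j \<in> J. j < ?q (Suc t)} < card {j \<in> J. j < k}" using fin by (intro psubset_card_mono) auto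
      moreover have "card {j \<in> J. j < ?q (Suc t)} = t" using count[OF t, of "?q (Suc t)"] step[OF t] by simp
      ultimately show False using c by simp
    qed
    ultimately show "?q t < k \<and> k \<le> ?q (Suc t)" ..
  qed
qed

text \<open>By \<open>rho_count\<close> and \<open>jnth_count\<close> a block of constant \<rho> is
  such a half-open interval. It contains two consecutive integers iff its endpoints differ by at
  least 2.\<close>

lemma wide_middle_gap:
  assumes J: "J \<subseteq> I_par n n" and m: "(a + 1) div 2 = int (card J) - int t" and t: "t \<le> card J"
  shows "wide_middle a J \<longleftrightarrow> int (jnth (I_par n n) J (Suc t)) - int (jnth (I_par n n) J t) \<ge> 2"
proof -
  let ?q = "jnth (I_par n n) J"
  have rho: "\<rho> J x = (a + 1) div 2 \<longleftrightarrow> ?q t < n - x \<and> n - x \<le> ?q (Suc t)" if "x < n" for x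
    unfolding rho_count[OF J that] m using jnth_count[OF J t, of "n - x"] that by auto
  have qn: "?q (Suc t) \<le> n"
  proof (cases "t = card J")
    case True
    have "Max (I_par n n) = n - 1" using n by (intro Max_eqI) (auto simp: I_par_last)
    then show ?thesis using True n by (simp add: jnth_def)
  next
    case False
    have "sorted_list_of_set J ! t \<in> J"
      using nth_mem[of t "sorted_list_of_set J"] False t finite_subset[OF J C.finite_I] by simp
    then show ?thesis using False t J by (auto simp: jnth_def I_iff subset_iff)
  qed
  show ?thesis
  proof
    assume "wide_middle a J"
    then obtain x where "Suc x < n" "\<rho> J x = (a + 1) div 2" "\<rho> J (Suc x) = (a + 1) div 2"
      by (auto simp: wide_middle_def)
    then have "?q t < n - Suc x" "n - x \<le> ?q (Suc t)" "n - Suc x < n - x" using rho[of x] rho[of "Suc x"] by auto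
    then show "int (?q (Suc t)) - int (?q t) \<ge> 2" by linarith
  next
    assume gap: "int (?q (Suc t)) - int (?q t) \<ge> 2"
    let ?x = "n - ?q (Suc t)"
    have "Suc ?x < n" "n - ?x = ?q (Suc t)" "n - Suc ?x = ?q (Suc t) - 1" using gap qn by auto
    then show "wide_middle a J" unfolding wide_middle_def using gap rho[of ?x] rho[of "Suc ?x"]
      by (intro exI[of _ ?x]) auto
  qed
qed

text \<open>Alternatives (i) and (ii) are the cases where \<open>card J\<close> equals the corrected
  level \<open>a\<close> or exceeds it by one. The bounds \<open>n - 3\<close> and
  \<open>n - 4\<close> follow from the gap.\<close>

lemma criteria_Dn_iff:
  assumes b: "0 \<le> b" and Jne: "J \<noteq> {}" and J: "J \<subseteq> I_par n n"
  defines "a \<equiv> b + of_bool (n - 1 \<in> J)"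
  shows "criteria_Dn n b J \<longleftrightarrow> (int (card J) = a \<or> int (card J) = a + 1) \<and> wide_middle a J"
proof -
  let ?p = "int (card J)"
  let ?q = "\<lambda>s. int (jnth (I_par n n) J (nat s))"
  have fin: "finite J" using finite_subset[OF J C.finite_I] .
  have p: "1 \<le> ?p" using Jne fin by (simp add: Suc_le_eq card_gt_0_iff)
  have a0: "0 \<le> a" using b by (simp add: a_def)
  have gap: "wide_middle a J \<longleftrightarrow> ?q s - ?q (s - 1) \<ge> 2"
    if s: "s = ?p - (a + 1) div 2 + 1" and pa: "?p = a \<or> ?p = a + 1" for s
  proof -
    have "(a + 1) div 2 \<le> ?p" "0 \<le> (a + 1) div 2" using pa p a0 by auto
    then obtain t where t: "int t = ?p - (a + 1) div 2" "t \<le> card J"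
      using nonneg_int_cases[of "?p - (a + 1) div 2"] by (metis diff_ge_0_iff_ge le_diff_eq add.right_neutral of_nat_le_iff diff_le_eq le_add_same_cancel1)
    have "nat s = Suc t" "nat (s - 1) = t" using s t by auto
    then show ?thesis using wide_middle_gap[OF J _ t(2), of a] t(1) by simp
  qed
  \<comment> \<open>The label inside the wide block is missing from \<open>J\<close>. If
    \<open>n - 1\<close> is missing too, it is a second absent label, unless the block starts at 0
    and then \<open>a = 0\<close>.\<close>
  have bound: "?p \<le> int n - 2 \<and> (n - 1 \<notin> J \<longrightarrow> ?p \<le> int n - 3 \<or> a = 0)" if w: "wide_middle a J"
  proof -
    obtain x where x: "Suc x < n" "\<rho> J x = (a + 1) div 2" "\<rho> J (Suc x) = (a + 1) div 2"
      using w by (auto simp: wide_middle_def)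
    then have nx: "n - Suc x \<notin> J" by (auto simp: C.rho_simps)
    have "J \<subseteq> {1..<n} - {n - Suc x}" using J nx by (auto simp: I_par_last)
    then have "card J \<le> card ({1..<n} - {n - Suc x})" by (intro card_mono) auto
    also have "\<dots> = n - 1 - 1" using x by (subst card_Diff_singleton) auto
    finally have 1: "?p \<le> int n - 2" using n by linarith
    have "?p \<le> int n - 3 \<or> a = 0" if n1: "n - 1 \<notin> J"
    proof (cases "x = 0")
      case True
      then have "(a + 1) div 2 = 0" using x(2) by (simp add: C.rho_simps)
      then show ?thesis using a0 by auto
    next
      case False
      have "J \<subseteq> {1..<n} - {n - Suc x, n - 1}" using J nx n1 by (auto simp: I_par_last)
      then have "card J \<le> card ({1..<n} - {n - Suc x, n - 1})" by (intro card_mono) auto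
      also have "\<dots> = n - 1 - 2" using x False by (subst card_Diff_subset) auto
      finally show ?thesis using n by linarith
    qed
    then show ?thesis using 1 by blast
  qed
  \<comment> \<open>The ceilings rewritten through the middle value m = (a + 1) div 2: for p = a the
    index is p - m + 1, and for p = a + 1 it is p - m. Both name the gap between
    \<open>j_(p-m)\<close> and its successor.\<close>
  have c1: "\<lceil>(real_of_int ?p + 1) / 2\<rceil> = ?p - (?p + 1) div 2 + 1"
    using ceiling_divide_eq_div[of "?p + 1" 2, where ?'a = real] by (simp, presburger?)
  have c2: "\<lceil>real_of_int ?p / 2\<rceil> = ?p - ?p div 2"
    using ceiling_divide_eq_div[of ?p 2, where ?'a = real] by (simp, presburger?)
  have "criteria_Dn n b J \<longleftrightarrow>
     (b \<le> int n - 3 \<and> ?p = a \<and> ?q (?p - (?p + 1) div 2 + 1) - ?q (?p - (?p + 1) div 2 + 1 - 1) \<ge> 2) \<or>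
     (b \<le> int n - 4 \<and> ?p = a + 1 \<and> ?q (?p - ?p div 2 + 1) - ?q (?p - ?p div 2) \<ge> 2)"
    unfolding criteria_Dn_def Let_def c1 c2 a_def by (cases "n - 1 \<in> J") auto
  also have "\<dots> \<longleftrightarrow> (b \<le> int n - 3 \<and> ?p = a \<and> wide_middle a J) \<or> (b \<le> int n - 4 \<and> ?p = a + 1 \<and> wide_middle a J)"
  proof (intro arg_cong2[where f = "(\<or>)"] conj_cong refl)
    assume "?p = a"
    then show "?q (?p - (?p + 1) div 2 + 1) - ?q (?p - (?p + 1) div 2 + 1 - 1) \<ge> 2 \<longleftrightarrow> wide_middle a J"
      using gap[of "?p - (?p + 1) div 2 + 1"] by simp
  next
    assume pa: "?p = a + 1"
    have "wide_middle a J \<longleftrightarrow> ?q (?p - ?p div 2 + 1) - ?q (?p - ?p div 2 + 1 - 1) \<ge> 2"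
      by (rule gap) (use pa in simp_all)
    then show "?q (?p - ?p div 2 + 1) - ?q (?p - ?p div 2) \<ge> 2 \<longleftrightarrow> wide_middle a J"
      unfolding add_diff_cancel_right' by blast
  qed
  also have "\<dots> \<longleftrightarrow> (?p = a \<or> ?p = a + 1) \<and> wide_middle a J"
    using bound p n b by (cases "n - 1 \<in> J") (auto simp: a_def)
  finally show ?thesis .
qed

theorem classified_Dn: "classified (vectorsD n) (I_par n n) (criteria_Dn n)"
proof (rule classifiedI)
  fix \<Phi> J assume *: "lowering_closed (vectorsD n) (I_par n n) \<Phi>" "J = raising_labels (vectorsD n) (I_par n n) \<Phi>"
    "\<Phi> \<noteq> {}" "\<Phi> \<noteq> vectorsD n"
  have JI: "J \<subseteq> I_par n n" using *(2) by (auto simp: raising_labels_def)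
  note L = level_of_ideal[OF *]
  have "criteria_Dn n (max_level J \<Phi>) J" using criteria_Dn_iff[OF L(6,3) JI] L(4,5) by blast
  then show "\<Phi> = {c \<in> vectorsD n. (\<Sum>j\<in>J. c j) \<le> max_level J \<Phi>} \<and> 0 \<le> max_level J \<Phi> \<and> J \<noteq> {} \<and>
      criteria_Dn n (max_level J \<Phi>) J" using L by blast
next
  fix a J assume *: "0 \<le> a" "J \<noteq> {}" "J \<subseteq> I_par n n" "criteria_Dn n a J"
  have "(int (card J) = a + of_bool (n - 1 \<in> J) \<or> int (card J) = a + of_bool (n - 1 \<in> J) + 1)"
    "wide_middle (a + of_bool (n - 1 \<in> J)) J" "0 \<le> a + of_bool (n - 1 \<in> J)"
    using criteria_Dn_iff[OF *(1-3)] *(1,4) by auto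
  from ideal_of_level[OF *(3) this(3,1,2)]
  show "max_level J {c \<in> vectorsD n. (\<Sum>j\<in>J. c j) \<le> a} = a \<and>
      raising_labels (vectorsD n) (I_par n n) {c \<in> vectorsD n. (\<Sum>j\<in>J. c j) \<le> a} = J" by simp
qed

end

section \<open>Quadrics: types B and D\<close>

text \<open>It suffices to guess, for each proper ideal, an admissible pair of which it is the level
  set. Realization then shows that the guess is the pair attached to the ideal.\<close>

lemma classified_levelsI:
  assumes ideals: "\<And>\<Phi>. lowering_closed E I \<Phi> \<Longrightarrow> \<Phi> \<noteq> {} \<Longrightarrow> \<Phi> \<noteq> E \<Longrightarrow>
      \<exists>a J. 0 \<le> a \<and> J \<noteq> {} \<and> J \<subseteq> I \<and> P a J \<and> \<Phi> = {c \<in> E. (\<Sum>j\<in>J. c j) \<le> a}"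
    and real: "\<And>a J. 0 \<le> a \<Longrightarrow> J \<noteq> {} \<Longrightarrow> J \<subseteq> I \<Longrightarrow> P a J \<Longrightarrow>
      max_level J {c \<in> E. (\<Sum>j\<in>J. c j) \<le> a} = a \<and> raising_labels E I {c \<in> E. (\<Sum>j\<in>J. c j) \<le> a} = J"
  shows "classified E I P"
proof (rule classifiedI)
  fix \<Phi> J assume *: "lowering_closed E I \<Phi>" "J = raising_labels E I \<Phi>" "\<Phi> \<noteq> {}" "\<Phi> \<noteq> E"
  obtain a J' where J': "0 \<le> a" "J' \<noteq> {}" "J' \<subseteq> I" "P a J'" "\<Phi> = {c \<in> E. (\<Sum>j\<in>J'. c j) \<le> a}"
    using ideals[OF *(1,3,4)] by blast
  have "max_level J' \<Phi> = a" "J = J'" using real[OF J'(1-4)] J'(5) *(2) by auto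
  then show "\<Phi> = {c \<in> E. (\<Sum>j\<in>J. c j) \<le> max_level J \<Phi>} \<and> 0 \<le> max_level J \<Phi> \<and> J \<noteq> {} \<and> P (max_level J \<Phi>) J"
    using J' by blast
qed (use real in blast)

lemma unit_inj: "unit j = unit k \<Longrightarrow> j = k"
proof -
  assume "unit j = unit k"
  then have "unit j j = unit k j" by simp
  then show "j = k" by (simp add: unit_def split: if_splits)
qed

lemma sum_add_unit: "j \<in> {1..n} \<Longrightarrow> (\<Sum>k = 1..n. (c + unit j) k) = (\<Sum>k = 1..n. c k) + 1"
  by (simp add: sum.distrib unit_def)

text \<open>The degree-one roots of \<open>B\<^sub>n / P\<^sub>1\<close> form a chain.\<close>

definition rootB :: "nat \<Rightarrow> nat \<Rightarrow> nat \<Rightarrow> int" where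
  "rootB n m = (\<lambda>j. if 1 \<le> j \<and> j \<le> n then of_bool (j \<le> Suc m) + of_bool (2 * n \<le> m + j) else 0)"

text \<open>The labels along the chain are 2, ..., n followed by n, ..., 2.\<close>

lemma rootB_Suc:
  assumes "Suc m < 2 * n - 1"
  shows "rootB n (Suc m) = rootB n m + unit (if m + 2 \<le> n then m + 2 else 2 * n - 1 - m)"
  using assms by (auto simp: rootB_def unit_def fun_eq_iff)

text \<open>The height of the m-th vector is m + 1, so adding a unit vector advances the index by
  one; the label is then forced.\<close>

lemma rootB_step:
  assumes m: "m < 2 * n - 1" "m' < 2 * n - 1" and j: "j \<in> {1..n}" and eq: "rootB n m' = rootB n m + unit j"
  shows "m' = Suc m \<and> j = (if m + 2 \<le> n then m + 2 else 2 * n - 1 - m)"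
proof -
  have n: "1 \<le> n" using m by auto
  have "m < 2 * n - 1 \<Longrightarrow> (\<Sum>k = 1..n. rootB n m k) = int m + 1" for m
  proof (induction m)
    case 0
    have "(\<Sum>k = 1..n. rootB n 0 k) = (\<Sum>k = 1..n. if k = 1 then 1 else 0)"
      using n by (intro sum.cong) (auto simp: rootB_def)
    also have "\<dots> = 1" using n by (subst sum.delta) auto
    finally show ?case by simp
  next
    case (Suc m)
    have "(if m + 2 \<le> n then m + 2 else 2 * n - 1 - m) \<in> {1..n}" using Suc.prems by auto
    then show ?case using sum_add_unit[of _ n "rootB n m"] rootB_Suc[OF Suc.prems] Suc by simp
  qed
  then have "m' = Suc m" using sum_add_unit[OF j, of "rootB n m"] eq m by fastforce
  then have "rootB n m + unit j = rootB n m + unit (if m + 2 \<le> n then m + 2 else 2 * n - 1 - m)"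
    using rootB_Suc[of m n] m eq by simp
  then show ?thesis using unit_inj \<open>m' = Suc m\<close> by simp
qed

lemma classified_B:
  assumes n: "2 \<le> n"
  shows "classified (rootB n ` {..<2 * n - 1}) (I_par n 1) criteria_B1"
proof (rule classified_levelsI)
  have I: "I_par n 1 = {2..n}" by (auto simp: I_par_def)
  fix \<Phi> assume low: "lowering_closed (rootB n ` {..<2 * n - 1}) (I_par n 1) \<Phi>" and ne: "\<Phi> \<noteq> {}" "\<Phi> \<noteq> rootB n ` {..<2 * n - 1}"
  have \<Phi>: "\<Phi> \<subseteq> rootB n ` {..<2 * n - 1}" using low by (simp add: lowering_closed_def)
  have down: "rootB n m \<in> \<Phi>" if m: "rootB n (Suc m) \<in> \<Phi>" "Suc m < 2 * n - 1" for m
  proof -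
    let ?j = "if m + 2 \<le> n then m + 2 else 2 * n - 1 - m"
    have "?j \<in> I_par n 1" using m(2) I by auto
    moreover have "rootB n (Suc m) - unit ?j = rootB n m" using rootB_Suc[OF m(2)] by simp
    ultimately show ?thesis
      using low[unfolded lowering_closed_def, THEN conjunct2, rule_format, OF m(1), of ?j] m(2) by simp
  qed
  define M where "M = (LEAST m. m < 2 * n - 1 \<and> rootB n m \<notin> \<Phi>)"
  have "\<exists>m. m < 2 * n - 1 \<and> rootB n m \<notin> \<Phi>" using \<Phi> ne(2) by auto
  then have M: "M < 2 * n - 1" "rootB n M \<notin> \<Phi>" unfolding M_def using LeastI_ex[of "\<lambda>m. m < 2 * n - 1 \<and> rootB n m \<notin> \<Phi>"] by auto
  have below: "rootB n m \<in> \<Phi>" if "m < M" for m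
    using not_less_Least[of m "\<lambda>m. m < 2 * n - 1 \<and> rootB n m \<notin> \<Phi>"] that M(1) unfolding M_def by auto
  have above: "rootB n m \<notin> \<Phi>" if "M \<le> m" "m < 2 * n - 1" for m
    using that
  proof (induction m rule: dec_induct)
    case (step m)
    then show ?case using down[of m] by auto
  qed (use M in simp)
  have mem: "rootB n m \<in> \<Phi> \<longleftrightarrow> m < M" if "m < 2 * n - 1" for m using below above that by (meson not_le)
  have M0: "0 < M" using ne(1) \<Phi> mem by force
  \<comment> \<open>\<open>j\<close> labels the step from \<open>M - 1\<close> to \<open>M\<close>,
    the first one out of the ideal, and \<open>a\<close> is the coefficient at \<open>j\<close>
    before it: 0 on the way up to \<open>n\<close>, 1 on the way back.\<close>
  define j where "j = (if M \<le> n - 1 then M + 1 else 2 * n - M)"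
  define a :: int where "a = (if M \<le> n - 1 then 0 else 1)"
  have "rootB n m j \<le> a \<longleftrightarrow> m < M" if "m < 2 * n - 1" for m
    using that M(1) M0 n by (auto simp: rootB_def j_def a_def)
  then have "\<Phi> = {c \<in> rootB n ` {..<2 * n - 1}. (\<Sum>j\<in>{j}. c j) \<le> a}" using \<Phi> mem by auto
  moreover have "j \<in> I_par n 1" using M(1) M0 n I by (auto simp: j_def)
  ultimately show "\<exists>a J. 0 \<le> a \<and> J \<noteq> {} \<and> J \<subseteq> I_par n 1 \<and> criteria_B1 a J \<and>
      \<Phi> = {c \<in> rootB n ` {..<2 * n - 1}. (\<Sum>j\<in>J. c j) \<le> a}"
    by (intro exI[of _ a] exI[of _ "{j}"]) (simp add: a_def criteria_B1_def)
next
  have I: "I_par n 1 = {2..n}" by (auto simp: I_par_def)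
  fix a J assume *: "0 \<le> a" "J \<noteq> {}" "J \<subseteq> I_par n 1" "criteria_B1 a J"
  then obtain j where "J = {j}" "a \<le> 1" by (auto simp: criteria_B1_def)
  then have a: "a = 0 \<or> a = 1" using *(1) by linarith
  from \<open>J = {j}\<close> have j: "J = {j}" "2 \<le> j" "j \<le> n" using *(3) unfolding I by auto
  \<comment> \<open>The number of chain elements before the first (a = 0) or the second (a = 1) step
    labelled \<open>j\<close>.\<close>
  define M where "M = (if a = 0 then j - 1 else 2 * n - j)"
  define \<Phi> where "\<Phi> = {c \<in> rootB n ` {..<2 * n - 1}. (\<Sum>j\<in>J. c j) \<le> a}"
  have lev: "rootB n m j \<le> a \<longleftrightarrow> m < M" if "m < 2 * n - 1" for m
    using that j a by (auto simp: rootB_def M_def)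
  have M: "0 < M" "M < 2 * n - 1" using j by (auto simp: M_def)
  have mem: "rootB n m \<in> \<Phi> \<longleftrightarrow> m < M" if "m < 2 * n - 1" for m
    using lev[OF that] that by (auto simp: \<Phi>_def j)
  have "max_level J \<Phi> = a"
    unfolding max_level_def
  proof (rule Max_eqI)
    show "finite ((\<lambda>c. \<Sum>j\<in>J. c j) ` \<Phi>)" by (simp add: \<Phi>_def)
    show "\<And>y. y \<in> (\<lambda>c. \<Sum>j\<in>J. c j) ` \<Phi> \<Longrightarrow> y \<le> a" by (auto simp: \<Phi>_def)
    have "rootB n (M - 1) j = a" using j a by (auto simp: rootB_def M_def)
    moreover have "rootB n (M - 1) \<in> \<Phi>" using mem[of "M - 1"] M by simp
    ultimately show "a \<in> (\<lambda>c. \<Sum>j\<in>J. c j) ` \<Phi>" by (intro image_eqI[of _ _ "rootB n (M - 1)"]) (simp_all add: j)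
  qed
  moreover have "raising_labels (rootB n ` {..<2 * n - 1}) (I_par n 1) \<Phi> = J"
  proof
    show "raising_labels (rootB n ` {..<2 * n - 1}) (I_par n 1) \<Phi> \<subseteq> J"
    proof
      fix k assume "k \<in> raising_labels (rootB n ` {..<2 * n - 1}) (I_par n 1) \<Phi>"
      then obtain c where c: "k \<in> I_par n 1" "c \<in> \<Phi>" "c + unit k \<in> rootB n ` {..<2 * n - 1}" "c + unit k \<notin> \<Phi>"
        by (auto simp: raising_labels_def)
      then obtain m where m: "c = rootB n m" "m < 2 * n - 1" by (auto simp: \<Phi>_def)
      obtain m' where m': "rootB n m' = rootB n m + unit k" "m' < 2 * n - 1" using c(3) m by (metis imageE lessThan_iff)
      have k: "m' = Suc m \<and> k = (if m + 2 \<le> n then m + 2 else 2 * n - 1 - m)"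
        using rootB_step[OF m(2) m'(2) _ m'(1)] c(1) I by auto
      have "m < M" "\<not> m' < M" using mem[OF m(2)] mem[OF m'(2)] c(2,4) m(1) m'(1) by auto
      then have "m = M - 1" using k by auto
      then show "k \<in> J" using k j a M by (auto simp: M_def)
    qed
    have "Suc (M - 1) < 2 * n - 1" using M by simp
    from rootB_Suc[OF this] have "rootB n M = rootB n (M - 1) + unit j" using j a M by (auto simp: M_def)
    then have "rootB n (M - 1) + unit j \<in> rootB n ` {..<2 * n - 1} - \<Phi>" using M mem[OF M(2)] by (metis DiffI imageI lessThan_iff less_irrefl)
    moreover have "rootB n (M - 1) \<in> \<Phi>" using mem[of "M - 1"] M by simp
    ultimately show "J \<subseteq> raising_labels (rootB n ` {..<2 * n - 1}) (I_par n 1) \<Phi>"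
      using j I unfolding raising_labels_def by auto
  qed
  ultimately show "max_level J {c \<in> rootB n ` {..<2 * n - 1}. (\<Sum>j\<in>J. c j) \<le> a} = a \<and>
      raising_labels (rootB n ` {..<2 * n - 1}) (I_par n 1) {c \<in> rootB n ` {..<2 * n - 1}. (\<Sum>j\<in>J. c j) \<le> a} = J"
    unfolding \<Phi>_def by blast
qed

text \<open>The degree-one roots of \<open>D\<^sub>n / P\<^sub>1\<close> form two chains joined by a square, whose two middle
  elements have the indices \<open>n - 2\<close> and \<open>n - 1\<close>.\<close>

definition rootQ :: "nat \<Rightarrow> nat \<Rightarrow> nat \<Rightarrow> int" where
  "rootQ n m = (\<lambda>j. if j = n then of_bool (n - 1 \<le> m)
     else if j = n - 1 then of_bool (n - 2 \<le> m \<and> m \<noteq> n - 1)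
     else if 1 \<le> j \<and> j < n then of_bool (j \<le> Suc m) + of_bool (2 * n - 1 \<le> m + j) else 0)"

text \<open>The labelled covering relations of the poset: an ascending chain, the square with
  corners n - 3, n - 2, n - 1, n, and a second chain. The bound on the indices is imposed where the
  relation is used.\<close>

definition edgeQ :: "nat \<Rightarrow> nat \<Rightarrow> nat \<Rightarrow> nat \<Rightarrow> bool" where
  "edgeQ n m m' j \<longleftrightarrow> (m' = Suc m \<and> m \<le> n - 3 \<and> j = m + 2) \<or> (m = n - 3 \<and> m' = n - 1 \<and> j = n) \<or>
     (m = n - 2 \<and> m' = n \<and> j = n) \<or> (m = n - 1 \<and> m' = n \<and> j = n - 1) \<or>
     (n \<le> m \<and> m' = Suc m \<and> j = 2 * n - 2 - m)"

lemma rootQ_edge: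
  assumes n: "4 \<le> n" and m: "m' < 2 * n - 2" and e: "edgeQ n m m' j"
  shows "rootQ n m' = rootQ n m + unit j"
proof
  fix k
  obtain q where q: "n = q + 4" using n by (metis add.commute le_Suc_ex)
  show "rootQ n m' k = (rootQ n m + unit j) k"
    using e m unfolding q edgeQ_def rootQ_def unit_def of_bool_def plus_fun_apply by (elim disjE conjE) auto
qed

lemma edgeQ_label: "4 \<le> n \<Longrightarrow> m' < 2 * n - 2 \<Longrightarrow> edgeQ n m m' j \<Longrightarrow> 2 \<le> j \<and> j \<le> n \<and> m < 2 * n - 2"
  by (auto simp: edgeQ_def)

lemma rootQ_height:
  assumes n: "4 \<le> n"
  shows "m < 2 * n - 2 \<Longrightarrow> (\<Sum>k = 1..n. rootQ n m k) = (if m \<le> n - 2 then int m + 1 else if m = n - 1 then int n - 1 else int m)"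
proof -
  have inc: "(\<Sum>k = 1..n. rootQ n m' k) = (\<Sum>k = 1..n. rootQ n m k) + 1" if "edgeQ n m m' j" "m' < 2 * n - 2" for m m' j
    unfolding rootQ_edge[OF n that(2,1)] using edgeQ_label[OF n that(2,1)] by (intro sum_add_unit) auto
  have base: "(\<Sum>k = 1..n. rootQ n 0 k) = 1"
  proof -
    have "(\<Sum>k = 1..n. rootQ n 0 k) = (\<Sum>k = 1..n. if k = 1 then 1 else 0)"
      using n by (intro sum.cong) (auto simp: rootQ_def)
    also have "\<dots> = 1" using n by (subst sum.delta) auto
    finally show ?thesis .
  qed
  have low: "m \<le> n - 2 \<Longrightarrow> (\<Sum>k = 1..n. rootQ n m k) = int m + 1" for m
  proof (induction m)
    case (Suc m)
    have "m \<le> n - 3" "Suc m < 2 * n - 2" using Suc.prems n by linarith+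
    then show ?case using inc[of m "Suc m" "m + 2"] Suc by (simp add: edgeQ_def)
  qed (use base in simp)
  have mid: "(\<Sum>k = 1..n. rootQ n (n - 1) k) = int n - 1"
    using inc[of "n - 3" "n - 1" n] low[of "n - 3"] n by (simp add: edgeQ_def)
  have high: "n \<le> m \<Longrightarrow> m < 2 * n - 2 \<Longrightarrow> (\<Sum>k = 1..n. rootQ n m k) = int m" for m
  proof (induction m rule: dec_induct)
    case base
    then show ?case using inc[of "n - 2" n n] low[of "n - 2"] n by (simp add: edgeQ_def)
  next
    case (step m)
    then show ?case using inc[of m "Suc m" "2 * n - 2 - m"] by (simp add: edgeQ_def)
  qed
  assume "m < 2 * n - 2"
  then show ?thesis using low[of m] mid high[of m] n by auto
qed

text \<open>Only the indices n - 2 and n - 1 share a height, so an increase of the height by one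
  leaves precisely the index pairs of the edges. Such a pair determines the label.\<close>

lemma rootQ_step:
  assumes n: "4 \<le> n" and m: "m < 2 * n - 2" "m' < 2 * n - 2" and j: "j \<in> {1..n}" and eq: "rootQ n m' = rootQ n m + unit j"
  shows "edgeQ n m m' j"
proof -
  have h: "(if m' \<le> n - 2 then int m' + 1 else if m' = n - 1 then int n - 1 else int m') =
      (if m \<le> n - 2 then int m + 1 else if m = n - 1 then int n - 1 else int m) + 1"
    using sum_add_unit[OF j, of "rootQ n m"] rootQ_height[OF n m(1)] rootQ_height[OF n m(2)] eq by simp
  have "\<exists>k. edgeQ n m m' k"
  proof -
    have "(m' = Suc m \<and> m \<le> n - 3) \<or> (m = n - 3 \<and> m' = n - 1) \<or> (m = n - 2 \<and> m' = n) \<or>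
      (m = n - 1 \<and> m' = n) \<or> (n \<le> m \<and> m' = Suc m)"
      using h n m by (auto split: if_splits)
    then show ?thesis unfolding edgeQ_def by blast
  qed
  then obtain k where k: "edgeQ n m m' k" by blast
  then have "rootQ n m + unit j = rootQ n m + unit k" using rootQ_edge[OF n m(2) k] eq by simp
  then have "j = k" using unit_inj by simp
  then show ?thesis using k by simp
qed

text \<open>Splits the admissible pairs in the way in which the ideals are split in
  \<open>levelQ_eq\<close>.\<close>

lemma criteria_D1_cases:
  assumes "4 \<le> n" "0 \<le> a" "J \<noteq> {}" "J \<subseteq> I_par n 1"
  shows "criteria_D1 n a J \<longleftrightarrow>
    (\<exists>j. 2 \<le> j \<and> j \<le> n - 2 \<and> J = {j} \<and> (a = 0 \<or> a = 1)) \<or> (J = {n - 1} \<and> a = 0) \<or> (J = {n} \<and> a = 0) \<or>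
    (J = {n - 1, n} \<and> (a = 0 \<or> a = 1))"
proof
  assume c: "criteria_D1 n a J"
  have a: "a = 0 \<or> a = 1" using c assms(2) unfolding criteria_D1_def by linarith
  have I: "\<And>j. J = {j} \<Longrightarrow> 2 \<le> j \<and> j \<le> n" using assms(4) by (auto simp: I_par_def)
  from a show "(\<exists>j. 2 \<le> j \<and> j \<le> n - 2 \<and> J = {j} \<and> (a = 0 \<or> a = 1)) \<or> (J = {n - 1} \<and> a = 0) \<or> (J = {n} \<and> a = 0) \<or>
    (J = {n - 1, n} \<and> (a = 0 \<or> a = 1))"
  proof
    assume a0: "a = 0"
    then consider j where "J = {j}" | "J = {n - 1, n}" using c unfolding criteria_D1_def by auto
    then show ?thesis
    proof cases
      case (1 j)
      then have "2 \<le> j" "j \<le> n - 2 \<or> j = n - 1 \<or> j = n" using I by force+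
      then show ?thesis using 1 a0 by auto
    qed (use a0 in simp)
  next
    assume "a = 1"
    then show ?thesis using c I unfolding criteria_D1_def by auto
  qed
qed (auto simp: criteria_D1_def)

definition levelQ :: "nat \<Rightarrow> nat set \<Rightarrow> int \<Rightarrow> nat set" where
  "levelQ n J a = {m. m < 2 * n - 2 \<and> (\<Sum>j\<in>J. rootQ n m j) \<le> a}"

text \<open>As the indices list the poset almost linearly, each of these ideals is an initial
  segment of indices, apart from the one that contains n - 1 but not n - 2.\<close>

lemma levelQ_eq:
  assumes n: "4 \<le> n"
  shows "2 \<le> j \<Longrightarrow> j \<le> n - 2 \<Longrightarrow> levelQ n {j} 0 = {..<j - 1}"
    "2 \<le> j \<Longrightarrow> j \<le> n - 2 \<Longrightarrow> levelQ n {j} 1 = {..<2 * n - 1 - j}"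
    "levelQ n {n - 1} 0 = insert (n - 1) {..<n - 2}"
    "levelQ n {n} 0 = {..<n - 1}"
    "levelQ n {n - 1, n} 0 = {..<n - 2}"
    "levelQ n {n - 1, n} 1 = {..<n}"
  using n by (auto simp: levelQ_def rootQ_def of_bool_def split: if_splits)

text \<open>Reduces a realization to a check on the diagram: the level \<open>a\<close> is attained,
  and the edges leaving \<open>L\<close> carry exactly the labels in \<open>J\<close>.\<close>

lemma level_real:
  assumes n: "4 \<le> n" and L: "L = levelQ n J a" and J: "J \<subseteq> I_par n 1"
    and att: "\<exists>m\<in>L. (\<Sum>j\<in>J. rootQ n m j) = a"
    and sub: "\<And>m m' j. m \<in> L \<Longrightarrow> m' \<notin> L \<Longrightarrow> m' < 2 * n - 2 \<Longrightarrow> edgeQ n m m' j \<Longrightarrow> j \<in> J"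
    and ex: "\<And>j. j \<in> J \<Longrightarrow> \<exists>m m'. m \<in> L \<and> m' \<notin> L \<and> m' < 2 * n - 2 \<and> edgeQ n m m' j"
  shows "max_level J {c \<in> rootQ n ` {..<2 * n - 2}. (\<Sum>j\<in>J. c j) \<le> a} = a \<and>
    raising_labels (rootQ n ` {..<2 * n - 2}) (I_par n 1) {c \<in> rootQ n ` {..<2 * n - 2}. (\<Sum>j\<in>J. c j) \<le> a} = J"
proof -
  let ?E = "rootQ n ` {..<2 * n - 2}"
  define \<Phi> where "\<Phi> = {c \<in> ?E. (\<Sum>j\<in>J. c j) \<le> a}"
  have mem: "rootQ n m \<in> \<Phi> \<longleftrightarrow> m \<in> L" if "m < 2 * n - 2" for m
    using that by (auto simp: \<Phi>_def L levelQ_def)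
  have "max_level J \<Phi> = a"
    unfolding max_level_def
  proof (rule Max_eqI)
    show "finite ((\<lambda>c. \<Sum>j\<in>J. c j) ` \<Phi>)" by (simp add: \<Phi>_def)
    show "\<And>y. y \<in> (\<lambda>c. \<Sum>j\<in>J. c j) ` \<Phi> \<Longrightarrow> y \<le> a" by (auto simp: \<Phi>_def)
    obtain m where "m \<in> L" "(\<Sum>j\<in>J. rootQ n m j) = a" using att by blast
    then show "a \<in> (\<lambda>c. \<Sum>j\<in>J. c j) ` \<Phi>"
      using mem[of m] by (intro image_eqI[of _ _ "rootQ n m"]) (auto simp: L levelQ_def)
  qed
  moreover have "raising_labels ?E (I_par n 1) \<Phi> = J"
  proof
    show "raising_labels ?E (I_par n 1) \<Phi> \<subseteq> J"
    proof
      fix j assume "j \<in> raising_labels ?E (I_par n 1) \<Phi>"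
      then obtain c where c: "j \<in> I_par n 1" "c \<in> \<Phi>" "c + unit j \<in> ?E" "c + unit j \<notin> \<Phi>"
        by (auto simp: raising_labels_def)
      obtain m where m: "c = rootQ n m" "m < 2 * n - 2" using c(2) by (auto simp: \<Phi>_def)
      obtain m' where m': "rootQ n m' = rootQ n m + unit j" "m' < 2 * n - 2" using c(3) m by (metis imageE lessThan_iff)
      have "edgeQ n m m' j" using rootQ_step[OF n m(2) m'(2) _ m'(1)] c(1) by (auto simp: I_par_def)
      moreover have "m \<in> L" "m' \<notin> L" using mem[OF m(2)] mem[OF m'(2)] c(2,4) m(1) m'(1) by auto
      ultimately show "j \<in> J" using sub m'(2) by blast
    qed
    show "J \<subseteq> raising_labels ?E (I_par n 1) \<Phi>"
    proof
      fix j assume j: "j \<in> J"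
      then obtain m m' where m: "m \<in> L" "m' \<notin> L" "m' < 2 * n - 2" "edgeQ n m m' j" using ex by blast
      have "m < 2 * n - 2" using m(1) by (simp add: L levelQ_def)
      then have "rootQ n m \<in> \<Phi>" "rootQ n m' \<notin> \<Phi>" using mem m by auto
      then have "rootQ n m + unit j \<in> ?E - \<Phi>"
        unfolding rootQ_edge[OF n m(3,4), symmetric] using m(3) by simp
      then show "j \<in> raising_labels ?E (I_par n 1) \<Phi>"
        using \<open>rootQ n m \<in> \<Phi>\<close> j J unfolding raising_labels_def by blast
    qed
  qed
  ultimately show ?thesis unfolding \<Phi>_def by blast
qed

lemma classified_D1:
  assumes n: "4 \<le> n"
  shows "classified (rootQ n ` {..<2 * n - 2}) (I_par n 1) (criteria_D1 n)"
proof (rule classified_levelsI)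
  let ?E = "rootQ n ` {..<2 * n - 2}"
  fix \<Phi> assume low: "lowering_closed ?E (I_par n 1) \<Phi>" and ne: "\<Phi> \<noteq> {}" "\<Phi> \<noteq> ?E"
  have \<Phi>: "\<Phi> \<subseteq> ?E" using low by (simp add: lowering_closed_def)
  have down: "rootQ n m \<in> \<Phi>" if m: "rootQ n m' \<in> \<Phi>" "m' < 2 * n - 2" "edgeQ n m m' j" for m m' j
  proof -
    note l = edgeQ_label[OF n m(2,3)]
    have "j \<in> I_par n 1" using l by (simp add: I_par_def)
    moreover have "rootQ n m' - unit j = rootQ n m" using rootQ_edge[OF n m(2,3)] by simp
    ultimately show ?thesis
      using low[unfolded lowering_closed_def, THEN conjunct2, rule_format, OF m(1), of j] l by simp
  qed
  define L where "L = {m. m < 2 * n - 2 \<and> rootQ n m \<in> \<Phi>}"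
  have L: "m \<in> L" if "m' \<in> L" "edgeQ n m m' j" for m m' j
    using down[of m' m j] edgeQ_label[OF n _ that(2)] that by (auto simp: L_def)
  have L1: "m \<in> L" if "Suc m \<in> L" "m \<le> n - 3 \<or> n \<le> m" for m
    using L[OF that(1), of m "m + 2"] L[OF that(1), of m "2 * n - 2 - m"] that(2) by (auto simp: edgeQ_def)
  have L2: "n - 3 \<in> L" if "n - 1 \<in> L" using L[OF that, of "n - 3" n] by (simp add: edgeQ_def)
  have L3: "n - 2 \<in> L" "n - 1 \<in> L" if "n \<in> L"
    using L[OF that, of "n - 2" n] L[OF that, of "n - 1" "n - 1"] by (simp_all add: edgeQ_def)
  have below: "m \<in> L" if "m' \<in> L" "m \<le> m'" "m' \<le> n - 2" for m m'
    using that(2,1,3) by (induction rule: inc_induct) (auto intro: L1)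
  have above: "m \<in> L" if "m' \<in> L" "m \<le> m'" "n \<le> m" for m m'
    using that(2,1,3) by (induction rule: inc_induct) (auto intro: L1)
  have bd: "m \<in> L \<Longrightarrow> m < 2 * n - 2" for m by (simp add: L_def)
  have Lne: "L \<noteq> {}" "L \<noteq> {..<2 * n - 2}" using ne \<Phi> by (auto simp: L_def)
  have levels: "\<exists>a J. 0 \<le> a \<and> J \<noteq> {} \<and> J \<subseteq> I_par n 1 \<and> criteria_D1 n a J \<and> L = levelQ n J a"
  proof -
    have crit: "\<exists>a J. 0 \<le> a \<and> J \<noteq> {} \<and> J \<subseteq> I_par n 1 \<and> criteria_D1 n a J \<and> L = levelQ n J a"
      if "0 \<le> a" "J \<noteq> {}" "J \<subseteq> {2..n}" "L = levelQ n J a"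
        "(\<exists>j. 2 \<le> j \<and> j \<le> n - 2 \<and> J = {j} \<and> (a = 0 \<or> a = 1)) \<or> (J = {n - 1} \<and> a = 0) \<or> (J = {n} \<and> a = 0) \<or>
          (J = {n - 1, n} \<and> (a = 0 \<or> a = 1))" for a J
    proof -
      have JI: "J \<subseteq> I_par n 1" using that(3) by (auto simp: I_par_def)
      have "criteria_D1 n a J" unfolding criteria_D1_cases[OF n that(1,2) JI] by (rule that(5))
      then show ?thesis using that(1,2,4) JI by (intro exI[of _ a] exI[of _ J] conjI)
    qed
    \<comment> \<open>The first index outside the ideal determines it, up to the choice at M = n -
      2, where the incomparable index n - 1 may or may not belong.\<close>
    define M where "M = (LEAST m. m \<notin> L)"
    have "2 * n - 2 \<notin> L" using bd by blast
    then have M: "M \<notin> L" "M \<le> 2 * n - 2"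
      unfolding M_def using LeastI[of "\<lambda>m. m \<notin> L"] Least_le[of "\<lambda>m. m \<notin> L"] by blast+
    have bM: "m < M \<Longrightarrow> m \<in> L" for m unfolding M_def using not_less_Least by blast
    have M2: "M < 2 * n - 2" using Lne(2) bM bd M(2) by (metis lessThan_iff order_le_less set_eq_subset subsetI)
    have M0: "0 < M"
    proof (rule ccontr)
      assume "\<not> 0 < M"
      then have z: "0 \<notin> L" using M by simp
      have lowm: "m \<notin> L" if "m \<le> n - 2" for m using below[of m 0] that z by auto
      have v: "n - 1 \<notin> L" using L2 lowm[of "n - 3"] by auto
      have "n \<notin> L" using L3 v by blast
      then have "m \<notin> L" if "n \<le> m" for m using above[of m n] that by auto
      moreover have "m \<le> n - 2 \<or> m = n - 1 \<or> n \<le> m" for m by linarith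
      ultimately have "L = {}" using lowm v by blast
      then show False using Lne(1) by simp
    qed
    have LM: "L = {..<M}" if Mne: "M \<noteq> n - 2"
    proof -
      have "m \<notin> L" if mM: "M < m" for m
      proof
        assume m: "m \<in> L"
        show False
        proof (cases "n \<le> M")
          case True
          then show False using above[OF m, of M] mM M(1) by simp
        next
          case False
          have "M \<noteq> n - 1 \<or> n \<le> m" using mM by linarith
          consider "m \<le> n - 2" | "m = n - 1" | "n \<le> m" by linarith
          then show False
          proof cases
            case 1
            then show False using below[OF m _ 1, of M] mM M(1) by simp
          next
            case 2
            then have "M \<le> n - 3" using mM Mne by linarith
            moreover have "n - 3 \<in> L" using L2 2 m by simp
            moreover have "n - 3 \<le> n - 2" by linarith
            ultimately show False using below M(1) by blast
          next
            case 3
            have nL: "n \<in> L" using above[OF m 3] by simp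
            then have "n - 2 \<in> L" "n - 1 \<in> L" using L3 by blast+
            moreover have "M = n - 1 \<or> M \<le> n - 2" using False by linarith
            ultimately show False using below[of "n - 2" M] M(1) by blast
          qed
        qed
      qed
      then show ?thesis using bM M(1) by (metis lessThan_iff linorder_neqE_nat set_eqI)
    qed
    consider "M \<le> n - 3" | "M = n - 2" "n - 1 \<notin> L" | "M = n - 2" "n - 1 \<in> L" | "M = n - 1" | "M = n" | "n < M" by linarith
    then show ?thesis
    proof cases
      case 1
      then have "L = levelQ n {M + 1} 0" using LM levelQ_eq(1)[OF n, of "M + 1"] M0 n by simp
      then show ?thesis using 1 M0 n by (intro crit[of 0 "{M + 1}"]) auto
    next
      case 2
      have "m \<notin> L" if "M < m" for m
      proof -
        have "n \<notin> L" using L3 2 by blast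
        then have "n \<le> m \<Longrightarrow> m \<notin> L" using above[of m n] by auto
        moreover have "m = n - 1 \<or> n \<le> m" using that 2 by linarith
        ultimately show ?thesis using 2 by blast
      qed
      then have "L = {..<n - 2}" using bM M(1) 2(1) by (metis lessThan_iff linorder_neqE_nat set_eqI)
      then have "L = levelQ n {n - 1, n} 0" using levelQ_eq(5)[OF n] by simp
      then show ?thesis using n by (intro crit[of 0 "{n - 1, n}"]) auto
    next
      case 3
      have "n \<notin> L" using L3 3(1) M(1) by blast
      then have "n \<le> m \<Longrightarrow> m \<notin> L" for m using above[of m n] by auto
      then have "m \<in> L \<longleftrightarrow> m < n - 2 \<or> m = n - 1" for m
        using bM[of m] 3 M(1) by (cases "m < n - 2"; cases "n \<le> m"; cases "m = n - 2") auto
      then have "L = levelQ n {n - 1} 0" using levelQ_eq(3)[OF n] by auto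
      then show ?thesis using n by (intro crit[of 0 "{n - 1}"]) auto
    next
      case 4
      then have "L = levelQ n {n} 0" using LM levelQ_eq(4)[OF n] n by simp
      then show ?thesis using n by (intro crit[of 0 "{n}"]) auto
    next
      case 5
      then have "L = levelQ n {n - 1, n} 1" using LM levelQ_eq(6)[OF n] n by simp
      then show ?thesis using n by (intro crit[of 1 "{n - 1, n}"]) auto
    next
      case 6
      then have "L = levelQ n {2 * n - 1 - M} 1" using LM levelQ_eq(2)[OF n, of "2 * n - 1 - M"] M2 n by simp
      then show ?thesis using 6 M2 n by (intro crit[of 1 "{2 * n - 1 - M}"]) auto
    qed
  qed
  then obtain a J where aJ: "0 \<le> a \<and> J \<noteq> {} \<and> J \<subseteq> I_par n 1 \<and> criteria_D1 n a J" "L = levelQ n J a" by blast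
  have "rootQ n m \<in> \<Phi> \<longleftrightarrow> (\<Sum>j\<in>J. rootQ n m j) \<le> a" if "m < 2 * n - 2" for m
    using aJ(2) that by (auto simp: L_def levelQ_def)
  then have "\<Phi> = {c \<in> ?E. (\<Sum>j\<in>J. c j) \<le> a}" using \<Phi> by auto
  then show "\<exists>a J. 0 \<le> a \<and> J \<noteq> {} \<and> J \<subseteq> I_par n 1 \<and> criteria_D1 n a J \<and> \<Phi> = {c \<in> ?E. (\<Sum>j\<in>J. c j) \<le> a}"
    using aJ(1) by blast
next
  let ?E = "rootQ n ` {..<2 * n - 2}"
  fix a J assume *: "0 \<le> a" "J \<noteq> {}" "J \<subseteq> I_par n 1" "criteria_D1 n a J"
  from *(4) have "(\<exists>j. 2 \<le> j \<and> j \<le> n - 2 \<and> J = {j} \<and> (a = 0 \<or> a = 1)) \<or> (J = {n - 1} \<and> a = 0) \<or> (J = {n} \<and> a = 0) \<or>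
    (J = {n - 1, n} \<and> (a = 0 \<or> a = 1))"
    unfolding criteria_D1_cases[OF n *(1-3)] .
  then consider j where "2 \<le> j" "j \<le> n - 2" "J = {j}" "a = 0" | j where "2 \<le> j" "j \<le> n - 2" "J = {j}" "a = 1" |
    "J = {n - 1}" "a = 0" | "J = {n}" "a = 0" | "J = {n - 1, n}" "a = 0" | "J = {n - 1, n}" "a = 1" by blast
  then show "max_level J {c \<in> ?E. (\<Sum>j\<in>J. c j) \<le> a} = a \<and>
      raising_labels ?E (I_par n 1) {c \<in> ?E. (\<Sum>j\<in>J. c j) \<le> a} = J"
  proof cases
    case (1 j)
    show ?thesis
    proof (rule level_real[OF n _ *(3)])
      show L: "{..<j - 1} = levelQ n J a" using 1 levelQ_eq(1)[OF n] by simp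
      show "\<exists>m\<in>{..<j - 1}. (\<Sum>j\<in>J. rootQ n m j) = a" using 1 n by (intro bexI[of _ "0"]) (auto simp: rootQ_def)
    next
      fix m m' k assume "m \<in> {..<j - 1}" "m' \<notin> {..<j - 1}" "m' < 2 * n - 2" "edgeQ n m m' k"
      then have "k = j"
        using 1 n unfolding edgeQ_def insert_iff lessThan_iff by (elim disjE conjE) arith+
      then show "k \<in> J" using 1 by simp
    next
      fix k assume "k \<in> J"
      then have "k = j" using 1 by simp
      moreover have "edgeQ n (j - 2) (j - 1) (j)" using 1 n unfolding edgeQ_def by (intro disjI1 conjI; linarith)
      moreover have "j - 2 \<in> {..<j - 1}" "j - 1 \<notin> {..<j - 1}" "j - 1 < 2 * n - 2"
        using 1 n by auto
      ultimately show "\<exists>m m'. m \<in> {..<j - 1} \<and> m' \<notin> {..<j - 1} \<and> m' < 2 * n - 2 \<and> edgeQ n m m' k"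
        by blast
    qed
  next
    case (2 j)
    show ?thesis
    proof (rule level_real[OF n _ *(3)])
      show L: "{..<2 * n - 1 - j} = levelQ n J a" using 2 levelQ_eq(2)[OF n] by simp
      show "\<exists>m\<in>{..<2 * n - 1 - j}. (\<Sum>j\<in>J. rootQ n m j) = a" using 2 n by (intro bexI[of _ "n"]) (auto simp: rootQ_def)
    next
      fix m m' k assume "m \<in> {..<2 * n - 1 - j}" "m' \<notin> {..<2 * n - 1 - j}" "m' < 2 * n - 2" "edgeQ n m m' k"
      then have "k = j"
        using 2 n unfolding edgeQ_def insert_iff lessThan_iff by (elim disjE conjE) arith+
      then show "k \<in> J" using 2 by simp
    next
      fix k assume "k \<in> J"
      then have "k = j" using 2 by simp
      moreover have "edgeQ n (2 * n - 2 - j) (2 * n - 1 - j) (j)" using 2 n unfolding edgeQ_def by (intro disjI2 conjI; linarith)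
      moreover have "2 * n - 2 - j \<in> {..<2 * n - 1 - j}" "2 * n - 1 - j \<notin> {..<2 * n - 1 - j}" "2 * n - 1 - j < 2 * n - 2"
        using 2 n by auto
      ultimately show "\<exists>m m'. m \<in> {..<2 * n - 1 - j} \<and> m' \<notin> {..<2 * n - 1 - j} \<and> m' < 2 * n - 2 \<and> edgeQ n m m' k"
        by blast
    qed
  next
    case 3
    show ?thesis
    proof (rule level_real[OF n _ *(3)])
      show L: "insert (n - 1) {..<n - 2} = levelQ n J a" using 3 levelQ_eq(3)[OF n] by simp
      show "\<exists>m\<in>insert (n - 1) {..<n - 2}. (\<Sum>j\<in>J. rootQ n m j) = a" using 3 n by (intro bexI[of _ "0"]) (auto simp: rootQ_def)
    next
      fix m m' k assume "m \<in> insert (n - 1) {..<n - 2}" "m' \<notin> insert (n - 1) {..<n - 2}" "m' < 2 * n - 2" "edgeQ n m m' k"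
      then have "k = n - 1"
        using 3 n unfolding edgeQ_def insert_iff lessThan_iff by (elim disjE conjE) arith+
      then show "k \<in> J" using 3 by simp
    next
      fix k assume "k \<in> J"
      then have "k = n - 1" using 3 by simp
      moreover have "edgeQ n (n - 3) (n - 2) (n - 1)" using 3 n unfolding edgeQ_def by (intro disjI1 conjI; linarith)
      moreover have "n - 3 \<in> insert (n - 1) {..<n - 2}" "n - 2 \<notin> insert (n - 1) {..<n - 2}" "n - 2 < 2 * n - 2"
        using 3 n by auto
      ultimately show "\<exists>m m'. m \<in> insert (n - 1) {..<n - 2} \<and> m' \<notin> insert (n - 1) {..<n - 2} \<and> m' < 2 * n - 2 \<and> edgeQ n m m' k"
        by blast
    qed
  next
    case 4
    show ?thesis
    proof (rule level_real[OF n _ *(3)])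
      show L: "{..<n - 1} = levelQ n J a" using 4 levelQ_eq(4)[OF n] by simp
      show "\<exists>m\<in>{..<n - 1}. (\<Sum>j\<in>J. rootQ n m j) = a" using 4 n by (intro bexI[of _ "0"]) (auto simp: rootQ_def)
    next
      fix m m' k assume "m \<in> {..<n - 1}" "m' \<notin> {..<n - 1}" "m' < 2 * n - 2" "edgeQ n m m' k"
      then have "k = n"
        using 4 n unfolding edgeQ_def insert_iff lessThan_iff by (elim disjE conjE) arith+
      then show "k \<in> J" using 4 by simp
    next
      fix k assume "k \<in> J"
      then have "k = n" using 4 by simp
      moreover have "edgeQ n (n - 2) (n) (n)" using 4 n unfolding edgeQ_def by simp
      moreover have "n - 2 \<in> {..<n - 1}" "n \<notin> {..<n - 1}" "n < 2 * n - 2"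
        using 4 n by auto
      ultimately show "\<exists>m m'. m \<in> {..<n - 1} \<and> m' \<notin> {..<n - 1} \<and> m' < 2 * n - 2 \<and> edgeQ n m m' k"
        by blast
    qed
  next
    case 5
    show ?thesis
    proof (rule level_real[OF n _ *(3)])
      show L: "{..<n - 2} = levelQ n J a" using 5 levelQ_eq(5)[OF n] by simp
      show "\<exists>m\<in>{..<n - 2}. (\<Sum>j\<in>J. rootQ n m j) = a" using 5 n by (intro bexI[of _ "0"]) (auto simp: rootQ_def)
    next
      fix m m' k assume "m \<in> {..<n - 2}" "m' \<notin> {..<n - 2}" "m' < 2 * n - 2" "edgeQ n m m' k"
      then have "k = n - 1 \<or> k = n"
        using 5 n unfolding edgeQ_def insert_iff lessThan_iff by (elim disjE conjE) arith+
      then show "k \<in> J" using 5 by simp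
    next
      fix k assume "k \<in> J"
      then have "k = n - 1 \<or> k = n" using 5 by simp
      moreover have "edgeQ n (n - 3) (n - 2) (n - 1)" using 5 n unfolding edgeQ_def by (intro disjI1 conjI; linarith)
      moreover have "edgeQ n (n - 3) (n - 1) (n)" using 5 n unfolding edgeQ_def by simp
      moreover have "n - 3 \<in> {..<n - 2}" "n - 2 \<notin> {..<n - 2}" "n - 2 < 2 * n - 2" "n - 3 \<in> {..<n - 2}" "n - 1 \<notin> {..<n - 2}" "n - 1 < 2 * n - 2"
        using 5 n by auto
      ultimately show "\<exists>m m'. m \<in> {..<n - 2} \<and> m' \<notin> {..<n - 2} \<and> m' < 2 * n - 2 \<and> edgeQ n m m' k"
        by blast
    qed
  next
    case 6
    show ?thesis
    proof (rule level_real[OF n _ *(3)])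
      show L: "{..<n} = levelQ n J a" using 6 levelQ_eq(6)[OF n] by simp
      show "\<exists>m\<in>{..<n}. (\<Sum>j\<in>J. rootQ n m j) = a" using 6 n by (intro bexI[of _ "n - 1"]) (auto simp: rootQ_def)
    next
      fix m m' k assume "m \<in> {..<n}" "m' \<notin> {..<n}" "m' < 2 * n - 2" "edgeQ n m m' k"
      then have "k = n - 1 \<or> k = n"
        using 6 n unfolding edgeQ_def insert_iff lessThan_iff by (elim disjE conjE) arith+
      then show "k \<in> J" using 6 by simp
    next
      fix k assume "k \<in> J"
      then have "k = n - 1 \<or> k = n" using 6 by simp
      moreover have "edgeQ n (n - 1) (n) (n - 1)" using 6 n unfolding edgeQ_def by simp
      moreover have "edgeQ n (n - 2) (n) (n)" using 6 n unfolding edgeQ_def by simp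
      moreover have "n - 1 \<in> {..<n}" "n \<notin> {..<n}" "n < 2 * n - 2" "n - 2 \<in> {..<n}" "n \<notin> {..<n}" "n < 2 * n - 2"
        using 6 n by auto
      ultimately show "\<exists>m m'. m \<in> {..<n} \<and> m' \<notin> {..<n} \<and> m' < 2 * n - 2 \<and> edgeQ n m m' k"
        by blast
    qed
  qed
qed

section \<open>Orbits of the simple roots under the Cartan matrix\<close>

definition pairing :: "dynkin \<Rightarrow> nat \<Rightarrow> (nat \<Rightarrow> int) \<Rightarrow> nat \<Rightarrow> int" where
  "pairing T n c j = (\<Sum>m = 1..n. c m * cartan_entry T n m j)"

definition srefl :: "dynkin \<Rightarrow> nat \<Rightarrow> nat \<Rightarrow> (nat \<Rightarrow> int) \<Rightarrow> nat \<Rightarrow> int" where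
  "srefl T n j c = (\<lambda>k. c k - (if k = j then pairing T n c j else 0))"

text \<open>Coefficient vectors of the roots, generated from the Cartan matrix alone, so that norms
  can be computed without reference to a Lie algebra.\<close>

inductive_set orbit :: "dynkin \<Rightarrow> nat \<Rightarrow> (nat \<Rightarrow> int) set" for T n where
  orbit_unit: "k \<in> {1..n} \<Longrightarrow> unit k \<in> orbit T n"
| orbit_refl: "c \<in> orbit T n \<Longrightarrow> j \<in> {1..n} \<Longrightarrow> srefl T n j c \<in> orbit T n"

definition supported :: "nat \<Rightarrow> (nat \<Rightarrow> int) \<Rightarrow> bool" where
  "supported n c \<longleftrightarrow> (\<forall>k. k \<notin> {1..n} \<longrightarrow> c k = 0)"

lemma orbit_supported: "c \<in> orbit T n \<Longrightarrow> supported n c"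
  by (induction rule: orbit.induct) (auto simp: supported_def unit_def srefl_def)

lemma pick: assumes "supported n c" shows "(\<Sum>m = 1..n. c m * of_bool (m = p)) = c p"
proof -
  have "(\<Sum>m = 1..n. c m * of_bool (m = p)) = (\<Sum>m = 1..n. if m = p then c m else 0)" by (intro sum.cong) auto
  also have "\<dots> = c p" using assms by (auto simp: sum.delta supported_def)
  finally show ?thesis .
qed

text \<open>A node has at most three neighbours \<open>p\<close>, \<open>q\<close>,
  \<open>r\<close>. Fewer are expressed by weight 0, and a neighbour 0 or n + 1 is harmless because
  \<open>c\<close> vanishes there.\<close>

lemma pairing_combination:
  assumes c: "supported n c" and e: "\<And>m. m \<in> {1..n} \<Longrightarrow> cartan_entry T n m j =
      2 * of_bool (m = j) - w * of_bool (m = p) - x * of_bool (m = q) - y * of_bool (m = r)"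
  shows "pairing T n c j = 2 * c j - w * c p - x * c q - y * c r"
proof -
  have "pairing T n c j = (\<Sum>m = 1..n. 2 * (c m * of_bool (m = j)) - w * (c m * of_bool (m = p)) -
      x * (c m * of_bool (m = q)) - y * (c m * of_bool (m = r)))"
    unfolding pairing_def by (intro sum.cong) (simp_all add: e right_diff_distrib mult.left_commute)
  then show ?thesis by (simp only: sum_subtractf sum_distrib_left[symmetric] pick[OF c])
qed

lemma pairing_A:
  assumes c: "supported n c" and j: "j \<in> {1..n}"
  shows "pairing TypeA n c j = 2 * c j - c (j - 1) - c (j + 1)"
  by (subst pairing_combination[OF c, of TypeA j 1 "j - 1" 1 "j + 1" 0 0]) (use j in auto)

lemma pairing_B:
  assumes c: "supported n c" and j: "j \<in> {1..n}" and n: "2 \<le> n"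
  shows "pairing TypeB n c j = (if j = n then 2 * c n - 2 * c (n - 1) else 2 * c j - c (j - 1) - c (j + 1))"
proof (cases "j = n")
  case True
  then show ?thesis
    by (subst pairing_combination[OF c, of TypeB j 2 "n - 1" 0 0 0 0]) (use j n in auto)
next
  case False
  then show ?thesis
    by (subst pairing_combination[OF c, of TypeB j 1 "j - 1" 1 "j + 1" 0 0]) (use j in auto)
qed

lemma pairing_C:
  assumes c: "supported n c" and j: "j \<in> {1..n}" and n: "2 \<le> n"
  shows "pairing TypeC n c j = (if j = n - 1 then 2 * c j - c (j - 1) - 2 * c n else 2 * c j - c (j - 1) - c (j + 1))"
proof (cases "j = n - 1")
  case True
  then show ?thesis
    by (subst pairing_combination[OF c, of TypeC j 1 "j - 1" 2 n 0 0]) (use j n in auto)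
next
  case False
  then show ?thesis
    by (subst pairing_combination[OF c, of TypeC j 1 "j - 1" 1 "j + 1" 0 0]) (use j in auto)
qed

lemma pairing_D:
  assumes c: "supported n c" and j: "j \<in> {1..n}" and n: "4 \<le> n"
  shows "pairing TypeD n c j = (if j = n then 2 * c n - c (n - 2) else if j = n - 1 then 2 * c j - c (n - 2)
    else if j = n - 2 then 2 * c j - c (j - 1) - c (n - 1) - c n else 2 * c j - c (j - 1) - c (j + 1))"
proof -
  obtain q where q: "n = q + 4" using n by (metis add.commute le_Suc_ex)
  note c' = c[unfolded q]
  consider "j = q + 4" | "j = q + 3" | "j = q + 2" | "j \<le> q + 1" using j q by fastforce
  then show ?thesis
  proof cases
    case 1
    then show ?thesis
      unfolding q
      by (subst pairing_combination[OF c', of TypeD j 1 "q + 2" 0 0 0 0]) (auto simp: doubleton_eq_iff add.commute[of 3 q] add.commute[of 4 q])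
  next
    case 2
    then show ?thesis
      unfolding q
      by (subst pairing_combination[OF c', of TypeD j 1 "q + 2" 0 0 0 0]) (auto simp: doubleton_eq_iff add.commute[of 3 q] add.commute[of 4 q])
  next
    case 3
    then show ?thesis
      unfolding q
      by (subst pairing_combination[OF c', of TypeD j 1 "q + 1" 1 "q + 3" 1 "q + 4"]) (auto simp: doubleton_eq_iff add.commute[of 3 q] add.commute[of 4 q])
  next
    case 4
    then show ?thesis
      unfolding q
      using j by (subst pairing_combination[OF c', of TypeD j 1 "j - 1" 1 "j + 1" 0 0]) (auto simp: doubleton_eq_iff add.commute[of 3 q] add.commute[of 4 q])
  qed
qed

text \<open>The coordinates of \<open>\<Sum> c\<^sub>k \<alpha>\<^sub>k\<close> in the orthonormal basis \<open>\<epsilon>\<^sub>1, \<epsilon>\<^sub>2, \<dots>\<close> of Bourbaki's tables, on which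
  the simple reflections act by signed permutations.\<close>

definition eps :: "dynkin \<Rightarrow> nat \<Rightarrow> (nat \<Rightarrow> int) \<Rightarrow> nat \<Rightarrow> int" where
  "eps T n c k = (case T of
     TypeC \<Rightarrow> (if k = n then 2 * c n else c k) - c (k - 1)
   | TypeD \<Rightarrow> (if k = n - 1 then c (n - 1) + c n else c k) - c (k - 1)
   | _ \<Rightarrow> c k - c (k - 1))"

text \<open>A simple reflection exchanges two coordinates up to sign. The case \<open>a = b\<close>
  serves reflections that change the sign of a single coordinate.\<close>

lemma sum_two_changes:
  fixes f f' :: "nat \<Rightarrow> int"
  assumes "finite K" "a \<in> K" "b \<in> K" "f' a = f b" "f' b = f a"
    and "\<And>k. k \<in> K \<Longrightarrow> k \<noteq> a \<Longrightarrow> k \<noteq> b \<Longrightarrow> f' k = f k"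
  shows "sum f' K = sum f K"
proof (cases "a = b")
  case True
  then show ?thesis using assms by (intro sum.cong) auto
next
  case False
  have K: "sum h K = h a + h b + sum h (K - {a, b})" for h :: "nat \<Rightarrow> int"
  proof -
    have "sum h K = sum h {a, b} + sum h (K - {a, b})"
      using assms(1-3) by (subst sum.subset_diff[of "{a, b}" K]) auto
    then show ?thesis using False by simp
  qed
  have "sum f' (K - {a, b}) = sum f (K - {a, b})" using assms(6) by (intro sum.cong) auto
  then show ?thesis using K[of f] K[of f'] assms(4,5) by simp
qed

lemma sum_two_points:
  fixes f :: "nat \<Rightarrow> int"
  assumes "finite K" "a \<in> K" "b \<in> K" "a \<noteq> b" "\<And>k. k \<in> K \<Longrightarrow> k \<noteq> a \<Longrightarrow> k \<noteq> b \<Longrightarrow> f k = 0"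
  shows "sum f K = f a + f b"
proof -
  have "sum f K = sum f {a, b}" using assms by (intro sum.mono_neutral_right) auto
  then show ?thesis using assms(4) by simp
qed

text \<open>There are n + 1 coordinates in type A. The sum of absolute values alone would allow
  \<plusminus>2 \<epsilon>_k, which is later excluded because the coordinates of a root sum to
  0.\<close>

lemma orbit_A_norm:
  assumes "1 \<le> n" shows "c \<in> orbit TypeA n \<Longrightarrow> (\<Sum>k = 1..n + 1. \<bar>eps TypeA n c k\<bar>) = 2"
proof (induction rule: orbit.induct)
  case (orbit_unit j)
  then show ?case by (subst sum_two_points[of _ j "j + 1"]) (auto simp: eps_def unit_def)
next
  case (orbit_refl c j)
  have s: "supported n c" by (rule orbit_supported[OF orbit_refl(1)])
  have "(\<Sum>k = 1..n + 1. \<bar>eps TypeA n (srefl TypeA n j c) k\<bar>) = (\<Sum>k = 1..n + 1. \<bar>eps TypeA n c k\<bar>)"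
    using orbit_refl(2) pairing_A[OF s orbit_refl(2)]
    by (intro sum_two_changes[of _ j "j + 1"]) (auto simp: eps_def srefl_def)
  then show ?case using orbit_refl.IH by simp
qed

text \<open>The two values are the squared lengths of short and long roots.\<close>

lemma orbit_B_norm:
  assumes n: "2 \<le> n" shows "c \<in> orbit TypeB n \<Longrightarrow> (\<Sum>k = 1..n. (eps TypeB n c k)\<^sup>2) \<in> {1, 2}"
proof (induction rule: orbit.induct)
  case (orbit_unit j)
  show ?case
  proof (cases "j = n")
    case True
    have "(\<Sum>k = 1..n. (eps TypeB n (unit j) k)\<^sup>2) = (\<Sum>k = 1..n. if k = n then 1 else 0)"
      using True by (intro sum.cong) (auto simp: eps_def unit_def)
    also have "\<dots> = 1" using n by (subst sum.delta) auto
    finally show ?thesis by simp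
  next
    case False
    then have "(\<Sum>k = 1..n. (eps TypeB n (unit j) k)\<^sup>2) = 2"
      using orbit_unit by (subst sum_two_points[of _ j "j + 1"]) (auto simp: eps_def unit_def)
    then show ?thesis by simp
  qed
next
  case (orbit_refl c j)
  have s: "supported n c" by (rule orbit_supported[OF orbit_refl(1)])
  have "(\<Sum>k = 1..n. (eps TypeB n (srefl TypeB n j c) k)\<^sup>2) = (\<Sum>k = 1..n. (eps TypeB n c k)\<^sup>2)"
  proof (cases "j = n")
    case True
    have "eps TypeB n (srefl TypeB n j c) n = - eps TypeB n c n"
      using pairing_B[OF s orbit_refl(2) n] True n by (simp add: eps_def srefl_def)
    then show ?thesis
    proof (intro sum_two_changes[of _ n n])
      show "(eps TypeB n (srefl TypeB n j c) k)\<^sup>2 = (eps TypeB n c k)\<^sup>2" if "k \<in> {1..n}" "k \<noteq> n" for k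
        using that True by (auto simp: eps_def srefl_def)
    qed (use n in auto)
  next
    case False
    then show ?thesis
      using orbit_refl(2) pairing_B[OF s orbit_refl(2) n]
      by (intro sum_two_changes[of _ j "j + 1"]) (auto simp: eps_def srefl_def)
  qed
  then show ?case using orbit_refl.IH by simp
qed

text \<open>The sum of absolute values is 2 for short and long roots alike, whereas their squared
  lengths differ.\<close>

lemma orbit_C_norm:
  assumes n: "2 \<le> n" shows "c \<in> orbit TypeC n \<Longrightarrow> (\<Sum>k = 1..n. \<bar>eps TypeC n c k\<bar>) = 2"
proof (induction rule: orbit.induct)
  case (orbit_unit j)
  show ?case
  proof (cases "j = n")
    case True
    have "(\<Sum>k = 1..n. \<bar>eps TypeC n (unit j) k\<bar>) = (\<Sum>k = 1..n. if k = n then 2 else 0)"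
      using True by (intro sum.cong) (auto simp: eps_def unit_def)
    also have "\<dots> = 2" using n by (subst sum.delta) auto
    finally show ?thesis by simp
  next
    case False
    then show ?thesis
      using orbit_unit by (subst sum_two_points[of _ j "j + 1"]) (auto simp: eps_def unit_def)
  qed
next
  case (orbit_refl c j)
  have s: "supported n c" by (rule orbit_supported[OF orbit_refl(1)])
  have "(\<Sum>k = 1..n. \<bar>eps TypeC n (srefl TypeC n j c) k\<bar>) = (\<Sum>k = 1..n. \<bar>eps TypeC n c k\<bar>)"
  proof (cases "j = n")
    case True
    have "c (Suc n) = 0" using s by (auto simp: supported_def)
    then have "eps TypeC n (srefl TypeC n j c) n = - eps TypeC n c n"
      using pairing_C[OF s orbit_refl(2) n] True n by (auto simp: eps_def srefl_def)
    then show ?thesis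
    proof (intro sum_two_changes[of _ n n])
      show "\<bar>eps TypeC n (srefl TypeC n j c) k\<bar> = \<bar>eps TypeC n c k\<bar>" if "k \<in> {1..n}" "k \<noteq> n" for k
        using that True by (auto simp: eps_def srefl_def)
    qed (use n in auto)
  next
    case False
    have "eps TypeC n (srefl TypeC n j c) j = eps TypeC n c (j + 1) \<and>
      eps TypeC n (srefl TypeC n j c) (j + 1) = eps TypeC n c j"
    proof (cases "j = n - 1")
      case True
      then have "j + 1 = n" "n - 1 - 1 \<noteq> n - 1" using n by simp_all
      then show ?thesis using True False pairing_C[OF s orbit_refl(2) n] by (simp add: eps_def srefl_def)
    next
      case F: False
      then have "j + 1 < n" "j - 1 \<noteq> j" using False orbit_refl(2) by auto
      then show ?thesis using F False orbit_refl(2) pairing_C[OF s orbit_refl(2) n] by (simp add: eps_def srefl_def)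
    qed
    then show ?thesis
    proof (intro sum_two_changes[of _ j "j + 1"])
      show "\<bar>eps TypeC n (srefl TypeC n j c) k\<bar> = \<bar>eps TypeC n c k\<bar>" if "k \<in> {1..n}" "k \<noteq> j" "k \<noteq> j + 1" for k
        using that False by (auto simp: eps_def srefl_def)
    qed (use False orbit_refl(2) in auto)
  qed
  then show ?case using orbit_refl.IH by simp
qed

text \<open>Squares are used here, since they rule out \<plusminus>2 \<epsilon>_k.\<close>

lemma orbit_D_norm:
  assumes n: "4 \<le> n" shows "c \<in> orbit TypeD n \<Longrightarrow> (\<Sum>k = 1..n. (eps TypeD n c k)\<^sup>2) = 2"
proof (induction rule: orbit.induct)
  case (orbit_unit j)
  show ?case
  proof (cases "j = n")
    case True
    then show ?thesis using n by (subst sum_two_points[of _ "n - 1" n]) (auto simp: eps_def unit_def)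
  next
    case False
    then show ?thesis
      using orbit_unit n by (subst sum_two_points[of _ j "j + 1"]) (auto simp: eps_def unit_def)
  qed
next
  case (orbit_refl c j)
  have s: "supported n c" by (rule orbit_supported[OF orbit_refl(1)])
  have "(\<Sum>k = 1..n. (eps TypeD n (srefl TypeD n j c) k)\<^sup>2) = (\<Sum>k = 1..n. (eps TypeD n c k)\<^sup>2)"
  proof (cases "j = n")
    case True
    have "eps TypeD n (srefl TypeD n j c) n = - eps TypeD n c (n - 1)"
      "eps TypeD n (srefl TypeD n j c) (n - 1) = - eps TypeD n c n"
      using pairing_D[OF s orbit_refl(2) n] True n by (auto simp: eps_def srefl_def numeral_2_eq_2)
    then show ?thesis
    proof (intro sum_two_changes[of _ "n - 1" n])
      show "(eps TypeD n (srefl TypeD n j c) k)\<^sup>2 = (eps TypeD n c k)\<^sup>2"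
        if "k \<in> {1..n}" "k \<noteq> n - 1" "k \<noteq> n" for k
        using that True by (auto simp: eps_def srefl_def)
    qed (use n in auto)
  next
    case False
    have "eps TypeD n (srefl TypeD n j c) j = eps TypeD n c (j + 1) \<and>
      eps TypeD n (srefl TypeD n j c) (j + 1) = eps TypeD n c j"
    proof -
      obtain q where q: "n = q + 4" using n by (metis add.commute le_Suc_ex)
      have jj: "j - 1 \<noteq> j" using orbit_refl(2) by auto
      consider "j = q + 3" | "j = q + 2" | "j \<le> q + 1" "1 \<le> j" using False orbit_refl(2) q by fastforce
      then show ?thesis
        using pairing_D[OF s orbit_refl(2) n] unfolding q using jj
        by cases (simp_all add: eps_def srefl_def add.commute[of 3 q] add.commute[of 4 q])
    qed
    then show ?thesis
    proof (intro sum_two_changes[of _ j "j + 1"])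
      show "(eps TypeD n (srefl TypeD n j c) k)\<^sup>2 = (eps TypeD n c k)\<^sup>2"
        if "k \<in> {1..n}" "k \<noteq> j" "k \<noteq> j + 1" for k
      proof -
        have "k - 1 \<noteq> j" using that by auto
        moreover have "j \<noteq> n" by (rule False)
        moreover have "k = n - 1 \<Longrightarrow> j \<noteq> n - 1" using that by simp
        ultimately show ?thesis using that by (auto simp: eps_def srefl_def)
      qed
    qed (use False orbit_refl(2) in auto)
  qed
  then show ?case using orbit_refl.IH by simp
qed

lemma abs_sum_one:
  fixes v :: "nat \<Rightarrow> int"
  assumes "finite K" "(\<Sum>k\<in>K. \<bar>v k\<bar>) = 1"
  obtains a where "a \<in> K" "\<bar>v a\<bar> = 1" "\<And>k. k \<in> K \<Longrightarrow> k \<noteq> a \<Longrightarrow> v k = 0"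
proof -
  obtain a where a: "a \<in> K" "v a \<noteq> 0" using assms(2) by (metis abs_0 sum.neutral zero_neq_one)
  have s: "\<bar>v a\<bar> + (\<Sum>k\<in>K - {a}. \<bar>v k\<bar>) = 1" using sum.remove[OF assms(1) a(1), of "\<lambda>k. \<bar>v k\<bar>"] assms(2) by simp
  have "0 \<le> (\<Sum>k\<in>K - {a}. \<bar>v k\<bar>)" by (rule sum_nonneg) simp
  then have "\<bar>v a\<bar> = 1" "(\<Sum>k\<in>K - {a}. \<bar>v k\<bar>) = 0" using s a(2) by linarith+
  then show ?thesis using that[of a] a(1) assms(1) by (simp add: sum_nonneg_eq_0_iff)
qed

lemma abs_sum_two:
  fixes v :: "nat \<Rightarrow> int"
  assumes fin: "finite K" and two: "(\<Sum>k\<in>K. \<bar>v k\<bar>) = 2"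
  obtains (double) a where "a \<in> K" "\<bar>v a\<bar> = 2" "\<And>k. k \<in> K \<Longrightarrow> k \<noteq> a \<Longrightarrow> v k = 0"
    | (single) a b where "a \<in> K" "b \<in> K" "a < b" "\<bar>v a\<bar> = 1" "\<bar>v b\<bar> = 1"
      "\<And>k. k \<in> K \<Longrightarrow> k \<noteq> a \<Longrightarrow> k \<noteq> b \<Longrightarrow> v k = 0"
proof -
  obtain a where a: "a \<in> K" "v a \<noteq> 0" using two by (metis abs_0 sum.neutral zero_neq_numeral)
  have s: "\<bar>v a\<bar> + (\<Sum>k\<in>K - {a}. \<bar>v k\<bar>) = 2" using sum.remove[OF fin a(1), of "\<lambda>k. \<bar>v k\<bar>"] two by simp
  have "0 \<le> (\<Sum>k\<in>K - {a}. \<bar>v k\<bar>)" by (rule sum_nonneg) simp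
  then consider "\<bar>v a\<bar> = 2" "(\<Sum>k\<in>K - {a}. \<bar>v k\<bar>) = 0" | "\<bar>v a\<bar> = 1" "(\<Sum>k\<in>K - {a}. \<bar>v k\<bar>) = 1"
    using s a(2) by linarith
  then show ?thesis
  proof cases
    case 1
    then show ?thesis using double[of a] a(1) fin by (simp add: sum_nonneg_eq_0_iff)
  next
    case 2
    obtain b where b: "b \<in> K - {a}" "\<bar>v b\<bar> = 1" "\<And>k. k \<in> K - {a} \<Longrightarrow> k \<noteq> b \<Longrightarrow> v k = 0"
      using abs_sum_one[OF _ 2(2)] fin by auto
    then show ?thesis using single[of a b] single[of b a] a(1) 2(1) by (cases "a < b") auto
  qed
qed

lemma square_eq_abs: fixes v :: "nat \<Rightarrow> int" assumes "finite K" "(\<Sum>k\<in>K. (v k)\<^sup>2) \<le> 2" "k \<in> K"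
  shows "\<bar>v k\<bar> \<le> 1" "(v k)\<^sup>2 = \<bar>v k\<bar>"
proof -
  have le: "(v k)\<^sup>2 \<le> 2" using member_le_sum[of k K "\<lambda>k. (v k)\<^sup>2"] assms by simp
  show 1: "\<bar>v k\<bar> \<le> 1"
  proof (rule ccontr)
    assume "\<not> \<bar>v k\<bar> \<le> 1"
    then have "2 * 2 \<le> \<bar>v k\<bar> * \<bar>v k\<bar>" by (intro mult_mono) auto
    then show False using le by (simp add: power2_eq_square)
  qed
  then have "v k = 0 \<or> v k = 1 \<or> v k = - 1" by linarith
  then show "(v k)\<^sup>2 = \<bar>v k\<bar>" by auto
qed

lemma square_sum_two:
  fixes v :: "nat \<Rightarrow> int"
  assumes fin: "finite K" and two: "(\<Sum>k\<in>K. (v k)\<^sup>2) = 2"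
  obtains a b where "a \<in> K" "b \<in> K" "a < b" "\<bar>v a\<bar> = 1" "\<bar>v b\<bar> = 1"
      "\<And>k. k \<in> K \<Longrightarrow> k \<noteq> a \<Longrightarrow> k \<noteq> b \<Longrightarrow> v k = 0"
proof -
  have h: "(\<Sum>k\<in>K. \<bar>v k\<bar>) = 2" using two square_eq_abs(2)[OF fin, of v] by simp
  show ?thesis
  proof (rule abs_sum_two[OF fin h])
    fix a assume "a \<in> K" "\<bar>v a\<bar> = 2"
    then show ?thesis using square_eq_abs(1)[OF fin, of v a] two by simp
  qed (rule that)
qed

lemma partial_sum_two:
  fixes v :: "nat \<Rightarrow> int"
  assumes "1 \<le> a" "a < b" "b \<le> N" "\<And>k. k \<in> {1..N} \<Longrightarrow> k \<noteq> a \<Longrightarrow> k \<noteq> b \<Longrightarrow> v k = 0"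
  shows "k \<le> N \<Longrightarrow> (\<Sum>m = 1..k. v m) = of_bool (a \<le> k) * v a + of_bool (b \<le> k) * v b"
proof (induction k)
  case 0
  then show ?case using assms by simp
next
  case (Suc k)
  then show ?case using assms by (cases "Suc k = a \<or> Suc k = b") (auto simp: le_Suc_eq)
qed

lemma partial_sum_one:
  fixes v :: "nat \<Rightarrow> int"
  assumes "1 \<le> a" "a \<le> N" "\<And>k. k \<in> {1..N} \<Longrightarrow> k \<noteq> a \<Longrightarrow> v k = 0"
  shows "k \<le> N \<Longrightarrow> (\<Sum>m = 1..k. v m) = of_bool (a \<le> k) * v a"
proof (induction k)
  case 0
  then show ?case using assms by simp
next
  case (Suc k)
  then show ?case using assms by (cases "Suc k = a") (auto simp: le_Suc_eq)
qed

text \<open>Recovers the coefficients of a root as partial sums of its coordinates.\<close>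

lemma telescope:
  fixes c v :: "nat \<Rightarrow> int" and k :: nat
  shows "c 0 = 0 \<Longrightarrow> (\<And>m. 1 \<le> m \<Longrightarrow> m \<le> k \<Longrightarrow> v m = c m - c (m - 1)) \<Longrightarrow> (\<Sum>m = 1..k. v m) = c k"
  by (induction k) auto

section \<open>Explicit degree-one roots\<close>

text \<open>What is retained of the set of roots: containment in the orbit bounds it from above, and
  the closure of root strings under raising bounds it from below.\<close>

locale root_vectors =
  fixes T :: dynkin and n :: nat and V :: "(nat \<Rightarrow> int) set" and i :: nat
  assumes orbit: "V \<subseteq> orbit T n"
    and i: "i \<in> {1..n}"
    and base: "unit i \<in> V"
    and raise: "c \<in> V \<Longrightarrow> c i = 1 \<Longrightarrow> j \<in> {1..n} \<Longrightarrow> j \<noteq> i \<Longrightarrow> 0 \<le> t \<Longrightarrow> t \<le> - pairing T n c j \<Longrightarrow>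
      (\<lambda>k. c k + t * unit j k) \<in> V"
begin

lemma supp: "c \<in> V \<Longrightarrow> supported n c" using orbit orbit_supported by blast

lemma raise_unit:
  assumes "c \<in> V" "c i = 1" "j \<in> {1..n}" "j \<noteq> i" "pairing T n c j \<le> - 1" shows "c + unit j \<in> V"
  using raise[OF assms(1-4), of 1] assms(5) by (simp add: plus_fun_def)

lemma zero: "c \<in> V \<Longrightarrow> c 0 = 0" "c \<in> V \<Longrightarrow> n < k \<Longrightarrow> c k = 0"
  using supp by (auto simp: supported_def)

end

lemma eps_sum_simple:
  assumes "T = TypeA \<or> T = TypeB" "c 0 = 0"
  shows "(\<Sum>m = 1..k. eps T n c m) = c k"
  by (rule telescope) (use assms in \<open>auto simp: eps_def\<close>)

lemma vectors_A:
  assumes "root_vectors TypeA n V i"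
  shows "c \<in> V \<Longrightarrow> c i \<le> 1"
    and "{c \<in> V. c i = 1} = (\<lambda>(x, y). rootA i x y) ` ({..<i} \<times> {..<n + 1 - i})"
proof -
  interpret root_vectors TypeA n V i by (rule assms)
  have n: "1 \<le> n" using i by simp
  have form: "\<exists>a b. 1 \<le> a \<and> a < b \<and> b \<le> n + 1 \<and> (\<exists>e. \<bar>e\<bar> = 1 \<and> (\<forall>k \<le> n + 1. c k = (of_bool (a \<le> k) - of_bool (b \<le> k)) * e))"
    if c: "c \<in> V" for c
  proof -
    have sum: "(\<Sum>m = 1..k. eps TypeA n c m) = c k" for k
      by (rule eps_sum_simple) (use zero c in auto)
    have norm: "(\<Sum>k = 1..n + 1. \<bar>eps TypeA n c k\<bar>) = 2" using orbit_A_norm[OF n] orbit c by blast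
    have last: "c (n + 1) = 0" using zero(2)[OF c] by simp
    show ?thesis
    proof (rule abs_sum_two[OF _ norm])
      \<comment> \<open>A single coordinate \<plusminus>2 would be the sum of all coordinates, which
        is \<open>c (n + 1) = 0\<close>.\<close>
      fix a assume a: "a \<in> {1..n + 1}" "\<bar>eps TypeA n c a\<bar> = 2" "\<And>k. k \<in> {1..n + 1} \<Longrightarrow> k \<noteq> a \<Longrightarrow> eps TypeA n c k = 0"
      have "(\<Sum>m = 1..n + 1. eps TypeA n c m) = of_bool (a \<le> n + 1) * eps TypeA n c a"
        by (rule partial_sum_one[where N = "n + 1"]) (use a(1) in simp, use a(1) in simp, rule a(3), simp_all)
      then have "c (n + 1) = of_bool (a \<le> n + 1) * eps TypeA n c a" by (simp only: sum)
      then show ?thesis using last a(1,2) by auto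
    next
      fix a b assume ab: "a \<in> {1..n + 1}" "b \<in> {1..n + 1}" "a < b" "\<bar>eps TypeA n c a\<bar> = 1" "\<bar>eps TypeA n c b\<bar> = 1"
        "\<And>k. k \<in> {1..n + 1} \<Longrightarrow> k \<noteq> a \<Longrightarrow> k \<noteq> b \<Longrightarrow> eps TypeA n c k = 0"
      have ck: "c k = of_bool (a \<le> k) * eps TypeA n c a + of_bool (b \<le> k) * eps TypeA n c b" if "k \<le> n + 1" for k
      proof -
        have "(\<Sum>m = 1..k. eps TypeA n c m) = of_bool (a \<le> k) * eps TypeA n c a + of_bool (b \<le> k) * eps TypeA n c b"
          using that by (intro partial_sum_two[where N = "n + 1"] ab(3,6)) (use ab(1,2) in auto)
        then show ?thesis by (simp only: sum)
      qed
      then have "eps TypeA n c b = - eps TypeA n c a" using ck[of "n + 1"] last ab by simp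
      then have "\<forall>k \<le> n + 1. c k = (of_bool (a \<le> k) - of_bool (b \<le> k)) * eps TypeA n c a"
        using ck by (simp add: left_diff_distrib)
      moreover have "1 \<le> a" "b \<le> n + 1" using ab(1,2) by simp_all
      ultimately show ?thesis using ab(3,4) by blast
    qed simp
  qed
  show "c i \<le> 1" if "c \<in> V" for c
  proof -
    obtain a b :: nat and e :: int where e: "\<bar>e\<bar> = 1" and ck: "\<forall>k \<le> n + 1. c k = (of_bool (a \<le> k) - of_bool (b \<le> k)) * e"
      using form[OF \<open>c \<in> V\<close>] by blast
    have "e = 1 \<or> e = - 1" using e by linarith
    moreover have "c i = (of_bool (a \<le> i) - of_bool (b \<le> i)) * e" using ck i by simp
    ultimately show ?thesis by (elim disjE) simp_all
  qed
  have sub: "c \<in> (\<lambda>(x, y). rootA i x y) ` ({..<i} \<times> {..<n + 1 - i})" if c: "c \<in> V" "c i = 1" for c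
  proof -
    obtain a b e where ab: "1 \<le> a" "a < b" "b \<le> n + 1" "\<bar>e\<bar> = 1"
      and ck: "\<And>k. k \<le> n + 1 \<Longrightarrow> c k = (of_bool (a \<le> k) - of_bool (b \<le> k)) * e" using form[OF c(1)] by blast
    have ai: "a \<le> i" "i < b" "e = 1"
    proof -
      have "1 = (of_bool (a \<le> i) - of_bool (b \<le> i)) * e" using ck[of i] i c(2) by simp
      moreover have "e = 1 \<or> e = - 1" using ab(4) by linarith
      ultimately show "a \<le> i" "i < b" "e = 1" using ab(2) by (auto simp: of_bool_def split: if_splits)
    qed
    have "c = rootA i (i - a) (b - 1 - i)"
    proof
      fix k
      show "c k = rootA i (i - a) (b - 1 - i) k"
        using ck[of k] zero(2)[OF c(1), of k] ai ab by (cases "k \<le> n + 1") (auto simp: rootA_def)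
    qed
    then show ?thesis using ai ab by (intro image_eqI[of _ _ "(i - a, b - 1 - i)"]) auto
  qed
  \<comment> \<open>All intervals are reached from \<open>unit i\<close> by growing to the left and
    afterwards to the right; at each end the Cartan integer is at most -1.\<close>
  have sup: "rootA i x y \<in> V" if "x < i" "y < n + 1 - i" for x y
  proof -
    have "rootA i x 0 \<in> V" using that(1)
    proof (induction x)
      case 0
      have "rootA i 0 0 = unit i" by (auto simp: rootA_def unit_def fun_eq_iff)
      then show ?case using base by simp
    next
      case (Suc x)
      let ?c = "rootA i x 0"
      have V: "?c \<in> V" using Suc by simp
      have j: "i - Suc x \<in> {1..n}" using Suc.prems i by auto
      have "pairing TypeA n ?c (i - Suc x) \<le> - 1"
        unfolding pairing_A[OF supp[OF V] j] using Suc.prems by (auto simp: rootA_def)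
      moreover have "?c i = 1" by (simp add: rootA_def)
      ultimately have "?c + unit (i - Suc x) \<in> V" using raise_unit[OF V _ j] Suc.prems by simp
      moreover have "?c + unit (i - Suc x) = rootA i (Suc x) 0"
        using Suc.prems by (auto simp: rootA_def unit_def fun_eq_iff)
      ultimately show ?case by simp
    qed
    then show ?thesis using that(2)
    proof (induction y)
      case (Suc y)
      let ?c = "rootA i x y"
      have V: "?c \<in> V" using Suc by simp
      have j: "i + Suc y \<in> {1..n}" using Suc.prems i by auto
      have "pairing TypeA n ?c (i + Suc y) \<le> - 1"
        unfolding pairing_A[OF supp[OF V] j] by (auto simp: rootA_def)
      moreover have "?c i = 1" by (simp add: rootA_def)
      ultimately have "?c + unit (i + Suc y) \<in> V" using raise_unit[OF V _ j] by simp
      moreover have "?c + unit (i + Suc y) = rootA i x (Suc y)" by (auto simp: rootA_def unit_def fun_eq_iff)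
      ultimately show ?case by simp
    qed
  qed
  show "{c \<in> V. c i = 1} = (\<lambda>(x, y). rootA i x y) ` ({..<i} \<times> {..<n + 1 - i})"
    using sub sup by (auto simp: rootA_def)
qed

lemma vectors_B:
  assumes n: "2 \<le> n" and rv: "root_vectors TypeB n V 1"
  shows "c \<in> V \<Longrightarrow> c 1 \<le> 1" and "{c \<in> V. c 1 = 1} = rootB n ` {..<2 * n - 1}"
proof -
  interpret root_vectors TypeB n V 1 by (rule rv)
  have sum: "(\<Sum>m = 1..k. eps TypeB n c m) = c k" if "c \<in> V" for c k
    by (rule eps_sum_simple) (use zero that in auto)
  have norm: "(\<Sum>k = 1..n. (eps TypeB n c k)\<^sup>2) = 1 \<or> (\<Sum>k = 1..n. (eps TypeB n c k)\<^sup>2) = 2" if "c \<in> V" for c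
    using orbit_B_norm[OF n, of c] orbit that by blast
  have c1: "eps TypeB n c 1 = c 1" if "c \<in> V" for c using zero(1)[OF that] by (simp add: eps_def)
  show "c 1 \<le> 1" if c: "c \<in> V" for c
    using square_eq_abs(1)[of "{1..n}" "eps TypeB n c" 1] norm[OF c] c1[OF c] n by force
  \<comment> \<open>The candidates are \<epsilon>_1, \<epsilon>_1 - \<epsilon>_b and \<epsilon>_1 +
    \<epsilon>_b, with chain indices n - 1, b - 2 and 2n - b.\<close>
  have sub: "c \<in> rootB n ` {..<2 * n - 1}" if c: "c \<in> V" "c 1 = 1" for c
    using norm[OF c(1)]
  proof
    assume "(\<Sum>k = 1..n. (eps TypeB n c k)\<^sup>2) = 1"
    then have "(\<Sum>k = 1..n. \<bar>eps TypeB n c k\<bar>) = 1" using square_eq_abs(2)[of "{1..n}" "eps TypeB n c"] by simp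
    then obtain a where a: "a \<in> {1..n}" "\<bar>eps TypeB n c a\<bar> = 1"
      "\<And>k. k \<in> {1..n} \<Longrightarrow> k \<noteq> a \<Longrightarrow> eps TypeB n c k = 0" using abs_sum_one[of "{1..n}"] by blast
    have "a = 1" using a(3)[of 1] c1[OF c(1)] c(2) n by force
    then have ck: "c k = of_bool (1 \<le> k)" if "k \<le> n" for k
      using partial_sum_one[of 1 n "eps TypeB n c" k] a that sum[OF c(1), of k] c1[OF c(1)] c(2) n by simp
    have "c = rootB n (n - 1)"
    proof
      fix k
      show "c k = rootB n (n - 1) k"
        using ck[of k] zero(2)[OF c(1), of k] n by (cases "k \<le> n") (auto simp: rootB_def)
    qed
    then show ?thesis using n by auto
  next
    assume "(\<Sum>k = 1..n. (eps TypeB n c k)\<^sup>2) = 2"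
    then obtain a b where ab: "a \<in> {1..n}" "b \<in> {1..n}" "a < b" "\<bar>eps TypeB n c a\<bar> = 1" "\<bar>eps TypeB n c b\<bar> = 1"
      "\<And>k. k \<in> {1..n} \<Longrightarrow> k \<noteq> a \<Longrightarrow> k \<noteq> b \<Longrightarrow> eps TypeB n c k = 0"
      by (rule square_sum_two[of "{1..n}" "eps TypeB n c", rotated]) auto
    have a1: "a = 1" using ab(6)[of 1] ab(1,3) c1[OF c(1)] c(2) n by force
    then have ck: "c k = of_bool (1 \<le> k) + of_bool (b \<le> k) * eps TypeB n c b" if "k \<le> n" for k
      using partial_sum_two[of 1 b n "eps TypeB n c" k] ab that sum[OF c(1), of k] c1[OF c(1)] c(2) by simp
    have "eps TypeB n c b = - 1 \<or> eps TypeB n c b = 1" using ab(5) by linarith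
    then show ?thesis
    proof
      assume e: "eps TypeB n c b = - 1"
      have "c = rootB n (b - 2)"
      proof
        fix k
        show "c k = rootB n (b - 2) k"
          using ck[of k] zero(2)[OF c(1), of k] e ab a1 by (cases "k \<le> n") (auto simp: rootB_def)
      qed
      then show ?thesis using ab by auto
    next
      assume e: "eps TypeB n c b = 1"
      have "c = rootB n (2 * n - b)"
      proof
        fix k
        show "c k = rootB n (2 * n - b) k"
          using ck[of k] zero(2)[OF c(1), of k] e ab a1 by (cases "k \<le> n") (auto simp: rootB_def)
      qed
      then show ?thesis using ab a1 by auto
    qed
  qed
  have r1: "rootB n m 1 = 1" if "m < 2 * n - 1" for m using that n by (auto simp: rootB_def)
  have low: "m \<le> n - 2 \<Longrightarrow> rootB n m \<in> V" for m
  proof (induction m)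
    case 0
    have "rootB n 0 = unit 1" using n by (auto simp: rootB_def unit_def fun_eq_iff)
    then show ?case using base by simp
  next
    case (Suc m)
    have V: "rootB n m \<in> V" using Suc by simp
    have j: "m + 2 \<in> {1..n}" "m + 2 \<noteq> n" using Suc.prems n by auto
    have "pairing TypeB n (rootB n m) (m + 2) \<le> - 1"
      unfolding pairing_B[OF supp[OF V] j(1) n] using Suc.prems j by (auto simp: rootB_def)
    then have "rootB n m + unit (m + 2) \<in> V" using raise_unit[OF V r1 j(1)] Suc.prems by simp
    moreover have "m + 2 \<le> n" "Suc m < 2 * n - 1" using Suc.prems n by linarith+
    then have "rootB n (Suc m) = rootB n m + unit (m + 2)" using rootB_Suc[of m n] by simp
    ultimately show ?case by (simp only:)
  qed
  \<comment> \<open>The string through the short simple root has three members. The last one must be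
    taken with t = 2, since the middle one has Cartan integer 0.\<close>
  have mid: "(\<lambda>k. rootB n (n - 2) k + t * unit n k) \<in> V" if "0 \<le> t" "t \<le> 2" for t
  proof -
    have V: "rootB n (n - 2) \<in> V" using low by simp
    have j: "n \<in> {1..n}" using n by simp
    have "pairing TypeB n (rootB n (n - 2)) n = - 2"
      unfolding pairing_B[OF supp[OF V] j n] using n by (auto simp: rootB_def)
    then show ?thesis using raise[OF V r1 j _ that(1)] that(2) n by simp
  qed
  have m1: "rootB n (n - 1) \<in> V"
  proof -
    have "(\<lambda>k. rootB n (n - 2) k + 1 * unit n k) = rootB n (n - 1)" using n by (auto simp: rootB_def unit_def fun_eq_iff)
    then show ?thesis using mid[of 1] by simp
  qed
  have high: "n \<le> m \<Longrightarrow> m < 2 * n - 1 \<Longrightarrow> rootB n m \<in> V" for m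
  proof (induction m rule: dec_induct)
    case base
    have "(\<lambda>k. rootB n (n - 2) k + 2 * unit n k) = rootB n n" using n by (auto simp: rootB_def unit_def fun_eq_iff)
    then show ?case using mid[of 2] by simp
  next
    case (step m)
    have V: "rootB n m \<in> V" using step by simp
    have j: "2 * n - 1 - m \<in> {1..n}" "2 * n - 1 - m \<noteq> n" "2 * n - 1 - m \<noteq> 1" using step by auto
    have "pairing TypeB n (rootB n m) (2 * n - 1 - m) \<le> - 1"
      unfolding pairing_B[OF supp[OF V] j(1) n] using step j by (auto simp: rootB_def)
    then have "rootB n m + unit (2 * n - 1 - m) \<in> V" using raise_unit[OF V r1 j(1,3)] step by simp
    moreover have "rootB n (Suc m) = rootB n m + unit (2 * n - 1 - m)" using rootB_Suc[of m n] step by simp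
    ultimately show ?case by (simp only:)
  qed
  have "rootB n m \<in> V" if "m < 2 * n - 1" for m
  proof -
    have "m \<le> n - 2 \<or> m = n - 1 \<or> n \<le> m" by linarith
    then show ?thesis using low m1 high that by blast
  qed
  then show "{c \<in> V. c 1 = 1} = rootB n ` {..<2 * n - 1}" using sub r1 by auto
qed

lemma vectors_C:
  assumes n: "2 \<le> n" and rv: "root_vectors TypeC n V n"
  shows "c \<in> V \<Longrightarrow> c n \<le> 1" and "{c \<in> V. c n = 1} = (\<lambda>(x, y). rootC n x y) ` ({..<n} \<times> {..<n})"
proof -
  interpret root_vectors TypeC n V n by (rule rv)
  \<comment> \<open>The partial sums give the coefficients except at \<open>n\<close>, where they
    give twice the last one. With total absolute value 2 this bounds \<open>c n\<close> by
    1.\<close>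
  have sum: "(\<Sum>m = 1..k. eps TypeC n c m) = (if k = n then 2 * c n else c k)" if "c \<in> V" "k \<le> n" for c k
  proof -
    have "(\<Sum>m = 1..k. eps TypeC n c m) = (c(n := 2 * c n)) k"
      by (rule telescope) (use zero that n in \<open>auto simp: eps_def\<close>)
    then show ?thesis by simp
  qed
  have norm: "(\<Sum>k = 1..n. \<bar>eps TypeC n c k\<bar>) = 2" if "c \<in> V" for c
    using orbit_C_norm[OF n, of c] orbit that by blast
  show "c n \<le> 1" if c: "c \<in> V" for c
  proof -
    have "2 * c n = (\<Sum>k = 1..n. eps TypeC n c k)" using sum[OF c order_refl] by simp
    also have "\<dots> \<le> (\<Sum>k = 1..n. \<bar>eps TypeC n c k\<bar>)" by (intro sum_mono) simp
    finally show ?thesis using norm[OF c] by simp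
  qed
  have sub: "c \<in> (\<lambda>(x, y). rootC n x y) ` ({..<n} \<times> {..<n})" if c: "c \<in> V" "c n = 1" for c
  proof (rule abs_sum_two[OF _ norm[OF c(1)]])
    fix a assume a: "a \<in> {1..n}" "\<bar>eps TypeC n c a\<bar> = 2" "\<And>k. k \<in> {1..n} \<Longrightarrow> k \<noteq> a \<Longrightarrow> eps TypeC n c k = 0"
    have ck: "(if k = n then 2 * c n else c k) = of_bool (a \<le> k) * eps TypeC n c a" if "k \<le> n" for k
      using partial_sum_one[of a n "eps TypeC n c" k] a that sum[OF c(1) that] by simp
    have e: "eps TypeC n c a = 2" using ck[of n] a c(2) by simp
    have "c = rootC n (n - a) (n - a)"
    proof
      fix k
      show "c k = rootC n (n - a) (n - a) k"
        using ck[of k] zero(2)[OF c(1), of k] a(1) c(2) e by (cases "k < n"; cases "k = n") (auto simp: rootC_def)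
    qed
    then show ?thesis using a by (intro image_eqI[of _ _ "(n - a, n - a)"]) auto
  next
    fix a b assume ab: "a \<in> {1..n}" "b \<in> {1..n}" "a < b" "\<bar>eps TypeC n c a\<bar> = 1" "\<bar>eps TypeC n c b\<bar> = 1"
      "\<And>k. k \<in> {1..n} \<Longrightarrow> k \<noteq> a \<Longrightarrow> k \<noteq> b \<Longrightarrow> eps TypeC n c k = 0"
    have ck: "(if k = n then 2 * c n else c k) = of_bool (a \<le> k) * eps TypeC n c a + of_bool (b \<le> k) * eps TypeC n c b" if "k \<le> n" for k
      using partial_sum_two[of a b n "eps TypeC n c" k] ab that sum[OF c(1) that] by simp
    have e: "eps TypeC n c a = 1" "eps TypeC n c b = 1" using ck[of n] ab c(2) by auto
    have "c = rootC n (n - a) (n - b)"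
    proof
      fix k
      show "c k = rootC n (n - a) (n - b) k"
        using ck[of k] zero(2)[OF c(1), of k] ab(1-3) c(2) e by (cases "k < n"; cases "k = n") (auto simp: rootC_def)
    qed
    then show ?thesis using ab by (intro image_eqI[of _ _ "(n - a, n - b)"]) auto
  qed simp
  have rn: "rootC n x y n = 1" for x y by (simp add: rootC_def)
  have grow: "rootC n (Suc x) y \<in> V" if V: "rootC n x y \<in> V" and x: "Suc x < n" and yx: "y \<le> x" for x y
  proof -
    have j: "n - Suc x \<in> {1..n}" "n - Suc x \<noteq> n" using x by auto
    have "n - Suc x < n" "\<not> n - x \<le> n - Suc x" "\<not> n - y \<le> n - Suc x" using x yx by linarith+
    then have v1: "rootC n x y (n - Suc x) = 0" by (simp add: rootC_def)
    have "n - Suc x - 1 < n" "\<not> n - x \<le> n - Suc x - 1" "\<not> n - y \<le> n - Suc x - 1" using x yx by linarith+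
    then have v2: "rootC n x y (n - Suc x - 1) = 0" by (simp add: rootC_def)
    have "n - Suc x + 1 = n \<or> n - Suc x + 1 < n" "n - x \<le> n - Suc x + 1" using x by linarith+
    then have v3: "1 \<le> rootC n x y (n - Suc x + 1)" by (auto simp: rootC_def)
    have "pairing TypeC n (rootC n x y) (n - Suc x) \<le> - 1"
      unfolding pairing_C[OF supp[OF V] j(1) n] v1 v2 rn using v3 by simp
    then have "rootC n x y + unit (n - Suc x) \<in> V" using raise_unit[OF V rn j] by simp
    moreover have "rootC n x y + unit (n - Suc x) = rootC n (Suc x) y"
      using x by (auto simp: rootC_def unit_def fun_eq_iff)
    ultimately show ?thesis by simp
  qed
  \<comment> \<open>Passing from one diagonal cell to the next takes the end of a string of length
    two, because the cell between them has Cartan integer 0.\<close>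
  have diag: "y < n \<Longrightarrow> rootC n y y \<in> V" for y
  proof (induction y)
    case 0
    have "rootC n 0 0 = unit n" by (auto simp: rootC_def unit_def fun_eq_iff)
    then show ?case using base by simp
  next
    case (Suc y)
    have V: "rootC n y y \<in> V" using Suc by simp
    have j: "n - Suc y \<in> {1..n}" "n - Suc y \<noteq> n" using Suc.prems by auto
    have "n - Suc y < n" "\<not> n - y \<le> n - Suc y" using Suc.prems by linarith+
    then have v1: "rootC n y y (n - Suc y) = 0" by (simp add: rootC_def)
    have "n - Suc y - 1 < n" "\<not> n - y \<le> n - Suc y - 1" using Suc.prems by linarith+
    then have v2: "rootC n y y (n - Suc y - 1) = 0" by (simp add: rootC_def)
    have v3: "rootC n y y (n - Suc y + 1) = 2" if "n - Suc y \<noteq> n - 1"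
    proof -
      have "n - Suc y + 1 < n" "n - y \<le> n - Suc y + 1" using that Suc.prems by linarith+
      then show ?thesis by (simp add: rootC_def)
    qed
    have "pairing TypeC n (rootC n y y) (n - Suc y) = - 2"
      unfolding pairing_C[OF supp[OF V] j(1) n] v1 v2 rn using v3 by simp
    then have "(\<lambda>k. rootC n y y k + 2 * unit (n - Suc y) k) \<in> V" using raise[OF V rn j, of 2] by simp
    moreover have "(\<lambda>k. rootC n y y k + 2 * unit (n - Suc y) k) = rootC n (Suc y) (Suc y)"
      using Suc.prems by (auto simp: rootC_def unit_def fun_eq_iff)
    ultimately show ?case by simp
  qed
  have half: "y \<le> x \<Longrightarrow> x < n \<Longrightarrow> rootC n x y \<in> V" for x y
  proof (induction x rule: dec_induct)
    case (step m)
    then show ?case using grow[of m y] by simp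
  qed (use diag in simp)
  have "rootC n x y \<in> V" if "x < n" "y < n" for x y
    using half[of y x] half[of x y] that rootC_sym[of n x y] by (cases "y \<le> x") auto
  then show "{c \<in> V. c n = 1} = (\<lambda>(x, y). rootC n x y) ` ({..<n} \<times> {..<n})" using sub rn by auto
qed

lemma vectors_D_form:
  assumes n: "4 \<le> n" and rv: "root_vectors TypeD n V i" and c: "c \<in> V"
  obtains a b :: nat and d e :: int where "1 \<le> a" "a < b" "b \<le> n" "\<bar>d\<bar> = 1" "\<bar>e\<bar> = 1"
    "\<And>k. k \<le> n - 2 \<Longrightarrow> c k = of_bool (a \<le> k) * d + of_bool (b \<le> k) * e"
    "c (n - 1) + c n = of_bool (a \<le> n - 1) * d + of_bool (b \<le> n - 1) * e"
    "2 * c n = d + e"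
proof -
  interpret root_vectors TypeD n V i by (rule rv)
  \<comment> \<open>The last two entries are adjusted so that all coordinates become successive
    differences: \<alpha>_n = \<epsilon>_(n-1) + \<epsilon>_n contributes to both of the last
    two.\<close>
  define c' where "c' = c(n - 1 := c (n - 1) + c n, n := 2 * c n)"
  have sum: "(\<Sum>m = 1..k. eps TypeD n c m) = c' k" if "k \<le> n" for k
    by (rule telescope) (use zero[OF c] that n in \<open>auto simp: eps_def c'_def\<close>)
  have "(\<Sum>k = 1..n. (eps TypeD n c k)\<^sup>2) = 2" using orbit_D_norm[OF n, of c] orbit c by blast
  then obtain a b where ab: "a \<in> {1..n}" "b \<in> {1..n}" "a < b" "\<bar>eps TypeD n c a\<bar> = 1" "\<bar>eps TypeD n c b\<bar> = 1"
    "\<And>k. k \<in> {1..n} \<Longrightarrow> k \<noteq> a \<Longrightarrow> k \<noteq> b \<Longrightarrow> eps TypeD n c k = 0"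
    by (rule square_sum_two[of "{1..n}" "eps TypeD n c", rotated]) auto
  have ck: "c' k = of_bool (a \<le> k) * eps TypeD n c a + of_bool (b \<le> k) * eps TypeD n c b" if "k \<le> n" for k
    using partial_sum_two[of a b n "eps TypeD n c" k] ab that sum[OF that] by simp
  show ?thesis
  proof (rule that[of a b "eps TypeD n c a" "eps TypeD n c b"])
    show "c k = of_bool (a \<le> k) * eps TypeD n c a + of_bool (b \<le> k) * eps TypeD n c b" if "k \<le> n - 2" for k
    proof -
      have "k \<noteq> n - 1" "k \<noteq> n" "k \<le> n" using that n by linarith+
      then show ?thesis using ck[of k] by (simp add: c'_def)
    qed
    have "n - 1 \<noteq> n" using n by linarith
    then show "c (n - 1) + c n = of_bool (a \<le> n - 1) * eps TypeD n c a + of_bool (b \<le> n - 1) * eps TypeD n c b"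
      using ck[of "n - 1"] by (simp add: c'_def)
    show "2 * c n = eps TypeD n c a + eps TypeD n c b" using ck[of n] ab(1,2) by (simp add: c'_def)
  qed (use ab in auto)
qed

lemma vectors_Dn:
  assumes n: "4 \<le> n" and rv: "root_vectors TypeD n V n"
  shows "c \<in> V \<Longrightarrow> c n \<le> 1" and "{c \<in> V. c n = 1} = vectorsD n"
proof -
  interpret root_vectors TypeD n V n by (rule rv)
  show "c n \<le> 1" if c: "c \<in> V" for c
    by (rule vectors_D_form[OF n rv c]) linarith
  have sub: "c \<in> vectorsD n" if c: "c \<in> V" "c n = 1" for c
  proof (rule vectors_D_form[OF n rv c(1)])
    fix a b :: nat and d e :: int
    assume ab: "1 \<le> a" "a < b" "b \<le> n" "\<bar>d\<bar> = 1" "\<bar>e\<bar> = 1"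
      and ck: "\<And>k. k \<le> n - 2 \<Longrightarrow> c k = of_bool (a \<le> k) * d + of_bool (b \<le> k) * e"
      and c1: "c (n - 1) + c n = of_bool (a \<le> n - 1) * d + of_bool (b \<le> n - 1) * e" and cn: "2 * c n = d + e"
    have de: "d = 1" "e = 1" using cn c(2) ab(4,5) by linarith+
    have "c = rootD n (n - a) (n - b)"
    proof
      fix k
      have nn: "n - (n - a) = a" "n - (n - b) = b" using ab by linarith+
      consider "k \<le> n - 2" "k < n" "k \<noteq> n - 1" | "k = n - 1" "k < n" | "k = n" "k \<noteq> n - 1" | "n < k" "k \<noteq> n - 1" using n by linarith
      then show "c k = rootD n (n - a) (n - b) k"
        using ck[of k] c1 zero(2)[OF c(1), of k] c(2)
        by cases (simp_all add: rootD_def rootC_def unit_def nn de)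
    qed
    moreover have "n - a < n" "n - b < n" "n - a \<noteq> n - b" using ab by linarith+
    ultimately show ?thesis by (auto simp: vectorsD_def)
  qed
  have rn: "rootD n x y n = 1" for x y using n by (simp add: rootD_def rootC_def unit_def)
  have D: "rootD n x y k = (if k < n then of_bool (n - x \<le> k) + of_bool (n - y \<le> k) else of_bool (k = n)) - of_bool (k = n - 1)" for x y k
    by (simp add: rootD_def rootC_def unit_def)
  \<comment> \<open>The conditions keep both the cell and its successor off the diagonal. The start
    is the cell (1, 0), which represents \<alpha>_n.\<close>
  have grow: "rootD n (Suc x) y \<in> V" if V: "rootD n x y \<in> V" and x: "1 \<le> x \<or> 1 \<le> y" "Suc x < n" and yx: "y < x \<or> Suc x < y" "y < n" for x y
  proof -
    have j: "n - Suc x \<in> {1..n}" "n - Suc x \<noteq> n" using x by auto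
    have "pairing TypeD n (rootD n x y) (n - Suc x) \<le> - 1"
    proof -
      have "n - x = Suc (n - Suc x)" using x by linarith
      moreover define k where "k = n - Suc x"
      ultimately have k: "n - x = Suc k" "1 \<le> k" "k < n" using x by auto
      have y: "n - y \<noteq> k" "n - y \<noteq> Suc k" "1 \<le> n - y" using yx k x(2) by linarith+
      obtain q where q: "n = q + 4" using n by (metis add.commute le_Suc_ex)
      have xk: "k = n - 1 \<longleftrightarrow> x = 0" using k by auto
      have yn: "k = n - 1 \<Longrightarrow> n - y < n - 1" using x(1) y xk by linarith
      define z where "z = n - y"
      have z: "z \<noteq> k" "z \<noteq> Suc k" "1 \<le> z" "k = n - 1 \<Longrightarrow> z < n - 1" "z \<le> n" using y yn by (auto simp: z_def)
      have z': "k = n - 2 \<Longrightarrow> z \<le> n - 3 \<or> z = n" using z by linarith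
      have "pairing TypeD n (rootD n x y) k \<le> - 1"
        unfolding pairing_D[OF supp[OF V] j(1)[folded k_def] n] D k(1) z_def[symmetric]
        using k(2,3) z z' unfolding q by (auto simp: of_bool_def)
      then show ?thesis by (simp add: k_def)
    qed
    then have "rootD n x y + unit (n - Suc x) \<in> V" using raise_unit[OF V rn j] by simp
    moreover have "rootD n (Suc x) y = rootD n x y + unit (n - Suc x)"
      using type_D.rootD_step_a[of n x y] x yx n by (simp add: type_D_def)
    ultimately show ?thesis by simp
  qed
  have axis: "1 \<le> x \<Longrightarrow> x < n \<Longrightarrow> rootD n x 0 \<in> V" for x
  proof (induction x rule: dec_induct)
    case base
    have "rootD n 1 0 = unit n"
    proof
      fix k
      show "rootD n 1 0 k = unit n k" using n unfolding D unit_def by (auto simp: of_bool_def)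
    qed
    then show ?case using root_vectors.base[OF rv] by simp
  next
    case (step x)
    then show ?case using grow[of x 0] by simp
  qed
  have half: "y < x \<Longrightarrow> x < n \<Longrightarrow> rootD n x y \<in> V" for x y
  proof (induction y)
    case 0
    then show ?case using axis by simp
  next
    case (Suc y)
    then have "rootD n y x \<in> V" using rootD_sym[of n x y] by simp
    then show ?case using grow[of y x] Suc.prems rootD_sym[of n x "Suc y"] by simp
  qed
  have "rootD n x y \<in> V" if "x < n" "y < n" "x \<noteq> y" for x y
    using half[of y x] half[of x y] that rootD_sym[of n x y] by (cases "y < x") auto
  then show "{c \<in> V. c n = 1} = vectorsD n" using sub rn by (auto simp: vectorsD_def)
qed

lemma pairing_edgeQ:
  assumes n: "4 \<le> n" and m: "m' < 2 * n - 2" and e: "edgeQ n m m' j" and s: "supported n (rootQ n m)"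
  shows "pairing TypeD n (rootQ n m) j \<le> - 1"
proof -
  have j: "j \<in> {1..n}" using edgeQ_label[OF n m e] by simp
  obtain q where q: "n = q + 4" using n by (metis add.commute le_Suc_ex)
  show ?thesis
    unfolding pairing_D[OF s j n] using e m j unfolding q edgeQ_def rootQ_def of_bool_def
    by (elim disjE conjE) (simp_all, presburger)
qed

lemma vectors_D1:
  assumes n: "4 \<le> n" and rv: "root_vectors TypeD n V 1"
  shows "c \<in> V \<Longrightarrow> c 1 \<le> 1" and "{c \<in> V. c 1 = 1} = rootQ n ` {..<2 * n - 2}"
proof -
  interpret root_vectors TypeD n V 1 by (rule rv)
  show "c 1 \<le> 1" if c: "c \<in> V" for c
  proof (rule vectors_D_form[OF n rv c])
    fix a b :: nat and d e :: int
    assume "1 \<le> a" "a < b" "\<bar>d\<bar> = 1" "\<And>k. k \<le> n - 2 \<Longrightarrow> c k = of_bool (a \<le> k) * d + of_bool (b \<le> k) * e"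
    from this(1-3) this(4)[of 1] n show ?thesis by (auto simp: of_bool_def)
  qed
  have sub: "c \<in> rootQ n ` {..<2 * n - 2}" if c: "c \<in> V" "c 1 = 1" for c
  proof (rule vectors_D_form[OF n rv c(1)])
    fix a b :: nat and d e :: int
    assume ab: "1 \<le> a" "a < b" "b \<le> n" "\<bar>d\<bar> = 1" "\<bar>e\<bar> = 1"
      and ck: "\<And>k. k \<le> n - 2 \<Longrightarrow> c k = of_bool (a \<le> k) * d + of_bool (b \<le> k) * e"
      and c1: "c (n - 1) + c n = of_bool (a \<le> n - 1) * d + of_bool (b \<le> n - 1) * e" and cn: "2 * c n = d + e"
    \<comment> \<open>Coefficient 1 at the first node forces the first nonzero coordinate to be +1
      at position 1. The sign at \<open>b\<close> then selects \<epsilon>_1 - \<epsilon>_b or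
      \<epsilon>_1 + \<epsilon>_b.\<close>
    have ad: "a = 1 \<and> d = 1"
      using ck[of 1] c(2) ab(1,2) n by (auto simp: of_bool_def split: if_splits)
    have cases: "(k \<le> n - 2 \<and> k < n - 1 \<and> k < n) \<or> (k = n - 1 \<and> k < n) \<or> k = n \<or> n < k" for k using n by linarith
    have "e = - 1 \<or> e = 1" using ab(5) by linarith
    then show ?thesis
    proof
      assume e: "e = - 1"
      have n0: "c n = 0" using cn ad e by simp
      have n1: "c (n - 1) = 1 - of_bool (b \<le> n - 1)" using c1 n0 ad e n by simp
      have "c = rootQ n (b - 2)"
      proof
        fix k
        show "c k = rootQ n (b - 2) k"
          using cases[of k] ck[of k] n0 n1 zero(2)[OF c(1), of k] ab(1-3) ad e n
          by (elim disjE) (auto simp: rootQ_def of_bool_def)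
      qed
      then show ?thesis using ab n by auto
    next
      assume e: "e = 1"
      have n0: "c n = 1" using cn ad e by simp
      have "Suc 0 \<le> n - Suc 0" using n by linarith
      then have n1: "c (n - 1) = of_bool (b \<le> n - 1)" using c1 n0 ad e by simp
      have "c = rootQ n (2 * n - 1 - b)"
      proof
        fix k
        show "c k = rootQ n (2 * n - 1 - b) k"
          using cases[of k] ck[of k] n0 n1 zero(2)[OF c(1), of k] ab(1-3) ad e n
          by (elim disjE) (auto simp: rootQ_def of_bool_def)
      qed
      then show ?thesis using ab ad n by auto
    qed
  qed
  have r1: "rootQ n m 1 = 1" if "m < 2 * n - 2" for m using that n by (auto simp: rootQ_def)
  have grow: "rootQ n m' \<in> V" if V: "rootQ n m \<in> V" and m: "m' < 2 * n - 2" and e: "edgeQ n m m' j" for m m' j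
  proof -
    note l = edgeQ_label[OF n m e]
    have "rootQ n m + unit j \<in> V"
      using raise_unit[OF V r1 _ _ pairing_edgeQ[OF n m e supp[OF V]]] l by simp
    then show ?thesis using rootQ_edge[OF n m e] by simp
  qed
  have low: "m \<le> n - 2 \<Longrightarrow> rootQ n m \<in> V" for m
  proof (induction m)
    case 0
    have "rootQ n 0 = unit 1" using n by (auto simp: rootQ_def unit_def fun_eq_iff)
    then show ?case using base by simp
  next
    case (Suc m)
    then have "m \<le> n - 2" "m \<le> n - 3" "Suc m < 2 * n - 2" using n by linarith+
    then show ?case using Suc.IH grow[of m "Suc m" "m + 2"] by (simp add: edgeQ_def)
  qed
  have mid: "rootQ n (n - 1) \<in> V" using grow[of "n - 3" "n - 1" n] low[of "n - 3"] n by (simp add: edgeQ_def)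
  have high: "n \<le> m \<Longrightarrow> m < 2 * n - 2 \<Longrightarrow> rootQ n m \<in> V" for m
  proof (induction m rule: dec_induct)
    case base
    then show ?case using grow[of "n - 2" n n] low[of "n - 2"] by (simp add: edgeQ_def)
  next
    case (step m)
    then show ?case using grow[of m "Suc m" "2 * n - 2 - m"] by (simp add: edgeQ_def)
  qed
  have "rootQ n m \<in> V" if "m < 2 * n - 2" for m
  proof -
    have "m \<le> n - 2 \<or> m = n - 1 \<or> n \<le> m" by linarith
    then show ?thesis using low mid high that by blast
  qed
  then show "{c \<in> V. c 1 = 1} = rootQ n ` {..<2 * n - 2}" using sub r1 by auto
qed

section \<open>Coefficient vectors of the actual roots\<close>

context cartan_setting
begin

lemma pair_simple:
  assumes type: "has_dynkin_type T \<hh> n \<alpha>" and \<beta>: "\<beta> \<in> R" and j: "j \<in> {1..n}"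
  shows "pair \<beta> (\<alpha> j) = pairing T n (cf \<beta>) j"
proof (rule pair_eqI)
  have "\<beta> (cor (\<alpha> j)) = (\<Sum>k = 1..n. of_int (cf \<beta> k) * \<alpha> k (cor (\<alpha> j)))"
    by (rule root_expand[OF \<beta> coroot_h[OF simple_root[OF j]]])
  also have "\<dots> = (\<Sum>k = 1..n. of_int (cf \<beta> k) * of_int (cartan_entry T n k j))"
    using type j by (intro sum.cong) (simp_all add: has_dynkin_type_def)
  finally show "\<beta> (cor (\<alpha> j)) = of_int (pairing T n (cf \<beta>) j)" by (simp add: pairing_def)
qed

lemma cf_simple_unit: "k \<in> {1..n} \<Longrightarrow> cf (\<alpha> k) = unit k"
  by (rule ext) (simp only: cf_simple unit_def)

text \<open>A root is a word applied to a simple root, and taking coefficients carries each simple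
  reflection to its version on integer vectors.\<close>

lemma cf_orbit:
  assumes type: "has_dynkin_type T \<hh> n \<alpha>" and \<beta>: "\<beta> \<in> R"
  shows "cf \<beta> \<in> orbit T n"
proof -
  obtain ks k where ks: "set ks \<subseteq> {1..n}" "k \<in> {1..n}" "\<beta> = word ks (\<alpha> k)" using root_word[OF \<beta>] .
  have "cf (word ks (\<alpha> k)) \<in> orbit T n" using ks(1)
  proof (induction ks)
    case Nil
    then show ?case using orbit_unit[OF ks(2)] cf_simple_unit[OF ks(2)] by simp
  next
    case (Cons j ks)
    let ?\<gamma> = "word ks (\<alpha> k)"
    have j: "j \<in> {1..n}" and \<gamma>: "?\<gamma> \<in> R" and IH: "cf ?\<gamma> \<in> orbit T n"
      using Cons W_root[OF word_W simple_root[OF ks(2)]] by simp_all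
    have "cf (sk j ?\<gamma>) = srefl T n j (cf ?\<gamma>)"
      by (rule ext) (simp only: cf_sk[OF \<gamma> j] pair_simple[OF type \<gamma> j] srefl_def)
    then show ?case using orbit_refl[OF IH j] by simp
  qed
  then show ?thesis using ks(3) by simp
qed

lemma root_vectors_cf:
  assumes type: "has_dynkin_type T \<hh> n \<alpha>" and i: "i \<in> {1..n}"
  shows "root_vectors T n (cf ` R) i"
proof
  show "cf ` R \<subseteq> orbit T n" using cf_orbit[OF type] by blast
  show "unit i \<in> cf ` R" using simple_root[OF i] cf_simple_unit[OF i] by (metis imageI)
  fix c j t assume c: "c \<in> cf ` R" "c i = 1" and j: "j \<in> {1..n}" "j \<noteq> i" and t: "0 \<le> t" "t \<le> - pairing T n c j"
  obtain \<beta> where \<beta>: "\<beta> \<in> R" "c = cf \<beta>" using c(1) by blast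
  note \<alpha>j = simple_root[OF j(1)]
  let ?\<gamma> = "str \<beta> (\<alpha> j) t"
  have "?\<gamma> (Z i) = of_int (cf \<beta> i + t * cf (\<alpha> j) i)"
    using cf[OF \<beta>(1) i] cf[OF \<alpha>j i] by (simp add: str_apply)
  \<comment> \<open>Raising along \<open>j\<close> different from \<open>i\<close> keeps the degree
    1, so the string member is nonzero and hence a root.\<close>
  then have "?\<gamma> (Z i) = 1" using c(2) \<beta>(2) j(2) cf_simple[OF j(1)] by simp
  then have "?\<gamma> \<noteq> 0" by auto
  then have R: "?\<gamma> \<in> R"
    using root_string_up[OF \<beta>(1) \<alpha>j t(1)] t(2) \<beta> pair_simple[OF type \<beta>(1) j(1)] by simp
  have "cf ?\<gamma> = (\<lambda>k. c k + t * unit j k)"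
    by (rule ext) (simp only: cf_str[OF \<beta>(1) \<alpha>j R] cf_simple_unit[OF j(1)] \<beta>(2))
  then show "(\<lambda>k. c k + t * unit j k) \<in> cf ` R" using R by (metis imageI)
qed (rule i)

end

lemma classical_classified:
  assumes "classical_chss T n i" "root_vectors T n V i"
  shows "(\<forall>c\<in>V. c i \<le> 1) \<and> classified {c \<in> V. c i = 1} (I_par n i) (criteria T n i)"
  using assms
proof cases
  case 1
  note V = assms(2)[unfolded 1(1)]
  have "criteria T n i = criteria_A n i" by (simp add: fun_eq_iff criteria_def 1)
  then show ?thesis using vectors_A[OF V] classified_A[OF 1(2,3)] by simp
next
  case 2
  note V = assms(2)[unfolded 2(1,2)]
  have "criteria T n i = criteria_B1" by (simp add: fun_eq_iff criteria_def 2)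
  then show ?thesis using vectors_B[OF 2(3) V] classified_B[OF 2(3)] 2(2) by simp
next
  case 3
  note V = assms(2)[unfolded 3(1,2)]
  have "criteria T n i = criteria_D1 n" by (simp add: fun_eq_iff criteria_def 3)
  then show ?thesis using vectors_D1[OF 3(3) V] classified_D1[OF 3(3)] 3(2) by simp
next
  case 4
  note V = assms(2)[unfolded 4(1,2)]
  have n: "1 \<le> n" "2 \<le> n" using 4 by simp_all
  have "criteria T n i = criteria_Cn n" by (simp add: fun_eq_iff criteria_def 4)
  then show ?thesis using vectors_C[OF n(2) V] classified_C[OF n(1)] 4(2) by simp
next
  case 5
  note V = assms(2)[unfolded 5(1,2)]
  have n: "type_D n" using 5 by (simp add: type_D_def)
  have "criteria T n i = criteria_Dn n" using 5 by (simp add: fun_eq_iff criteria_def)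
  then show ?thesis using vectors_Dn[OF 5(3) V] type_D.classified_Dn[OF n] 5(2) by simp
qed

theorem corollary3p17:
  fixes \<hh> :: "'g::complex_lie_algebra set"
    and \<alpha> :: "nat \<Rightarrow> 'g \<Rightarrow> complex"
    and n i :: nat
    and T :: dynkin
  assumes "simple_lie_algebra TYPE('g)"
    and "cartan_subalgebra \<hh>"
    and "simple_roots \<hh> n \<alpha>"
    and "has_dynkin_type T \<hh> n \<alpha>"
    and "classical_chss T n i"
  shows "(\<forall>w\<in>hasse \<hh> n \<alpha> i. proper_schubert \<hh> n \<alpha> i w \<longrightarrow>
            schubert_a \<hh> n \<alpha> i w \<ge> 0 \<and>
            schubert_J \<hh> n \<alpha> i w \<noteq> {} \<and>
            schubert_J \<hh> n \<alpha> i w \<subseteq> I_par n i \<and>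
            criteria T n i (schubert_a \<hh> n \<alpha> i w) (schubert_J \<hh> n \<alpha> i w))
       \<and> (\<forall>(a::int) J. a \<ge> 0 \<and> J \<noteq> {} \<and> J \<subseteq> I_par n i \<and> criteria T n i a J \<longrightarrow>
            (\<exists>!w. w \<in> hasse \<hh> n \<alpha> i \<and>
                  a = schubert_a \<hh> n \<alpha> i w \<and> J = schubert_J \<hh> n \<alpha> i w))"
proof -
  interpret cartan_setting \<hh> n \<alpha> by unfold_locales (rule assms)+
  have i: "i \<in> {1..n}" using assms(5) by cases auto
  note V = classical_classified[OF assms(5) root_vectors_cf[OF assms(4) i]]
  \<comment> \<open>The bound on the coefficient at \<open>i\<close> is derived from the explicit
    lists of vectors, which is why they come before the geometry.\<close>
  interpret cominuscule \<hh> n \<alpha> i by unfold_locales (use i V in auto)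
  show ?thesis by (rule schubert_classification) (use V in blast)
qed

end
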